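(* Let $\{\epsilon_{i,j}\}_{(i,j)\in\mathbb Z^2}$ be the i.i.d. coordinate variables on the product probability space described in the context, with zero mean and finite variance, and let $$Z_{i,j}=\sum_{r\in\mathbb Z}\sum_{s\in\mathbb Z}a_{r,s}\,\epsilon_{i-r,j-s},\qquad (i,j)\in\mathbb Z^2,$$ be a causal linear random field: $\sum_{(i,j)\in\mathbb Z^2}a_{i,j}^2<\infty$ and $a_{i,j}=0$ unless $i\ge0$ and $j\ge0$. Let $h$ be a strictly positive integer, $K:\mathbb R^{h^2}\to\mathbb R$ a measurable function, and $f=K(\{Z_{i,j}\}_h^{0,0})$, so that $f\circ T_{k,l}=K(\{Z_{i,j}\}_h^{k,l})$ for $(k,l)\in\mathbb Z^2$. For $p\ge2$ consider the conditions $$\mathbb E K(\{Z_{i,j}\}_h^{0,0})=0,\qquad \mathbb E\,|K(\{Z_{i,j}\}_h^{0,0})|^p<\infty,\qquad \sum_{k=1}^\infty\sum_{l=1}^\infty\frac{\|K_{k,l}(W_{k,l,-})\|_p}{k^{1/2}l^{1/2}}<\infty. \qquad(\ast_p)$$ If $(\ast_p)$ holds with $p=2$, then $\sigma^2=\lim_{n\to\infty}\mathbb E(S_n^2)/|V_n|<\infty$ exists and $S_n/|V_n|^{1/2}\Rightarrow\mathcal N(0,\sigma^2)$, where $S_n=S_n(f)$. If $(\ast_p)$ holds with some $p>2$, then the invariance principle $$\frac{B_{n,\cdot}(f)}{|V_n|^{1/2}}\Rightarrow\sigma\,\mathbb B(\cdot)$$ holds in $C[0,1]^2$.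
   Context: $\mathbb N=\{1,2,\dots\}$. Product probability space: $(\Omega,\mathcal A,\mathbb P)=(\mathbb R^{\mathbb Z^2},\mathcal B^{\mathbb Z^2},P^{\mathbb Z^2})$ with $P$ a probability measure on the Borel $\sigma$-field $\mathcal B$ of $\mathbb R$, $\epsilon_{i,j}(\omega)=\omega_{i,j}$, and shifts $(T_{k,l}\,\omega)_{i,j}=\omega_{i+k,j+l}$. For a family $\{x_{i,j}\}_{(i,j)\in\mathbb Z^2}$ and $(k,l)\in\mathbb Z^2$, $\{x_{i,j}\}_h^{k,l}=\{x_{i,j}:k-h+1\le i\le k,\ l-h+1\le j\le l\}$ is viewed as a vector in $\mathbb R^{h^2}$ with coordinates lexicographically ordered. Put $\Gamma(i,j)=\{(r,s)\in\mathbb Z^2:r\le i,\ s\le j\}$ and decompose $Z_{i,j}=Z_{i,j,+}+Z_{i,j,-}$ with $$Z_{i,j,+}=\sum_{(r,s)\in\Gamma(i,j)\setminus\Gamma(1,1)}a_{i-r,j-s}\epsilon_{r,s},\qquad Z_{i,j,-}=\sum_{(r,s)\in\Gamma(1,1)}a_{i-r,j-s}\epsilon_{r,s}.$$ Let $W_{k,l,-}=\{Z_{i,j,-}\}_h^{k,l}$ and $K_{k,l}(\{x_{i,j}\}_h^{k,l})=\mathbb E K(\{Z_{i,j,+}+x_{i,j}\}_h^{k,l})$ for deterministic $\{x_{i,j}\}$ (wherever this expectation exists), so that $K_{k,l}(W_{k,l,-})=\mathbb E(f\circ T_{k,l}\mid\mathcal F_{1,1})$ with $\mathcal F_{1,1}=\sigma(\epsilon_{i,j}:i\le1,\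 j\le1)$. $\|\cdot\|_p$ is the $L^p(\mathbb P)$ norm. $V_n=\{1,\dots,m_1^{(n)}\}\times\{1,\dots,m_2^{(n)}\}$ with $m_i^{(n)}$ increasing to infinity as $n\to\infty$, $i=1,2$; $S_n(f)=\sum_{k\in V_n}f\circ T_k$. For $t\in[0,1]^2$, $V_n(t)=[0,m_1^{(n)}t_1]\times[0,m_2^{(n)}t_2]$, $R_k=(k_1-1,k_1]\times(k_2-1,k_2]$, and $B_{n,t}(f)=\sum_{k\in\mathbb N^2}\lambda(V_n(t)\cap R_k)\,f\circ T_k$ with $\lambda$ Lebesgue measure on $\mathbb R^2$. $\Rightarrow$ denotes convergence in distribution, respectively weak convergence of laws on $C[0,1]^2$ (continuous real functions on $[0,1]^2$ with the uniform metric). $\mathbb B$ is the standard Brownian sheet on $[0,1]^2$: the mean-zero continuous Gaussian field with covariance $\mathbb E(\mathbb B(s)\mathbb B(t))=\min(s_1,t_1)\min(s_2,t_2)$. *)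

theory Defs
  imports "HOL-Probability.Probability"
begin

section \<open>The product space, the coordinates and the shifts\<close>

definition Omega :: "real measure \<Rightarrow> (int \<times> int \<Rightarrow> real) measure" where
  "Omega P = (\<Pi>\<^sub>M ij\<in>UNIV. P)"

definition eps :: "int \<times> int \<Rightarrow> (int \<times> int \<Rightarrow> real) \<Rightarrow> real" where
  "eps ij \<omega> = \<omega> ij"

definition shift :: "int \<times> int \<Rightarrow> (int \<times> int \<Rightarrow> real) \<Rightarrow> (int \<times> int \<Rightarrow> real)" where
  "shift = (\<lambda>(k, l) \<omega> (i, j). \<omega> (i + k, j + l))"

section \<open>Linear random fields\<close>

text \<open>\<open>Y\<close> is a version of the sum of the random variables \<open>X i\<close>, \<open>i \<in> I\<close>, the series
  converging unconditionally in \<open>L\<^sup>2\<close>. This determines \<open>Y\<close> almost surely.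
  Almost sure absolute convergence is not available for coefficients that
  are merely square summable, hence \<open>infsum\<close> cannot be used pointwise.\<close>

definition has_L2_sum ::
  "'a measure \<Rightarrow> ('i \<Rightarrow> 'a \<Rightarrow> real) \<Rightarrow> 'i set \<Rightarrow> ('a \<Rightarrow> real) \<Rightarrow> bool" where
  "has_L2_sum M X I Y \<longleftrightarrow>
     (\<forall>i\<in>I. X i \<in> borel_measurable M) \<and> Y \<in> borel_measurable M \<and>
     ((\<lambda>F. \<integral>\<^sup>+\<omega>. ennreal ((Y \<omega> - (\<Sum>i\<in>F. X i \<omega>))\<^sup>2) \<partial>M) \<longlongrightarrow> 0) (finite_subsets_at_top I)"

definition Gamma_set :: "int \<times> int \<Rightarrow> (int \<times> int) set" where
  "Gamma_set = (\<lambda>(i, j). {(r, s). r \<le> i \<and> s \<le> j})"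

definition linear_field ::
  "real measure \<Rightarrow> (int \<times> int \<Rightarrow> real) \<Rightarrow> (int \<times> int \<Rightarrow> (int \<times> int \<Rightarrow> real) \<Rightarrow> real) \<Rightarrow> bool" where
  "linear_field P a Z \<longleftrightarrow>
     (\<forall>i j. has_L2_sum (Omega P) (\<lambda>(r, s) \<omega>. a (r, s) * eps (i - r, j - s) \<omega>) UNIV (Z (i, j)))"

definition linear_field_plus ::
  "real measure \<Rightarrow> (int \<times> int \<Rightarrow> real) \<Rightarrow> (int \<times> int \<Rightarrow> (int \<times> int \<Rightarrow> real) \<Rightarrow> real) \<Rightarrow> bool" where
  "linear_field_plus P a Zp \<longleftrightarrow>
     (\<forall>i j. has_L2_sum (Omega P) (\<lambda>(r, s) \<omega>. a (i - r, j - s) * eps (r, s) \<omega>)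
              (Gamma_set (i, j) - Gamma_set (1, 1)) (Zp (i, j)))"

definition linear_field_minus ::
  "real measure \<Rightarrow> (int \<times> int \<Rightarrow> real) \<Rightarrow> (int \<times> int \<Rightarrow> (int \<times> int \<Rightarrow> real) \<Rightarrow> real) \<Rightarrow> bool" where
  "linear_field_minus P a Zm \<longleftrightarrow>
     (\<forall>i j. has_L2_sum (Omega P) (\<lambda>(r, s) \<omega>. a (i - r, j - s) * eps (r, s) \<omega>)
              (Gamma_set (1, 1)) (Zm (i, j)))"

section \<open>Windows and functionals of the field\<close>

text \<open>\<open>h\<^sup>2\<close>-dimensional space is the carrier of \<open>\<Pi>\<^sub>M m\<in>{..<h\<^sup>2}. borel\<close>, i.e. the functions on
  \<open>{..<h\<^sup>2}\<close> (extended by \<open>undefined\<close>). The quotient \<open>m div h\<close> moves the first index and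
  the remainder \<open>m mod h\<close> the second one, which is the lexicographic order of the
  sites \<open>k - h + 1 \<le> i \<le> k\<close>, \<open>l - h + 1 \<le> j \<le> l\<close>.\<close>

definition window :: "nat \<Rightarrow> int \<times> int \<Rightarrow> (int \<times> int \<Rightarrow> real) \<Rightarrow> (nat \<Rightarrow> real)" where
  "window h = (\<lambda>(k, l) x. \<lambda>m\<in>{..<h\<^sup>2}.
     x (k - int h + 1 + int (m div h), l - int h + 1 + int (m mod h)))"

definition functional ::
  "nat \<Rightarrow> ((nat \<Rightarrow> real) \<Rightarrow> real) \<Rightarrow> (int \<times> int \<Rightarrow> (int \<times> int \<Rightarrow> real) \<Rightarrow> real)
     \<Rightarrow> (int \<times> int \<Rightarrow> real) \<Rightarrow> real" where
  "functional h K Z \<omega> = K (window h (0, 0) (\<lambda>ij. Z ij \<omega>))"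

text \<open>The function \<open>K\<^bsub>k,l\<^esub>\<close> of a vector \<open>v\<close>. Where the expectation does not exist
  the value is the default 0 of the Bochner integral; if \<open>functional h K Z\<close> is integrable
  this happens only on a null set of the law of \<open>W_minus h Zm kl\<close>.\<close>

definition K_kl ::
  "real measure \<Rightarrow> nat \<Rightarrow> ((nat \<Rightarrow> real) \<Rightarrow> real) \<Rightarrow> (int \<times> int \<Rightarrow> (int \<times> int \<Rightarrow> real) \<Rightarrow> real)
     \<Rightarrow> int \<times> int \<Rightarrow> (nat \<Rightarrow> real) \<Rightarrow> real" where
  "K_kl P h K Zp kl v =
     (\<integral>\<omega>. K (\<lambda>m\<in>{..<h\<^sup>2}. window h kl (\<lambda>ij. Zp ij \<omega>) m + v m) \<partial>Omega P)"

definition W_minus ::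
  "nat \<Rightarrow> (int \<times> int \<Rightarrow> (int \<times> int \<Rightarrow> real) \<Rightarrow> real) \<Rightarrow> int \<times> int
     \<Rightarrow> (int \<times> int \<Rightarrow> real) \<Rightarrow> (nat \<Rightarrow> real)" where
  "W_minus h Zm kl \<omega> = window h kl (\<lambda>ij. Zm ij \<omega>)"

definition Lp_norm :: "'a measure \<Rightarrow> real \<Rightarrow> ('a \<Rightarrow> real) \<Rightarrow> ennreal" where
  "Lp_norm M p X =
     (let I = \<integral>\<^sup>+\<omega>. ennreal (\<bar>X \<omega>\<bar> powr p) \<partial>M
      in if I = \<infinity> then \<infinity> else ennreal (enn2real I powr (1 / p)))"

text \<open>The sums over \<open>k, l \<ge> 1\<close> are indexed from 0; they are sums in \<open>[0, \<infinity>]\<close>.\<close>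

definition star_condition ::
  "real measure \<Rightarrow> nat \<Rightarrow> ((nat \<Rightarrow> real) \<Rightarrow> real) \<Rightarrow> (int \<times> int \<Rightarrow> (int \<times> int \<Rightarrow> real) \<Rightarrow> real)
     \<Rightarrow> (int \<times> int \<Rightarrow> (int \<times> int \<Rightarrow> real) \<Rightarrow> real)
     \<Rightarrow> (int \<times> int \<Rightarrow> (int \<times> int \<Rightarrow> real) \<Rightarrow> real) \<Rightarrow> real \<Rightarrow> bool" where
  "star_condition P h K Z Zp Zm p \<longleftrightarrow>
     integrable (Omega P) (functional h K Z) \<and>
     (\<integral>\<omega>. functional h K Z \<omega> \<partial>Omega P) = 0 \<and>
     integrable (Omega P) (\<lambda>\<omega>. \<bar>functional h K Z \<omega>\<bar> powr p) \<and>
     (\<Sum>k. \<Sum>l. Lp_norm (Omega P) p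
                (\<lambda>\<omega>. K_kl P h K Zp (int (Suc k), int (Suc l)) (W_minus h Zm (int (Suc k), int (Suc l)) \<omega>))
              / ennreal (sqrt (real (Suc k)) * sqrt (real (Suc l)))) < \<infinity>"

section \<open>Partial sums and the smoothed partial sum process\<close>

definition S_rect ::
  "((int \<times> int \<Rightarrow> real) \<Rightarrow> real) \<Rightarrow> nat \<Rightarrow> nat \<Rightarrow> (int \<times> int \<Rightarrow> real) \<Rightarrow> real" where
  "S_rect f m1 m2 \<omega> = (\<Sum>k\<in>{1..int m1} \<times> {1..int m2}. f (shift k \<omega>))"

definition V_rect :: "nat \<Rightarrow> nat \<Rightarrow> real \<times> real \<Rightarrow> (real \<times> real) set" where
  "V_rect m1 m2 t = {0..real m1 * fst t} \<times> {0..real m2 * snd t}"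

definition R_cell :: "int \<times> int \<Rightarrow> (real \<times> real) set" where
  "R_cell k = {real_of_int (fst k) - 1<..real_of_int (fst k)} \<times> {real_of_int (snd k) - 1<..real_of_int (snd k)}"

text \<open>For fixed \<open>t\<close> only finitely many terms are nonzero.\<close>

definition B_rect ::
  "((int \<times> int \<Rightarrow> real) \<Rightarrow> real) \<Rightarrow> nat \<Rightarrow> nat \<Rightarrow> real \<times> real \<Rightarrow> (int \<times> int \<Rightarrow> real) \<Rightarrow> real" where
  "B_rect f m1 m2 t \<omega> =
     (\<Sum>\<^sub>\<infinity>k\<in>{1..} \<times> {1..}. measure lborel (V_rect m1 m2 t \<inter> R_cell k) * f (shift k \<omega>))"

section \<open>Convergence in distribution, the limit laws\<close>

text \<open>The degenerate case \<open>s = 0\<close> is the point mass at \<open>m\<close>.\<close>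

definition normal_law :: "real \<Rightarrow> real \<Rightarrow> real measure" where
  "normal_law m s = (if s = 0 then return borel m else density lborel (normal_density m s))"

definition unit_square :: "(real \<times> real) set" where
  "unit_square = {0..1} \<times> {0..1}"

text \<open>\<open>C[0,1]\<^sup>2\<close> with the topology of the uniform metric; its points are the continuous
  functions on the square, extended by \<open>undefined\<close>.\<close>

definition C_square :: "(real \<times> real \<Rightarrow> real) topology" where
  "C_square = mtopology_of (cfunspace (top_of_set unit_square) euclidean_metric)"

definition borel_of :: "'a topology \<Rightarrow> 'a measure" where
  "borel_of T = sigma (topspace T) {U. openin T U}"

text \<open>Weak convergence of the laws of random elements \<open>X n\<close> of \<open>T\<close>, defined on \<open>M\<close>, to the law
  of a random element \<open>Y\<close>, defined on \<open>N\<close>.\<close>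

definition converges_in_distribution ::
  "'t topology \<Rightarrow> 'a measure \<Rightarrow> (nat \<Rightarrow> 'a \<Rightarrow> 't) \<Rightarrow> 'b measure \<Rightarrow> ('b \<Rightarrow> 't) \<Rightarrow> bool" where
  "converges_in_distribution T M X N Y \<longleftrightarrow>
     (\<forall>n. X n \<in> M \<rightarrow>\<^sub>M borel_of T) \<and> Y \<in> N \<rightarrow>\<^sub>M borel_of T \<and>
     (\<forall>\<phi>. continuous_map T euclideanreal \<phi> \<and> bounded (\<phi> ` topspace T) \<longrightarrow>
        (\<lambda>n. \<integral>x. \<phi> x \<partial>distr M (borel_of T) (X n)) \<longlonglongrightarrow> (\<integral>x. \<phi> x \<partial>distr N (borel_of T) Y))"

definition standard_brownian_sheet :: "'b measure \<Rightarrow> (real \<times> real \<Rightarrow> 'b \<Rightarrow> real) \<Rightarrow> bool" where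
  "standard_brownian_sheet N BB \<longleftrightarrow>
     prob_space N \<and>
     (\<forall>t\<in>unit_square. BB t \<in> borel_measurable N) \<and>
     (\<forall>\<omega>\<in>space N. continuous_on unit_square (\<lambda>t. BB t \<omega>)) \<and>
     (\<forall>F c. finite F \<and> F \<subseteq> unit_square \<longrightarrow>
        (\<exists>m s. s \<ge> 0 \<and> distr N borel (\<lambda>\<omega>. \<Sum>t\<in>F. c t * BB t \<omega>) = normal_law m s)) \<and>
     (\<forall>t\<in>unit_square. (\<integral>\<omega>. BB t \<omega> \<partial>N) = 0) \<and>
     (\<forall>s\<in>unit_square. \<forall>t\<in>unit_square.
        (\<integral>\<omega>. BB s \<omega> * BB t \<omega> \<partial>N) = min (fst s) (fst t) * min (snd s) (snd t))"

end

theory Submission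
  imports Defs
begin

text \<open>By the projective criterion, \<open>(\<ast>\<^sub>2)\<close> makes the norms of the orthomartingale projections of \<open>f\<close>
  summable. Cairoli's maximal inequality then bounds the maximal partial sums of \<open>f - g\<close> in
  \<open>L\<^sup>2\<close>, uniformly in the rectangle and up to its normalization, where \<open>g\<close> is a finite sum of
  projections of bounded functions of finitely many coordinates. It remains to treat such \<open>g\<close>,
  whose translates are bounded and finitely dependent: the mean of \<open>cos (\<theta> s + \<alpha>)\<close> for a normalized
  weighted sum \<open>s\<close> satisfies the differential equation of the Gaussian up to a vanishing error,
  which gives the finite dimensional limits, and fourth moments of maxima over strips give
  tightness. Convergence in distribution on the space of continuous functions only has to be tested
  on bounded Lipschitz functions, for which the approximation of \<open>f\<close> by \<open>g\<close> and that of a path by its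
  interpolation on a grid cost no more than the mean uniform distance.\<close>

section \<open>Square integrable functions\<close>

text \<open>Conditional expectations are realized by resampling coordinates, so they are functions
  defined everywhere. Adaptedness becomes a pointwise notion, and the exceptional null sets come
  from Fubini and from the choice of versions of the field. Since the coordinates are independent,
  the conditional expectations given two quadrants commute; this makes the projections orthogonal
  and lets the two directions be treated one after the other. The weights
  \<open>1 / (sqrt k * sqrt l)\<close> of the hypothesis are those which Cauchy-Schwarz on windows
  of comparable indices produces when square sums of projection norms are turned into plain sums.
  For exponents above 2 the condition is first reduced to exponent 2 by monotonicity of the norms.
  The approximants are bounded because tightness calls for more than second moments: over
  \<open>M + 1\<close> strips of relative width of order \<open>1 / M\<close>, second moments add up
  to a constant, whereas fourth moments leave a bound of order \<open>1 / M\<close>.\<close>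

definition L2 :: "'a measure \<Rightarrow> ('a \<Rightarrow> real) \<Rightarrow> bool" where
  "L2 M u \<longleftrightarrow> u \<in> borel_measurable M \<and> integrable M (\<lambda>x. (u x)\<^sup>2)"

definition nrm :: "'a measure \<Rightarrow> ('a \<Rightarrow> real) \<Rightarrow> real" where
  "nrm M u = sqrt (\<integral>x. (u x)\<^sup>2 \<partial>M)"

lemma L2_meas [measurable_dest]: "L2 M u \<Longrightarrow> u \<in> borel_measurable M"
  by (simp add: L2_def)

lemma L2_sq: "L2 M u \<Longrightarrow> integrable M (\<lambda>x. (u x)\<^sup>2)"
  by (simp add: L2_def)

lemma nrm_nonneg [simp]: "nrm M u \<ge> 0"
  by (simp add: nrm_def)

lemma nrm_sq: "(nrm M u)\<^sup>2 = (\<integral>x. (u x)\<^sup>2 \<partial>M)"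
  by (simp add: nrm_def)

lemma L2_mult_integrable:
  assumes "L2 M u" "L2 M v"
  shows "integrable M (\<lambda>x. u x * v x)"
proof (rule Bochner_Integration.integrable_bound)
  show "integrable M (\<lambda>x. (u x)\<^sup>2 + (v x)\<^sup>2)"
    using assms by (auto simp: L2_def)
  show "(\<lambda>x. u x * v x) \<in> borel_measurable M"
    using assms by (auto simp: L2_def)
  show "AE x in M. norm (u x * v x) \<le> norm ((u x)\<^sup>2 + (v x)\<^sup>2)"
  proof (rule AE_I2)
    fix x
    have "2 * (\<bar>u x\<bar> * \<bar>v x\<bar>) \<le> (u x)\<^sup>2 + (v x)\<^sup>2"
      using sum_squares_bound[of "\<bar>u x\<bar>" "\<bar>v x\<bar>"] by simp
    moreover have "0 \<le> \<bar>u x\<bar> * \<bar>v x\<bar>" by simp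
    ultimately show "norm (u x * v x) \<le> norm ((u x)\<^sup>2 + (v x)\<^sup>2)"
      unfolding abs_mult real_norm_def using zero_le_power2[of "u x"] zero_le_power2[of "v x"] by linarith
  qed
qed

lemma L2_cmult [intro]: "L2 M u \<Longrightarrow> L2 M (\<lambda>x. c * u x)"
  by (auto simp: L2_def power_mult_distrib)

lemma L2_add [intro]:
  assumes "L2 M u" "L2 M v"
  shows "L2 M (\<lambda>x. u x + v x)"
  using L2_mult_integrable[OF assms] assms
  by (auto simp: L2_def power2_sum mult.assoc)

lemma L2_minus [intro]: "L2 M u \<Longrightarrow> L2 M (\<lambda>x. - u x)"
  by (auto simp: L2_def)

lemma L2_diff [intro]:
  assumes "L2 M u" "L2 M v"
  shows "L2 M (\<lambda>x. u x - v x)"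
  using L2_add[OF assms(1) L2_minus[OF assms(2)]] by simp

lemma L2_zero [simp]: "L2 M (\<lambda>x. 0)"
  by (simp add: L2_def)

lemma L2_sum [intro]: "(\<And>i. i \<in> I \<Longrightarrow> L2 M (u i)) \<Longrightarrow> L2 M (\<lambda>x. \<Sum>i\<in>I. u i x)"
  by (induction I rule: infinite_finite_induct) auto

lemma L2_abs [intro]: "L2 M u \<Longrightarrow> L2 M (\<lambda>x. \<bar>u x\<bar>)"
  by (auto simp: L2_def)

lemma L2_bound:
  assumes "L2 M u" "v \<in> borel_measurable M" "\<And>x. x \<in> space M \<Longrightarrow> \<bar>v x\<bar> \<le> \<bar>u x\<bar>"
  shows "L2 M v"
  unfolding L2_def
proof
  show "integrable M (\<lambda>x. (v x)\<^sup>2)"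
  proof (rule Bochner_Integration.integrable_bound[OF L2_sq[OF assms(1)]])
    show "AE x in M. norm ((v x)\<^sup>2) \<le> norm ((u x)\<^sup>2)"
      by (rule AE_I2) (auto simp: assms(3) abs_le_square_iff[symmetric])
  qed (use assms in measurable)
qed (use assms in simp)

lemma L2_max [intro]:
  assumes "L2 M u" "L2 M v"
  shows "L2 M (\<lambda>x. max (u x) (v x))"
proof (rule L2_bound[of M "\<lambda>x. \<bar>u x\<bar> + \<bar>v x\<bar>"])
  show "L2 M (\<lambda>x. \<bar>u x\<bar> + \<bar>v x\<bar>)" using assms by auto
  show "(\<lambda>x. max (u x) (v x)) \<in> borel_measurable M"
    using assms by (auto simp: L2_def)
qed auto

lemma L2_times_indicator:
  assumes "L2 M u" "A \<in> sets M"
  shows "L2 M (\<lambda>x. u x * indicator A x)"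
  by (rule L2_bound[OF assms(1)]) (use assms in \<open>auto simp: L2_def indicator_def\<close>)

lemma nrm_mono:
  assumes "L2 M u" "v \<in> borel_measurable M" "AE x in M. \<bar>v x\<bar> \<le> \<bar>u x\<bar>"
  shows "nrm M v \<le> nrm M u"
  unfolding nrm_def
  by (rule real_sqrt_le_mono, rule integral_mono_AE')
    (use assms in \<open>auto simp: L2_def abs_le_square_iff[symmetric]\<close>)

lemma nrm_cong_AE:
  assumes "u \<in> borel_measurable M" "v \<in> borel_measurable M" "AE x in M. u x = v x"
  shows "nrm M u = nrm M v"
  unfolding nrm_def
  by (rule arg_cong[where f=sqrt], rule integral_cong_AE) (use assms in auto)

lemma nrm_cmult: "nrm M (\<lambda>x. c * u x) = \<bar>c\<bar> * nrm M u"
  by (simp add: nrm_def power_mult_distrib real_sqrt_mult)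

lemma nrm_minus_commute: "nrm M (\<lambda>x. u x - v x) = nrm M (\<lambda>x. v x - u x)"
  by (simp add: nrm_def power2_commute)

lemma L2_cauchy_schwarz:
  assumes "L2 M u" "L2 M v"
  shows "\<bar>\<integral>x. u x * v x \<partial>M\<bar> \<le> nrm M u * nrm M v"
proof -
  note i = L2_mult_integrable[OF assms]
  define A B C where "A = (\<integral>x. (u x)\<^sup>2 \<partial>M)" "B = (\<integral>x. (v x)\<^sup>2 \<partial>M)" "C = (\<integral>x. u x * v x \<partial>M)"
  have AB: "A \<ge> 0" "B \<ge> 0" by (auto simp: A_B_C_def)
  have q: "0 \<le> B * t\<^sup>2 - 2 * C * t + A" for t
  proof -
    have "0 \<le> (\<integral>x. (u x - t * v x)\<^sup>2 \<partial>M)" by simp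
    also have "(\<lambda>x. (u x - t * v x)\<^sup>2) = (\<lambda>x. (u x)\<^sup>2 - 2 * t * (u x * v x) + t\<^sup>2 * (v x)\<^sup>2)"
      by (auto simp: power2_eq_square algebra_simps)
    also have "(\<integral>x. (u x)\<^sup>2 - 2 * t * (u x * v x) + t\<^sup>2 * (v x)\<^sup>2 \<partial>M) = A - 2 * t * C + t\<^sup>2 * B"
      using i assms by (simp add: L2_def A_B_C_def)
    finally show ?thesis by (simp add: algebra_simps)
  qed
  have "C\<^sup>2 \<le> A * B"
  proof (cases "B = 0")
    case True
    have "C = 0"
    proof (rule ccontr)
      assume "C \<noteq> 0"
      \<comment> \<open>For \<open>B = 0\<close> the quadratic is affine in \<open>t\<close>, and at
        this point it takes the value \<open>-1\<close>.\<close>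
      then show False using q[of "(A + 1) / (2 * C)"] True by (simp add: field_simps)
    qed
    then show ?thesis using AB by simp
  next
    case False
    then have "B > 0" using AB by simp
    then show ?thesis using q[of "C / B"] by (simp add: field_simps power2_eq_square)
  qed
  then have "\<bar>C\<bar> \<le> sqrt (A * B)"
    using real_le_rsqrt by (metis power2_abs)
  then show ?thesis
    by (simp add: A_B_C_def nrm_def real_sqrt_mult)
qed

lemma nrm_triangle:
  assumes "L2 M u" "L2 M v"
  shows "nrm M (\<lambda>x. u x + v x) \<le> nrm M u + nrm M v"
proof (rule power2_le_imp_le)
  have "(nrm M (\<lambda>x. u x + v x))\<^sup>2 = (\<integral>x. (u x)\<^sup>2 + (v x)\<^sup>2 + 2 * (u x * v x) \<partial>M)"
    by (simp add: nrm_sq power2_sum mult.assoc)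
  also have "\<dots> = (nrm M u)\<^sup>2 + (nrm M v)\<^sup>2 + 2 * (\<integral>x. u x * v x \<partial>M)"
    using L2_mult_integrable[OF assms] assms by (simp add: L2_def nrm_sq)
  also have "\<dots> \<le> (nrm M u)\<^sup>2 + (nrm M v)\<^sup>2 + 2 * (nrm M u * nrm M v)"
    using L2_cauchy_schwarz[OF assms] by linarith
  also have "\<dots> = (nrm M u + nrm M v)\<^sup>2" by (simp add: power2_sum)
  finally show "(nrm M (\<lambda>x. u x + v x))\<^sup>2 \<le> (nrm M u + nrm M v)\<^sup>2" .
qed simp

lemma nrm_triangle_diff:
  assumes "L2 M u" "L2 M v"
  shows "nrm M u \<le> nrm M v + nrm M (\<lambda>x. u x - v x)"
  using nrm_triangle[OF assms(2) L2_diff[OF assms]] by simp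

lemma nrm_sum:
  assumes "finite I" "\<And>i. i \<in> I \<Longrightarrow> L2 M (u i)"
  shows "nrm M (\<lambda>x. \<Sum>i\<in>I. u i x) \<le> (\<Sum>i\<in>I. nrm M (u i))"
  using assms
proof (induction I rule: finite_induct)
  case (insert i I)
  have "nrm M (\<lambda>x. u i x + (\<Sum>i\<in>I. u i x)) \<le> nrm M (u i) + nrm M (\<lambda>x. \<Sum>i\<in>I. u i x)"
    using insert by (intro nrm_triangle) auto
  then show ?case using insert by simp
qed (simp add: nrm_def)

context prob_space
begin

lemma L2_const [simp]: "L2 M (\<lambda>x. c)"
  by (simp add: L2_def)

lemma L2_integrable: "L2 M u \<Longrightarrow> integrable M u"
  using L2_mult_integrable[of M u "\<lambda>x. 1"] by simp

lemma L2_bounded: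
  assumes "u \<in> borel_measurable M" "\<And>x. \<bar>u x\<bar> \<le> b"
  shows "L2 M u"
  by (rule L2_bound[of M "\<lambda>x. b"]) (use assms in \<open>auto intro: order_trans[OF _ abs_ge_self]\<close>)

lemma integrable_bounded:
  assumes "u \<in> borel_measurable M" "\<And>x. \<bar>u x\<bar> \<le> (b::real)"
  shows "integrable M u"
  using L2_integrable[OF L2_bounded[OF assms]] .

lemma expectation_abs_le_nrm: "L2 M u \<Longrightarrow> (\<integral>x. \<bar>u x\<bar> \<partial>M) \<le> nrm M u"
  using L2_cauchy_schwarz[of M "\<lambda>x. \<bar>u x\<bar>" "\<lambda>x. 1"]
  by (auto simp: nrm_def prob_space)

lemma nrm_bounded:
  assumes "u \<in> borel_measurable M" "\<And>x. \<bar>u x\<bar> \<le> b"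
  shows "nrm M u \<le> b"
proof -
  have "b \<ge> 0" using assms(2)[of undefined] by linarith
  have "nrm M u \<le> nrm M (\<lambda>x. b)"
    by (rule nrm_mono) (use assms \<open>b \<ge> 0\<close> in auto)
  also have "\<dots> = b" using \<open>b \<ge> 0\<close> by (simp add: nrm_def prob_space)
  finally show ?thesis .
qed

end

section \<open>Coordinates of the product space\<close>

text \<open>Keeps the coordinates in \<open>A\<close> and takes the others from a second point. All
  conditioning is expressed through this map.\<close>

definition merge :: "'i set \<Rightarrow> ('i \<Rightarrow> 'v) \<Rightarrow> ('i \<Rightarrow> 'v) \<Rightarrow> 'i \<Rightarrow> 'v" where
  "merge A \<omega> \<omega>' = (\<lambda>i. if i \<in> A then \<omega> i else \<omega>' i)"

text \<open>Pointwise counterpart of measurability with respect to the sigma-field of the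
  coordinates in \<open>A\<close>. Being free of null sets, it passes through sums, maxima and
  compositions by mere substitution.\<close>

definition dep :: "'i set \<Rightarrow> (('i \<Rightarrow> 'v) \<Rightarrow> 'c) \<Rightarrow> bool" where
  "dep A g \<longleftrightarrow> (\<forall>\<omega> \<omega>'. (\<forall>i\<in>A. \<omega> i = \<omega>' i) \<longrightarrow> g \<omega> = g \<omega>')"

lemma depD: "dep A g \<Longrightarrow> (\<And>i. i \<in> A \<Longrightarrow> \<omega> i = \<omega>' i) \<Longrightarrow> g \<omega> = g \<omega>'"
  by (auto simp: dep_def)

lemma dep_mono: "dep A g \<Longrightarrow> A \<subseteq> B \<Longrightarrow> dep B g"
  unfolding dep_def by blast

lemma dep_const [simp]: "dep A (\<lambda>_. c)"
  by (simp add: dep_def)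

lemma dep_comp: "dep A u \<Longrightarrow> dep A (\<lambda>\<omega>. F (u \<omega>))"
  unfolding dep_def by metis

lemma dep_comp2: "dep A u \<Longrightarrow> dep A v \<Longrightarrow> dep A (\<lambda>\<omega>. F (u \<omega>) (v \<omega>))"
  unfolding dep_def by metis

lemma dep_sum: "(\<And>i. i \<in> I \<Longrightarrow> dep A (u i)) \<Longrightarrow> dep A (\<lambda>\<omega>. \<Sum>i\<in>I. u i \<omega>)"
  unfolding dep_def by (meson sum.cong)

lemma dep_shift:
  assumes "dep A g"
  shows "dep ((\<lambda>i. i + k) ` A) (\<lambda>\<omega>. g (shift k \<omega>))"
  using assms unfolding dep_def shift_def by (auto simp: case_prod_beta plus_prod_def)

lemma dep_merge_same: "dep A g \<Longrightarrow> A \<subseteq> B \<Longrightarrow> g (merge B \<omega> \<omega>') = g \<omega>"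
  by (erule depD) (auto simp: merge_def)

lemma dep_merge_other: "dep A g \<Longrightarrow> A \<inter> B = {} \<Longrightarrow> g (merge B \<omega> \<omega>') = g \<omega>'"
  by (erule depD) (auto simp: merge_def)

lemma shift_apply: "shift k \<omega> i = \<omega> (i + k)"
  by (cases k; cases i) (simp add: shift_def)

lemma shift_shift: "shift k (shift l \<omega>) = shift (k + l) \<omega>"
  by (rule ext) (simp add: shift_apply add.assoc)

section \<open>Stationarity and resampling of the product measure\<close>

locale iid_field =
  fixes P :: "real measure"
  assumes prob_P: "prob_space P" and sets_P: "sets P = sets borel"
begin

abbreviation "\<Omega> \<equiv> Omega P"

lemma space_P [simp]: "space P = UNIV"
  using sets_eq_imp_space_eq[OF sets_P] by simp

lemma space_Omega [simp]: "space \<Omega> = UNIV"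
  by (auto simp: Omega_def space_PiM)

sublocale Om: prob_space \<Omega>
  unfolding Omega_def by (intro prob_space_PiM prob_P)

sublocale Om2: pair_prob_space \<Omega> \<Omega> ..

lemma coordinate_measurable [measurable]: "(\<lambda>\<omega>. \<omega> i) \<in> borel_measurable \<Omega>"
proof -
  have "(\<lambda>\<omega>. \<omega> i) \<in> \<Omega> \<rightarrow>\<^sub>M P"
    unfolding Omega_def by (rule measurable_component_singleton) simp
  then show ?thesis using measurable_cong_sets[OF refl sets_P] by blast
qed

lemma measurable_into_Omega:
  assumes "\<And>i. (\<lambda>x. g x i) \<in> borel_measurable N"
  shows "g \<in> N \<rightarrow>\<^sub>M \<Omega>"
  unfolding Omega_def
proof (rule measurable_PiM_single')
  show "(\<lambda>\<omega>. g \<omega> i) \<in> N \<rightarrow>\<^sub>M P" for i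
    using assms[of i] measurable_cong_sets[OF refl sets_P] by blast
qed (auto simp: space_PiM)

lemma shift_measurable [measurable]: "shift k \<in> \<Omega> \<rightarrow>\<^sub>M \<Omega>"
  by (rule measurable_into_Omega) (simp add: shift_apply)

lemma merge_measurable [measurable]:
  assumes [measurable]: "u \<in> N \<rightarrow>\<^sub>M \<Omega>" "v \<in> N \<rightarrow>\<^sub>M \<Omega>"
  shows "(\<lambda>x. merge A (u x) (v x)) \<in> N \<rightarrow>\<^sub>M \<Omega>"
proof (rule measurable_into_Omega)
  show "(\<lambda>x. merge A (u x) (v x) i) \<in> borel_measurable N" for i
    by (cases "i \<in> A") (simp_all add: merge_def)
qed

text \<open>Translation is a bijection of the index set and all factors are equal.\<close>

lemma distr_shift: "distr \<Omega> \<Omega> (shift k) = \<Omega>"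
proof -
  have "distr (Pi\<^sub>M UNIV (\<lambda>_. P)) (Pi\<^sub>M UNIV (\<lambda>_. P)) (\<lambda>\<omega>. \<lambda>n\<in>UNIV. \<omega> (n + k)) = Pi\<^sub>M UNIV (\<lambda>_::int\<times>int. P)"
    by (rule distr_PiM_reindex[of UNIV "\<lambda>_. P" "\<lambda>n. n + k" UNIV]) (auto simp: prob_P inj_on_def)
  moreover have "(\<lambda>\<omega>. \<lambda>n\<in>UNIV. \<omega> (n + k)) = shift k"
    by (auto simp: shift_apply fun_eq_iff)
  ultimately show ?thesis by (simp add: Omega_def)
qed

text \<open>Independence of the coordinates inside and outside \<open>A\<close>: a mixture of two
  independent copies has the law of one. On cylinder sets the first copy is tested only inside
  \<open>A\<close> and the second only outside, so the preimage is a rectangle and the measure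
  factorizes.\<close>

lemma distr_merge: "distr (\<Omega> \<Otimes>\<^sub>M \<Omega>) \<Omega> (\<lambda>x. merge A (fst x) (snd x)) = \<Omega>"
proof -
  let ?M = "Pi\<^sub>M UNIV (\<lambda>_::int\<times>int. P)" and ?t = "\<lambda>x. merge A (fst x) (snd x)"
  have mt[measurable]: "?t \<in> \<Omega> \<Otimes>\<^sub>M \<Omega> \<rightarrow>\<^sub>M ?M"
    using merge_measurable[of fst "\<Omega> \<Otimes>\<^sub>M \<Omega>" snd A] by (simp add: Omega_def)
  have "?M = distr (\<Omega> \<Otimes>\<^sub>M \<Omega>) ?M ?t"
  proof (rule measure_eqI_PiM_infinite)
    show "finite_measure ?M" using Om.finite_measure_axioms by (simp add: Omega_def)
    fix E :: "int \<times> int \<Rightarrow> real set" and J :: "(int \<times> int) set"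
    assume J: "finite J" and E: "\<And>i. i \<in> J \<Longrightarrow> E i \<in> sets P"
    have *: "emeasure ?M (prod_emb UNIV (\<lambda>_. P) J (Pi\<^sub>E J E)) = (\<Prod>i\<in>J. emeasure P (E i))"
      if "finite J" "\<And>i. i \<in> J \<Longrightarrow> E i \<in> sets P" for J :: "(int \<times> int) set"
      using that by (intro emeasure_PiM_emb prob_P) auto
    let ?C = "\<lambda>J. prod_emb UNIV (\<lambda>_. P) J (Pi\<^sub>E J E)"
    have ms: "?C J \<in> sets ?M" if "J \<subseteq> UNIV" "finite J" "\<And>i. i \<in> J \<Longrightarrow> E i \<in> sets P" for J
      using that by (intro sets_PiM_I) auto
    have pre: "?t -` ?C J \<inter> space (\<Omega> \<Otimes>\<^sub>M \<Omega>) = ?C (J \<inter> A) \<times> ?C (J - A)"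
    proof -
      have C: "?C J = {\<omega>. \<forall>i\<in>J. \<omega> i \<in> E i}" for J
        by (auto simp: prod_emb_def)
      show ?thesis
        unfolding C by (auto simp: space_pair_measure merge_def)
    qed
    have "emeasure (distr (\<Omega> \<Otimes>\<^sub>M \<Omega>) ?M ?t) (?C J) = emeasure (\<Omega> \<Otimes>\<^sub>M \<Omega>) (?C (J \<inter> A) \<times> ?C (J - A))"
      using J E ms[of J] by (subst emeasure_distr) (auto simp: pre)
    also have "\<dots> = emeasure \<Omega> (?C (J \<inter> A)) * emeasure \<Omega> (?C (J - A))"
      by (rule Om.emeasure_pair_measure_Times) (use ms J E in \<open>auto simp: Omega_def\<close>)
    also have "\<dots> = (\<Prod>i\<in>J \<inter> A. emeasure P (E i)) * (\<Prod>i\<in>J - A. emeasure P (E i))"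
      using J E *[of "J \<inter> A"] *[of "J - A"] by (simp add: Omega_def)
    also have "\<dots> = (\<Prod>i\<in>J. emeasure P (E i))"
      using prod.Int_Diff[OF J, of "\<lambda>i. emeasure P (E i)" A] by simp
    finally show "emeasure ?M (?C J) = emeasure (distr (\<Omega> \<Otimes>\<^sub>M \<Omega>) ?M ?t) (?C J)"
      using J E by (simp add: *)
  qed simp_all
  then show ?thesis by (simp add: Omega_def)
qed

end

context iid_field begin

section \<open>Conditional expectations given a set of coordinates\<close>

lemma prob_Omega_UNIV [simp]: "measure \<Omega> UNIV = 1"
  using Om.prob_space by simp

lemma integral_shift:
  "g \<in> borel_measurable \<Omega> \<Longrightarrow> (\<integral>\<omega>. g (shift k \<omega>) \<partial>\<Omega>) = (\<integral>\<omega>. g \<omega> \<partial>\<Omega>)" for g :: "_ \<Rightarrow> real"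
  using integral_distr[OF shift_measurable, of g k] by (simp add: distr_shift)

lemma integrable_shift:
  fixes g :: "_ \<Rightarrow> real"
  assumes "integrable \<Omega> g"
  shows "integrable \<Omega> (\<lambda>\<omega>. g (shift k \<omega>))"
  using assms integrable_distr_eq[OF shift_measurable, of g k] by (simp add: distr_shift)

lemma L2_shift [intro]: "L2 \<Omega> g \<Longrightarrow> L2 \<Omega> (\<lambda>\<omega>. g (shift k \<omega>))"
  by (auto simp: L2_def intro: integrable_shift)

lemma nrm_shift: "g \<in> borel_measurable \<Omega> \<Longrightarrow> nrm \<Omega> (\<lambda>\<omega>. g (shift k \<omega>)) = nrm \<Omega> g"
  unfolding nrm_def by (subst integral_shift[of "\<lambda>\<omega>. (g \<omega>)\<^sup>2"]) auto

lemma AE_shift: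
  assumes "AE \<omega> in \<Omega>. Q \<omega>"
  shows "AE \<omega> in \<Omega>. Q (shift k \<omega>)"
  by (rule AE_distrD[OF shift_measurable[of k]]) (use assms in \<open>simp only: distr_shift\<close>)

lemma merge_pair_measurable [measurable]:
  "(\<lambda>x. merge A (fst x) (snd x)) \<in> \<Omega> \<Otimes>\<^sub>M \<Omega> \<rightarrow>\<^sub>M \<Omega>"
  by measurable

lemma merge_right_measurable [measurable]: "merge A \<omega> \<in> \<Omega> \<rightarrow>\<^sub>M \<Omega>"
  by measurable

lemma integral_merge:
  "g \<in> borel_measurable \<Omega> \<Longrightarrow> (\<integral>x. g (merge A (fst x) (snd x)) \<partial>(\<Omega> \<Otimes>\<^sub>M \<Omega>)) = (\<integral>\<omega>. g \<omega> \<partial>\<Omega>)"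
  for g :: "_ \<Rightarrow> real"
  using integral_distr[OF merge_pair_measurable, of g A] by (simp add: distr_merge)

lemma integrable_merge:
  "integrable \<Omega> g \<Longrightarrow> integrable (\<Omega> \<Otimes>\<^sub>M \<Omega>) (\<lambda>x. g (merge A (fst x) (snd x)))"
  for g :: "_ \<Rightarrow> real"
  using integrable_distr_eq[OF merge_pair_measurable, of g A] by (simp add: distr_merge)

lemma nn_integral_merge:
  "g \<in> borel_measurable \<Omega> \<Longrightarrow> (\<integral>\<^sup>+x. g (merge A (fst x) (snd x)) \<partial>(\<Omega> \<Otimes>\<^sub>M \<Omega>)) = (\<integral>\<^sup>+\<omega>. g \<omega> \<partial>\<Omega>)"
  using nn_integral_distr[OF merge_pair_measurable, of g A] by (simp add: distr_merge)

lemma AE_integrable_merge: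
  fixes g :: "_ \<Rightarrow> real"
  assumes "integrable \<Omega> g"
  shows "AE \<omega> in \<Omega>. integrable \<Omega> (\<lambda>\<omega>'. g (merge A \<omega> \<omega>'))"
  using Om2.AE_integrable_fst'[OF integrable_merge[OF assms, of A]] by simp

text \<open>An everywhere defined version of the conditional expectation given the coordinates in \<open>A\<close>: the
  other coordinates are integrated out.\<close>

definition cexp :: "(int \<times> int) set \<Rightarrow> ((int \<times> int \<Rightarrow> real) \<Rightarrow> real) \<Rightarrow> (int \<times> int \<Rightarrow> real) \<Rightarrow> real" where
  "cexp A g = (\<lambda>\<omega>. \<integral>\<omega>'. g (merge A \<omega> \<omega>') \<partial>\<Omega>)"

lemma cexp_measurable [measurable]:
  assumes [measurable]: "g \<in> borel_measurable \<Omega>"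
  shows "cexp A g \<in> borel_measurable \<Omega>"
  unfolding cexp_def by measurable

lemma dep_cexp: "dep A (cexp A g)"
  unfolding dep_def cexp_def
proof (intro allI impI)
  fix \<omega> \<omega>2 :: "int \<times> int \<Rightarrow> real" assume "\<forall>i\<in>A. \<omega> i = \<omega>2 i"
  then have "merge A \<omega> = merge A \<omega>2"
    by (intro ext) (simp add: merge_def)
  then show "(\<integral>\<omega>'. g (merge A \<omega> \<omega>') \<partial>\<Omega>) = (\<integral>\<omega>'. g (merge A \<omega>2 \<omega>') \<partial>\<Omega>)" by simp
qed

text \<open>Conditioning uses no coordinates beyond those of \<open>g\<close>; projections of a
  local function therefore stay local.\<close>

lemma dep_cexp_Int:
  assumes "dep B g"
  shows "dep (A \<inter> B) (cexp A g)"
  unfolding dep_def cexp_def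
proof (intro allI impI)
  fix \<omega> \<omega>2 :: "int \<times> int \<Rightarrow> real" assume "\<forall>i\<in>A \<inter> B. \<omega> i = \<omega>2 i"
  then have "g (merge A \<omega> \<omega>') = g (merge A \<omega>2 \<omega>')" for \<omega>'
    by (intro depD[OF assms]) (simp add: merge_def)
  then show "(\<integral>\<omega>'. g (merge A \<omega> \<omega>') \<partial>\<Omega>) = (\<integral>\<omega>'. g (merge A \<omega>2 \<omega>') \<partial>\<Omega>)" by simp
qed

lemma cexp_bounded:
  assumes "g \<in> borel_measurable \<Omega>" "\<And>\<omega>. \<bar>g \<omega>\<bar> \<le> b"
  shows "\<bar>cexp A g \<omega>\<bar> \<le> b"
proof -
  have m: "(\<lambda>\<omega>'. g (merge A \<omega> \<omega>')) \<in> borel_measurable \<Omega>" using assms(1) by measurable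
  have i: "integrable \<Omega> (\<lambda>\<omega>'. g (merge A \<omega> \<omega>'))"
    by (rule Om.integrable_bounded[OF m assms(2)])
  have "\<bar>cexp A g \<omega>\<bar> \<le> (\<integral>\<omega>'. \<bar>g (merge A \<omega> \<omega>')\<bar> \<partial>\<Omega>)"
    unfolding cexp_def by (rule integral_abs_bound)
  also have "\<dots> \<le> (\<integral>\<omega>'. b \<partial>\<Omega>)"
    by (rule integral_mono) (use i assms in auto)
  finally show ?thesis by (simp add: Om.prob_space)
qed

lemma integral_eq_integral_merge:
  fixes g :: "_ \<Rightarrow> real"
  assumes "integrable \<Omega> g"
  shows "(\<integral>\<omega>. g \<omega> \<partial>\<Omega>) = (\<integral>\<omega>. (\<integral>\<omega>'. g (merge A \<omega> \<omega>') \<partial>\<Omega>) \<partial>\<Omega>)"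
  using Om2.integral_fst'[OF integrable_merge[OF assms, of A]] integral_merge[of g A] assms
  by simp

text \<open>Jensen's inequality for the square, from Cauchy-Schwarz for the resampled section. The
  section is known to be square integrable only for almost every point.\<close>

lemma cexp_sq_le:
  assumes "L2 \<Omega> g"
  shows "AE \<omega> in \<Omega>. (cexp A g \<omega>)\<^sup>2 \<le> cexp A (\<lambda>\<omega>. (g \<omega>)\<^sup>2) \<omega>"
  using AE_integrable_merge[OF L2_sq[OF assms], of A]
proof eventually_elim
  case (elim \<omega>)
  have l2: "L2 \<Omega> (\<lambda>\<omega>'. g (merge A \<omega> \<omega>'))"
    using elim L2_meas[OF assms] by (simp add: L2_def)
  have "\<bar>cexp A g \<omega>\<bar> \<le> nrm \<Omega> (\<lambda>\<omega>'. g (merge A \<omega> \<omega>'))"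
    unfolding cexp_def by (rule order_trans[OF integral_abs_bound Om.expectation_abs_le_nrm[OF l2]])
  then have "\<bar>cexp A g \<omega>\<bar>\<^sup>2 \<le> (nrm \<Omega> (\<lambda>\<omega>'. g (merge A \<omega> \<omega>')))\<^sup>2"
    by (rule power_mono) simp
  then show ?case by (simp add: nrm_sq cexp_def)
qed

lemma integral_cexp:
  assumes "integrable \<Omega> g"
  shows "(\<integral>\<omega>. cexp A g \<omega> \<partial>\<Omega>) = (\<integral>\<omega>. g \<omega> \<partial>\<Omega>)"
  unfolding cexp_def by (rule integral_eq_integral_merge[OF assms, symmetric])

lemma integrable_cexp:
  assumes "integrable \<Omega> g"
  shows "integrable \<Omega> (cexp A g)"
  unfolding cexp_def using Om2.integrable_fst'[OF integrable_merge[OF assms, of A]] by simp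

lemma L2_cexp [intro]:
  assumes "L2 \<Omega> g"
  shows "L2 \<Omega> (cexp A g)"
  unfolding L2_def
proof
  show m: "cexp A g \<in> borel_measurable \<Omega>" using L2_meas[OF assms] by measurable
  show "integrable \<Omega> (\<lambda>\<omega>. (cexp A g \<omega>)\<^sup>2)"
  proof (rule Bochner_Integration.integrable_bound[OF integrable_cexp[OF L2_sq[OF assms], of A]])
    show "AE \<omega> in \<Omega>. norm ((cexp A g \<omega>)\<^sup>2) \<le> norm (cexp A (\<lambda>\<omega>. (g \<omega>)\<^sup>2) \<omega>)"
      using cexp_sq_le[OF assms, of A] by eventually_elim simp
  qed (use m in simp)
qed

lemma nrm_cexp_le:
  assumes "L2 \<Omega> g"
  shows "nrm \<Omega> (cexp A g) \<le> nrm \<Omega> g"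
proof -
  have "(\<integral>\<omega>. (cexp A g \<omega>)\<^sup>2 \<partial>\<Omega>) \<le> (\<integral>\<omega>. cexp A (\<lambda>\<omega>. (g \<omega>)\<^sup>2) \<omega> \<partial>\<Omega>)"
    by (rule integral_mono_AE[OF L2_sq[OF L2_cexp[OF assms]] integrable_cexp[OF L2_sq[OF assms]]
        cexp_sq_le[OF assms]])
  also have "\<dots> = (\<integral>\<omega>. (g \<omega>)\<^sup>2 \<partial>\<Omega>)"
    by (rule integral_cexp[OF L2_sq[OF assms]])
  finally show ?thesis by (simp add: nrm_def)
qed

text \<open>The characteristic property of conditional expectation: a factor that depends on
  \<open>A\<close> is untouched by the resampling and leaves the inner integral.\<close>

lemma integral_dep_cexp:
  assumes "L2 \<Omega> u" "dep A u" "L2 \<Omega> g"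
  shows "(\<integral>\<omega>. u \<omega> * cexp A g \<omega> \<partial>\<Omega>) = (\<integral>\<omega>. u \<omega> * g \<omega> \<partial>\<Omega>)"
proof -
  have "(\<integral>\<omega>. u \<omega> * g \<omega> \<partial>\<Omega>) = (\<integral>\<omega>. (\<integral>\<omega>'. u (merge A \<omega> \<omega>') * g (merge A \<omega> \<omega>') \<partial>\<Omega>) \<partial>\<Omega>)"
    by (rule integral_eq_integral_merge[OF L2_mult_integrable[OF assms(1,3)]])
  then show ?thesis
    by (simp add: dep_merge_same[OF assms(2)] cexp_def)
qed

text \<open>Conditioning on \<open>A\<close> resamples every coordinate that \<open>v\<close> uses,
  so its conditional expectation is the constant mean.\<close>

lemma integral_indep:
  assumes "L2 \<Omega> u" "L2 \<Omega> v" "dep A u" "dep B v" "A \<inter> B = {}"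
  shows "(\<integral>\<omega>. u \<omega> * v \<omega> \<partial>\<Omega>) = (\<integral>\<omega>. u \<omega> \<partial>\<Omega>) * (\<integral>\<omega>. v \<omega> \<partial>\<Omega>)"
proof -
  have "cexp A v = (\<lambda>\<omega>. \<integral>\<omega>. v \<omega> \<partial>\<Omega>)"
    using assms(5) by (intro ext) (simp add: cexp_def dep_merge_other[OF assms(4)] Int_commute)
  then show ?thesis
    using integral_dep_cexp[OF assms(1,3,2)] by simp
qed

text \<open>Only almost everywhere, because splitting the inner integral needs both sections to be
  integrable.\<close>

lemma cexp_diff:
  assumes "L2 \<Omega> g" "L2 \<Omega> g'"
  shows "AE \<omega> in \<Omega>. cexp A (\<lambda>\<omega>. g \<omega> - g' \<omega>) \<omega> = cexp A g \<omega> - cexp A g' \<omega>"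
  using AE_integrable_merge[OF Om.L2_integrable[OF assms(1)], of A]
    AE_integrable_merge[OF Om.L2_integrable[OF assms(2)], of A]
  by eventually_elim (simp add: cexp_def)

text \<open>Resampling outside \<open>A\<close> and then outside \<open>B\<close> amounts to
  resampling outside \<open>A \<inter> B\<close>. The two-parameter martingale arguments rest on
  this commutation, which is a consequence of independence. It can fail only where a section of
  \<open>g\<close> is not integrable, that is, on a null set.\<close>

lemma cexp_cexp:
  assumes "L2 \<Omega> g"
  shows "AE \<omega> in \<Omega>. cexp A (cexp B g) \<omega> = cexp (A \<inter> B) g \<omega>"
  using AE_integrable_merge[OF Om.L2_integrable[OF assms], of "A \<inter> B"]
proof eventually_elim
  case (elim \<omega>)
  have "merge (A \<inter> B) \<omega> (merge B \<omega>' \<omega>'') = merge B (merge A \<omega> \<omega>') \<omega>''" for \<omega>' \<omega>''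
    by (auto simp: merge_def)
  then show ?case
    using integral_eq_integral_merge[OF elim, of B] by (simp add: cexp_def)
qed

text \<open>\<open>merge\<close> and \<open>shift\<close> commute once \<open>A\<close> is
  translated along, and the law of the resampled point is invariant under shifts.\<close>

lemma cexp_shift:
  assumes "g \<in> borel_measurable \<Omega>"
  shows "cexp A g (shift k \<omega>) = cexp ((\<lambda>i. i + k) ` A) (\<lambda>\<omega>. g (shift k \<omega>)) \<omega>"
proof -
  have "merge A (shift k \<omega>) (shift k \<omega>') = shift k (merge ((\<lambda>i. i + k) ` A) \<omega> \<omega>')" for \<omega>'
  proof
    fix i
    have "i \<in> A \<longleftrightarrow> i + k \<in> (\<lambda>i. i + k) ` A" by auto
    then show "merge A (shift k \<omega>) (shift k \<omega>') i = shift k (merge ((\<lambda>i. i + k) ` A) \<omega> \<omega>') i"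
      by (simp add: merge_def shift_apply)
  qed
  then show ?thesis
    unfolding cexp_def using integral_shift[of "\<lambda>\<omega>'. g (merge A (shift k \<omega>) \<omega>')" k] assms
    by (simp add: measurable_compose[OF merge_right_measurable])
qed

section \<open>The orthomartingale projections\<close>

text \<open>The product of two martingale difference operators, one per direction, each being
  conditioning up to \<open>k\<close> minus conditioning up to one step before; the product is
  written out as four quadrants.\<close>

definition PP :: "int \<times> int \<Rightarrow> ((int \<times> int \<Rightarrow> real) \<Rightarrow> real) \<Rightarrow> (int \<times> int \<Rightarrow> real) \<Rightarrow> real" where
  "PP k g = (\<lambda>\<omega>. cexp (Gamma_set k) g \<omega> - cexp (Gamma_set (fst k - 1, snd k)) g \<omega>
      - cexp (Gamma_set (fst k, snd k - 1)) g \<omega> + cexp (Gamma_set (fst k - 1, snd k - 1)) g \<omega>)"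

lemma Gamma_set_Int: "Gamma_set (i, j) \<inter> Gamma_set (i', j') = Gamma_set (min i i', min j j')"
  by (auto simp: Gamma_set_def)

lemma Gamma_set_shift: "(\<lambda>i. i + k) ` Gamma_set j = Gamma_set (j + k)"
proof (cases k; cases j)
  fix a b c d assume [simp]: "k = (a, b)" "j = (c, d)"
  have "x \<in> (\<lambda>i. i + k) ` Gamma_set j" if "x \<in> Gamma_set (j + k)" for x
    by (rule image_eqI[of _ _ "x - k"]) (use that in \<open>auto simp: Gamma_set_def\<close>)
  then show ?thesis by (auto simp: Gamma_set_def)
qed

lemma L2_PP [intro]: "L2 \<Omega> g \<Longrightarrow> L2 \<Omega> (PP k g)"
  unfolding PP_def by (intro L2_add L2_diff L2_cexp)

lemma PP_measurable [measurable]: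
  assumes "g \<in> borel_measurable \<Omega>"
  shows "PP k g \<in> borel_measurable \<Omega>"
  unfolding PP_def by (intro borel_measurable_add borel_measurable_diff cexp_measurable assms)

lemma dep_PP: "dep (Gamma_set k) (PP k g)"
proof -
  have "dep (Gamma_set k) (cexp (Gamma_set j) g)" if "fst j \<le> fst k" "snd j \<le> snd k" for j
    by (rule dep_mono[OF dep_cexp]) (use that in \<open>cases j; cases k; auto simp: Gamma_set_def\<close>)
  then show ?thesis
    unfolding PP_def by (intro dep_comp2[where F="(+)"] dep_comp2[where F="(-)"]) auto
qed

lemma dep_PP_finite:
  assumes "dep B g"
  shows "dep B (PP k g)"
proof -
  have "dep B (cexp A g)" for A
    by (rule dep_mono[OF dep_cexp_Int[OF assms]]) auto
  then show ?thesis
    unfolding PP_def by (intro dep_comp2[where F="(+)"] dep_comp2[where F="(-)"]) auto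
qed

lemma PP_bounded:
  assumes "g \<in> borel_measurable \<Omega>" "\<And>\<omega>. \<bar>g \<omega>\<bar> \<le> b"
  shows "\<bar>PP k g \<omega>\<bar> \<le> 4 * b"
  using cexp_bounded[OF assms, of "Gamma_set k" \<omega>] cexp_bounded[OF assms, of "Gamma_set (fst k - 1, snd k)" \<omega>]
    cexp_bounded[OF assms, of "Gamma_set (fst k, snd k - 1)" \<omega>]
    cexp_bounded[OF assms, of "Gamma_set (fst k - 1, snd k - 1)" \<omega>]
  unfolding PP_def by linarith

lemma PP_shift:
  assumes "g \<in> borel_measurable \<Omega>"
  shows "PP j g (shift k \<omega>) = PP (j + k) (\<lambda>\<omega>. g (shift k \<omega>)) \<omega>"
  unfolding PP_def by (simp add: cexp_shift[OF assms] Gamma_set_shift) (simp add: algebra_simps plus_prod_def)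

text \<open>The four quadrants of \<open>PP k\<close> lie inside that of \<open>l\<close>. Hence
  \<open>PP_bessel\<close> may be applied to a conditional expectation, which bounds the tails of
  the projection norms.\<close>

lemma PP_cexp:
  assumes "L2 \<Omega> g" "fst k \<le> fst l" "snd k \<le> snd l"
  shows "AE \<omega> in \<Omega>. PP k (cexp (Gamma_set l) g) \<omega> = PP k g \<omega>"
proof -
  have *: "AE \<omega> in \<Omega>. cexp (Gamma_set (i, j)) (cexp (Gamma_set l) g) \<omega> = cexp (Gamma_set (i, j)) g \<omega>"
    if "i \<le> fst k" "j \<le> snd k" for i j
    using cexp_cexp[OF assms(1), of "Gamma_set (i, j)" "Gamma_set l"] that assms(2,3)
    by (cases l) (simp add: Gamma_set_Int min_absorb1)
  have **: "AE \<omega> in \<Omega>. cexp (Gamma_set k) (cexp (Gamma_set l) g) \<omega> = cexp (Gamma_set k) g \<omega>"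
    using *[of "fst k" "snd k"] by simp
  show ?thesis
    using ** *[of "fst k - 1" "snd k", simplified] *[of "fst k" "snd k - 1", simplified]
      *[of "fst k - 1" "snd k - 1", simplified]
    by eventually_elim (simp add: PP_def)
qed

lemma PP_diff:
  assumes "L2 \<Omega> g" "L2 \<Omega> g'"
  shows "AE \<omega> in \<Omega>. PP k (\<lambda>\<omega>. g \<omega> - g' \<omega>) \<omega> = PP k g \<omega> - PP k g' \<omega>"
  using cexp_diff[OF assms, of "Gamma_set k"] cexp_diff[OF assms, of "Gamma_set (fst k - 1, snd k)"]
    cexp_diff[OF assms, of "Gamma_set (fst k, snd k - 1)"] cexp_diff[OF assms, of "Gamma_set (fst k - 1, snd k - 1)"]
  by eventually_elim (simp add: PP_def)

section \<open>Orthogonality of the projections\<close>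

lemma integral_mult_PP:
  assumes "L2 \<Omega> w" "L2 \<Omega> g"
  shows "(\<integral>\<omega>. w \<omega> * PP k g \<omega> \<partial>\<Omega>) =
    (\<integral>\<omega>. w \<omega> * cexp (Gamma_set k) g \<omega> \<partial>\<Omega>) - (\<integral>\<omega>. w \<omega> * cexp (Gamma_set (fst k - 1, snd k)) g \<omega> \<partial>\<Omega>)
    - (\<integral>\<omega>. w \<omega> * cexp (Gamma_set (fst k, snd k - 1)) g \<omega> \<partial>\<Omega>)
    + (\<integral>\<omega>. w \<omega> * cexp (Gamma_set (fst k - 1, snd k - 1)) g \<omega> \<partial>\<Omega>)"
  using L2_mult_integrable[OF assms(1) L2_cexp[OF assms(2)]]
  by (simp add: PP_def algebra_simps)

text \<open>Sets with the same trace on \<open>H\<close> become indistinguishable when tested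
  against \<open>w\<close>; the orthogonality relations are cancellations of this kind.\<close>

lemma integral_dep_cexp_Int:
  assumes "L2 \<Omega> w" "dep H w" "L2 \<Omega> g"
  shows "(\<integral>\<omega>. w \<omega> * cexp A g \<omega> \<partial>\<Omega>) = (\<integral>\<omega>. w \<omega> * cexp (H \<inter> A) g \<omega> \<partial>\<Omega>)"
proof -
  have "(\<integral>\<omega>. w \<omega> * cexp A g \<omega> \<partial>\<Omega>) = (\<integral>\<omega>. w \<omega> * cexp H (cexp A g) \<omega> \<partial>\<Omega>)"
    using integral_dep_cexp[OF assms(1,2) L2_cexp[OF assms(3)]] by simp
  also have "\<dots> = (\<integral>\<omega>. w \<omega> * cexp (H \<inter> A) g \<omega> \<partial>\<Omega>)"
  proof (rule integral_cong_AE)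
    show "AE \<omega> in \<Omega>. w \<omega> * cexp H (cexp A g) \<omega> = w \<omega> * cexp (H \<inter> A) g \<omega>"
      using cexp_cexp[OF assms(3), of H A] by eventually_elim simp
  qed (use L2_meas[OF assms(1)] L2_meas[OF assms(3)] in measurable)
  finally show ?thesis .
qed

text \<open>On the half-plane before \<open>fst k\<close>, quadrants ending at \<open>fst k\<close>
  and at \<open>fst k - 1\<close> have the same trace, so the four terms of the projection cancel in
  pairs.\<close>

lemma integral_PP_orth1:
  assumes "L2 \<Omega> w" "L2 \<Omega> g" "dep {r. fst r < fst k} w"
  shows "(\<integral>\<omega>. w \<omega> * PP k g \<omega> \<partial>\<Omega>) = 0"
proof -
  have "{r. fst r < fst k} \<inter> Gamma_set (fst k, j) = {r. fst r < fst k} \<inter> Gamma_set (fst k - 1, j)" for j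
    by (auto simp: Gamma_set_def)
  then have "(\<integral>\<omega>. w \<omega> * cexp (Gamma_set (fst k, j)) g \<omega> \<partial>\<Omega>) =
      (\<integral>\<omega>. w \<omega> * cexp (Gamma_set (fst k - 1, j)) g \<omega> \<partial>\<Omega>)" for j
    using integral_dep_cexp_Int[OF assms(1,3,2), of "Gamma_set (fst k, j)"]
      integral_dep_cexp_Int[OF assms(1,3,2), of "Gamma_set (fst k - 1, j)"] by metis
  from this[of "snd k"] this[of "snd k - 1"] show ?thesis
    unfolding integral_mult_PP[OF assms(1,2)] by simp
qed

lemma integral_PP_orth2:
  assumes "L2 \<Omega> w" "L2 \<Omega> g" "dep {r. snd r < snd k} w"
  shows "(\<integral>\<omega>. w \<omega> * PP k g \<omega> \<partial>\<Omega>) = 0"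
proof -
  have "{r. snd r < snd k} \<inter> Gamma_set (i, snd k) = {r. snd r < snd k} \<inter> Gamma_set (i, snd k - 1)" for i
    by (auto simp: Gamma_set_def)
  then have "(\<integral>\<omega>. w \<omega> * cexp (Gamma_set (i, snd k)) g \<omega> \<partial>\<Omega>) =
      (\<integral>\<omega>. w \<omega> * cexp (Gamma_set (i, snd k - 1)) g \<omega> \<partial>\<Omega>)" for i
    using integral_dep_cexp_Int[OF assms(1,3,2), of "Gamma_set (i, snd k)"]
      integral_dep_cexp_Int[OF assms(1,3,2), of "Gamma_set (i, snd k - 1)"] by metis
  from this[of "fst k"] this[of "fst k - 1"] show ?thesis
    unfolding integral_mult_PP[OF assms(1,2)] by simp
qed

text \<open>Distinct sites differ in some coordinate. The projection at the site that is smaller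
  there depends on a half-plane, and the other projection is orthogonal to every function of that
  half-plane.\<close>

lemma integral_PP_PP:
  assumes "L2 \<Omega> g" "L2 \<Omega> g'" "k \<noteq> l"
  shows "(\<integral>\<omega>. PP k g \<omega> * PP l g' \<omega> \<partial>\<Omega>) = 0"
proof -
  have *: "(\<integral>\<omega>. PP k g \<omega> * PP l g' \<omega> \<partial>\<Omega>) = 0"
    if "L2 \<Omega> g" "L2 \<Omega> g'" "fst k < fst l \<or> snd k < snd l" for k l g g'
    using that(3)
  proof
    assume "fst k < fst l"
    then show ?thesis
      by (intro integral_PP_orth1 L2_PP that dep_mono[OF dep_PP]) (auto simp: Gamma_set_def split: prod.splits)
  next
    assume "snd k < snd l"
    then show ?thesis
      by (intro integral_PP_orth2 L2_PP that dep_mono[OF dep_PP]) (auto simp: Gamma_set_def split: prod.splits)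
  qed
  have "fst k < fst l \<or> snd k < snd l \<or> fst l < fst k \<or> snd l < snd k"
    using assms(3) by (auto simp: prod_eq_iff)
  then show ?thesis
    using *[OF assms(1,2), of k l] *[OF assms(2,1), of l k] by (auto simp: mult.commute)
qed

text \<open>When one factor is expanded, only the full quadrant survives: the other three terms
  depend on half-planes behind \<open>k\<close>. So \<open>PP k\<close> acts as an orthogonal
  projection.\<close>

lemma integral_self_PP:
  assumes "L2 \<Omega> g"
  shows "(\<integral>\<omega>. g \<omega> * PP k g \<omega> \<partial>\<Omega>) = (nrm \<Omega> (PP k g))\<^sup>2"
proof -
  have "(nrm \<Omega> (PP k g))\<^sup>2 = (\<integral>\<omega>. PP k g \<omega> * PP k g \<omega> \<partial>\<Omega>)"
    unfolding nrm_sq by (simp add: power2_eq_square)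
  also have "\<dots> = (\<integral>\<omega>. PP k g \<omega> * cexp (Gamma_set k) g \<omega> \<partial>\<Omega>)"
  proof -
    have "(\<integral>\<omega>. cexp (Gamma_set (fst k - 1, j)) g \<omega> * PP k g \<omega> \<partial>\<Omega>) = 0" for j
      by (intro integral_PP_orth1 L2_cexp assms dep_mono[OF dep_cexp]) (auto simp: Gamma_set_def)
    moreover have "(\<integral>\<omega>. cexp (Gamma_set (i, snd k - 1)) g \<omega> * PP k g \<omega> \<partial>\<Omega>) = 0" for i
      by (intro integral_PP_orth2 L2_cexp assms dep_mono[OF dep_cexp]) (auto simp: Gamma_set_def)
    ultimately show ?thesis
      by (subst integral_mult_PP[OF L2_PP[OF assms] assms]) (simp add: mult.commute)
  qed
  also have "\<dots> = (\<integral>\<omega>. PP k g \<omega> * g \<omega> \<partial>\<Omega>)"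
    by (rule integral_dep_cexp[OF L2_PP[OF assms] dep_PP assms])
  finally show ?thesis by (simp add: mult.commute)
qed

text \<open>Bessel's inequality for mutually orthogonal projections, by expanding the square of
  \<open>g\<close> minus its projection sum.\<close>

lemma PP_bessel:
  assumes "L2 \<Omega> g" "finite I"
  shows "(\<Sum>k\<in>I. (nrm \<Omega> (PP k g))\<^sup>2) \<le> (nrm \<Omega> g)\<^sup>2"
proof -
  let ?s = "\<lambda>\<omega>. \<Sum>k\<in>I. PP k g \<omega>"
  have l2: "L2 \<Omega> ?s" using assms by auto
  have gs: "(\<integral>\<omega>. g \<omega> * ?s \<omega> \<partial>\<Omega>) = (\<Sum>k\<in>I. (nrm \<Omega> (PP k g))\<^sup>2)"
    using L2_mult_integrable[OF assms(1) L2_PP[OF assms(1)]]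
    by (simp add: sum_distrib_left integral_self_PP[OF assms(1)])
  have "(\<integral>\<omega>. ?s \<omega> * ?s \<omega> \<partial>\<Omega>) = (\<Sum>k\<in>I. \<Sum>l\<in>I. \<integral>\<omega>. PP k g \<omega> * PP l g \<omega> \<partial>\<Omega>)"
    using L2_mult_integrable[OF L2_PP[OF assms(1)] L2_PP[OF assms(1)]]
    by (simp add: sum_distrib_left sum_distrib_right) (rule sum.swap)
  also have "\<dots> = (\<Sum>k\<in>I. \<Sum>l\<in>I. if l = k then (nrm \<Omega> (PP k g))\<^sup>2 else 0)"
    unfolding nrm_sq
    by (intro sum.cong refl) (auto simp: integral_PP_PP[OF assms(1) assms(1)] power2_eq_square)
  also have "\<dots> = (\<Sum>k\<in>I. (nrm \<Omega> (PP k g))\<^sup>2)"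
    using assms(2) by simp
  finally have ss: "(\<integral>\<omega>. ?s \<omega> * ?s \<omega> \<partial>\<Omega>) = (\<Sum>k\<in>I. (nrm \<Omega> (PP k g))\<^sup>2)" .
  have "0 \<le> (\<integral>\<omega>. (g \<omega> - ?s \<omega>)\<^sup>2 \<partial>\<Omega>)" by simp
  also have "(\<lambda>\<omega>. (g \<omega> - ?s \<omega>)\<^sup>2) = (\<lambda>\<omega>. (g \<omega>)\<^sup>2 - 2 * (g \<omega> * ?s \<omega>) + ?s \<omega> * ?s \<omega>)"
    by (auto simp: power2_eq_square algebra_simps)
  also have "(\<integral>\<omega>. (g \<omega>)\<^sup>2 - 2 * (g \<omega> * ?s \<omega>) + ?s \<omega> * ?s \<omega> \<partial>\<Omega>) =
      (nrm \<Omega> g)\<^sup>2 - 2 * (\<integral>\<omega>. g \<omega> * ?s \<omega> \<partial>\<Omega>) + (\<integral>\<omega>. ?s \<omega> * ?s \<omega> \<partial>\<Omega>)"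
    using L2_mult_integrable[OF assms(1) l2] L2_mult_integrable[OF l2 l2] L2_sq[OF assms(1)]
    by (simp add: nrm_sq)
  finally show ?thesis unfolding gs ss by simp
qed

lemma nrm_PP_le:
  assumes "L2 \<Omega> g"
  shows "nrm \<Omega> (PP k g) \<le> nrm \<Omega> g"
  using PP_bessel[OF assms, of "{k}"] by (auto intro: power2_le_imp_le)

end

section \<open>Maximal inequalities\<close>

text \<open>The maximum over the indices 0 to \<open>n\<close>, as a recursion: both the summation
  by parts in \<open>doob_pathwise\<close> and the closure of submartingales under maxima then go by
  induction.\<close>

primrec rmax :: "(nat \<Rightarrow> real) \<Rightarrow> nat \<Rightarrow> real" where
  "rmax x 0 = x 0"
| "rmax x (Suc n) = max (rmax x n) (x (Suc n))"

lemma rmax_ge: "i \<le> n \<Longrightarrow> x i \<le> rmax x n"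
  by (induction n) (auto simp: le_Suc_eq)

lemma rmax_le: "(\<And>i. i \<le> n \<Longrightarrow> x i \<le> c) \<Longrightarrow> rmax x n \<le> c"
  by (induction n) auto

lemma rmax_nonneg: "(\<And>i. x i \<ge> 0) \<Longrightarrow> rmax x n \<ge> 0"
  using rmax_ge[of 0 n x] by (meson order_trans le0)

lemma rmax_power2: "(\<And>i. x i \<ge> 0) \<Longrightarrow> rmax (\<lambda>i. (x i)\<^sup>2) n = (rmax x n)\<^sup>2"
proof (induction n)
  case (Suc n)
  have "max (a\<^sup>2) (b\<^sup>2) = (max a b)\<^sup>2" if "a \<ge> 0" "b \<ge> 0" for a b :: real
    using that by (auto simp: max_def power_mono_iff)
  then show ?case using Suc rmax_nonneg[of x n] by simp
qed simp

text \<open>A pathwise form of Doob's inequality. The left side is a discrete stochastic integral of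
  the running maximum, whose mean is nonnegative for a submartingale. When a new maximum is reached,
  \<open>2 * a * b <= a^2 + b^2\<close> closes the induction.\<close>

lemma doob_pathwise:
  assumes "\<And>i. x i \<ge> 0"
  shows "(\<Sum>i<n. rmax x i * (x (Suc i) - x i)) \<le> rmax x n * x n - (rmax x n)\<^sup>2 / 2"
proof (induction n)
  case (Suc n)
  let ?a = "rmax x n" and ?b = "x (Suc n)"
  have "?a * ?b - ?a\<^sup>2 / 2 \<le> max ?a ?b * ?b - (max ?a ?b)\<^sup>2 / 2"
  proof (cases "?b \<le> ?a")
    case False
    have "0 \<le> (?a - ?b)\<^sup>2" by simp
    then have "2 * (?a * ?b) \<le> ?a\<^sup>2 + ?b\<^sup>2" by (simp add: power2_eq_square algebra_simps)
    then show ?thesis using False by (simp add: max_def power2_eq_square)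
  qed (simp add: max_def)
  then show ?case using Suc by (simp add: algebra_simps)
qed (simp add: power2_eq_square)

section \<open>Submartingales in one direction, and Cairoli's inequality in two\<close>

context iid_field begin

text \<open>The filtration is a sequence of coordinate sets, and the submartingale inequality is
  tested against nonnegative adapted weights. In this weak form, events and signs known at time
  \<open>l\<close> are simply absorbed into the weight.\<close>

definition submart :: "(nat \<Rightarrow> (int \<times> int) set) \<Rightarrow> (nat \<Rightarrow> (int \<times> int \<Rightarrow> real) \<Rightarrow> real) \<Rightarrow> bool" where
  "submart A y \<longleftrightarrow> (\<forall>l. L2 \<Omega> (y l) \<and> dep (A l) (y l) \<and> (\<forall>\<omega>. 0 \<le> y l \<omega>)) \<and>
     (\<forall>l w. L2 \<Omega> w \<and> dep (A l) w \<and> (\<forall>\<omega>. 0 \<le> w \<omega>) \<longrightarrow> 0 \<le> (\<integral>\<omega>. w \<omega> * (y (Suc l) \<omega> - y l \<omega>) \<partial>\<Omega>))"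

definition mart :: "(nat \<Rightarrow> (int \<times> int) set) \<Rightarrow> (nat \<Rightarrow> (int \<times> int \<Rightarrow> real) \<Rightarrow> real) \<Rightarrow> bool" where
  "mart A y \<longleftrightarrow> (\<forall>l. L2 \<Omega> (y l) \<and> dep (A l) (y l)) \<and>
     (\<forall>l w. L2 \<Omega> w \<and> dep (A l) w \<longrightarrow> (\<integral>\<omega>. w \<omega> * (y (Suc l) \<omega> - y l \<omega>) \<partial>\<Omega>) = 0)"

text \<open>The weight is split along the event, known at time \<open>l\<close>, that
  \<open>y\<close> dominates \<open>z\<close>. On each part the increment of the maximum is at least
  that of the function which is larger at time \<open>l\<close>.\<close>

lemma submart_max:
  assumes "submart A y" "submart A z"
  shows "submart A (\<lambda>l \<omega>. max (y l \<omega>) (z l \<omega>))"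
proof -
  have y: "L2 \<Omega> (y l)" "dep (A l) (y l)" "0 \<le> y l \<omega>" for l \<omega>
    using assms(1) by (auto simp: submart_def)
  have z: "L2 \<Omega> (z l)" "dep (A l) (z l)" for l
    using assms(2) by (auto simp: submart_def)
  have "0 \<le> (\<integral>\<omega>. w \<omega> * (max (y (Suc l) \<omega>) (z (Suc l) \<omega>) - max (y l \<omega>) (z l \<omega>)) \<partial>\<Omega>)"
    if w: "L2 \<Omega> w" "dep (A l) w" "\<And>\<omega>. 0 \<le> w \<omega>" for l w
  proof -
    note [measurable] = L2_meas[OF y(1)] L2_meas[OF z(1)]
    define H where "H = {\<omega>. z l \<omega> \<le> y l \<omega>}"
    have "{\<omega> \<in> space \<Omega>. z l \<omega> \<le> y l \<omega>} \<in> sets \<Omega>" by measurable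
    then have [measurable]: "H \<in> sets \<Omega>" by (simp add: H_def)
    let ?u = "\<lambda>\<omega>. w \<omega> * indicator H \<omega>" and ?v = "\<lambda>\<omega>. w \<omega> * indicator (- H) \<omega>"
    have H': "- H \<in> sets \<Omega>" using sets.compl_sets[of H \<Omega>] by (simp add: Compl_eq_Diff_UNIV)
    have iH: "indicat_real H = (\<lambda>\<omega>. if z l \<omega> \<le> y l \<omega> then 1 else 0)"
      "indicat_real (- H) = (\<lambda>\<omega>. if z l \<omega> \<le> y l \<omega> then 0 else 1)"
      by (auto simp: H_def indicator_def)
    have dH: "dep (A l) (indicat_real H)" "dep (A l) (indicat_real (- H))"
      unfolding iH using dep_comp2[OF y(2)[of l] z(2)[of l], of "\<lambda>a b. if b \<le> a then 1 else 0"]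
        dep_comp2[OF y(2)[of l] z(2)[of l], of "\<lambda>a b. if b \<le> a then 0 else 1"] by simp_all
    have u: "L2 \<Omega> ?u" "dep (A l) ?u" "0 \<le> ?u \<omega>" for \<omega>
      using L2_times_indicator[OF w(1) \<open>H \<in> sets \<Omega>\<close>] dep_comp2[OF w(2) dH(1), of "(*)"] w(3) by simp_all
    have v: "L2 \<Omega> ?v" "dep (A l) ?v" "0 \<le> ?v \<omega>" for \<omega>
      using L2_times_indicator[OF w(1) H'] dep_comp2[OF w(2) dH(2), of "(*)"] w(3) by simp_all
    have "0 \<le> (\<integral>\<omega>. ?u \<omega> * (y (Suc l) \<omega> - y l \<omega>) \<partial>\<Omega>) + (\<integral>\<omega>. ?v \<omega> * (z (Suc l) \<omega> - z l \<omega>) \<partial>\<Omega>)"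
      by (rule add_nonneg_nonneg) (use assms u v in \<open>auto simp: submart_def\<close>)
    also have "\<dots> = (\<integral>\<omega>. ?u \<omega> * (y (Suc l) \<omega> - y l \<omega>) + ?v \<omega> * (z (Suc l) \<omega> - z l \<omega>) \<partial>\<Omega>)"
      by (rule Bochner_Integration.integral_add[symmetric]; intro L2_mult_integrable u v L2_diff y z)
    also have "\<dots> \<le> (\<integral>\<omega>. w \<omega> * (max (y (Suc l) \<omega>) (z (Suc l) \<omega>) - max (y l \<omega>) (z l \<omega>)) \<partial>\<Omega>)"
    proof (rule integral_mono)
      show "integrable \<Omega> (\<lambda>\<omega>. ?u \<omega> * (y (Suc l) \<omega> - y l \<omega>) + ?v \<omega> * (z (Suc l) \<omega> - z l \<omega>))"
        by (intro Bochner_Integration.integrable_add L2_mult_integrable u v L2_diff y z)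
      show "integrable \<Omega> (\<lambda>\<omega>. w \<omega> * (max (y (Suc l) \<omega>) (z (Suc l) \<omega>) - max (y l \<omega>) (z l \<omega>)))"
        by (intro L2_mult_integrable w L2_diff L2_max y z)
      fix \<omega>
      have "w \<omega> * (y (Suc l) \<omega> - y l \<omega>) \<le> w \<omega> * (max (y (Suc l) \<omega>) (z (Suc l) \<omega>) - max (y l \<omega>) (z l \<omega>))"
        if "\<omega> \<in> H" by (rule mult_left_mono) (use that w(3) in \<open>auto simp: H_def\<close>)
      moreover have "w \<omega> * (z (Suc l) \<omega> - z l \<omega>) \<le> w \<omega> * (max (y (Suc l) \<omega>) (z (Suc l) \<omega>) - max (y l \<omega>) (z l \<omega>))"
        if "\<omega> \<notin> H" by (rule mult_left_mono) (use that w(3) in \<open>auto simp: H_def\<close>)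
      ultimately show "?u \<omega> * (y (Suc l) \<omega> - y l \<omega>) + ?v \<omega> * (z (Suc l) \<omega> - z l \<omega>)
          \<le> w \<omega> * (max (y (Suc l) \<omega>) (z (Suc l) \<omega>) - max (y l \<omega>) (z l \<omega>))"
        by (auto simp: indicator_def)
    qed
    finally show ?thesis .
  qed
  then show ?thesis
    unfolding submart_def
    using y z by (auto intro: dep_comp2[where F=max] simp: le_max_iff_disj)
qed

lemma submart_rmax:
  assumes "\<And>k. submart A (\<lambda>l. y k l)"
  shows "submart A (\<lambda>l \<omega>. rmax (\<lambda>k. y k l \<omega>) n)"
  by (induction n) (simp_all add: assms submart_max)

lemma L2_rmax [intro]: "(\<And>i. L2 \<Omega> (y i)) \<Longrightarrow> L2 \<Omega> (\<lambda>\<omega>. rmax (\<lambda>i. y i \<omega>) n)"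
  by (induction n) auto

text \<open>The submartingale inequalities are summed with the running maxima as weights, and
  \<open>doob_pathwise\<close> is applied. The factor 4 comes from
  \<open>m * y <= m^2 / 4 + y^2\<close>.\<close>

lemma doob_maximal:
  assumes "submart A y" "incseq A"
  shows "(\<integral>\<omega>. (rmax (\<lambda>i. y i \<omega>) n)\<^sup>2 \<partial>\<Omega>) \<le> 4 * (\<integral>\<omega>. (y n \<omega>)\<^sup>2 \<partial>\<Omega>)"
proof -
  have y: "L2 \<Omega> (y l)" "dep (A l) (y l)" "0 \<le> y l \<omega>" for l \<omega>
    using assms(1) by (auto simp: submart_def)
  let ?m = "\<lambda>i \<omega>. rmax (\<lambda>i. y i \<omega>) i"
  have m: "L2 \<Omega> (?m i)" for i using y by auto
  have d: "dep (A i) (?m i)" for i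
  proof (induction i)
    case (Suc i)
    have "dep (A (Suc i)) (?m i)"
      by (rule dep_mono[OF Suc]) (use assms(2) in \<open>auto simp: incseq_Suc_iff\<close>)
    then show ?case using y(2)[of "Suc i"] by (auto intro: dep_comp2[where F=max])
  qed (use y in simp)
  have n: "0 \<le> ?m i \<omega>" for i \<omega> by (rule rmax_nonneg) (rule y)
  have i: "integrable \<Omega> (\<lambda>\<omega>. ?m i \<omega> * (y j \<omega> - y k \<omega>))" for i j k
    by (intro L2_mult_integrable m L2_diff y)
  have "0 \<le> (\<Sum>i<n. \<integral>\<omega>. ?m i \<omega> * (y (Suc i) \<omega> - y i \<omega>) \<partial>\<Omega>)"
    by (rule sum_nonneg) (use assms(1) m d n in \<open>auto simp: submart_def\<close>)
  also have "\<dots> = (\<integral>\<omega>. (\<Sum>i<n. ?m i \<omega> * (y (Suc i) \<omega> - y i \<omega>)) \<partial>\<Omega>)"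
    using i by simp
  also have "\<dots> \<le> (\<integral>\<omega>. (y n \<omega>)\<^sup>2 - (?m n \<omega>)\<^sup>2 / 4 \<partial>\<Omega>)"
  proof (rule integral_mono)
    fix \<omega>
    have "0 \<le> (?m n \<omega> / 2 - y n \<omega>)\<^sup>2" by simp
    then have "?m n \<omega> * y n \<omega> \<le> (?m n \<omega>)\<^sup>2 / 4 + (y n \<omega>)\<^sup>2"
      by (simp add: power2_eq_square algebra_simps)
    then show "(\<Sum>i<n. ?m i \<omega> * (y (Suc i) \<omega> - y i \<omega>)) \<le> (y n \<omega>)\<^sup>2 - (?m n \<omega>)\<^sup>2 / 4"
      using doob_pathwise[of "\<lambda>i. y i \<omega>" n] y(3) by force
  qed (use i L2_sq[OF y(1)] L2_sq[OF m] in auto)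
  also have "\<dots> = (\<integral>\<omega>. (y n \<omega>)\<^sup>2 \<partial>\<Omega>) - (\<integral>\<omega>. (?m n \<omega>)\<^sup>2 \<partial>\<Omega>) / 4"
    using L2_sq[OF y(1)] L2_sq[OF m] by simp
  finally show ?thesis by simp
qed

text \<open>Maxima over one index again form a submartingale in the other, so Doob's inequality
  applies once per direction and the two factors 4 multiply.\<close>

lemma cairoli_maximal:
  assumes "\<And>l. submart A (\<lambda>k. y k l)" "\<And>k. submart B (\<lambda>l. y k l)" "incseq A" "incseq B"
  shows "(\<integral>\<omega>. (rmax (\<lambda>l. rmax (\<lambda>k. y k l \<omega>) n1) n2)\<^sup>2 \<partial>\<Omega>) \<le> 16 * (\<integral>\<omega>. (y n1 n2 \<omega>)\<^sup>2 \<partial>\<Omega>)"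
proof -
  have "(\<integral>\<omega>. (rmax (\<lambda>l. rmax (\<lambda>k. y k l \<omega>) n1) n2)\<^sup>2 \<partial>\<Omega>) \<le> 4 * (\<integral>\<omega>. (rmax (\<lambda>k. y k n2 \<omega>) n1)\<^sup>2 \<partial>\<Omega>)"
    by (rule doob_maximal[OF submart_rmax[OF assms(2)] assms(4)])
  also have "(\<integral>\<omega>. (rmax (\<lambda>k. y k n2 \<omega>) n1)\<^sup>2 \<partial>\<Omega>) \<le> 4 * (\<integral>\<omega>. (y n1 n2 \<omega>)\<^sup>2 \<partial>\<Omega>)"
    by (rule doob_maximal[OF assms(1,3)])
  finally show ?thesis by simp
qed

text \<open>The weight is multiplied by the sign of \<open>y l\<close>, a subgradient of the
  absolute value, which turns the martingale equality into a lower bound for the increment.\<close>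

lemma submart_abs:
  assumes "mart A y"
  shows "submart A (\<lambda>l \<omega>. \<bar>y l \<omega>\<bar>)"
proof -
  have y: "L2 \<Omega> (y l)" "dep (A l) (y l)" for l
    using assms by (auto simp: mart_def)
  note [measurable] = L2_meas[OF y(1)]
  have "0 \<le> (\<integral>\<omega>. w \<omega> * (\<bar>y (Suc l) \<omega>\<bar> - \<bar>y l \<omega>\<bar>) \<partial>\<Omega>)"
    if w: "L2 \<Omega> w" "dep (A l) w" "\<And>\<omega>. 0 \<le> w \<omega>" for l w
  proof -
    let ?u = "\<lambda>\<omega>. w \<omega> * (if 0 \<le> y l \<omega> then 1 else -1)"
    have u: "L2 \<Omega> ?u"
    proof (rule L2_bound[OF w(1)])
      show "?u \<in> borel_measurable \<Omega>" using L2_meas[OF w(1)] by measurable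
    qed auto
    have "dep (A l) ?u"
      using dep_comp2[OF w(2) y(2)[of l], of "\<lambda>a b. a * (if 0 \<le> b then 1 else -1)"] by simp
    then have "0 = (\<integral>\<omega>. ?u \<omega> * (y (Suc l) \<omega> - y l \<omega>) \<partial>\<Omega>)"
      using assms u by (auto simp: mart_def)
    also have "\<dots> \<le> (\<integral>\<omega>. w \<omega> * (\<bar>y (Suc l) \<omega>\<bar> - \<bar>y l \<omega>\<bar>) \<partial>\<Omega>)"
    proof (rule integral_mono)
      show "integrable \<Omega> (\<lambda>\<omega>. ?u \<omega> * (y (Suc l) \<omega> - y l \<omega>))"
        by (intro L2_mult_integrable u L2_diff y)
      show "integrable \<Omega> (\<lambda>\<omega>. w \<omega> * (\<bar>y (Suc l) \<omega>\<bar> - \<bar>y l \<omega>\<bar>))"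
        by (intro L2_mult_integrable w L2_diff L2_abs y)
      fix \<omega>
      have "w \<omega> * ((if 0 \<le> y l \<omega> then 1 else -1) * (y (Suc l) \<omega> - y l \<omega>)) \<le> w \<omega> * (\<bar>y (Suc l) \<omega>\<bar> - \<bar>y l \<omega>\<bar>)"
        by (rule mult_left_mono) (use w(3) in auto)
      then show "?u \<omega> * (y (Suc l) \<omega> - y l \<omega>) \<le> w \<omega> * (\<bar>y (Suc l) \<omega>\<bar> - \<bar>y l \<omega>\<bar>)"
        by (simp add: mult.assoc)
    qed
    finally show ?thesis .
  qed
  then show ?thesis
    unfolding submart_def using y by (auto intro: dep_comp)
qed

text \<open>The same convexity argument with the derivative \<open>2 * y l\<close> as multiplier.
  Boundedness keeps the new weight and the squares in \<open>L2\<close>.\<close>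

lemma submart_power2:
  assumes "mart A y" "\<And>l. \<exists>b. \<forall>\<omega>. \<bar>y l \<omega>\<bar> \<le> b"
  shows "submart A (\<lambda>l \<omega>. (y l \<omega>)\<^sup>2)"
proof -
  have y: "L2 \<Omega> (y l)" "dep (A l) (y l)" for l
    using assms by (auto simp: mart_def)
  note [measurable] = L2_meas[OF y(1)]
  have y2: "L2 \<Omega> (\<lambda>\<omega>. (y l \<omega>)\<^sup>2)" for l
  proof -
    obtain b where "\<And>\<omega>. \<bar>y l \<omega>\<bar> \<le> b" using assms(2) by blast
    then have "\<bar>(y l \<omega>)\<^sup>2\<bar> \<le> b\<^sup>2" for \<omega>
      by (metis abs_ge_zero power2_abs power_mono abs_power2)
    then show ?thesis by (intro Om.L2_bounded) auto
  qed
  have "0 \<le> (\<integral>\<omega>. w \<omega> * ((y (Suc l) \<omega>)\<^sup>2 - (y l \<omega>)\<^sup>2) \<partial>\<Omega>)"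
    if w: "L2 \<Omega> w" "dep (A l) w" "\<And>\<omega>. 0 \<le> w \<omega>" for l w
  proof -
    obtain b where b: "\<And>\<omega>. \<bar>y l \<omega>\<bar> \<le> b" using assms(2) by blast
    let ?u = "\<lambda>\<omega>. w \<omega> * (2 * y l \<omega>)"
    have u: "L2 \<Omega> ?u"
    proof (rule L2_bound[OF L2_cmult[OF w(1), of "2 * b"]])
      show "?u \<in> borel_measurable \<Omega>" using L2_meas[OF w(1)] by measurable
      show "\<bar>w \<omega> * (2 * y l \<omega>)\<bar> \<le> \<bar>2 * b * w \<omega>\<bar>" for \<omega>
        using mult_right_mono[OF order_trans[OF b[of \<omega>] abs_ge_self] abs_ge_zero[of "w \<omega>"]] 
        by (simp add: abs_mult mult.commute mult.left_commute)
    qed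
    have "dep (A l) ?u"
      using dep_comp2[OF w(2) y(2)[of l], of "\<lambda>a b. a * (2 * b)"] by simp
    then have "0 = (\<integral>\<omega>. ?u \<omega> * (y (Suc l) \<omega> - y l \<omega>) \<partial>\<Omega>)"
      using assms(1) u by (auto simp: mart_def)
    also have "\<dots> \<le> (\<integral>\<omega>. w \<omega> * ((y (Suc l) \<omega>)\<^sup>2 - (y l \<omega>)\<^sup>2) \<partial>\<Omega>)"
    proof (rule integral_mono)
      show "integrable \<Omega> (\<lambda>\<omega>. ?u \<omega> * (y (Suc l) \<omega> - y l \<omega>))"
        by (intro L2_mult_integrable u L2_diff y)
      show "integrable \<Omega> (\<lambda>\<omega>. w \<omega> * ((y (Suc l) \<omega>)\<^sup>2 - (y l \<omega>)\<^sup>2))"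
        by (intro L2_mult_integrable w L2_diff y2)
      fix \<omega>
      have "0 \<le> (y (Suc l) \<omega> - y l \<omega>)\<^sup>2" by simp
      then have "w \<omega> * ((2 * y l \<omega>) * (y (Suc l) \<omega> - y l \<omega>)) \<le> w \<omega> * ((y (Suc l) \<omega>)\<^sup>2 - (y l \<omega>)\<^sup>2)"
        by (intro mult_left_mono) (use w(3) in \<open>auto simp: power2_eq_square algebra_simps\<close>)
      then show "?u \<omega> * (y (Suc l) \<omega> - y l \<omega>) \<le> w \<omega> * ((y (Suc l) \<omega>)\<^sup>2 - (y l \<omega>)\<^sup>2)"
        by (simp add: mult.assoc)
    qed
    finally show ?thesis .
  qed
  then show ?thesis
    unfolding submart_def using y y2 by (auto intro: dep_comp)
qed

section \<open>Maxima of the partial sums\<close>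

text \<open>The maximum over all subrectangles with lower corner at the origin, empty ones included.
  Smoothed sums interpolate between these rectangle sums, so \<open>Mx\<close> also dominates the
  whole path.\<close>

definition Mx :: "((int \<times> int \<Rightarrow> real) \<Rightarrow> real) \<Rightarrow> nat \<Rightarrow> nat \<Rightarrow> (int \<times> int \<Rightarrow> real) \<Rightarrow> real" where
  "Mx g n1 n2 \<omega> = rmax (\<lambda>j. rmax (\<lambda>i. \<bar>S_rect g i j \<omega>\<bar>) n1) n2"

lemma Mx_ge: "i \<le> n1 \<Longrightarrow> j \<le> n2 \<Longrightarrow> \<bar>S_rect g i j \<omega>\<bar> \<le> Mx g n1 n2 \<omega>"
  unfolding Mx_def using rmax_ge[of i n1 "\<lambda>i. \<bar>S_rect g i j \<omega>\<bar>"]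
    rmax_ge[of j n2 "\<lambda>j. rmax (\<lambda>i. \<bar>S_rect g i j \<omega>\<bar>) n1"] by linarith

lemma Mx_le: "(\<And>i j. i \<le> n1 \<Longrightarrow> j \<le> n2 \<Longrightarrow> \<bar>S_rect g i j \<omega>\<bar> \<le> c) \<Longrightarrow> Mx g n1 n2 \<omega> \<le> c"
  unfolding Mx_def by (intro rmax_le)

lemma Mx_nonneg [simp]: "0 \<le> Mx g n1 n2 \<omega>"
  unfolding Mx_def by (intro rmax_nonneg) simp

lemma S_rect_add: "S_rect (\<lambda>\<omega>. f \<omega> + g \<omega>) i j \<omega> = S_rect f i j \<omega> + S_rect g i j \<omega>"
  by (simp add: S_rect_def sum.distrib)

lemma S_rect_diff: "S_rect (\<lambda>\<omega>. f \<omega> - g \<omega>) i j \<omega> = S_rect f i j \<omega> - S_rect g i j \<omega>"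
  by (simp add: S_rect_def sum_subtractf)

lemma S_rect_0 [simp]: "S_rect g 0 j \<omega> = 0" "S_rect g i 0 \<omega> = 0"
  by (simp_all add: S_rect_def)

lemma S_rect_Suc1: "S_rect g (Suc i) j \<omega> = S_rect g i j \<omega> + (\<Sum>l\<in>{1..int j}. g (shift (1 + int i, l) \<omega>))"
proof -
  have "{1..int (Suc i)} \<times> {1..int j} = ({1..int i} \<times> {1..int j}) \<union> {1 + int i} \<times> {1..int j}"
    by auto
  moreover have "(\<Sum>k\<in>{1 + int i} \<times> {1..int j}. g (shift k \<omega>)) = (\<Sum>l\<in>{1..int j}. g (shift (1 + int i, l) \<omega>))"
    by (simp add: sum.cartesian_product')
  moreover have "{1..int i} \<times> {1..int j} \<inter> {1 + int i} \<times> {1..int j} = {}" by auto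
  ultimately show ?thesis
    unfolding S_rect_def by (simp add: sum.union_disjoint del: of_nat_Suc)
qed

lemma S_rect_Suc2: "S_rect g i (Suc j) \<omega> = S_rect g i j \<omega> + (\<Sum>l\<in>{1..int i}. g (shift (l, 1 + int j) \<omega>))"
proof -
  have "{1..int i} \<times> {1..int (Suc j)} = ({1..int i} \<times> {1..int j}) \<union> {1..int i} \<times> {1 + int j}"
    by auto
  moreover have "(\<Sum>k\<in>{1..int i} \<times> {1 + int j}. g (shift k \<omega>)) = (\<Sum>l\<in>{1..int i}. g (shift (l, 1 + int j) \<omega>))"
    by (simp add: sum.cartesian_product')
  moreover have "{1..int i} \<times> {1..int j} \<inter> {1..int i} \<times> {1 + int j} = {}" by auto
  ultimately show ?thesis
    unfolding S_rect_def by (simp add: sum.union_disjoint del: of_nat_Suc)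
qed

lemma L2_S_rect [intro]: "L2 \<Omega> g \<Longrightarrow> L2 \<Omega> (S_rect g i j)"
  unfolding S_rect_def[abs_def] by auto

lemma S_rect_measurable [measurable]:
  assumes [measurable]: "g \<in> borel_measurable \<Omega>"
  shows "S_rect g i j \<in> borel_measurable \<Omega>"
  unfolding S_rect_def[abs_def] by measurable

lemma L2_Mx [intro]: "L2 \<Omega> g \<Longrightarrow> L2 \<Omega> (Mx g n1 n2)"
  unfolding Mx_def[abs_def] by (intro L2_rmax L2_abs L2_S_rect)

lemma Mx_add_le: "Mx (\<lambda>\<omega>. f \<omega> + g \<omega>) n1 n2 \<omega> \<le> Mx f n1 n2 \<omega> + Mx g n1 n2 \<omega>"
proof (rule Mx_le)
  fix i j assume "i \<le> n1" "j \<le> n2"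
  then show "\<bar>S_rect (\<lambda>\<omega>. f \<omega> + g \<omega>) i j \<omega>\<bar> \<le> Mx f n1 n2 \<omega> + Mx g n1 n2 \<omega>"
    using Mx_ge[of i n1 j n2 f \<omega>] Mx_ge[of i n1 j n2 g \<omega>] unfolding S_rect_add by linarith
qed

lemma Mx_zero [simp]: "Mx (\<lambda>\<omega>. 0) n1 n2 \<omega> = 0"
  using Mx_le[of n1 n2 "\<lambda>\<omega>. 0" \<omega> 0] Mx_nonneg[of "\<lambda>\<omega>. 0" n1 n2 \<omega>] by (simp add: S_rect_def)

lemma Mx_sum_le: "Mx (\<lambda>\<omega>. \<Sum>i\<in>I. f i \<omega>) n1 n2 \<omega> \<le> (\<Sum>i\<in>I. Mx (f i) n1 n2 \<omega>)"
proof (induction I rule: infinite_finite_induct)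
  case (insert i I)
  then show ?case using Mx_add_le[of "f i" "\<lambda>\<omega>. \<Sum>i\<in>I. f i \<omega>" n1 n2 \<omega>] by simp
qed simp_all

text \<open>Compared with the martingale bound this loses a factor \<open>sqrt (n1 * n2)\<close>. It
  serves for a remainder whose norm tends to 0 while the rectangle is fixed.\<close>

lemma nrm_Mx_crude:
  assumes "L2 \<Omega> g"
  shows "nrm \<Omega> (Mx g n1 n2) \<le> real (n1 * n2) * nrm \<Omega> g"
proof -
  let ?s = "\<lambda>\<omega>. \<Sum>k\<in>{1..int n1} \<times> {1..int n2}. \<bar>g (shift k \<omega>)\<bar>"
  have "Mx g n1 n2 \<omega> \<le> ?s \<omega>" for \<omega>
  proof (rule Mx_le)
    fix i j assume ij: "i \<le> n1" "j \<le> n2"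
    have "\<bar>S_rect g i j \<omega>\<bar> \<le> (\<Sum>k\<in>{1..int i} \<times> {1..int j}. \<bar>g (shift k \<omega>)\<bar>)"
      unfolding S_rect_def by (rule sum_abs)
    also have "\<dots> \<le> ?s \<omega>"
      by (rule sum_mono2) (use ij in auto)
    finally show "\<bar>S_rect g i j \<omega>\<bar> \<le> ?s \<omega>" .
  qed
  then have "nrm \<Omega> (Mx g n1 n2) \<le> nrm \<Omega> ?s"
    using assms by (intro nrm_mono L2_sum L2_abs L2_shift L2_meas[OF L2_Mx])
      (auto intro!: AE_I2 order_trans[OF _ abs_ge_self])
  also have "\<dots> \<le> (\<Sum>k\<in>{1..int n1} \<times> {1..int n2}. nrm \<Omega> (\<lambda>\<omega>. \<bar>g (shift k \<omega>)\<bar>))"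
    using assms by (intro nrm_sum) auto
  also have "\<dots> = (\<Sum>k\<in>{1..int n1} \<times> {1..int n2}. nrm \<Omega> g)"
    using nrm_shift[OF L2_meas[OF assms]] by (simp add: nrm_def)
  finally show ?thesis by (simp add: card_cartesian_product)
qed

text \<open>A translate of \<open>PP c u\<close> by \<open>k\<close> is a projection at
  \<open>c + k\<close>. The column added in step \<open>i\<close> thus consists of projections at
  sites with first coordinate \<open>fst c + i + 1\<close>, orthogonal to all functions of the
  half-plane seen before.\<close>

lemma mart_PP1:
  assumes "L2 \<Omega> u"
  shows "mart (\<lambda>i. {r. fst r \<le> fst c + int i}) (\<lambda>i. S_rect (PP c u) i j)"
proof -
  have d: "dep {r. fst r \<le> fst c + int i} (S_rect (PP c u) i j)" for i
    unfolding S_rect_def[abs_def] PP_shift[OF L2_meas[OF assms]]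
    by (intro dep_sum dep_mono[OF dep_PP]) (cases c; auto simp: Gamma_set_def)
  have "(\<integral>\<omega>. w \<omega> * (S_rect (PP c u) (Suc i) j \<omega> - S_rect (PP c u) i j \<omega>) \<partial>\<Omega>) = 0"
    if w: "L2 \<Omega> w" "dep {r. fst r \<le> fst c + int i} w" for w i
  proof -
    have "(\<integral>\<omega>. w \<omega> * PP c u (shift (1 + int i, l) \<omega>) \<partial>\<Omega>) = 0" for l
      unfolding PP_shift[OF L2_meas[OF assms]]
      by (intro integral_PP_orth1 w L2_shift assms dep_mono[OF w(2)]) auto
    then have "(\<Sum>l\<in>{1..int j}. \<integral>\<omega>. w \<omega> * PP c u (shift (1 + int i, l) \<omega>) \<partial>\<Omega>) = 0"
      by simp
    then show ?thesis
      unfolding S_rect_Suc1 using assms w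
      by (simp add: sum_distrib_left L2_mult_integrable L2_shift L2_PP)
  qed
  then show ?thesis using d assms by (auto simp: mart_def)
qed

lemma mart_PP2:
  assumes "L2 \<Omega> u"
  shows "mart (\<lambda>j. {r. snd r \<le> snd c + int j}) (\<lambda>j. S_rect (PP c u) i j)"
proof -
  have d: "dep {r. snd r \<le> snd c + int j} (S_rect (PP c u) i j)" for j
    unfolding S_rect_def[abs_def] PP_shift[OF L2_meas[OF assms]]
    by (intro dep_sum dep_mono[OF dep_PP]) (cases c; auto simp: Gamma_set_def)
  have "(\<integral>\<omega>. w \<omega> * (S_rect (PP c u) i (Suc j) \<omega> - S_rect (PP c u) i j \<omega>) \<partial>\<Omega>) = 0"
    if w: "L2 \<Omega> w" "dep {r. snd r \<le> snd c + int j} w" for w j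
  proof -
    have "(\<integral>\<omega>. w \<omega> * PP c u (shift (l, 1 + int j) \<omega>) \<partial>\<Omega>) = 0" for l
      unfolding PP_shift[OF L2_meas[OF assms]]
      by (intro integral_PP_orth2 w L2_shift assms dep_mono[OF w(2)]) auto
    then have "(\<Sum>l\<in>{1..int i}. \<integral>\<omega>. w \<omega> * PP c u (shift (l, 1 + int j) \<omega>) \<partial>\<Omega>) = 0"
      by simp
    then show ?thesis
      unfolding S_rect_Suc2 using assms w
      by (simp add: sum_distrib_left L2_mult_integrable L2_shift L2_PP)
  qed
  then show ?thesis using d assms by (auto simp: mart_def)
qed

text \<open>The translates are projections at distinct sites, hence orthogonal and of equal
  norm.\<close>

lemma integral_S_rect_PP:
  assumes "L2 \<Omega> u"
  shows "(\<integral>\<omega>. (S_rect (PP c u) n1 n2 \<omega>)\<^sup>2 \<partial>\<Omega>) = real (n1 * n2) * (nrm \<Omega> (PP c u))\<^sup>2"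
proof -
  let ?V = "{1..int n1} \<times> {1..int n2}" and ?g = "\<lambda>k \<omega>. PP c u (shift k \<omega>)"
  have l2: "L2 \<Omega> (?g k)" for k using assms by auto
  have "(\<integral>\<omega>. (S_rect (PP c u) n1 n2 \<omega>)\<^sup>2 \<partial>\<Omega>) = (\<Sum>k\<in>?V. \<Sum>l\<in>?V. \<integral>\<omega>. ?g k \<omega> * ?g l \<omega> \<partial>\<Omega>)"
    using L2_mult_integrable[OF l2 l2]
    by (simp add: S_rect_def power2_eq_square sum_distrib_left sum_distrib_right) (rule sum.swap)
  also have "\<dots> = (\<Sum>k\<in>?V. \<Sum>l\<in>?V. if l = k then (nrm \<Omega> (PP c u))\<^sup>2 else 0)"
  proof (intro sum.cong refl)
    fix k l
    have "(\<integral>\<omega>. ?g k \<omega> * ?g l \<omega> \<partial>\<Omega>) = 0" if "l \<noteq> k"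
      unfolding PP_shift[OF L2_meas[OF assms]]
      by (rule integral_PP_PP) (use that assms in auto)
    moreover have "(\<integral>\<omega>. ?g k \<omega> * ?g k \<omega> \<partial>\<Omega>) = (nrm \<Omega> (PP c u))\<^sup>2"
      using nrm_shift[OF L2_meas[OF L2_PP[OF assms]], of c k] nrm_sq[of \<Omega> "?g k"]
      by (simp add: power2_eq_square)
    ultimately show "(\<integral>\<omega>. ?g k \<omega> * ?g l \<omega> \<partial>\<Omega>) = (if l = k then (nrm \<Omega> (PP c u))\<^sup>2 else 0)"
      by auto
  qed
  also have "\<dots> = real (n1 * n2) * (nrm \<Omega> (PP c u))\<^sup>2"
    by (simp add: card_cartesian_product)
  finally show ?thesis .
qed

lemma nrm_Mx_PP:
  assumes "L2 \<Omega> u"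
  shows "nrm \<Omega> (Mx (PP c u) n1 n2) \<le> 4 * sqrt (real (n1 * n2)) * nrm \<Omega> (PP c u)"
proof -
  have "(nrm \<Omega> (Mx (PP c u) n1 n2))\<^sup>2 \<le> 16 * (\<integral>\<omega>. \<bar>S_rect (PP c u) n1 n2 \<omega>\<bar>\<^sup>2 \<partial>\<Omega>)"
    unfolding nrm_sq Mx_def
    by (rule cairoli_maximal[OF submart_abs[OF mart_PP1[OF assms]] submart_abs[OF mart_PP2[OF assms]]])
      (auto simp: incseq_def)
  also have "\<dots> = (4 * sqrt (real (n1 * n2)) * nrm \<Omega> (PP c u))\<^sup>2"
    by (simp add: integral_S_rect_PP[OF assms] power_mult_distrib)
  finally show ?thesis by (rule power2_le_imp_le) simp
qed

text \<open>Cairoli's inequality for the squares of the partial sums: the square of a maximum of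
  squares is the fourth power of \<open>Mx\<close>.\<close>

lemma Mx_PP_power4:
  assumes "u \<in> borel_measurable \<Omega>" "\<And>\<omega>. \<bar>u \<omega>\<bar> \<le> b"
  shows "(\<integral>\<omega>. (Mx (PP c u) n1 n2 \<omega>)^4 \<partial>\<Omega>) \<le> 16 * (\<integral>\<omega>. (S_rect (PP c u) n1 n2 \<omega>)^4 \<partial>\<Omega>)"
proof -
  have l2: "L2 \<Omega> u" by (rule Om.L2_bounded[OF assms])
  have b: "\<exists>b. \<forall>\<omega>. \<bar>S_rect (PP c u) i j \<omega>\<bar> \<le> b" for i j
  proof (intro exI allI)
    fix \<omega>
    have "\<bar>S_rect (PP c u) i j \<omega>\<bar> \<le> (\<Sum>k\<in>{1..int i} \<times> {1..int j}. \<bar>PP c u (shift k \<omega>)\<bar>)"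
      unfolding S_rect_def by (rule sum_abs)
    also have "\<dots> \<le> (\<Sum>k\<in>{1..int i} \<times> {1..int j}. 4 * b)"
      by (intro sum_mono PP_bounded assms)
    finally show "\<bar>S_rect (PP c u) i j \<omega>\<bar> \<le> (\<Sum>k\<in>{1..int i} \<times> {1..int j}. 4 * b)" .
  qed
  have eq: "rmax (\<lambda>j. rmax (\<lambda>i. (S_rect (PP c u) i j \<omega>)\<^sup>2) n1) n2 = (Mx (PP c u) n1 n2 \<omega>)\<^sup>2" for \<omega>
  proof -
    have "rmax (\<lambda>i. (S_rect (PP c u) i j \<omega>)\<^sup>2) n1 = (rmax (\<lambda>i. \<bar>S_rect (PP c u) i j \<omega>\<bar>) n1)\<^sup>2" for j
      using rmax_power2[of "\<lambda>i. \<bar>S_rect (PP c u) i j \<omega>\<bar>" n1] by simp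
    then show ?thesis
      unfolding Mx_def by (simp add: rmax_power2 rmax_nonneg)
  qed
  have "(\<integral>\<omega>. (rmax (\<lambda>j. rmax (\<lambda>i. (S_rect (PP c u) i j \<omega>)\<^sup>2) n1) n2)\<^sup>2 \<partial>\<Omega>)
      \<le> 16 * (\<integral>\<omega>. ((S_rect (PP c u) n1 n2 \<omega>)\<^sup>2)\<^sup>2 \<partial>\<Omega>)"
    by (rule cairoli_maximal[OF submart_power2[OF mart_PP1[OF l2] b] submart_power2[OF mart_PP2[OF l2] b]])
      (auto simp: incseq_def)
  then show ?thesis unfolding eq by simp
qed

end

section \<open>Sums of locally dependent bounded variables\<close>

text \<open>The real part of \<open>exp (i x) * (exp (i h) - 1 - i h)\<close>.\<close>

lemma cos_taylor: "\<bar>cos (x + h) - cos x + h * sin x\<bar> \<le> h\<^sup>2 / 2" for x h :: real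
proof -
  let ?z = "iexp x * (iexp h - (1 + \<i> * h))"
  have "cmod ?z \<le> h\<^sup>2 / 2"
    using iexp_approx1[of h 1] by (simp add: norm_mult numeral_2_eq_2)
  moreover have "Re ?z = cos (x + h) - cos x + h * sin x"
    by (simp add: Re_exp Im_exp cos_add) (simp add: algebra_simps)
  ultimately show ?thesis using abs_Re_le_cmod[of ?z] by linarith
qed

lemma sin_taylor: "\<bar>sin (x + h) - sin x - h * cos x\<bar> \<le> h\<^sup>2 / 2" for x h :: real
proof -
  have c: "cos (y - pi / 2) = sin y" "sin (y - pi / 2) = - cos y" for y :: real
    by (simp_all add: cos_diff sin_diff)
  have eq: "x - pi / 2 + h = (x + h) - pi / 2" by simp
  show ?thesis
    using cos_taylor[of "x - pi / 2" h] unfolding eq c by (simp add: abs_le_iff)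
qed

definition box :: "int \<times> int \<Rightarrow> nat \<Rightarrow> (int \<times> int) set" where
  "box k m = {fst k - int m..fst k + int m} \<times> {snd k - int m..snd k + int m}"

lemma finite_box [simp]: "finite (box k m)"
  by (simp add: box_def)

lemma card_box: "card (box k m) = (2 * m + 1)\<^sup>2"
proof -
  have "nat (1 + (i + int m) - (i - int m)) = 2 * m + 1" for i by simp
  then show ?thesis by (simp add: box_def card_cartesian_product power2_eq_square algebra_simps)
qed

lemma box_mono: "m \<le> m' \<Longrightarrow> box k m \<subseteq> box k m'"
  by (auto simp: box_def)

lemma box_shift: "(\<lambda>i. i + k) ` box j m = box (j + k) m"
proof (intro set_eqI iffI)
  fix x assume "x \<in> box (j + k) m"
  then have "x - k \<in> box j m" by (cases x; cases k) (auto simp: box_def)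
  then show "x \<in> (\<lambda>i. i + k) ` box j m" by (intro image_eqI[of _ _ "x - k"]) simp_all
qed (cases k; auto simp: box_def)

lemma box_disjoint: "l \<notin> box k (m + m') \<Longrightarrow> box k m \<inter> box l m' = {}"
  by (cases k; cases l) (auto simp: box_def)

lemma box_subset: "l \<in> box k m \<Longrightarrow> box l m' \<subseteq> box k (m + m')"
  by (cases k; cases l) (auto simp: box_def)

text \<open>Variables at sites farther apart than \<open>2 * \<rho>\<close> depend on disjoint sets
  of coordinates. In the application the bound \<open>A\<close> is of the order of the inverse
  square root of the number of sites, so every estimate is kept explicit in it.\<close>

locale local_dep = iid_field +
  fixes V :: "(int \<times> int) set" and X :: "int \<times> int \<Rightarrow> (int \<times> int \<Rightarrow> real) \<Rightarrow> real"
    and A :: real and \<rho> :: nat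
  assumes finite_V: "finite V"
    and X_meas [measurable]: "\<And>k. k \<in> V \<Longrightarrow> X k \<in> borel_measurable (Omega P)"
    and X_bound: "\<And>k \<omega>. k \<in> V \<Longrightarrow> \<bar>X k \<omega>\<bar> \<le> A"
    and X_mean: "\<And>k. k \<in> V \<Longrightarrow> (\<integral>\<omega>. X k \<omega> \<partial>Omega P) = 0"
    and X_dep: "\<And>k. k \<in> V \<Longrightarrow> dep (box k \<rho>) (X k)"
    and A_nonneg: "0 \<le> A"
begin

definition "n = real (card V)"
text \<open>The number of sites in a box of radius \<open>2 * \<rho>\<close>, hence a bound for the
  number of summands of \<open>r k\<close>.\<close>

definition "D = real ((4 * \<rho> + 1)\<^sup>2)"
definition "s \<omega> = (\<Sum>k\<in>V. X k \<omega>)"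
text \<open>The summands that may depend on \<open>X k\<close>; what remains of \<open>s\<close>
  without them is independent of \<open>X k\<close>.\<close>

definition "r k \<omega> = (\<Sum>l\<in>V \<inter> box k (2 * \<rho>). X l \<omega>)"

lemma n_nonneg: "0 \<le> n" by (simp add: n_def)

lemma D_ge_1: "1 \<le> D" unfolding D_def by (simp add: power2_eq_square)

lemma s_measurable [measurable]: "s \<in> borel_measurable \<Omega>"
  unfolding s_def[abs_def] by measurable

lemma r_measurable [measurable]: "r k \<in> borel_measurable \<Omega>"
  unfolding r_def[abs_def] by measurable

lemma s_bound: "\<bar>s \<omega>\<bar> \<le> n * A"
proof -
  have "\<bar>s \<omega>\<bar> \<le> (\<Sum>k\<in>V. \<bar>X k \<omega>\<bar>)" unfolding s_def by (rule sum_abs)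
  also have "\<dots> \<le> (\<Sum>k\<in>V. A)" by (rule sum_mono) (rule X_bound)
  finally show ?thesis by (simp add: n_def)
qed

lemma r_bound: "\<bar>r k \<omega>\<bar> \<le> D * A"
proof -
  have "\<bar>r k \<omega>\<bar> \<le> (\<Sum>k\<in>V \<inter> box k (2 * \<rho>). \<bar>X k \<omega>\<bar>)" unfolding r_def by (rule sum_abs)
  also have "\<dots> \<le> (\<Sum>k\<in>V \<inter> box k (2 * \<rho>). A)" by (rule sum_mono) (simp add: X_bound)
  also have "\<dots> \<le> real (card (box k (2 * \<rho>))) * A"
    using A_nonneg by (simp add: mult_right_mono card_mono)
  finally show ?thesis by (simp add: D_def card_box)
qed

lemma s_minus_r: "s \<omega> - r k \<omega> = (\<Sum>l\<in>V - box k (2 * \<rho>). X l \<omega>)"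
  unfolding s_def r_def using finite_V by (subst sum.Int_Diff[where B="box k (2 * \<rho>)"]) auto

lemma dep_s_minus_r: "dep (- box k \<rho>) (\<lambda>\<omega>. s \<omega> - r k \<omega>)"
  unfolding s_minus_r
proof (rule dep_sum)
  fix l assume "l \<in> V - box k (2 * \<rho>)"
  then show "dep (- box k \<rho>) (X l)"
    using box_disjoint[of l k \<rho> \<rho>] by (intro dep_mono[OF X_dep]) (auto simp: mult_2)
qed

lemma X_L2: "k \<in> V \<Longrightarrow> L2 \<Omega> (X k)"
  by (rule Om.L2_bounded[OF X_meas X_bound])

lemma integral_X_mult:
  assumes "k \<in> V" "L2 \<Omega> (\<lambda>\<omega>. F (s \<omega> - r k \<omega>))"
  shows "(\<integral>\<omega>. X k \<omega> * F (s \<omega> - r k \<omega>) \<partial>\<Omega>) = 0"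
  using integral_indep[OF X_L2[OF assms(1)] assms(2) X_dep[OF assms(1)] dep_comp[OF dep_s_minus_r, where F=F]]
  by (simp add: X_mean assms)

lemma abs_s_minus_r: "\<bar>s \<omega> - r k \<omega>\<bar> \<le> n * A + D * A"
  using s_bound[of \<omega>] r_bound[of k \<omega>] by linarith

lemma integral_X_r:
  assumes "k \<in> V"
  shows "(\<integral>\<omega>. X k \<omega> * r k \<omega> \<partial>\<Omega>) = (\<integral>\<omega>. X k \<omega> * s \<omega> \<partial>\<Omega>)"
proof -
  have [simp]: "integrable \<Omega> (\<lambda>\<omega>. X k \<omega> * s \<omega>)" "integrable \<Omega> (\<lambda>\<omega>. X k \<omega> * r k \<omega>)"
    by (intro L2_mult_integrable X_L2 assms Om.L2_bounded[OF _ s_bound] Om.L2_bounded[OF _ r_bound]; measurable)+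
  have "(\<integral>\<omega>. X k \<omega> * (s \<omega> - r k \<omega>) \<partial>\<Omega>) = 0"
    by (rule integral_X_mult[OF assms, where F="\<lambda>x. x"]) (rule Om.L2_bounded[OF _ abs_s_minus_r], measurable)
  then show ?thesis by (simp add: algebra_simps)
qed

lemma integral_s_sq_eq: "(\<integral>\<omega>. (s \<omega>)\<^sup>2 \<partial>\<Omega>) = (\<integral>\<omega>. (\<Sum>k\<in>V. X k \<omega> * r k \<omega>) \<partial>\<Omega>)"
proof -
  have i: "integrable \<Omega> (\<lambda>\<omega>. X k \<omega> * s \<omega>)" "integrable \<Omega> (\<lambda>\<omega>. X k \<omega> * r k \<omega>)" if "k \<in> V" for k
    by (intro L2_mult_integrable X_L2 that Om.L2_bounded[OF _ s_bound] Om.L2_bounded[OF _ r_bound]; measurable)+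
  have "(\<integral>\<omega>. (s \<omega>)\<^sup>2 \<partial>\<Omega>) = (\<integral>\<omega>. (\<Sum>k\<in>V. X k \<omega> * s \<omega>) \<partial>\<Omega>)"
    by (simp add: power2_eq_square s_def sum_distrib_right)
  also have "\<dots> = (\<integral>\<omega>. (\<Sum>k\<in>V. X k \<omega> * r k \<omega>) \<partial>\<Omega>)"
    using i by (simp add: integral_X_r)
  finally show ?thesis .
qed

lemma X_r_bound: "k \<in> V \<Longrightarrow> \<bar>X k \<omega> * r k \<omega>\<bar> \<le> D * A\<^sup>2"
  using mult_mono[OF X_bound[of k \<omega>] r_bound[of k \<omega>]] A_nonneg
  by (simp add: abs_mult power2_eq_square mult_ac)

lemma second_moment: "(\<integral>\<omega>. (s \<omega>)\<^sup>2 \<partial>\<Omega>) \<le> n * (D * A\<^sup>2)"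
proof -
  have b: "\<bar>\<Sum>k\<in>V. X k \<omega> * r k \<omega>\<bar> \<le> n * (D * A\<^sup>2)" for \<omega>
  proof -
    have "\<bar>\<Sum>k\<in>V. X k \<omega> * r k \<omega>\<bar> \<le> (\<Sum>k\<in>V. \<bar>X k \<omega> * r k \<omega>\<bar>)" by (rule sum_abs)
    also have "\<dots> \<le> (\<Sum>k\<in>V. D * A\<^sup>2)" by (rule sum_mono) (rule X_r_bound)
    finally show ?thesis by (simp add: n_def)
  qed
  have "(\<integral>\<omega>. (\<Sum>k\<in>V. X k \<omega> * r k \<omega>) \<partial>\<Omega>) \<le> (\<integral>\<omega>. n * (D * A\<^sup>2) \<partial>\<Omega>)"
    by (rule integral_mono) (use b in \<open>auto intro!: Om.integrable_bounded[OF _ b] simp: abs_le_iff\<close>)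
  then show ?thesis unfolding integral_s_sq_eq by simp
qed

text \<open>One factor \<open>X k\<close> is split off from \<open>s\<close>. Against the cube of
  \<open>s - r k\<close> it has mean 0 by independence, and the difference of the two cubes contains
  the factor \<open>r k\<close>, so only a second moment of \<open>s\<close> is left; the total is
  of order \<open>n^2\<close>.\<close>

lemma fourth_moment: "(\<integral>\<omega>. (s \<omega>)^4 \<partial>\<Omega>) \<le> 8 * n\<^sup>2 * D^3 * A^4"
proof -
  have bd: "\<bar>(s \<omega>)^m\<bar> \<le> (n * A)^m" for \<omega> m
    unfolding power_abs by (rule power_mono[OF s_bound]) simp
  have bd': "\<bar>(s \<omega> - r k \<omega>)^m\<bar> \<le> (n * A + D * A)^m" for \<omega> m k
    unfolding power_abs by (rule power_mono[OF abs_s_minus_r]) simp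
  have L: "L2 \<Omega> (\<lambda>\<omega>. (s \<omega>)^m)" "L2 \<Omega> (\<lambda>\<omega>. (s \<omega> - r k \<omega>)^m)" for m k
    by (rule Om.L2_bounded[OF _ bd] Om.L2_bounded[OF _ bd'], measurable)+
  have i: "integrable \<Omega> (\<lambda>\<omega>. X k \<omega> * (s \<omega>)^3)" "integrable \<Omega> (\<lambda>\<omega>. X k \<omega> * (s \<omega> - r k \<omega>)^3)" if "k \<in> V" for k
    by (intro L2_mult_integrable X_L2 that L)+
  have k: "(\<integral>\<omega>. X k \<omega> * (s \<omega>)^3 \<partial>\<Omega>) \<le> D * A\<^sup>2 * (5 * (n * (D * A\<^sup>2)) + 3 * (D * A)\<^sup>2)" if k: "k \<in> V" for k
  proof -
    have "(\<integral>\<omega>. X k \<omega> * (s \<omega>)^3 \<partial>\<Omega>) = (\<integral>\<omega>. X k \<omega> * (s \<omega>)^3 - X k \<omega> * (s \<omega> - r k \<omega>)^3 \<partial>\<Omega>)"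
      using i[OF k] integral_X_mult[OF k L(2)] by simp
    also have "\<dots> \<le> (\<integral>\<omega>. D * A\<^sup>2 * (5 * (s \<omega>)\<^sup>2 + 3 * (D * A)\<^sup>2) \<partial>\<Omega>)"
    proof (rule integral_mono)
      show "integrable \<Omega> (\<lambda>\<omega>. D * A\<^sup>2 * (5 * (s \<omega>)\<^sup>2 + 3 * (D * A)\<^sup>2))"
        using Om.L2_integrable[OF L(1)[of 2]] by simp
      fix \<omega>
      let ?s = "s \<omega>" and ?r = "r k \<omega>"
      have "\<bar>3 * ?s\<^sup>2 - 3 * (?s * ?r) + ?r\<^sup>2\<bar> \<le> 5 * ?s\<^sup>2 + 3 * ?r\<^sup>2"
      proof -
        have "2 * \<bar>?s * ?r\<bar> \<le> ?s\<^sup>2 + ?r\<^sup>2"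
          using sum_squares_bound[of "\<bar>?s\<bar>" "\<bar>?r\<bar>"] by (simp add: abs_mult)
        moreover have "0 \<le> ?s\<^sup>2" "0 \<le> ?r\<^sup>2" by simp_all
        ultimately show ?thesis by linarith
      qed
      also have "\<dots> \<le> 5 * ?s\<^sup>2 + 3 * (D * A)\<^sup>2"
        using power_mono[OF r_bound[of k \<omega>], of 2] by simp
      finally have q: "\<bar>3 * ?s\<^sup>2 - 3 * (?s * ?r) + ?r\<^sup>2\<bar> \<le> 5 * ?s\<^sup>2 + 3 * (D * A)\<^sup>2" .
      have "X k \<omega> * ?s^3 - X k \<omega> * (?s - ?r)^3 = (X k \<omega> * ?r) * (3 * ?s\<^sup>2 - 3 * (?s * ?r) + ?r\<^sup>2)"
        by (simp add: power2_eq_square power3_eq_cube algebra_simps)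
      also have "\<dots> \<le> \<bar>X k \<omega> * ?r\<bar> * \<bar>3 * ?s\<^sup>2 - 3 * (?s * ?r) + ?r\<^sup>2\<bar>"
        by (simp add: flip: abs_mult)
      also have "\<dots> \<le> (D * A\<^sup>2) * (5 * ?s\<^sup>2 + 3 * (D * A)\<^sup>2)"
        by (rule mult_mono[OF X_r_bound[OF k] q]) (use D_ge_1 in auto)
      finally show "X k \<omega> * ?s^3 - X k \<omega> * (?s - ?r)^3 \<le> D * A\<^sup>2 * (5 * ?s\<^sup>2 + 3 * (D * A)\<^sup>2)" .
    qed (use i[OF k] in auto)
    also have "\<dots> = D * A\<^sup>2 * (5 * (\<integral>\<omega>. (s \<omega>)\<^sup>2 \<partial>\<Omega>) + 3 * (D * A)\<^sup>2)"
      using Om.L2_integrable[OF L(1)[of 2]] by simp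
    also have "\<dots> \<le> D * A\<^sup>2 * (5 * (n * (D * A\<^sup>2)) + 3 * (D * A)\<^sup>2)"
      using second_moment D_ge_1 by (intro mult_left_mono) auto
    finally show ?thesis .
  qed
  have "(\<integral>\<omega>. (s \<omega>)^4 \<partial>\<Omega>) = (\<integral>\<omega>. (\<Sum>k\<in>V. X k \<omega> * (s \<omega>)^3) \<partial>\<Omega>)"
    by (rule Bochner_Integration.integral_cong)
      (auto simp: sum_distrib_right[symmetric] s_def[symmetric] power_Suc[symmetric] simp del: power_Suc)
  also have "\<dots> = (\<Sum>k\<in>V. \<integral>\<omega>. X k \<omega> * (s \<omega>)^3 \<partial>\<Omega>)"
    using i by simp
  also have "\<dots> \<le> (\<Sum>k\<in>V. D * A\<^sup>2 * (5 * (n * (D * A\<^sup>2)) + 3 * (D * A)\<^sup>2))"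
    by (rule sum_mono) (rule k)
  also have "\<dots> = (A^4 * D\<^sup>2) * (5 * n\<^sup>2 + 3 * n * D)"
    by (simp add: n_def power2_eq_square power4_eq_xxxx algebra_simps)
  also have "\<dots> \<le> (A^4 * D\<^sup>2) * (8 * n\<^sup>2 * D)"
  proof (rule mult_left_mono)
    \<comment> \<open>\<open>n\<close> is a natural number, so it is at most its square, also for
      \<open>n = 0\<close>. Together with \<open>1 <= D\<close> this absorbs both terms, and 5 + 3
      gives the 8.\<close>
    have "n \<le> n\<^sup>2" unfolding n_def by (cases "card V") (auto simp: power2_eq_square)
    then have "n * D \<le> n\<^sup>2 * D"
      by (rule mult_right_mono) (use D_ge_1 in simp)
    moreover have "n\<^sup>2 * 1 \<le> n\<^sup>2 * D"
      by (rule mult_left_mono) (use D_ge_1 in simp_all)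
    ultimately show "5 * n\<^sup>2 + 3 * n * D \<le> 8 * n\<^sup>2 * D" by simp
  qed simp
  also have "\<dots> = 8 * n\<^sup>2 * D^3 * A^4" by (simp add: power2_eq_square power3_eq_cube)
  finally show ?thesis .
qed

text \<open>With \<open>q = (\<Sum>k. X k * r k)\<close>, whose mean is the variance of the sum \<open>s\<close>, the function
  \<open>u \<theta> = E cos (\<theta> s + \<alpha>)\<close> satisfies \<open>u' = - \<theta> E (q cos (\<theta> s + \<alpha>))\<close> up to a third order term,
  and \<open>q\<close> is nearly constant because it is itself a sum of locally dependent variables.\<close>

lemma q_variance:
  "nrm \<Omega> (\<lambda>\<omega>. (\<Sum>k\<in>V. X k \<omega> * r k \<omega>) - (\<integral>\<omega>. (s \<omega>)\<^sup>2 \<partial>\<Omega>)) \<le> (12 * real \<rho> + 1) * 2 * D * A\<^sup>2 * sqrt n"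
proof -
  let ?Y = "\<lambda>k \<omega>. X k \<omega> * r k \<omega> - (\<integral>\<omega>. X k \<omega> * r k \<omega> \<partial>\<Omega>)"
  have i: "integrable \<Omega> (\<lambda>\<omega>. X k \<omega> * r k \<omega>)" if "k \<in> V" for k
    by (rule Om.integrable_bounded[OF _ X_r_bound[OF that]]) (use that in measurable)
  have e: "\<bar>\<integral>\<omega>. X k \<omega> * r k \<omega> \<partial>\<Omega>\<bar> \<le> D * A\<^sup>2" if k: "k \<in> V" for k
  proof -
    have "\<bar>\<integral>\<omega>. X k \<omega> * r k \<omega> \<partial>\<Omega>\<bar> \<le> (\<integral>\<omega>. \<bar>X k \<omega> * r k \<omega>\<bar> \<partial>\<Omega>)" by (rule integral_abs_bound)
    also have "\<dots> \<le> (\<integral>\<omega>. D * A\<^sup>2 \<partial>\<Omega>)"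
      by (rule integral_mono) (use i[OF k] X_r_bound[OF k] in auto)
    finally show ?thesis by simp
  qed
  \<comment> \<open>\<open>X k * r k\<close> uses coordinates at distance up to
    \<open>2 * \<rho> + \<rho>\<close>, so the centered products are locally dependent with radius
    \<open>3 * \<rho>\<close>. Their neighbourhoods have \<open>(12 * \<rho> + 1)^2\<close> sites,
    which explains the constant.\<close>
  interpret Y: local_dep P V ?Y "2 * (D * A\<^sup>2)" "3 * \<rho>"
  proof
    fix k assume k: "k \<in> V"
    show "?Y k \<in> borel_measurable (Omega P)" using k by measurable
    show "\<bar>?Y k \<omega>\<bar> \<le> 2 * (D * A\<^sup>2)" for \<omega> using X_r_bound[OF k, of \<omega>] e[OF k] by linarith
    show "(\<integral>\<omega>. ?Y k \<omega> \<partial>\<Omega>) = 0" using i[OF k] by simp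
    have "dep (box k (3 * \<rho>)) (r k)"
      unfolding r_def[abs_def]
    proof (rule dep_sum)
      fix l assume "l \<in> V \<inter> box k (2 * \<rho>)"
      then show "dep (box k (3 * \<rho>)) (X l)"
        using box_subset[of l k "2 * \<rho>" \<rho>] by (intro dep_mono[OF X_dep]) auto
    qed
    moreover have "dep (box k (3 * \<rho>)) (X k)"
      by (rule dep_mono[OF X_dep[OF k] box_mono]) simp
    ultimately show "dep (box k (3 * \<rho>)) (?Y k)"
      by (intro dep_comp2[where F="(-)"] dep_comp2[where F="(*)"]) auto
  qed (use finite_V D_ge_1 in auto)
  have eq: "Y.s = (\<lambda>\<omega>. (\<Sum>k\<in>V. X k \<omega> * r k \<omega>) - (\<integral>\<omega>. (s \<omega>)\<^sup>2 \<partial>\<Omega>))"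
    unfolding Y.s_def[abs_def] integral_s_sq_eq using i by (simp add: sum_subtractf)
  have "(nrm \<Omega> (\<lambda>\<omega>. (\<Sum>k\<in>V. X k \<omega> * r k \<omega>) - (\<integral>\<omega>. (s \<omega>)\<^sup>2 \<partial>\<Omega>)))\<^sup>2 \<le> Y.n * (Y.D * (2 * (D * A\<^sup>2))\<^sup>2)"
    unfolding nrm_sq using Y.second_moment unfolding eq by simp
  also have "\<dots> = ((12 * real \<rho> + 1) * 2 * D * A\<^sup>2 * sqrt n)\<^sup>2"
    using n_nonneg
    by (simp add: Y.n_def n_def Y.D_def power_mult_distrib) (auto simp: power2_eq_square algebra_simps)
  finally show ?thesis
    by (rule power2_le_imp_le) (use D_ge_1 n_nonneg in auto)
qed

text \<open>The first term is the deviation of the sum of the \<open>X k * r k\<close> from its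
  mean, the second collects \<open>n\<close> Taylor remainders \<open>A * (D * A)^2 / 2\<close>.
  Both are of order \<open>1 / sqrt n\<close> when \<open>A\<close> is.\<close>

definition "clt_error = (12 * real \<rho> + 1) * 2 * D * A\<^sup>2 * sqrt n + n * A^3 * D\<^sup>2 / 2"

text \<open>Differentiation under the integral: the first order Taylor remainder is dominated by
  \<open>h^2\<close> times the integrable square of \<open>s\<close>.\<close>

lemma cos_integral_derivative:
  "((\<lambda>\<theta>. \<integral>\<omega>. cos (\<theta> * s \<omega> + \<alpha>) \<partial>\<Omega>) has_real_derivative (- (\<integral>\<omega>. s \<omega> * sin (\<theta> * s \<omega> + \<alpha>) \<partial>\<Omega>))) (at \<theta>)"
  (is "(?u has_real_derivative - ?d) _")
proof -
  have [simp]: "integrable \<Omega> (\<lambda>\<omega>. cos (\<theta> * s \<omega> + \<alpha>))" for \<theta>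
    by (rule Om.integrable_bounded[where b=1]) auto
  have [simp]: "integrable \<Omega> (\<lambda>\<omega>. s \<omega> * sin (\<theta> * s \<omega> + \<alpha>))" for \<theta>
    by (intro L2_mult_integrable Om.L2_bounded[OF _ s_bound] Om.L2_bounded[where b=1]) auto
  have [simp]: "integrable \<Omega> (\<lambda>\<omega>. (s \<omega>)\<^sup>2)"
    using L2_sq[OF Om.L2_bounded[OF s_measurable s_bound]] .
  have b: "\<bar>(?u (\<theta> + h) - ?u \<theta>) / h - (- ?d)\<bar> \<le> \<bar>h\<bar> * (\<integral>\<omega>. (s \<omega>)\<^sup>2 \<partial>\<Omega>)" if "h \<noteq> 0" for h
  proof -
    have "\<bar>?u (\<theta> + h) - ?u \<theta> + h * ?d\<bar> = \<bar>\<integral>\<omega>. cos ((\<theta> + h) * s \<omega> + \<alpha>) - cos (\<theta> * s \<omega> + \<alpha>)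
        + h * (s \<omega> * sin (\<theta> * s \<omega> + \<alpha>)) \<partial>\<Omega>\<bar>"
      by simp
    also have "\<dots> \<le> (\<integral>\<omega>. \<bar>cos ((\<theta> + h) * s \<omega> + \<alpha>) - cos (\<theta> * s \<omega> + \<alpha>)
        + h * (s \<omega> * sin (\<theta> * s \<omega> + \<alpha>))\<bar> \<partial>\<Omega>)"
      by (rule integral_abs_bound)
    also have "\<dots> \<le> (\<integral>\<omega>. h\<^sup>2 * (s \<omega>)\<^sup>2 \<partial>\<Omega>)"
    proof (rule integral_mono)
      fix \<omega>
      have eq: "(\<theta> + h) * s \<omega> + \<alpha> = (\<theta> * s \<omega> + \<alpha>) + h * s \<omega>" by (simp add: algebra_simps)
      have "\<bar>cos ((\<theta> + h) * s \<omega> + \<alpha>) - cos (\<theta> * s \<omega> + \<alpha>) + h * (s \<omega> * sin (\<theta> * s \<omega> + \<alpha>))\<bar> \<le> (h * s \<omega>)\<^sup>2 / 2"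
        using cos_taylor[of "\<theta> * s \<omega> + \<alpha>" "h * s \<omega>"] unfolding eq by (simp only: mult.assoc)
      also have "\<dots> \<le> h\<^sup>2 * (s \<omega>)\<^sup>2" by (simp add: power_mult_distrib)
      finally show "\<bar>cos ((\<theta> + h) * s \<omega> + \<alpha>) - cos (\<theta> * s \<omega> + \<alpha>) + h * (s \<omega> * sin (\<theta> * s \<omega> + \<alpha>))\<bar> \<le> h\<^sup>2 * (s \<omega>)\<^sup>2" .
    qed simp_all
    finally have "\<bar>?u (\<theta> + h) - ?u \<theta> + h * ?d\<bar> \<le> h\<^sup>2 * (\<integral>\<omega>. (s \<omega>)\<^sup>2 \<partial>\<Omega>)" by simp
    then have "\<bar>?u (\<theta> + h) - ?u \<theta> + h * ?d\<bar> / \<bar>h\<bar> \<le> h\<^sup>2 * (\<integral>\<omega>. (s \<omega>)\<^sup>2 \<partial>\<Omega>) / \<bar>h\<bar>"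
      by (intro divide_right_mono) auto
    moreover have "h\<^sup>2 * (\<integral>\<omega>. (s \<omega>)\<^sup>2 \<partial>\<Omega>) / \<bar>h\<bar> = \<bar>h\<bar> * (\<integral>\<omega>. (s \<omega>)\<^sup>2 \<partial>\<Omega>)"
      using that by (simp add: power2_eq_square field_simps abs_if)
    moreover have "(?u (\<theta> + h) - ?u \<theta>) / h - (- ?d) = (?u (\<theta> + h) - ?u \<theta> + h * ?d) / h"
      using that by (simp add: field_simps)
    ultimately show ?thesis by (simp add: abs_divide)
  qed
  have "((\<lambda>h. (?u (\<theta> + h) - ?u \<theta>) / h - (- ?d)) \<longlongrightarrow> 0) (at 0)"
  proof (rule Lim_null_comparison)
    show "\<forall>\<^sub>F h in at 0. norm ((?u (\<theta> + h) - ?u \<theta>) / h - (- ?d)) \<le> \<bar>h\<bar> * (\<integral>\<omega>. (s \<omega>)\<^sup>2 \<partial>\<Omega>)"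
      unfolding eventually_at_filter using b by (auto intro!: always_eventually)
    have "((\<lambda>h. \<bar>h\<bar> * (\<integral>\<omega>. (s \<omega>)\<^sup>2 \<partial>\<Omega>)) \<longlongrightarrow> \<bar>0\<bar> * (\<integral>\<omega>. (s \<omega>)\<^sup>2 \<partial>\<Omega>)) (at 0)"
      by (intro tendsto_intros)
    then show "((\<lambda>h. \<bar>h\<bar> * (\<integral>\<omega>. (s \<omega>)\<^sup>2 \<partial>\<Omega>)) \<longlongrightarrow> 0) (at 0)" by simp
  qed
  then show ?thesis unfolding DERIV_def using LIM_zero_iff by blast
qed

lemma cos_integral_ode:
  assumes "0 \<le> \<theta>" "\<theta> \<le> 1"
  shows "\<bar>- (\<integral>\<omega>. s \<omega> * sin (\<theta> * s \<omega> + \<alpha>) \<partial>\<Omega>)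
     + \<theta> * (\<integral>\<omega>. (s \<omega>)\<^sup>2 \<partial>\<Omega>) * (\<integral>\<omega>. cos (\<theta> * s \<omega> + \<alpha>) \<partial>\<Omega>)\<bar> \<le> clt_error"
proof -
  let ?v = "\<integral>\<omega>. (s \<omega>)\<^sup>2 \<partial>\<Omega>" and ?q = "\<lambda>\<omega>. \<Sum>k\<in>V. X k \<omega> * r k \<omega>"
  let ?c = "\<lambda>\<omega>. cos (\<theta> * s \<omega> + \<alpha>)" and ?sn = "\<lambda>\<omega>. sin (\<theta> * s \<omega> + \<alpha>)"
  have c: "L2 \<Omega> ?c" "L2 \<Omega> ?sn" "L2 \<Omega> (\<lambda>\<omega>. sin (\<theta> * (s \<omega> - r k \<omega>) + \<alpha>))" for k
    by (auto intro!: Om.L2_bounded[where b=1])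
  have xr: "L2 \<Omega> (\<lambda>\<omega>. X k \<omega> * r k \<omega>)" if "k \<in> V" for k
    by (rule Om.L2_bounded[OF _ X_r_bound[OF that]]) (use that in measurable)
  have i: "integrable \<Omega> (\<lambda>\<omega>. X k \<omega> * ?sn \<omega>)" "integrable \<Omega> (\<lambda>\<omega>. X k \<omega> * r k \<omega> * ?c \<omega>)"
     "integrable \<Omega> (\<lambda>\<omega>. X k \<omega> * sin (\<theta> * (s \<omega> - r k \<omega>) + \<alpha>))" if "k \<in> V" for k
    by (intro L2_mult_integrable c xr X_L2 that)+
  have k: "\<bar>(\<integral>\<omega>. X k \<omega> * ?sn \<omega> \<partial>\<Omega>) - \<theta> * (\<integral>\<omega>. X k \<omega> * r k \<omega> * ?c \<omega> \<partial>\<Omega>)\<bar> \<le> A * ((D * A)\<^sup>2 / 2)"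
    if k: "k \<in> V" for k
  proof -
    \<comment> \<open>The sine of the reduced sum is independent of the centered \<open>X k\<close>,
      so it may be subtracted at no cost. Expanding around \<open>\<theta> * s\<close> then brings
      out the factor \<open>r k\<close>.\<close>
    have "(\<integral>\<omega>. X k \<omega> * sin (\<theta> * (s \<omega> - r k \<omega>) + \<alpha>) \<partial>\<Omega>) = 0"
      by (rule integral_X_mult[OF k]) (rule c)
    then have dif: "(\<integral>\<omega>. X k \<omega> * ?sn \<omega> \<partial>\<Omega>) - \<theta> * (\<integral>\<omega>. X k \<omega> * r k \<omega> * ?c \<omega> \<partial>\<Omega>)
       = (\<integral>\<omega>. X k \<omega> * ?sn \<omega> - X k \<omega> * sin (\<theta> * (s \<omega> - r k \<omega>) + \<alpha>) - \<theta> * (X k \<omega> * r k \<omega> * ?c \<omega>) \<partial>\<Omega>)"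
      using i[OF k] by simp
    have "\<bar>(\<integral>\<omega>. X k \<omega> * ?sn \<omega> \<partial>\<Omega>) - \<theta> * (\<integral>\<omega>. X k \<omega> * r k \<omega> * ?c \<omega> \<partial>\<Omega>)\<bar>
      \<le> (\<integral>\<omega>. \<bar>X k \<omega> * ?sn \<omega> - X k \<omega> * sin (\<theta> * (s \<omega> - r k \<omega>) + \<alpha>) - \<theta> * (X k \<omega> * r k \<omega> * ?c \<omega>)\<bar> \<partial>\<Omega>)"
      unfolding dif by (rule integral_abs_bound)
    also have "\<dots> \<le> (\<integral>\<omega>. A * ((D * A)\<^sup>2 / 2) \<partial>\<Omega>)"
    proof (rule integral_mono)
      fix \<omega>
      let ?x = "\<theta> * s \<omega> + \<alpha>" and ?h = "- (\<theta> * r k \<omega>)"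
      have eq: "\<theta> * (s \<omega> - r k \<omega>) + \<alpha> = ?x + ?h" by (simp add: algebra_simps)
      have "\<bar>\<theta> * r k \<omega>\<bar> \<le> 1 * (D * A)"
        unfolding abs_mult by (rule mult_mono) (use assms r_bound[of k \<omega>] in auto)
      then have "\<bar>\<theta> * r k \<omega>\<bar>\<^sup>2 \<le> (1 * (D * A))\<^sup>2" by (rule power_mono) simp
      then have h2: "?h\<^sup>2 / 2 \<le> (D * A)\<^sup>2 / 2" by simp
      have dif': "X k \<omega> * ?sn \<omega> - X k \<omega> * sin (\<theta> * (s \<omega> - r k \<omega>) + \<alpha>) - \<theta> * (X k \<omega> * r k \<omega> * ?c \<omega>)
         = - (X k \<omega> * (sin (?x + ?h) - sin ?x - ?h * cos ?x))"
        unfolding eq by (simp add: algebra_simps)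
      have "\<bar>X k \<omega> * ?sn \<omega> - X k \<omega> * sin (\<theta> * (s \<omega> - r k \<omega>) + \<alpha>) - \<theta> * (X k \<omega> * r k \<omega> * ?c \<omega>)\<bar>
         = \<bar>X k \<omega>\<bar> * \<bar>sin (?x + ?h) - sin ?x - ?h * cos ?x\<bar>"
        by (simp only: dif' abs_minus_cancel abs_mult)
      also have "\<dots> \<le> A * ((D * A)\<^sup>2 / 2)"
        by (rule mult_mono[OF X_bound[OF k] order_trans[OF sin_taylor h2]]) (use A_nonneg in auto)
      finally show "\<bar>X k \<omega> * ?sn \<omega> - X k \<omega> * sin (\<theta> * (s \<omega> - r k \<omega>) + \<alpha>) - \<theta> * (X k \<omega> * r k \<omega> * ?c \<omega>)\<bar>
         \<le> A * ((D * A)\<^sup>2 / 2)" .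
    qed (use i[OF k] in auto)
    finally show ?thesis by simp
  qed
  have "s \<omega> * c = (\<Sum>k\<in>V. X k \<omega> * c)" for \<omega> c
    by (simp add: s_def sum_distrib_right)
  then have s1: "(\<integral>\<omega>. s \<omega> * ?sn \<omega> \<partial>\<Omega>) = (\<Sum>k\<in>V. \<integral>\<omega>. X k \<omega> * ?sn \<omega> \<partial>\<Omega>)"
    using i by simp
  have s2: "(\<integral>\<omega>. ?q \<omega> * ?c \<omega> \<partial>\<Omega>) = (\<Sum>k\<in>V. \<integral>\<omega>. X k \<omega> * r k \<omega> * ?c \<omega> \<partial>\<Omega>)"
    using i by (simp add: sum_distrib_right)
  have "\<bar>(\<integral>\<omega>. s \<omega> * ?sn \<omega> \<partial>\<Omega>) - \<theta> * (\<integral>\<omega>. ?q \<omega> * ?c \<omega> \<partial>\<Omega>)\<bar> =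
      \<bar>\<Sum>k\<in>V. (\<integral>\<omega>. X k \<omega> * ?sn \<omega> \<partial>\<Omega>) - \<theta> * (\<integral>\<omega>. X k \<omega> * r k \<omega> * ?c \<omega> \<partial>\<Omega>)\<bar>"
    unfolding s1 s2 by (simp add: sum_subtractf sum_distrib_left)
  also have "\<dots> \<le> (\<Sum>k\<in>V. A * ((D * A)\<^sup>2 / 2))"
    by (rule order_trans[OF sum_abs sum_mono]) (rule k)
  also have "\<dots> = n * A^3 * D\<^sup>2 / 2"
    by (simp add: n_def power2_eq_square power3_eq_cube)
  finally have e1: "\<bar>(\<integral>\<omega>. s \<omega> * ?sn \<omega> \<partial>\<Omega>) - \<theta> * (\<integral>\<omega>. ?q \<omega> * ?c \<omega> \<partial>\<Omega>)\<bar> \<le> n * A^3 * D\<^sup>2 / 2" .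
  have q2: "L2 \<Omega> ?q" by (intro L2_sum xr)
  have l2: "L2 \<Omega> (\<lambda>\<omega>. ?q \<omega> - ?v)" by (intro L2_diff q2) simp
  have dif: "(\<integral>\<omega>. ?q \<omega> * ?c \<omega> \<partial>\<Omega>) - ?v * (\<integral>\<omega>. ?c \<omega> \<partial>\<Omega>) = (\<integral>\<omega>. (?q \<omega> - ?v) * ?c \<omega> \<partial>\<Omega>)"
    using L2_mult_integrable[OF q2 c(1)] Om.L2_integrable[OF c(1)]
    by (simp add: left_diff_distrib)
  have "\<bar>(\<integral>\<omega>. ?q \<omega> * ?c \<omega> \<partial>\<Omega>) - ?v * (\<integral>\<omega>. ?c \<omega> \<partial>\<Omega>)\<bar> \<le> nrm \<Omega> (\<lambda>\<omega>. ?q \<omega> - ?v) * nrm \<Omega> ?c"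
    unfolding dif by (rule L2_cauchy_schwarz[OF l2 c(1)])
  also have "\<dots> \<le> nrm \<Omega> (\<lambda>\<omega>. ?q \<omega> - ?v) * 1"
    by (intro mult_left_mono Om.nrm_bounded) auto
  also have "\<dots> \<le> (12 * real \<rho> + 1) * 2 * D * A\<^sup>2 * sqrt n"
    using q_variance by simp
  finally have e2: "\<bar>(\<integral>\<omega>. ?q \<omega> * ?c \<omega> \<partial>\<Omega>) - ?v * (\<integral>\<omega>. ?c \<omega> \<partial>\<Omega>)\<bar> \<le> (12 * real \<rho> + 1) * 2 * D * A\<^sup>2 * sqrt n" .
  have "\<bar>\<theta> * ((\<integral>\<omega>. ?q \<omega> * ?c \<omega> \<partial>\<Omega>) - ?v * (\<integral>\<omega>. ?c \<omega> \<partial>\<Omega>))\<bar> \<le> 1 * ((12 * real \<rho> + 1) * 2 * D * A\<^sup>2 * sqrt n)"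
    unfolding abs_mult by (rule mult_mono) (use assms e2 in auto)
  then have e3: "\<bar>\<theta> * (\<integral>\<omega>. ?q \<omega> * ?c \<omega> \<partial>\<Omega>) - \<theta> * ?v * (\<integral>\<omega>. ?c \<omega> \<partial>\<Omega>)\<bar> \<le> (12 * real \<rho> + 1) * 2 * D * A\<^sup>2 * sqrt n"
    by (simp add: right_diff_distrib mult.assoc)
  show ?thesis using e1 e3 unfolding clt_error_def by linarith
qed

text \<open>With the integrating factor \<open>exp (v * \<theta>^2 / 2)\<close> the mean value
  theorem on \<open>[0, 1]\<close> applies. The factor at the intermediate point is at most its
  value at 1, so the error of the differential equation is passed on without loss.\<close>

lemma cos_integral_clt:
  "\<bar>(\<integral>\<omega>. cos (s \<omega> + \<alpha>) \<partial>\<Omega>) - cos \<alpha> * exp (- (\<integral>\<omega>. (s \<omega>)\<^sup>2 \<partial>\<Omega>) / 2)\<bar> \<le> clt_error"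
proof -
  define v where "v = (\<integral>\<omega>. (s \<omega>)\<^sup>2 \<partial>\<Omega>)"
  define u where "u \<theta> = (\<integral>\<omega>. cos (\<theta> * s \<omega> + \<alpha>) \<partial>\<Omega>)" for \<theta>
  define u' where "u' \<theta> = - (\<integral>\<omega>. s \<omega> * sin (\<theta> * s \<omega> + \<alpha>) \<partial>\<Omega>)" for \<theta>
  define h where "h \<theta> = u \<theta> * exp (v * \<theta>\<^sup>2 / 2)" for \<theta>
  have v: "0 \<le> v" by (simp add: v_def)
  have du: "(u has_real_derivative u' \<theta>) (at \<theta>)" for \<theta>
    unfolding u_def[abs_def] u'_def by (rule cos_integral_derivative)
  have dh: "(h has_real_derivative (u' \<theta> + \<theta> * v * u \<theta>) * exp (v * \<theta>\<^sup>2 / 2)) (at \<theta>)" for \<theta>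
    unfolding h_def[abs_def]
    by (auto intro!: derivative_eq_intros du simp: algebra_simps)
  obtain z where z: "0 < z" "z < 1" "h 1 - h 0 = (1 - 0) * ((u' z + z * v * u z) * exp (v * z\<^sup>2 / 2))"
    using MVT2[of 0 1 h "\<lambda>\<theta>. (u' \<theta> + \<theta> * v * u \<theta>) * exp (v * \<theta>\<^sup>2 / 2)"] dh by auto
  have ode: "\<bar>u' z + z * v * u z\<bar> \<le> clt_error"
    using cos_integral_ode[of z \<alpha>] z by (simp add: u'_def u_def v_def)
  have "v * z\<^sup>2 \<le> v * 1"
    using z v by (intro mult_left_mono) (auto simp: power_le_one)
  then have ee: "exp (v * z\<^sup>2 / 2) \<le> exp (v / 2)" by simp
  have "\<bar>h 1 - h 0\<bar> = \<bar>u' z + z * v * u z\<bar> * exp (v * z\<^sup>2 / 2)"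
    using z by (simp add: abs_mult)
  also have "\<dots> \<le> clt_error * exp (v / 2)"
    by (rule mult_mono[OF ode ee]) (use ode in auto)
  finally have "\<bar>h 1 - h 0\<bar> * exp (- v / 2) \<le> clt_error * exp (v / 2) * exp (- v / 2)"
    by (rule mult_right_mono) simp
  also have "\<dots> = clt_error" by (simp add: exp_minus field_simps)
  finally have "\<bar>(h 1 - h 0) * exp (- v / 2)\<bar> \<le> clt_error" by (simp add: abs_mult)
  moreover have "(h 1 - h 0) * exp (- v / 2) = u 1 - cos \<alpha> * exp (- v / 2)"
    by (simp add: h_def u_def exp_minus field_simps)
  ultimately show ?thesis by (simp add: u_def v_def)
qed

end

context iid_field begin

section \<open>Approximation by functions of finitely many coordinates\<close>

text \<open>The sets that can be approximated in measure by finite dimensional ones contain the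
  generators and are closed under complements and countable unions, so the induction rule of
  \<open>sigma_sets\<close> covers all measurable sets.\<close>

lemma sets_approx:
  assumes "A \<in> sets \<Omega>" "0 < \<epsilon>"
  shows "\<exists>B\<in>sets \<Omega>. (\<exists>F. finite F \<and> dep F (\<lambda>\<omega>. \<omega> \<in> B)) \<and> measure \<Omega> ((A - B) \<union> (B - A)) < \<epsilon>"
proof -
  let ?G = "{{f \<in> (\<Pi>\<^sub>E i\<in>UNIV. space P). f i \<in> A} | i A. i \<in> (UNIV :: (int \<times> int) set) \<and> A \<in> sets P}"
  have eq: "sets \<Omega> = sigma_sets UNIV ?G"
    unfolding Omega_def using sets_PiM_single[of UNIV "\<lambda>_::int\<times>int. P"] by simp
  from assms(1) have "A \<in> sigma_sets UNIV ?G" unfolding eq .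
  then show ?thesis using assms(2)
  proof (induction arbitrary: \<epsilon>)
    case (Basic a)
    then obtain i A where a: "a = {f. f i \<in> A}" by auto
    have "dep {i} (\<lambda>\<omega>. \<omega> \<in> a)" unfolding a by (auto simp: dep_def)
    moreover have "a \<in> sets \<Omega>" unfolding eq using Basic by (intro sigma_sets.Basic) auto
    ultimately show ?case using Basic by (intro bexI[of _ a]) auto
  next
    case Empty
    then show ?case by (intro bexI[of _ "{}"]) (auto intro!: exI[of _ "{}"])
  next
    case (Compl a)
    then obtain B F where B: "B \<in> sets \<Omega>" "finite F" "dep F (\<lambda>\<omega>. \<omega> \<in> B)"
        "measure \<Omega> ((a - B) \<union> (B - a)) < \<epsilon>" by blast
    have "dep F (\<lambda>\<omega>. \<omega> \<in> UNIV - B)" using dep_comp[OF B(3), of Not] by simp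
    moreover have "(UNIV - a - (UNIV - B)) \<union> (UNIV - B - (UNIV - a)) = (a - B) \<union> (B - a)" by auto
    moreover have "UNIV - B \<in> sets \<Omega>" using sets.compl_sets[OF B(1)] by simp
    ultimately show ?case using B by (intro bexI[of _ "UNIV - B"]) auto
  next
    case (Union a)
    have a: "a i \<in> sets \<Omega>" for i unfolding eq using Union by auto
    have "(\<Union>i<n. a i) \<subseteq> (\<Union>i<n'. a i)" if "n \<le> n'" for n n'
      by (rule UN_mono) (use that in auto)
    then have "incseq (\<lambda>n. \<Union>i<n. a i)" unfolding incseq_def by blast
    moreover have "range (\<lambda>n. \<Union>i<n. a i) \<subseteq> sets \<Omega>" using a by auto
    ultimately have "(\<lambda>n. measure \<Omega> (\<Union>i<n. a i)) \<longlonglongrightarrow> measure \<Omega> (\<Union>n. \<Union>i<n. a i)"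
      by (intro Om.finite_Lim_measure_incseq)
    moreover have "(\<Union>n. \<Union>i<n. a i) = (\<Union>i. a i)" by auto
    ultimately have lim: "(\<lambda>n. measure \<Omega> (\<Union>i<n. a i)) \<longlonglongrightarrow> measure \<Omega> (\<Union>i. a i)" by simp
    then obtain n where n: "\<bar>measure \<Omega> (\<Union>i<n. a i) - measure \<Omega> (\<Union>i. a i)\<bar> < \<epsilon> / 2"
      using LIMSEQ_D[OF lim, of "\<epsilon> / 2"] Union.prems by auto
    \<comment> \<open>Half of the tolerance has been spent on truncating the union at
      \<open>n\<close>; the other half is shared among the \<open>n\<close> sets.
      \<open>Suc n\<close> avoids a division by 0.\<close>
    have "\<forall>i. \<exists>B\<in>sets \<Omega>. (\<exists>F. finite F \<and> dep F (\<lambda>\<omega>. \<omega> \<in> B)) \<and> measure \<Omega> ((a i - B) \<union> (B - a i)) < \<epsilon> / (2 * real (Suc n))"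
      using Union by auto
    then obtain B F where B: "\<And>i. B i \<in> sets \<Omega>" "\<And>i. finite (F i)" "\<And>i. dep (F i) (\<lambda>\<omega>. \<omega> \<in> B i)"
      "\<And>i. measure \<Omega> ((a i - B i) \<union> (B i - a i)) < \<epsilon> / (2 * real (Suc n))"
      by metis
    let ?B = "\<Union>i<n. B i" and ?F = "\<Union>i<n. F i" and ?A = "\<Union>i. a i"
    have "dep ?F (\<lambda>\<omega>. \<omega> \<in> ?B)"
      unfolding dep_def
    proof (intro allI impI)
      fix \<omega> \<omega>' :: "int \<times> int \<Rightarrow> real" assume "\<forall>i\<in>?F. \<omega> i = \<omega>' i"
      then have "(\<omega> \<in> B i) = (\<omega>' \<in> B i)" if "i < n" for i
        using that by (intro depD[OF B(3)]) auto
      then show "(\<omega> \<in> ?B) = (\<omega>' \<in> ?B)" by auto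
    qed
    moreover have Bs: "?B \<in> sets \<Omega>" using B by auto
    moreover have "measure \<Omega> ((?A - ?B) \<union> (?B - ?A)) < \<epsilon>"
    proof -
      let ?D = "\<lambda>i. (a i - B i) \<union> (B i - a i)"
      have D: "?D i \<in> sets \<Omega>" for i using a B by auto
      have "measure \<Omega> ((?A - ?B) \<union> (?B - ?A)) \<le> measure \<Omega> ((?A - (\<Union>i<n. a i)) \<union> (\<Union>i<n. ?D i))"
        by (rule Om.finite_measure_mono) (use a D in \<open>auto\<close>)
      also have "\<dots> \<le> measure \<Omega> (?A - (\<Union>i<n. a i)) + measure \<Omega> (\<Union>i<n. ?D i)"
        by (rule measure_subadditive) (use a D in \<open>auto simp: Om.emeasure_eq_measure\<close>)
      also have "measure \<Omega> (?A - (\<Union>i<n. a i)) = measure \<Omega> ?A - measure \<Omega> (\<Union>i<n. a i)"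
        using a by (intro Om.finite_measure_Diff) auto
      also have "\<dots> < \<epsilon> / 2" using n by linarith
      also have "measure \<Omega> (\<Union>i<n. ?D i) \<le> (\<Sum>i<n. measure \<Omega> (?D i))"
        using D by (intro Om.finite_measure_subadditive_finite) auto
      also have "\<dots> \<le> (\<Sum>i<n. \<epsilon> / (2 * real (Suc n)))"
        by (intro sum_mono less_imp_le B)
      also have "\<dots> \<le> \<epsilon> / 2"
        using Union.prems by (simp add: field_simps)
      finally show ?thesis by simp
    qed
    ultimately show ?case using B by (intro bexI[of _ ?B] conjI exI[of _ ?F]) auto
  qed
qed

text \<open>Follows the construction of integrable functions: indicators from
  \<open>sets_approx\<close>, then sums, then dominated limits.\<close>

lemma integrable_approx:
  assumes "integrable \<Omega> f" "0 < \<epsilon>"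
  shows "\<exists>g F. integrable \<Omega> g \<and> finite F \<and> dep F g \<and> (\<integral>\<omega>. \<bar>f \<omega> - g \<omega>\<bar> \<partial>\<Omega>) < (\<epsilon>::real)"
  using assms
proof (induction arbitrary: \<epsilon> rule: integrable_induct)
  case (base A c)
  obtain B F where B: "B \<in> sets \<Omega>" "finite F" "dep F (\<lambda>\<omega>. \<omega> \<in> B)"
      "measure \<Omega> ((A - B) \<union> (B - A)) < \<epsilon> / (\<bar>c\<bar> + 1)"
    using sets_approx[OF base(1), of "\<epsilon> / (\<bar>c\<bar> + 1)"] base(3) by auto
  let ?g = "\<lambda>\<omega>. indicator B \<omega> * c"
  have "dep F ?g"
    using dep_comp[OF B(3), of "\<lambda>b. of_bool b * c"] by (simp add: indicator_def)
  moreover have "integrable \<Omega> ?g" using B by (simp add: Om.emeasure_eq_measure)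
  moreover have "(\<integral>\<omega>. \<bar>indicator A \<omega> *\<^sub>R c - ?g \<omega>\<bar> \<partial>\<Omega>) < \<epsilon>"
  proof -
    have "(\<integral>\<omega>. \<bar>indicator A \<omega> *\<^sub>R c - ?g \<omega>\<bar> \<partial>\<Omega>) = (\<integral>\<omega>. indicator ((A - B) \<union> (B - A)) \<omega> * \<bar>c\<bar> \<partial>\<Omega>)"
      by (rule Bochner_Integration.integral_cong) (auto simp: indicator_def)
    also have "\<dots> = measure \<Omega> ((A - B) \<union> (B - A)) * \<bar>c\<bar>"
      using base B by simp
    also have "\<dots> \<le> measure \<Omega> ((A - B) \<union> (B - A)) * (\<bar>c\<bar> + 1)"
      by (intro mult_left_mono) auto
    also have "\<dots> < \<epsilon> / (\<bar>c\<bar> + 1) * (\<bar>c\<bar> + 1)"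
      using B(4) by (intro mult_strict_right_mono) auto
    also have "\<dots> = \<epsilon>" by simp
    finally show ?thesis .
  qed
  ultimately show ?case using B(2) by blast
next
  case (add f1 f2)
  obtain g1 F1 where 1: "integrable \<Omega> g1" "finite F1" "dep F1 g1" "(\<integral>\<omega>. \<bar>f1 \<omega> - g1 \<omega>\<bar> \<partial>\<Omega>) < \<epsilon> / 2"
    using add(3)[of "\<epsilon> / 2"] add(5) by auto
  obtain g2 F2 where 2: "integrable \<Omega> g2" "finite F2" "dep F2 g2" "(\<integral>\<omega>. \<bar>f2 \<omega> - g2 \<omega>\<bar> \<partial>\<Omega>) < \<epsilon> / 2"
    using add(4)[of "\<epsilon> / 2"] add(5) by auto
  have "(\<integral>\<omega>. \<bar>f1 \<omega> + f2 \<omega> - (g1 \<omega> + g2 \<omega>)\<bar> \<partial>\<Omega>) \<le> (\<integral>\<omega>. \<bar>f1 \<omega> - g1 \<omega>\<bar> + \<bar>f2 \<omega> - g2 \<omega>\<bar> \<partial>\<Omega>)"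
    using 1 2 add by (intro integral_mono) auto
  also have "\<dots> < \<epsilon>" using 1 2 add by simp
  finally have "(\<integral>\<omega>. \<bar>f1 \<omega> + f2 \<omega> - (g1 \<omega> + g2 \<omega>)\<bar> \<partial>\<Omega>) < \<epsilon>" .
  moreover have "dep (F1 \<union> F2) (\<lambda>\<omega>. g1 \<omega> + g2 \<omega>)"
    by (intro dep_comp2[where F="(+)"] dep_mono[OF 1(3)] dep_mono[OF 2(3)]) auto
  ultimately show ?case using 1 2
    by (intro exI[of _ "\<lambda>\<omega>. g1 \<omega> + g2 \<omega>"] exI[of _ "F1 \<union> F2"]) auto
next
  case (lim f s)
  have "(\<lambda>i. \<integral>\<omega>. \<bar>f \<omega> - s i \<omega>\<bar> \<partial>\<Omega>) \<longlonglongrightarrow> (\<integral>\<omega>. 0 \<partial>\<Omega>)"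
  proof (rule integral_dominated_convergence[where w="\<lambda>\<omega>. 3 * \<bar>f \<omega>\<bar>"])
    show "AE \<omega> in \<Omega>. (\<lambda>i. \<bar>f \<omega> - s i \<omega>\<bar>) \<longlonglongrightarrow> 0"
    proof (rule AE_I2)
      fix \<omega> assume "\<omega> \<in> space \<Omega>"
      then have "(\<lambda>i. \<bar>f \<omega> - s i \<omega>\<bar>) \<longlonglongrightarrow> \<bar>f \<omega> - f \<omega>\<bar>"
        by (intro tendsto_intros lim)
      then show "(\<lambda>i. \<bar>f \<omega> - s i \<omega>\<bar>) \<longlonglongrightarrow> 0" by simp
    qed
    show "AE \<omega> in \<Omega>. norm \<bar>f \<omega> - s i \<omega>\<bar> \<le> 3 * \<bar>f \<omega>\<bar>" for i
    proof (rule AE_I2)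
      fix \<omega>
      have "norm (s i \<omega>) \<le> 2 * norm (f \<omega>)" using lim.hyps by simp
      then show "norm \<bar>f \<omega> - s i \<omega>\<bar> \<le> 3 * \<bar>f \<omega>\<bar>" by simp
    qed
  qed (use lim in auto)
  then have "\<forall>\<^sub>F i in sequentially. (\<integral>\<omega>. \<bar>f \<omega> - s i \<omega>\<bar> \<partial>\<Omega>) < \<epsilon> / 2"
    using lim.prems by (intro order_tendstoD(2)) auto
  then obtain i where i: "(\<integral>\<omega>. \<bar>f \<omega> - s i \<omega>\<bar> \<partial>\<Omega>) < \<epsilon> / 2"
    by (auto simp: eventually_sequentially)
  obtain g F where g: "integrable \<Omega> g" "finite F" "dep F g" "(\<integral>\<omega>. \<bar>s i \<omega> - g \<omega>\<bar> \<partial>\<Omega>) < \<epsilon> / 2"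
    using lim.IH[of "\<epsilon> / 2" i] lim.prems by auto
  have "(\<integral>\<omega>. \<bar>f \<omega> - g \<omega>\<bar> \<partial>\<Omega>) \<le> (\<integral>\<omega>. \<bar>f \<omega> - s i \<omega>\<bar> + \<bar>s i \<omega> - g \<omega>\<bar> \<partial>\<Omega>)"
    using g lim by (intro integral_mono) auto
  also have "\<dots> < \<epsilon>" using i g lim by simp
  finally show ?case using g by blast
qed

text \<open>For two functions bounded by \<open>c\<close>, the squared difference is at most
  \<open>2 * c + 1\<close> times the absolute one, so after truncation an approximation in mean
  suffices. Clipping the approximant keeps it local and, being a contraction, does not move it away.
  The added 1 keeps the divisor positive when \<open>c = 0\<close>.\<close>

lemma L2_approx:
  assumes "L2 \<Omega> f" "0 < \<epsilon>"
  obtains g b F where "g \<in> borel_measurable \<Omega>" "\<And>\<omega>. \<bar>g \<omega>\<bar> \<le> b" "finite F" "dep F g"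
    "nrm \<Omega> (\<lambda>\<omega>. f \<omega> - g \<omega>) < \<epsilon>"
proof -
  note [measurable] = L2_meas[OF assms(1)]
  define clip where "clip c x = max (- c) (min c x)" for c x :: real
  have [measurable]: "clip c \<in> borel_measurable borel" for c unfolding clip_def by measurable
  have "(\<lambda>n::nat. \<integral>\<omega>. (f \<omega> - clip (real n) (f \<omega>))\<^sup>2 \<partial>\<Omega>) \<longlonglongrightarrow> (\<integral>\<omega>. 0 \<partial>\<Omega>)"
  proof (rule integral_dominated_convergence[where w="\<lambda>\<omega>. (f \<omega>)\<^sup>2"])
    show "AE \<omega> in \<Omega>. (\<lambda>n. (f \<omega> - clip (real n) (f \<omega>))\<^sup>2) \<longlonglongrightarrow> 0"
    proof (rule AE_I2, rule tendsto_eventually)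
      fix \<omega>
      have "\<forall>\<^sub>F n in sequentially. \<bar>f \<omega>\<bar> \<le> real n"
        using filterlim_real_sequentially by (simp add: filterlim_at_top)
      then show "\<forall>\<^sub>F n in sequentially. (f \<omega> - clip (real n) (f \<omega>))\<^sup>2 = 0"
        by eventually_elim (auto simp: clip_def)
    qed
    show "AE \<omega> in \<Omega>. norm ((f \<omega> - clip (real n) (f \<omega>))\<^sup>2) \<le> (f \<omega>)\<^sup>2" for n
      by (rule AE_I2) (auto simp: clip_def abs_le_square_iff[symmetric])
  qed (use L2_sq[OF assms(1)] in auto)
  then have "\<forall>\<^sub>F n in sequentially. (\<integral>\<omega>. (f \<omega> - clip (real n) (f \<omega>))\<^sup>2 \<partial>\<Omega>) < (\<epsilon> / 2)\<^sup>2"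
    using assms(2) by (intro order_tendstoD(2)) auto
  then obtain n :: nat where n: "(\<integral>\<omega>. (f \<omega> - clip (real n) (f \<omega>))\<^sup>2 \<partial>\<Omega>) < (\<epsilon> / 2)\<^sup>2"
    by (auto simp: eventually_sequentially)
  define c where "c = real n"
  let ?fc = "\<lambda>\<omega>. clip c (f \<omega>)"
  have cb: "\<bar>clip c x\<bar> \<le> c" for x by (auto simp: clip_def c_def)
  have fc: "L2 \<Omega> ?fc" by (rule Om.L2_bounded[OF _ cb]) measurable
  have n': "nrm \<Omega> (\<lambda>\<omega>. f \<omega> - ?fc \<omega>) < \<epsilon> / 2"
    using n assms(2) unfolding nrm_def c_def by (intro real_less_lsqrt) auto
  obtain g0 F where g0: "integrable \<Omega> g0" "finite F" "dep F g0"
      "(\<integral>\<omega>. \<bar>?fc \<omega> - g0 \<omega>\<bar> \<partial>\<Omega>) < (\<epsilon> / 2)\<^sup>2 / (2 * c + 1)"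
    using integrable_approx[OF Om.L2_integrable[OF fc], of "(\<epsilon> / 2)\<^sup>2 / (2 * c + 1)"] assms(2)
    by (auto simp: c_def)
  let ?g = "\<lambda>\<omega>. clip c (g0 \<omega>)"
  have [measurable]: "g0 \<in> borel_measurable \<Omega>" using g0 by auto
  have g: "L2 \<Omega> ?g" by (rule Om.L2_bounded[OF _ cb]) measurable
  have "(\<integral>\<omega>. (?fc \<omega> - ?g \<omega>)\<^sup>2 \<partial>\<Omega>) \<le> (\<integral>\<omega>. (2 * c + 1) * \<bar>?fc \<omega> - g0 \<omega>\<bar> \<partial>\<Omega>)"
  proof (rule integral_mono)
    fix \<omega>
    have "\<bar>?fc \<omega> - ?g \<omega>\<bar> \<le> \<bar>?fc \<omega> - g0 \<omega>\<bar>"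
      by (auto simp: clip_def c_def max_def min_def)
    moreover have "\<bar>?fc \<omega> - ?g \<omega>\<bar> \<le> 2 * c + 1" using cb[of "f \<omega>"] cb[of "g0 \<omega>"] by linarith
    ultimately have "\<bar>?fc \<omega> - ?g \<omega>\<bar> * \<bar>?fc \<omega> - ?g \<omega>\<bar> \<le> (2 * c + 1) * \<bar>?fc \<omega> - g0 \<omega>\<bar>"
      by (intro mult_mono) auto
    then show "(?fc \<omega> - ?g \<omega>)\<^sup>2 \<le> (2 * c + 1) * \<bar>?fc \<omega> - g0 \<omega>\<bar>"
      by (simp add: power2_eq_square)
  qed (use L2_sq[OF L2_diff[OF fc g]] Om.L2_integrable[OF fc] g0 in auto)
  also have "\<dots> = (2 * c + 1) * (\<integral>\<omega>. \<bar>?fc \<omega> - g0 \<omega>\<bar> \<partial>\<Omega>)" by simp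
  also have "\<dots> < (2 * c + 1) * ((\<epsilon> / 2)\<^sup>2 / (2 * c + 1))"
    using g0(4) by (intro mult_strict_left_mono) (auto simp: c_def)
  also have "\<dots> = (\<epsilon> / 2)\<^sup>2" by (simp add: c_def)
  finally have "nrm \<Omega> (\<lambda>\<omega>. ?fc \<omega> - ?g \<omega>) < \<epsilon> / 2"
    using assms(2) unfolding nrm_def by (intro real_less_lsqrt) auto
  then have "nrm \<Omega> (\<lambda>\<omega>. (f \<omega> - ?fc \<omega>) + (?fc \<omega> - ?g \<omega>)) < \<epsilon>"
    using nrm_triangle[OF L2_diff[OF assms(1) fc] L2_diff[OF fc g]] n' by simp
  then have "nrm \<Omega> (\<lambda>\<omega>. f \<omega> - ?g \<omega>) < \<epsilon>" by simp
  then show thesis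
    using that[of ?g c F] cb g0(2) dep_comp[OF g0(3), of "clip c"] by auto
qed

section \<open>Reduction to finite sums of bounded projections\<close>

text \<open>Such a \<open>g\<close> is at once a finite sum of projections, so that the maximal
  inequalities apply, and a bounded local function, so that \<open>local_dep\<close> applies to its
  translates.\<close>

definition nice :: "((int \<times> int \<Rightarrow> real) \<Rightarrow> real) \<Rightarrow> bool" where
  "nice g \<longleftrightarrow> (\<exists>I u b m. finite I \<and> u \<in> borel_measurable \<Omega> \<and> (\<forall>\<omega>. \<bar>u \<omega>\<bar> \<le> b) \<and>
     dep (box 0 m) u \<and> g = (\<lambda>\<omega>. \<Sum>j\<in>I. PP j u \<omega>))"

lemma finite_subset_box:
  assumes "finite F"
  obtains m where "F \<subseteq> box 0 m"
proof -
  obtain B1 where B1: "\<And>x. x \<in> F \<Longrightarrow> nat \<bar>fst x\<bar> \<le> B1"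
    using finite_nat_set_iff_bounded_le[of "(\<lambda>x. nat \<bar>fst x\<bar>) ` F"] assms by auto
  obtain B2 where B2: "\<And>x. x \<in> F \<Longrightarrow> nat \<bar>snd x\<bar> \<le> B2"
    using finite_nat_set_iff_bounded_le[of "(\<lambda>x. nat \<bar>snd x\<bar>) ` F"] assms by auto
  have "F \<subseteq> box 0 (B1 + B2)"
  proof
    fix x assume "x \<in> F"
    then show "x \<in> box 0 (B1 + B2)" using B1[of x] B2[of x] by (cases x) (auto simp: box_def)
  qed
  then show thesis by (rule that)
qed

lemma nice_props:
  assumes "nice g"
  obtains b m where "g \<in> borel_measurable \<Omega>" "\<And>\<omega>. \<bar>g \<omega>\<bar> \<le> b" "0 \<le> b" "dep (box 0 m) g" "(\<integral>\<omega>. g \<omega> \<partial>\<Omega>) = 0"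
proof -
  obtain I u b m where g: "finite I" "u \<in> borel_measurable \<Omega>" "\<And>\<omega>. \<bar>u \<omega>\<bar> \<le> b" "dep (box 0 m) u"
      "g = (\<lambda>\<omega>. \<Sum>j\<in>I. PP j u \<omega>)"
    using assms unfolding nice_def by blast
  have l2: "L2 \<Omega> u" by (rule Om.L2_bounded[OF g(2,3)])
  have "\<bar>g \<omega>\<bar> \<le> (\<Sum>j\<in>I. 4 * b)" for \<omega>
    unfolding g(5) by (rule order_trans[OF sum_abs sum_mono]) (rule PP_bounded[OF g(2,3)])
  moreover have "0 \<le> (\<Sum>j\<in>I. 4 * b)"
    using g(3)[of undefined] by (intro sum_nonneg) linarith
  moreover have "g \<in> borel_measurable \<Omega>" unfolding g(5) using g(2) by measurable
  moreover have "dep (box 0 m) g" unfolding g(5) by (intro dep_sum dep_PP_finite g)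
  moreover have "(\<integral>\<omega>. g \<omega> \<partial>\<Omega>) = 0"
  proof -
    have "(\<integral>\<omega>. PP j u \<omega> \<partial>\<Omega>) = 0" for j
      using integral_PP_orth1[of "\<lambda>_. 1" u j] l2 by simp
    then show ?thesis unfolding g(5) using Om.L2_integrable[OF L2_PP[OF l2]] by simp
  qed
  ultimately show thesis using that by blast
qed

lemma local_dep_weighted:
  assumes "g \<in> borel_measurable \<Omega>" "\<And>\<omega>. \<bar>g \<omega>\<bar> \<le> b" "dep (box 0 m) g" "(\<integral>\<omega>. g \<omega> \<partial>\<Omega>) = 0"
    and "finite V" "\<And>k. k \<in> V \<Longrightarrow> \<bar>W k\<bar> \<le> w" "0 \<le> w"
  shows "local_dep P V (\<lambda>k \<omega>. W k * g (shift k \<omega>)) (w * b) m"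
proof
  have "0 \<le> b" using assms(2)[of undefined] by linarith
  then show "0 \<le> w * b" using assms(7) by simp
  fix k assume k: "k \<in> V"
  show "(\<lambda>\<omega>. W k * g (shift k \<omega>)) \<in> borel_measurable (Omega P)"
    using assms(1) by measurable
  show "\<bar>W k * g (shift k \<omega>)\<bar> \<le> w * b" for \<omega>
    unfolding abs_mult by (rule mult_mono[OF assms(6)[OF k] assms(2)]) (use assms(7) in auto)
  show "(\<integral>\<omega>. W k * g (shift k \<omega>) \<partial>Omega P) = 0"
    using integral_shift[OF assms(1), of k] assms(4) by simp
  have "dep (box k m) (\<lambda>\<omega>. g (shift k \<omega>))"
    using dep_shift[OF assms(3), of k] by (simp add: box_shift)
  then show "dep (box k m) (\<lambda>\<omega>. W k * g (shift k \<omega>))" by (rule dep_comp)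
qed (fact assms)

text \<open>Cauchy-Schwarz twice.\<close>

lemma sum_power4_le:
  fixes a :: "'i \<Rightarrow> real"
  shows "(\<Sum>i\<in>I. a i)^4 \<le> real (card I)^3 * (\<Sum>i\<in>I. (a i)^4)"
proof -
  have "(\<Sum>i\<in>I. a i)\<^sup>2 \<le> real (card I) * (\<Sum>i\<in>I. (a i)\<^sup>2)"
    using sum_squared_le_sum_of_squares[of a I] by (cases "finite I") (auto simp: mult.commute)
  then have "((\<Sum>i\<in>I. a i)\<^sup>2)\<^sup>2 \<le> (real (card I) * (\<Sum>i\<in>I. (a i)\<^sup>2))\<^sup>2"
    by (rule power_mono) simp
  also have "\<dots> = (real (card I))\<^sup>2 * (\<Sum>i\<in>I. (a i)\<^sup>2)\<^sup>2" by (simp add: power_mult_distrib)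
  also have "\<dots> \<le> (real (card I))\<^sup>2 * (real (card I) * (\<Sum>i\<in>I. ((a i)\<^sup>2)\<^sup>2))"
    using sum_squared_le_sum_of_squares[of "\<lambda>i. (a i)\<^sup>2" I]
    by (intro mult_left_mono) (cases "finite I"; auto simp: mult.commute)+
  finally show ?thesis by (simp add: power2_eq_square power3_eq_cube power4_eq_xxxx mult.assoc)
qed

text \<open>Cairoli's inequality reduces the maximum for each projection to the full rectangle,
  where the fourth moment of a locally dependent sum is known. The finitely many projections are
  then put together with \<open>sum_power4_le\<close>.\<close>

lemma nice_Mx_power4:
  assumes "nice g"
  obtains C where "0 \<le> C" "\<And>n1 n2. integrable \<Omega> (\<lambda>\<omega>. (Mx g n1 n2 \<omega>)^4)"
    "\<And>n1 n2. (\<integral>\<omega>. (Mx g n1 n2 \<omega>)^4 \<partial>\<Omega>) \<le> C * (real (n1 * n2))\<^sup>2"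
proof -
  obtain I u b m where g: "finite I" "u \<in> borel_measurable \<Omega>" "\<And>\<omega>. \<bar>u \<omega>\<bar> \<le> b" "dep (box 0 m) u"
      "g = (\<lambda>\<omega>. \<Sum>j\<in>I. PP j u \<omega>)"
    using assms unfolding nice_def by blast
  have l2: "L2 \<Omega> u" by (rule Om.L2_bounded[OF g(2,3)])
  have "0 \<le> b" using g(3)[of undefined] by linarith
  have mPP: "PP j u \<in> borel_measurable \<Omega>" for j using g(2) by measurable
  have int4: "integrable \<Omega> (\<lambda>\<omega>. (Mx v n1 n2 \<omega>)^4)"
    if v: "L2 \<Omega> v" "\<And>\<omega>. \<bar>v \<omega>\<bar> \<le> c" for v c n1 n2
  proof -
    have "Mx v n1 n2 \<omega> \<le> (\<Sum>k\<in>{1..int n1} \<times> {1..int n2}. c)" for \<omega>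
    proof (rule Mx_le)
      fix i j assume ij: "i \<le> n1" "j \<le> n2"
      have c: "0 \<le> c" using v(2)[of undefined] by linarith
      have "\<bar>S_rect v i j \<omega>\<bar> \<le> (\<Sum>k\<in>{1..int i} \<times> {1..int j}. c)"
        unfolding S_rect_def by (rule order_trans[OF sum_abs sum_mono]) (rule v)
      also have "\<dots> \<le> (\<Sum>k\<in>{1..int n1} \<times> {1..int n2}. c)"
        by (rule sum_mono2) (use ij c in auto)
      finally show "\<bar>S_rect v i j \<omega>\<bar> \<le> (\<Sum>k\<in>{1..int n1} \<times> {1..int n2}. c)" .
    qed
    then have "\<bar>(Mx v n1 n2 \<omega>)^4\<bar> \<le> (\<Sum>k\<in>{1..int n1} \<times> {1..int n2}. c)^4" for \<omega>
      by (simp add: power_mono)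
    then show ?thesis
      using L2_meas[OF L2_Mx[OF v(1), of n1 n2]] by (intro Om.integrable_bounded) auto
  qed
  define D where "D = real ((4 * m + 1)\<^sup>2)"
  define C where "C = real (card I)^3 * (real (card I) * (16 * (8 * D^3 * (4 * b)^4)))"
  have j: "(\<integral>\<omega>. (Mx (PP j u) n1 n2 \<omega>)^4 \<partial>\<Omega>) \<le> 16 * (8 * D^3 * (4 * b)^4) * (real (n1 * n2))\<^sup>2" for j n1 n2
  proof -
    let ?V = "{1..int n1} \<times> {1..int n2}"
    have "(\<integral>\<omega>. PP j u \<omega> \<partial>\<Omega>) = 0"
      using integral_PP_orth1[of "\<lambda>_. 1" u j] l2 by simp
    from local_dep_weighted[OF mPP PP_bounded[OF g(2,3)] dep_PP_finite[OF g(4)] this, of ?V "\<lambda>_. 1" 1]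
    interpret X: local_dep P ?V "\<lambda>k \<omega>. 1 * PP j u (shift k \<omega>)" "1 * (4 * b)" m by simp
    have s: "X.s = S_rect (PP j u) n1 n2" unfolding X.s_def[abs_def] S_rect_def[abs_def] by simp
    have nn: "X.n = real (n1 * n2)" by (simp add: X.n_def card_cartesian_product)
    have "(\<integral>\<omega>. (S_rect (PP j u) n1 n2 \<omega>)^4 \<partial>\<Omega>) \<le> 8 * (real (n1 * n2))\<^sup>2 * D^3 * (4 * b)^4"
      using X.fourth_moment unfolding s nn X.D_def D_def by simp
    then show ?thesis
      using Mx_PP_power4[OF g(2,3), of j n1 n2] by (simp add: mult_ac)
  qed
  show thesis
  proof (rule that[of C])
    show "0 \<le> C" using \<open>0 \<le> b\<close> by (simp add: C_def D_def)
    obtain b' where b': "g \<in> borel_measurable \<Omega>" "\<And>\<omega>. \<bar>g \<omega>\<bar> \<le> b'" using nice_props[OF assms] by blast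
    show ig: "integrable \<Omega> (\<lambda>\<omega>. (Mx g n1 n2 \<omega>)^4)" for n1 n2
      by (rule int4[OF Om.L2_bounded[OF b'] b'(2)])
    have ij: "integrable \<Omega> (\<lambda>\<omega>. (Mx (PP j u) n1 n2 \<omega>)^4)" for j n1 n2
      by (rule int4[OF L2_PP[OF l2] PP_bounded[OF g(2,3)]])
    fix n1 n2
    have "(\<integral>\<omega>. (Mx g n1 n2 \<omega>)^4 \<partial>\<Omega>) \<le> (\<integral>\<omega>. real (card I)^3 * (\<Sum>j\<in>I. (Mx (PP j u) n1 n2 \<omega>)^4) \<partial>\<Omega>)"
    proof (rule integral_mono[OF ig])
      fix \<omega>
      have "(Mx g n1 n2 \<omega>)^4 \<le> (\<Sum>j\<in>I. Mx (PP j u) n1 n2 \<omega>)^4"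
        unfolding g(5) by (rule power_mono[OF Mx_sum_le]) simp
      also have "\<dots> \<le> real (card I)^3 * (\<Sum>j\<in>I. (Mx (PP j u) n1 n2 \<omega>)^4)" by (rule sum_power4_le)
      finally show "(Mx g n1 n2 \<omega>)^4 \<le> real (card I)^3 * (\<Sum>j\<in>I. (Mx (PP j u) n1 n2 \<omega>)^4)" .
    qed (use ij in simp)
    also have "\<dots> = real (card I)^3 * (\<Sum>j\<in>I. \<integral>\<omega>. (Mx (PP j u) n1 n2 \<omega>)^4 \<partial>\<Omega>)"
      using ij by simp
    also have "\<dots> \<le> real (card I)^3 * (\<Sum>j\<in>I. 16 * (8 * D^3 * (4 * b)^4) * (real (n1 * n2))\<^sup>2)"
      by (intro mult_left_mono sum_mono j) simp
    also have "\<dots> = C * (real (n1 * n2))\<^sup>2" by (simp add: C_def)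
    finally show "(\<integral>\<omega>. (Mx g n1 n2 \<omega>)^4 \<partial>\<Omega>) \<le> C * (real (n1 * n2))\<^sup>2" .
  qed
qed

text \<open>There are countably many shifts, so the exceptional set stays null.\<close>

lemma nrm_Mx_cong:
  assumes "L2 \<Omega> f" "L2 \<Omega> g" "AE \<omega> in \<Omega>. f \<omega> = g \<omega>"
  shows "nrm \<Omega> (Mx f n1 n2) = nrm \<Omega> (Mx g n1 n2)"
proof (rule nrm_cong_AE)
  have "AE \<omega> in \<Omega>. \<forall>k. f (shift k \<omega>) = g (shift k \<omega>)"
    unfolding AE_all_countable using AE_shift[OF assms(3)] by blast
  then show "AE \<omega> in \<Omega>. Mx f n1 n2 \<omega> = Mx g n1 n2 \<omega>"
    by eventually_elim (simp add: Mx_def S_rect_def del: split_paired_All)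
qed (use L2_meas[OF L2_Mx] assms in auto)

text \<open>The mixed differences have the shape of \<open>PP\<close>: over a square of sites the
  projections collapse to four corner terms.\<close>

lemma double_telescope:
  fixes d :: "nat \<Rightarrow> nat \<Rightarrow> real"
  shows "(\<Sum>i<I. \<Sum>j<J. d i j - d (Suc i) j - d i (Suc j) + d (Suc i) (Suc j)) = d 0 0 - d I 0 - d 0 J + d I J"
proof -
  have "(\<Sum>j<J. d i j - d (Suc i) j - d i (Suc j) + d (Suc i) (Suc j)) = (d i 0 - d i J) - (d (Suc i) 0 - d (Suc i) J)" for i
    by (induction J) auto
  then have "(\<Sum>i<I. \<Sum>j<J. d i j - d (Suc i) j - d i (Suc j) + d (Suc i) (Suc j))
     = (\<Sum>i<I. (d i 0 - d i J) - (d (Suc i) 0 - d (Suc i) J))" by simp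
  also have "\<dots> = d 0 0 - d I 0 - d 0 J + d I J" by (induction I) auto
  finally show ?thesis .
qed

text \<open>\<open>f - g\<close> splits into finitely many projections of \<open>f - u\<close>, a
  tail of projections of \<open>f\<close>, and a remainder. The first two obey the martingale
  maximal inequality, uniformly in the rectangle. The remainder has only the crude bound, but it
  vanishes when \<open>J'\<close> grows with the rectangle held fixed.\<close>

theorem hannan_approximation:
  assumes f: "L2 \<Omega> f" and adapted: "AE \<omega> in \<Omega>. cexp (Gamma_set (0, 0)) f \<omega> = f \<omega>"
    and bounded: "\<And>J. (\<Sum>i<J. \<Sum>j<J. nrm \<Omega> (PP (- int i, - int j) f)) \<le> B"
    and tail1: "(\<lambda>J. nrm \<Omega> (cexp (Gamma_set (- int J, 0)) f)) \<longlonglongrightarrow> 0"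
    and tail2: "(\<lambda>J. nrm \<Omega> (cexp (Gamma_set (0, - int J)) f)) \<longlonglongrightarrow> 0"
    and "0 < \<epsilon>"
  obtains g where "nice g" "\<And>n1 n2. nrm \<Omega> (Mx (\<lambda>\<omega>. f \<omega> - g \<omega>) n1 n2) \<le> \<epsilon> * sqrt (real (n1 * n2))"
proof -
  define p where "p x = (- int (fst x), - int (snd x))" for x :: "nat \<times> nat"
  define Q where "Q J = {..<J} \<times> {..<J::nat}" for J
  define c where "c x = nrm \<Omega> (PP (p x) f)" for x
  define R where "R J \<omega> = f \<omega> - (\<Sum>x\<in>Q J. PP (p x) f \<omega>)" for J \<omega>
  have [simp]: "finite (Q J)" for J by (simp add: Q_def)
  have Qmono: "Q J \<subseteq> Q J'" if "J \<le> J'" for J J' using that by (auto simp: Q_def)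
  have R: "L2 \<Omega> (R J)" for J unfolding R_def[abs_def] using f by (intro L2_diff L2_sum L2_PP)
  have "(\<Sum>x\<in>Q J. c x) \<le> B" for J
    using bounded[of J] by (simp add: Q_def c_def p_def sum.cartesian_product case_prod_unfold)
  then have "norm (\<Sum>x\<in>Q J. c x) \<le> \<bar>B\<bar>" for J
    by (simp add: c_def sum_nonneg order_trans[OF _ abs_ge_self])
  moreover have "(\<Sum>x\<in>Q J. c x) \<le> (\<Sum>x\<in>Q J'. c x)" if "J \<le> J'" for J J'
    by (intro sum_mono2 Qmono that) (auto simp: c_def)
  ultimately have "convergent (\<lambda>J. \<Sum>x\<in>Q J. c x)"
    by (intro Bseq_mono_convergent BseqI'[of _ "\<bar>B\<bar>"]) auto
  then have "Cauchy (\<lambda>J. \<Sum>x\<in>Q J. c x)" by (rule convergent_Cauchy)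
  then obtain J where J: "\<And>J'. J' \<ge> J \<Longrightarrow> \<bar>(\<Sum>x\<in>Q J'. c x) - (\<Sum>x\<in>Q J. c x)\<bar> < \<epsilon> / 8"
    using \<open>0 < \<epsilon>\<close> unfolding Cauchy_iff by (metis order_refl real_norm_def zero_less_divide_iff zero_less_numeral)
  \<comment> \<open>The constant 4 of \<open>nrm_Mx_PP\<close> times
    \<open>card (Q J) * \<delta>\<close> is at most half of \<open>\<epsilon>\<close>; the tail
    bound \<open>\<epsilon> / 8\<close> fixed before pays for the other half in the same
    way.\<close>
  define \<delta> where "\<delta> = \<epsilon> / (8 * (real (card (Q J)) + 1))"
  have "0 < \<delta>" using \<open>0 < \<epsilon>\<close> by (auto simp: \<delta>_def intro!: divide_pos_pos add_nonneg_pos)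
  obtain u b F where u: "u \<in> borel_measurable \<Omega>" "\<And>\<omega>. \<bar>u \<omega>\<bar> \<le> b" "finite F" "dep F u"
      "nrm \<Omega> (\<lambda>\<omega>. f \<omega> - u \<omega>) < \<delta>"
    using L2_approx[OF f \<open>0 < \<delta>\<close>] by blast
  have lu: "L2 \<Omega> u" by (rule Om.L2_bounded[OF u(1,2)])
  obtain m where "F \<subseteq> box 0 m" using finite_subset_box[OF u(3)] by blast
  define g where "g \<omega> = (\<Sum>x\<in>Q J. PP (p x) u \<omega>)" for \<omega>
  have lg: "L2 \<Omega> g" unfolding g_def[abs_def] using lu by auto
  have "nice g"
    unfolding nice_def
  proof (intro exI conjI allI)
    show "finite (p ` Q J)" by simp
    show "u \<in> borel_measurable \<Omega>" "\<bar>u \<omega>\<bar> \<le> b" for \<omega> by (fact u)+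
    show "dep (box 0 m) u" by (rule dep_mono) fact+
    have "inj_on p (Q J)" by (auto simp: p_def inj_on_def)
    then show "g = (\<lambda>\<omega>. \<Sum>j\<in>p ` Q J. PP j u \<omega>)" by (simp add: g_def[abs_def] sum.reindex)
  qed
  \<comment> \<open>By telescoping, the projections add up to the conditional expectation at the
    origin, which is \<open>f\<close>, up to two edge terms and a corner term. The corner term is a
    further conditioning of the edge term \<open>?a\<close>, which therefore occurs twice.\<close>
  have Rlim: "(\<lambda>J. nrm \<Omega> (R J)) \<longlonglongrightarrow> 0"
  proof (rule real_tendsto_sandwich[OF always_eventually always_eventually tendsto_const])
    let ?a = "\<lambda>J. nrm \<Omega> (cexp (Gamma_set (- int J, 0)) f)" and ?b = "\<lambda>J. nrm \<Omega> (cexp (Gamma_set (0, - int J)) f)"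
    have "(\<lambda>J. ?a J + ?b J + ?a J) \<longlonglongrightarrow> 0 + 0 + 0" by (intro tendsto_add tail1 tail2)
    then show "(\<lambda>J. ?a J + ?b J + ?a J) \<longlonglongrightarrow> 0" by simp
    show "\<forall>J. 0 \<le> nrm \<Omega> (R J)" by simp
    show "\<forall>J. nrm \<Omega> (R J) \<le> ?a J + ?b J + ?a J"
    proof
      fix J
      let ?A = "cexp (Gamma_set (- int J, 0)) f" and ?B = "cexp (Gamma_set (0, - int J)) f"
        and ?C = "cexp (Gamma_set (- int J, - int J)) f"
      have suc: "- int (Suc i) = - int i - 1" for i by simp
      have "(\<Sum>x\<in>Q J. PP (p x) f \<omega>) = cexp (Gamma_set (0, 0)) f \<omega> - ?A \<omega> - ?B \<omega> + ?C \<omega>" for \<omega>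
        using double_telescope[of "\<lambda>i j. cexp (Gamma_set (- int i, - int j)) f \<omega>" J J]
        unfolding suc by (simp add: Q_def p_def sum.cartesian_product' PP_def)
      then have "AE \<omega> in \<Omega>. R J \<omega> = (?A \<omega> + ?B \<omega>) - ?C \<omega>"
        using adapted by (auto simp: R_def elim!: eventually_mono)
      then have "nrm \<Omega> (R J) = nrm \<Omega> (\<lambda>\<omega>. (?A \<omega> + ?B \<omega>) - ?C \<omega>)"
        by (intro nrm_cong_AE L2_meas[OF R] L2_meas[OF L2_diff[OF L2_add]] L2_cexp f)
      also have "\<dots> \<le> nrm \<Omega> (\<lambda>\<omega>. ?A \<omega> + ?B \<omega>) + nrm \<Omega> (\<lambda>\<omega>. - ?C \<omega>)"
        using nrm_triangle[of \<Omega> "\<lambda>\<omega>. ?A \<omega> + ?B \<omega>" "\<lambda>\<omega>. - ?C \<omega>"] f by (auto simp: L2_add L2_minus L2_cexp)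
      also have "nrm \<Omega> (\<lambda>\<omega>. ?A \<omega> + ?B \<omega>) \<le> nrm \<Omega> ?A + nrm \<Omega> ?B"
        by (intro nrm_triangle L2_cexp f)
      also have "nrm \<Omega> (\<lambda>\<omega>. - ?C \<omega>) = nrm \<Omega> ?C" by (simp add: nrm_def)
      also have "\<dots> = nrm \<Omega> (cexp (Gamma_set (0, - int J)) ?A)"
      proof (rule nrm_cong_AE)
        show "AE \<omega> in \<Omega>. ?C \<omega> = cexp (Gamma_set (0, - int J)) ?A \<omega>"
          using cexp_cexp[OF f, of "Gamma_set (0, - int J)" "Gamma_set (- int J, 0)"]
          unfolding Gamma_set_Int by eventually_elim simp
      qed (intro L2_meas L2_cexp f)+
      also have "\<dots> \<le> nrm \<Omega> ?A" by (intro nrm_cexp_le L2_cexp f)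
      finally show "nrm \<Omega> (R J) \<le> nrm \<Omega> ?A + nrm \<Omega> ?B + nrm \<Omega> ?A" by simp
    qed
  qed
  have main: "nrm \<Omega> (Mx (\<lambda>\<omega>. f \<omega> - g \<omega>) n1 n2) \<le> \<epsilon> * sqrt (real (n1 * n2)) + real (n1 * n2) * nrm \<Omega> (R J')"
    if "J \<le> J'" for J' n1 n2
  proof -
    let ?s = "sqrt (real (n1 * n2))"
    let ?h1 = "\<lambda>\<omega>. \<Sum>x\<in>Q J. PP (p x) f \<omega> - PP (p x) u \<omega>" and ?h2 = "\<lambda>\<omega>. \<Sum>x\<in>Q J' - Q J. PP (p x) f \<omega>"
    have l12: "L2 \<Omega> (\<lambda>\<omega>. PP (p x) f \<omega> - PP (p x) u \<omega>)" "L2 \<Omega> (PP (p x) f)" for x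
      using f lu by auto
    have l: "L2 \<Omega> ?h1" "L2 \<Omega> ?h2" using l12 by auto
    have "f \<omega> - g \<omega> = (?h1 \<omega> + ?h2 \<omega>) + R J' \<omega>" for \<omega>
      using sum.subset_diff[OF Qmono[OF that], of "\<lambda>x. PP (p x) f \<omega>"]
      by (simp add: R_def g_def sum_subtractf)
    then have "Mx (\<lambda>\<omega>. f \<omega> - g \<omega>) n1 n2 \<omega> \<le> (Mx ?h1 n1 n2 \<omega> + Mx ?h2 n1 n2 \<omega>) + Mx (R J') n1 n2 \<omega>" for \<omega>
      using Mx_add_le[of "\<lambda>\<omega>. ?h1 \<omega> + ?h2 \<omega>" "R J'" n1 n2 \<omega>] Mx_add_le[of ?h1 ?h2 n1 n2 \<omega>] by simp
    then have "nrm \<Omega> (Mx (\<lambda>\<omega>. f \<omega> - g \<omega>) n1 n2) \<le> nrm \<Omega> (\<lambda>\<omega>. (Mx ?h1 n1 n2 \<omega> + Mx ?h2 n1 n2 \<omega>) + Mx (R J') n1 n2 \<omega>)"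
      by (intro nrm_mono L2_meas[OF L2_Mx] L2_add L2_Mx L2_diff l R f lg AE_I2) simp
    also have "\<dots> \<le> nrm \<Omega> (\<lambda>\<omega>. Mx ?h1 n1 n2 \<omega> + Mx ?h2 n1 n2 \<omega>) + nrm \<Omega> (Mx (R J') n1 n2)"
      by (intro nrm_triangle L2_add L2_Mx l R)
    also have "nrm \<Omega> (\<lambda>\<omega>. Mx ?h1 n1 n2 \<omega> + Mx ?h2 n1 n2 \<omega>) \<le> nrm \<Omega> (Mx ?h1 n1 n2) + nrm \<Omega> (Mx ?h2 n1 n2)"
      by (intro nrm_triangle L2_Mx l)
    also have "nrm \<Omega> (Mx ?h1 n1 n2) \<le> \<epsilon> / 2 * ?s"
    proof -
      have "nrm \<Omega> (Mx ?h1 n1 n2) \<le> nrm \<Omega> (\<lambda>\<omega>. \<Sum>x\<in>Q J. Mx (\<lambda>\<omega>. PP (p x) f \<omega> - PP (p x) u \<omega>) n1 n2 \<omega>)"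
        by (intro nrm_mono L2_meas[OF L2_Mx] L2_sum L2_Mx l l12 AE_I2)
          (auto intro: order_trans[OF Mx_sum_le abs_ge_self])
      also have "\<dots> \<le> (\<Sum>x\<in>Q J. nrm \<Omega> (Mx (\<lambda>\<omega>. PP (p x) f \<omega> - PP (p x) u \<omega>) n1 n2))"
        by (intro nrm_sum L2_Mx l12) simp
      also have "\<dots> \<le> (\<Sum>x\<in>Q J. 4 * ?s * \<delta>)"
      proof (rule sum_mono)
        fix x
        have "nrm \<Omega> (Mx (\<lambda>\<omega>. PP (p x) f \<omega> - PP (p x) u \<omega>) n1 n2) = nrm \<Omega> (Mx (PP (p x) (\<lambda>\<omega>. f \<omega> - u \<omega>)) n1 n2)"
          using PP_diff[OF f lu, of "p x"]
          by (intro nrm_Mx_cong l12 L2_PP L2_diff f lu) (auto elim!: eventually_mono)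
        also have "\<dots> \<le> 4 * ?s * nrm \<Omega> (PP (p x) (\<lambda>\<omega>. f \<omega> - u \<omega>))"
          by (rule nrm_Mx_PP[OF L2_diff[OF f lu]])
        also have "\<dots> \<le> 4 * ?s * \<delta>"
          using nrm_PP_le[OF L2_diff[OF f lu], of "p x"] u(5) by (intro mult_left_mono) auto
        finally show "nrm \<Omega> (Mx (\<lambda>\<omega>. PP (p x) f \<omega> - PP (p x) u \<omega>) n1 n2) \<le> 4 * ?s * \<delta>" .
      qed
      also have "\<dots> = (4 * real (card (Q J)) * \<delta>) * ?s" by simp
      also have "\<dots> \<le> \<epsilon> / 2 * ?s"
        using \<open>0 < \<epsilon>\<close> by (intro mult_right_mono) (auto simp: \<delta>_def field_simps)
      finally show ?thesis .
    qed
    also have "nrm \<Omega> (Mx ?h2 n1 n2) \<le> \<epsilon> / 2 * ?s"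
    proof -
      have "nrm \<Omega> (Mx ?h2 n1 n2) \<le> nrm \<Omega> (\<lambda>\<omega>. \<Sum>x\<in>Q J' - Q J. Mx (PP (p x) f) n1 n2 \<omega>)"
        by (intro nrm_mono L2_meas[OF L2_Mx] L2_sum L2_Mx l l12 AE_I2)
          (auto intro: order_trans[OF Mx_sum_le abs_ge_self])
      also have "\<dots> \<le> (\<Sum>x\<in>Q J' - Q J. nrm \<Omega> (Mx (PP (p x) f) n1 n2))"
        by (intro nrm_sum L2_Mx l12) simp
      also have "\<dots> \<le> (\<Sum>x\<in>Q J' - Q J. 4 * ?s * c x)"
        unfolding c_def by (intro sum_mono nrm_Mx_PP f)
      also have "\<dots> = 4 * ?s * ((\<Sum>x\<in>Q J'. c x) - (\<Sum>x\<in>Q J. c x))"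
        using sum.subset_diff[OF Qmono[OF that], of c] by (simp add: sum_distrib_left[symmetric])
      also have "\<dots> \<le> 4 * ?s * (\<epsilon> / 8)"
      proof (rule mult_left_mono)
        show "(\<Sum>x\<in>Q J'. c x) - (\<Sum>x\<in>Q J. c x) \<le> \<epsilon> / 8" using J[OF that] by linarith
      qed simp
      finally show ?thesis by simp
    qed
    also have "nrm \<Omega> (Mx (R J') n1 n2) \<le> real (n1 * n2) * nrm \<Omega> (R J')"
      by (rule nrm_Mx_crude[OF R])
    finally show ?thesis by (simp add: algebra_simps)
  qed
  have "nrm \<Omega> (Mx (\<lambda>\<omega>. f \<omega> - g \<omega>) n1 n2) \<le> \<epsilon> * sqrt (real (n1 * n2))" for n1 n2
  proof (rule LIMSEQ_le_const)
    have "(\<lambda>J. \<epsilon> * sqrt (real (n1 * n2)) + real (n1 * n2) * nrm \<Omega> (R J)) \<longlonglongrightarrow> \<epsilon> * sqrt (real (n1 * n2)) + real (n1 * n2) * 0"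
      by (intro tendsto_intros Rlim)
    then show "(\<lambda>J. \<epsilon> * sqrt (real (n1 * n2)) + real (n1 * n2) * nrm \<Omega> (R J)) \<longlonglongrightarrow> \<epsilon> * sqrt (real (n1 * n2))"
      by simp
    show "\<exists>N. \<forall>J'\<ge>N. nrm \<Omega> (Mx (\<lambda>\<omega>. f \<omega> - g \<omega>) n1 n2) \<le> \<epsilon> * sqrt (real (n1 * n2)) + real (n1 * n2) * nrm \<Omega> (R J')"
      using main by blast
  qed
  with \<open>nice g\<close> show thesis by (rule that)
qed

end

section \<open>Weights of the smoothed sums\<close>

definition cl :: "real \<Rightarrow> real" where
  "cl x = max 0 (min 1 x)"

text \<open>For \<open>t\<close> in \<open>[0, 1]\<close> the length of the part of the cell
  \<open>(k - 1, k]\<close> covered by \<open>[0, n * t]\<close>. The value 0 outside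
  \<open>1..n\<close> lets products with a translated index \<open>k + d\<close> be summed without
  boundary cases.\<close>

definition wt :: "nat \<Rightarrow> real \<Rightarrow> int \<Rightarrow> real" where
  "wt n t k = (if 1 \<le> k \<and> k \<le> int n then cl (real n * t - real_of_int k + 1) else 0)"

lemma wt_nonneg: "0 \<le> wt n t k" and wt_le_1: "wt n t k \<le> 1"
  by (auto simp: wt_def cl_def)

lemma wt_1: "1 \<le> k \<Longrightarrow> k \<le> int n \<Longrightarrow> wt n 1 k = 1"
  by (auto simp: wt_def cl_def)

lemma wt_outside: "k \<notin> {1..int n} \<Longrightarrow> wt n t k = 0"
  by (auto simp: wt_def)

text \<open>Each factor is the indicator of an initial segment, up to one fractional cell. The
  product can be nonzero only up to about \<open>N\<close>, so the sum counts \<open>N\<close>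
  sites, with an error due to the shift by \<open>d\<close> and to the fractional cells.\<close>

lemma wt_convolution_bound:
  assumes "0 \<le> s" "s \<le> 1" "0 \<le> t" "t \<le> 1"
  shows "\<bar>(\<Sum>k\<in>{1..int n}. wt n s k * wt n t (k + d)) - real n * min s t\<bar> \<le> 2 * \<bar>real_of_int d\<bar> + 2"
proof -
  let ?p = "\<lambda>k. wt n s k * wt n t (k + d)"
  define N where "N = min (real n * s) (real n * t - real_of_int d)"
  define e where "e = \<bar>real_of_int d\<bar>"
  have ns: "real n * s \<le> real n" "real n * t \<le> real n"
    using assms by (auto intro: mult_left_le)
  have mn: "real n * min s t = min (real n * s) (real n * t)"
    by (simp add: min_mult_distrib_left)
  have m0: "0 \<le> real n * min s t" using assms by simp
  have N1: "real n * min s t - e \<le> N" and N2: "N \<le> real n * min s t + e"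
    unfolding mn N_def e_def by linarith+
  have p01: "0 \<le> ?p k" "?p k \<le> 1" for k
    using wt_nonneg[of n s k] wt_nonneg[of n t "k + d"] wt_le_1[of n s k] wt_le_1[of n t "k + d"]
    by (auto intro: mult_le_one)
  have "real n * min s t - 2 * e - 1 \<le> (\<Sum>k\<in>{1..int n}. ?p k)"
  proof -
    \<comment> \<open>Here the cells \<open>k\<close> and \<open>k + d\<close> both lie in the
      rectangle and are fully covered, so the product is 1.\<close>
    let ?I = "{max 1 (1 - d)..\<lfloor>N\<rfloor>}"
    have "real (card ?I) \<ge> real_of_int (\<lfloor>N\<rfloor> - max 1 (1 - d) + 1)" by simp
    moreover have "real_of_int (max 1 (1 - d)) \<le> 1 + e" unfolding e_def by auto
    moreover have "N < real_of_int \<lfloor>N\<rfloor> + 1" by linarith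
    ultimately have "real n * min s t - 2 * e - 1 \<le> real (card ?I)" using N1 by linarith
    also have "\<dots> = (\<Sum>k\<in>?I. 1)" by simp
    also have "\<dots> = (\<Sum>k\<in>?I. ?p k)"
    proof (rule sum.cong[OF refl])
      fix k assume k: "k \<in> ?I"
      then have "real_of_int k \<le> N" by (simp add: le_floor_iff)
      then have "real_of_int k \<le> real n * s" "real_of_int (k + d) \<le> real n * t" by (auto simp: N_def)
      moreover from this have "k \<le> int n" "k + d \<le> int n" using ns by linarith+
      ultimately show "1 = ?p k" using k by (auto simp: wt_def cl_def)
    qed
    also have "\<dots> \<le> (\<Sum>k\<in>{1..int n}. ?p k)"
    proof (rule sum_mono2)
      show "?I \<subseteq> {1..int n}"
      proof
        fix k assume k: "k \<in> ?I"
        then have "real_of_int k \<le> N" by (simp add: le_floor_iff)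
        then have "real_of_int k \<le> real n" using ns by (auto simp: N_def)
        then show "k \<in> {1..int n}" using k by auto
      qed
    qed (use p01 in auto)
    finally show ?thesis .
  qed
  moreover have "(\<Sum>k\<in>{1..int n}. ?p k) \<le> real n * min s t + e + 1"
  proof -
    \<comment> \<open>Beyond \<open>N + 1\<close> one of the two cells is not covered at all, so the
      product is 0.\<close>
    let ?I = "{1..\<lfloor>N + 1\<rfloor>}"
    have "(\<Sum>k\<in>{1..int n}. ?p k) \<le> (\<Sum>k\<in>{1..int n}. if k \<in> ?I then 1 else 0)"
    proof (rule sum_mono)
      fix k assume k: "k \<in> {1..int n}"
      have "?p k = 0" if "k \<notin> ?I"
      proof -
        have "\<lfloor>N\<rfloor> + 1 < k" using that k by simp
        then have "N + 1 < real_of_int k" by linarith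
        then show ?thesis using k by (auto simp: N_def wt_def cl_def min_def split: if_splits)
      qed
      then show "?p k \<le> (if k \<in> ?I then 1 else 0)" using p01[of k] by auto
    qed
    also have "\<dots> = (\<Sum>k\<in>{1..int n} \<inter> ?I. 1)"
      by (rule sum.inter_restrict[symmetric]) simp
    also have "\<dots> = real (card ({1..int n} \<inter> ?I))" by simp
    also have "\<dots> \<le> real (card ?I)" by (simp add: card_mono)
    also have "\<dots> \<le> real n * min s t + e + 1"
    proof (cases "\<lfloor>N + 1\<rfloor> \<ge> 0")
      case True
      then have "real (card ?I) = real_of_int \<lfloor>N + 1\<rfloor>" by simp
      also have "\<dots> \<le> N + 1" by linarith
      finally show ?thesis using N2 by linarith
    next
      case False
      then show ?thesis using m0 by (simp add: e_def)
    qed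
    finally show ?thesis .
  qed
  ultimately show ?thesis unfolding e_def by linarith
qed

lemma wt_convolution_limit:
  assumes "0 \<le> s" "s \<le> 1" "0 \<le> t" "t \<le> 1" "filterlim m at_top sequentially"
  shows "(\<lambda>n. (\<Sum>k\<in>{1..int (m n)}. wt (m n) s k * wt (m n) t (k + d)) / real (m n)) \<longlonglongrightarrow> min s t"
proof (rule LIM_zero_cancel, rule Lim_null_comparison)
  have r: "filterlim (\<lambda>n. real (m n)) at_top sequentially"
    using filterlim_compose[OF filterlim_real_sequentially assms(5)] .
  show "(\<lambda>n. (2 * \<bar>real_of_int d\<bar> + 2) / real (m n)) \<longlonglongrightarrow> 0"
    by (rule real_tendsto_divide_at_top[OF tendsto_const r])
  have "\<forall>\<^sub>F n in sequentially. 0 < real (m n)"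
    using r unfolding filterlim_at_top_dense by blast
  then show "\<forall>\<^sub>F n in sequentially. norm ((\<Sum>k\<in>{1..int (m n)}. wt (m n) s k * wt (m n) t (k + d)) / real (m n) - min s t)
      \<le> (2 * \<bar>real_of_int d\<bar> + 2) / real (m n)"
  proof eventually_elim
    case (elim n)
    let ?S = "\<Sum>k\<in>{1..int (m n)}. wt (m n) s k * wt (m n) t (k + d)"
    have "?S / real (m n) - min s t = (?S - real (m n) * min s t) / real (m n)"
      using elim by (simp add: field_simps)
    then have "norm (?S / real (m n) - min s t) = \<bar>?S - real (m n) * min s t\<bar> / real (m n)"
      using elim by (simp add: abs_divide)
    also have "\<dots> \<le> (2 * \<bar>real_of_int d\<bar> + 2) / real (m n)"
      using wt_convolution_bound[OF assms(1-4), of "m n" d] by (intro divide_right_mono) auto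
    finally show ?case .
  qed
qed

definition sheet_cov :: "real \<times> real \<Rightarrow> real \<times> real \<Rightarrow> real" where
  "sheet_cov s t = min (fst s) (fst t) * min (snd s) (snd t)"

context iid_field begin

section \<open>Gaussian limits for weighted sums\<close>

text \<open>\<open>B_rect\<close> as a finite sum; the two agree for \<open>t\<close> in the unit
  square by \<open>B_rect_eq_Bsum\<close>.\<close>

definition Bsum :: "((int \<times> int \<Rightarrow> real) \<Rightarrow> real) \<Rightarrow> nat \<Rightarrow> nat \<Rightarrow> real \<times> real \<Rightarrow> (int \<times> int \<Rightarrow> real) \<Rightarrow> real" where
  "Bsum g n1 n2 t \<omega> = (\<Sum>k\<in>{1..int n1} \<times> {1..int n2}. wt n1 (fst t) (fst k) * wt n2 (snd t) (snd k) * g (shift k \<omega>))"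

lemma Bsum_measurable [measurable]:
  assumes [measurable]: "g \<in> borel_measurable \<Omega>"
  shows "Bsum g n1 n2 t \<in> borel_measurable \<Omega>"
  unfolding Bsum_def[abs_def] by measurable

lemma Bsum_1: "Bsum g n1 n2 (1, 1) \<omega> = S_rect g n1 n2 \<omega>"
  unfolding Bsum_def S_rect_def by (rule sum.cong) (auto simp: wt_1)

definition lincomb ::
  "((int \<times> int \<Rightarrow> real) \<Rightarrow> real) \<Rightarrow> nat \<Rightarrow> nat \<Rightarrow> (real \<times> real) set \<Rightarrow> (real \<times> real \<Rightarrow> real) \<Rightarrow> (int \<times> int \<Rightarrow> real) \<Rightarrow> real" where
  "lincomb g n1 n2 F c \<omega> = (\<Sum>t\<in>F. c t * Bsum g n1 n2 t \<omega>) / sqrt (real (n1 * n2))"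

text \<open>Covariances of translates vanish beyond distance \<open>2 * \<rho>\<close>, so the
  square of \<open>\<sigma>\<close> is the finite sum of all covariances and does not depend on the
  rectangles, \<open>F\<close> or \<open>c\<close>. The phase \<open>\<alpha>\<close> lets real
  cosines carry both parts of the characteristic function.\<close>

theorem nice_clt:
  assumes "nice g"
  obtains \<sigma> where "0 \<le> \<sigma>"
    "\<And>m1 m2 F c. filterlim m1 at_top sequentially \<Longrightarrow> filterlim m2 at_top sequentially \<Longrightarrow>
       finite F \<Longrightarrow> F \<subseteq> unit_square \<Longrightarrow>
       (\<lambda>n. \<integral>\<omega>. (lincomb g (m1 n) (m2 n) F c \<omega>)\<^sup>2 \<partial>\<Omega>) \<longlonglongrightarrow> \<sigma>\<^sup>2 * (\<Sum>s\<in>F. \<Sum>t\<in>F. c s * c t * sheet_cov s t)"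
    "\<And>m1 m2 F c \<alpha>. filterlim m1 at_top sequentially \<Longrightarrow> filterlim m2 at_top sequentially \<Longrightarrow>
       finite F \<Longrightarrow> F \<subseteq> unit_square \<Longrightarrow>
       (\<lambda>n. \<integral>\<omega>. cos (lincomb g (m1 n) (m2 n) F c \<omega> + \<alpha>) \<partial>\<Omega>)
         \<longlonglongrightarrow> cos \<alpha> * exp (- (\<sigma>\<^sup>2 * (\<Sum>s\<in>F. \<Sum>t\<in>F. c s * c t * sheet_cov s t)) / 2)"
proof -
  obtain b \<rho> where g: "g \<in> borel_measurable \<Omega>" "\<And>\<omega>. \<bar>g \<omega>\<bar> \<le> b" "0 \<le> b" "dep (box 0 \<rho>) g" "(\<integral>\<omega>. g \<omega> \<partial>\<Omega>) = 0"
    using nice_props[OF assms] by blast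
  have l2: "L2 \<Omega> g" by (rule Om.L2_bounded[OF g(1,2)])
  define r where "r d = (\<integral>\<omega>. g \<omega> * g (shift d \<omega>) \<partial>\<Omega>)" for d
  have r0: "r d = 0" if "d \<notin> box 0 (2 * \<rho>)" for d
  proof -
    have "dep (box d \<rho>) (\<lambda>\<omega>. g (shift d \<omega>))"
      using dep_shift[OF g(4), of d] by (simp add: box_shift)
    moreover have "box 0 \<rho> \<inter> box d \<rho> = {}"
      using box_disjoint[of d 0 \<rho> \<rho>] that by (simp add: mult_2)
    ultimately show ?thesis
      unfolding r_def using integral_indep[OF l2 L2_shift[OF l2] g(4)] g(5) by simp
  qed
  have cov: "(\<integral>\<omega>. g (shift k \<omega>) * g (shift l \<omega>) \<partial>\<Omega>) = r (l - k)" for k l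
    using integral_shift[of "\<lambda>\<omega>. g \<omega> * g (shift (l - k) \<omega>)" k] g(1)
    by (simp add: r_def shift_shift)
  define v where "v = (\<Sum>d\<in>box 0 (2 * \<rho>). r d)"
  define W where "W n1 n2 F c k = (\<Sum>t\<in>F. c t * (wt n1 (fst t) (fst k) * wt n2 (snd t) (snd k)))"
    for n1 n2 F c and k :: "int \<times> int"
  define V where "V n1 n2 = {1..int n1} \<times> {1..int n2}" for n1 n2
  have W0: "W n1 n2 F c k = 0" if "k \<notin> V n1 n2" for n1 n2 F c k
  proof -
    have "fst k \<notin> {1..int n1} \<or> snd k \<notin> {1..int n2}" using that by (cases k) (auto simp: V_def)
    then show ?thesis unfolding W_def by (auto intro!: sum.neutral simp: wt_outside)
  qed
  have lin: "lincomb g n1 n2 F c \<omega> = (\<Sum>k\<in>V n1 n2. W n1 n2 F c k / sqrt (real (n1 * n2)) * g (shift k \<omega>))"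
    for n1 n2 F c \<omega>
  proof -
    have "(\<Sum>t\<in>F. c t * Bsum g n1 n2 t \<omega>) = (\<Sum>k\<in>V n1 n2. W n1 n2 F c k * g (shift k \<omega>))"
      unfolding Bsum_def W_def V_def sum_distrib_left sum_distrib_right
      by (subst sum.swap) (simp add: mult_ac)
    then show ?thesis by (simp add: lincomb_def sum_divide_distrib)
  qed
  have var: "(\<integral>\<omega>. (lincomb g n1 n2 F c \<omega>)\<^sup>2 \<partial>\<Omega>) = (\<Sum>d\<in>box 0 (2 * \<rho>). r d * (\<Sum>s\<in>F. \<Sum>t\<in>F. c s * c t *
      (((\<Sum>k\<in>{1..int n1}. wt n1 (fst s) k * wt n1 (fst t) (k + fst d)) / real n1) *
       ((\<Sum>k\<in>{1..int n2}. wt n2 (snd s) k * wt n2 (snd t) (k + snd d)) / real n2))))" for n1 n2 F c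
  proof -
    let ?W = "W n1 n2 F c" and ?V = "V n1 n2"
    have i: "integrable \<Omega> (\<lambda>\<omega>. g (shift k \<omega>) * g (shift l \<omega>))" for k l
      by (intro L2_mult_integrable L2_shift l2)
    have "(\<integral>\<omega>. (\<Sum>k\<in>?V. ?W k * g (shift k \<omega>))\<^sup>2 \<partial>\<Omega>)
       = (\<integral>\<omega>. (\<Sum>k\<in>?V. \<Sum>l\<in>?V. (?W k * ?W l) * (g (shift k \<omega>) * g (shift l \<omega>))) \<partial>\<Omega>)"
      by (simp add: power2_eq_square sum_product mult_ac)
    also have "\<dots> = (\<Sum>k\<in>?V. \<Sum>l\<in>?V. (?W k * ?W l) * r (l - k))"
      using i by (simp add: cov)
    \<comment> \<open>Pairs are ordered by their difference \<open>d\<close>. Pairs too far apart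
      have covariance 0, and sites \<open>k + d\<close> outside the rectangle have weight 0.\<close>
    also have "\<dots> = (\<Sum>k\<in>?V. \<Sum>d\<in>box 0 (2 * \<rho>). ?W k * ?W (k + d) * r d)"
    proof (rule sum.cong[OF refl])
      fix k assume "k \<in> ?V"
      have "(\<Sum>l\<in>?V. (?W k * ?W l) * r (l - k)) = (\<Sum>l\<in>?V \<inter> box k (2 * \<rho>). (?W k * ?W l) * r (l - k))"
      proof (rule sum.mono_neutral_right)
        show "\<forall>l\<in>?V - ?V \<inter> box k (2 * \<rho>). (?W k * ?W l) * r (l - k) = 0"
        proof
          fix l assume l: "l \<in> ?V - ?V \<inter> box k (2 * \<rho>)"
          then have "l - k \<notin> box 0 (2 * \<rho>)" by (cases l; cases k) (auto simp: box_def)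
          then show "(?W k * ?W l) * r (l - k) = 0" by (simp add: r0)
        qed
      qed (auto simp: V_def)
      also have "\<dots> = (\<Sum>l\<in>box k (2 * \<rho>). (?W k * ?W l) * r (l - k))"
      proof (rule sum.mono_neutral_left)
        show "\<forall>l\<in>box k (2 * \<rho>) - ?V \<inter> box k (2 * \<rho>). (?W k * ?W l) * r (l - k) = 0"
        proof
          fix l assume "l \<in> box k (2 * \<rho>) - ?V \<inter> box k (2 * \<rho>)"
          then have "l \<notin> ?V" by auto
          then show "(?W k * ?W l) * r (l - k) = 0" by (simp add: W0)
        qed
      qed auto
      also have "\<dots> = (\<Sum>d\<in>box 0 (2 * \<rho>). (?W k * ?W (k + d)) * r d)"
        by (rule sum.reindex_bij_witness[of _ "\<lambda>d. k + d" "\<lambda>l. l - k"])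
          (cases k; auto simp: box_def)+
      finally show "(\<Sum>l\<in>?V. (?W k * ?W l) * r (l - k)) = (\<Sum>d\<in>box 0 (2 * \<rho>). ?W k * ?W (k + d) * r d)" .
    qed
    also have "\<dots> = (\<Sum>d\<in>box 0 (2 * \<rho>). r d * (\<Sum>k\<in>?V. ?W k * ?W (k + d)))"
      by (subst sum.swap) (simp add: sum_distrib_left mult_ac)
    finally have e1: "(\<integral>\<omega>. (\<Sum>k\<in>?V. ?W k * g (shift k \<omega>))\<^sup>2 \<partial>\<Omega>) = (\<Sum>d\<in>box 0 (2 * \<rho>). r d * (\<Sum>k\<in>?V. ?W k * ?W (k + d)))" .
    have e2: "(\<Sum>k\<in>?V. ?W k * ?W (k + d)) = (\<Sum>s\<in>F. \<Sum>t\<in>F. c s * c t *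
       ((\<Sum>k\<in>{1..int n1}. wt n1 (fst s) k * wt n1 (fst t) (k + fst d)) *
        (\<Sum>k\<in>{1..int n2}. wt n2 (snd s) k * wt n2 (snd t) (k + snd d))))" for d
    proof -
      have "(\<Sum>k\<in>?V. ?W k * ?W (k + d)) = (\<Sum>k\<in>?V. \<Sum>s\<in>F. \<Sum>t\<in>F. c s * c t *
         ((wt n1 (fst s) (fst k) * wt n1 (fst t) (fst k + fst d)) * (wt n2 (snd s) (snd k) * wt n2 (snd t) (snd k + snd d))))"
        unfolding W_def sum_product by (simp add: mult_ac)
      also have "\<dots> = (\<Sum>s\<in>F. \<Sum>t\<in>F. \<Sum>k\<in>?V. c s * c t *
         ((wt n1 (fst s) (fst k) * wt n1 (fst t) (fst k + fst d)) * (wt n2 (snd s) (snd k) * wt n2 (snd t) (snd k + snd d))))"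
        by (subst sum.swap, rule sum.cong[OF refl], rule sum.swap)
      also have "\<dots> = (\<Sum>s\<in>F. \<Sum>t\<in>F. c s * c t *
       ((\<Sum>k\<in>{1..int n1}. wt n1 (fst s) k * wt n1 (fst t) (k + fst d)) *
        (\<Sum>k\<in>{1..int n2}. wt n2 (snd s) k * wt n2 (snd t) (k + snd d))))"
        unfolding sum_product V_def sum.cartesian_product'[symmetric] by (simp add: sum_distrib_left sum.cartesian_product')
      finally show ?thesis .
    qed
    have "(\<integral>\<omega>. (lincomb g n1 n2 F c \<omega>)\<^sup>2 \<partial>\<Omega>) = (\<integral>\<omega>. (\<Sum>k\<in>?V. ?W k * g (shift k \<omega>))\<^sup>2 / real (n1 * n2) \<partial>\<Omega>)"
      unfolding lin by (simp add: sum_divide_distrib[symmetric] power_divide)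
    also have "\<dots> = (\<Sum>d\<in>box 0 (2 * \<rho>). r d * (\<Sum>k\<in>?V. ?W k * ?W (k + d))) / real (n1 * n2)"
      using e1 by simp
    finally show ?thesis
      unfolding e2 times_divide_times_eq
      by (simp only: of_nat_mult times_divide_eq_right sum_divide_distrib[symmetric])
  qed
  have lim_var: "(\<lambda>n. \<integral>\<omega>. (lincomb g (m1 n) (m2 n) F c \<omega>)\<^sup>2 \<partial>\<Omega>) \<longlonglongrightarrow> v * (\<Sum>s\<in>F. \<Sum>t\<in>F. c s * c t * sheet_cov s t)"
    if m: "filterlim m1 at_top sequentially" "filterlim m2 at_top sequentially" and F: "F \<subseteq> unit_square" for m1 m2 F c
  proof -
    have "(\<lambda>n. (\<Sum>d\<in>box 0 (2 * \<rho>). r d * (\<Sum>s\<in>F. \<Sum>t\<in>F. c s * c t *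
      (((\<Sum>k\<in>{1..int (m1 n)}. wt (m1 n) (fst s) k * wt (m1 n) (fst t) (k + fst d)) / real (m1 n)) *
       ((\<Sum>k\<in>{1..int (m2 n)}. wt (m2 n) (snd s) k * wt (m2 n) (snd t) (k + snd d)) / real (m2 n))))))
      \<longlonglongrightarrow> (\<Sum>d\<in>box 0 (2 * \<rho>). r d * (\<Sum>s\<in>F. \<Sum>t\<in>F. c s * c t * (min (fst s) (fst t) * min (snd s) (snd t))))"
      by (intro tendsto_sum tendsto_mult tendsto_const wt_convolution_limit m)
        (use F in \<open>auto simp: unit_square_def\<close>)
    then show ?thesis unfolding var v_def sheet_cov_def by (simp add: sum_distrib_right)
  qed
  \<comment> \<open>\<open>v\<close> is itself a limit of second moments, those of the normalized
    full sums over squares.\<close>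
  have "0 \<le> v"
  proof (rule LIMSEQ_le_const)
    show "(\<lambda>n. \<integral>\<omega>. (lincomb g n n {(1, 1)} (\<lambda>_. 1) \<omega>)\<^sup>2 \<partial>\<Omega>) \<longlonglongrightarrow> v"
      using lim_var[of "\<lambda>n. n" "\<lambda>n. n" "{(1, 1)}" "\<lambda>_. 1"]
      by (simp add: unit_square_def sheet_cov_def filterlim_ident)
  qed auto
  have lim_cos: "(\<lambda>n. \<integral>\<omega>. cos (lincomb g (m1 n) (m2 n) F c \<omega> + \<alpha>) \<partial>\<Omega>)
         \<longlonglongrightarrow> cos \<alpha> * exp (- (v * (\<Sum>s\<in>F. \<Sum>t\<in>F. c s * c t * sheet_cov s t)) / 2)"
    if m: "filterlim m1 at_top sequentially" "filterlim m2 at_top sequentially" and F: "finite F" "F \<subseteq> unit_square"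
    for m1 m2 F c \<alpha>
  proof -
    define w where "w = (\<Sum>t\<in>F. \<bar>c t\<bar>)"
    define D where "D = real ((4 * \<rho> + 1)\<^sup>2)"
    define E where "E = (12 * real \<rho> + 1) * 2 * D * (w * b)\<^sup>2 + (w * b)^3 * D\<^sup>2 / 2"
    have w: "0 \<le> w" by (simp add: w_def sum_nonneg)
    have Wb: "\<bar>W n1 n2 F c k\<bar> \<le> w" for n1 n2 k
    proof -
      have "\<bar>W n1 n2 F c k\<bar> \<le> (\<Sum>t\<in>F. \<bar>c t * (wt n1 (fst t) (fst k) * wt n2 (snd t) (snd k))\<bar>)"
        unfolding W_def by (rule sum_abs)
      also have "\<dots> \<le> (\<Sum>t\<in>F. \<bar>c t\<bar> * 1)"
      proof (rule sum_mono)
        fix t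
        have "wt n1 (fst t) (fst k) * wt n2 (snd t) (snd k) \<le> 1"
          by (intro mult_le_one wt_le_1 wt_nonneg)
        then show "\<bar>c t * (wt n1 (fst t) (fst k) * wt n2 (snd t) (snd k))\<bar> \<le> \<bar>c t\<bar> * 1"
          unfolding abs_mult by (intro mult_left_mono) (auto simp: wt_nonneg abs_mult)
      qed
      finally show ?thesis by (simp add: w_def)
    qed
    have err: "\<bar>(\<integral>\<omega>. cos (lincomb g n1 n2 F c \<omega> + \<alpha>) \<partial>\<Omega>)
       - cos \<alpha> * exp (- (\<integral>\<omega>. (lincomb g n1 n2 F c \<omega>)\<^sup>2 \<partial>\<Omega>) / 2)\<bar> \<le> E / sqrt (real (n1 * n2))"
      if N: "0 < n1 * n2" for n1 n2
    proof -
      let ?N = "real (n1 * n2)"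
      have "\<bar>W n1 n2 F c k / sqrt ?N\<bar> \<le> w / sqrt ?N" for k
        using Wb[of n1 n2 k] by (simp add: abs_divide divide_right_mono)
      from local_dep_weighted[OF g(1,2,4,5) _ this, of "V n1 n2"]
      interpret X: local_dep P "V n1 n2" "\<lambda>k \<omega>. W n1 n2 F c k / sqrt ?N * g (shift k \<omega>)" "w / sqrt ?N * b" \<rho>
        using w by (simp add: V_def)
      have s: "X.s = lincomb g n1 n2 F c"
        unfolding X.s_def[abs_def] lin by simp
      have n: "X.n = ?N" by (simp only: X.n_def) (simp add: V_def card_cartesian_product)
      have N': "0 < sqrt ?N" using N by simp
      have q: "?N = sqrt ?N * sqrt ?N" by simp
      \<comment> \<open>With \<open>?N\<close> summands bounded by \<open>w * b / sqrt ?N\<close>,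
        both terms of the error scale as \<open>1 / sqrt ?N\<close>.\<close>
      have "X.clt_error = E / sqrt ?N"
      proof -
        define q where "q = sqrt ?N"
        have q: "?N = q * q" "0 < q" using N' by (auto simp: q_def)
        have "X.clt_error = (12 * real \<rho> + 1) * 2 * D * (w / q * b)\<^sup>2 * q + q * q * (w / q * b)^3 * D\<^sup>2 / 2"
          unfolding X.clt_error_def n X.D_def D_def q_def by simp
        also have "\<dots> = E / q"
          unfolding E_def using q(2) by (simp add: power2_eq_square power3_eq_cube field_simps)
        finally show ?thesis by (simp add: q_def)
      qed
      then show ?thesis using X.cos_integral_clt[of \<alpha>] unfolding s by simp
    qed
    have r1: "filterlim (\<lambda>n. real (m1 n * m2 n)) at_top sequentially"
    proof -
      have "filterlim (\<lambda>n. real (m1 n)) at_top sequentially" "filterlim (\<lambda>n. real (m2 n)) at_top sequentially"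
        using filterlim_compose[OF filterlim_real_sequentially] m by auto
      then show ?thesis using filterlim_at_top_mult_at_top by simp
    qed
    have r2: "filterlim (\<lambda>n. sqrt (real (m1 n * m2 n))) at_top sequentially"
      by (rule filterlim_compose[OF sqrt_at_top r1])
    have "(\<lambda>n. (\<integral>\<omega>. cos (lincomb g (m1 n) (m2 n) F c \<omega> + \<alpha>) \<partial>\<Omega>)
       - cos \<alpha> * exp (- (\<integral>\<omega>. (lincomb g (m1 n) (m2 n) F c \<omega>)\<^sup>2 \<partial>\<Omega>) / 2)) \<longlonglongrightarrow> 0"
    proof (rule Lim_null_comparison)
      show "(\<lambda>n. E / sqrt (real (m1 n * m2 n))) \<longlonglongrightarrow> 0"
        by (rule real_tendsto_divide_at_top[OF tendsto_const r2])
      have "\<forall>\<^sub>F n in sequentially. 0 < real (m1 n * m2 n)"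
        using r1 unfolding filterlim_at_top_dense by blast
      then show "\<forall>\<^sub>F n in sequentially. norm ((\<integral>\<omega>. cos (lincomb g (m1 n) (m2 n) F c \<omega> + \<alpha>) \<partial>\<Omega>)
          - cos \<alpha> * exp (- (\<integral>\<omega>. (lincomb g (m1 n) (m2 n) F c \<omega>)\<^sup>2 \<partial>\<Omega>) / 2)) \<le> E / sqrt (real (m1 n * m2 n))"
      proof eventually_elim
        case (elim n)
        then have "0 < m1 n * m2 n" by linarith
        from err[OF this] show ?case by simp
      qed
    qed
    moreover have "(\<lambda>n. cos \<alpha> * exp (- (\<integral>\<omega>. (lincomb g (m1 n) (m2 n) F c \<omega>)\<^sup>2 \<partial>\<Omega>) / 2))
      \<longlonglongrightarrow> cos \<alpha> * exp (- (v * (\<Sum>s\<in>F. \<Sum>t\<in>F. c s * c t * sheet_cov s t)) / 2)"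
      by (intro tendsto_intros lim_var m F) auto
    ultimately show ?thesis using tendsto_add by fastforce
  qed
  show thesis
    using that[of "sqrt v"] \<open>0 \<le> v\<close> lim_var lim_cos by simp
qed

end

section \<open>The projective criterion\<close>

text \<open>The window consists of the \<open>k\<close> between about half of \<open>j\<close> and
  \<open>j\<close>. It has at least \<open>(j + 1) / 2\<close> elements, each contributing at least
  \<open>1 / sqrt (j + 1)\<close>.\<close>

lemma inverse_sqrt_window:
  "1 \<le> 2 / sqrt (real (Suc j)) * (\<Sum>k\<in>{k. k \<le> j \<and> j < 2 * k + 1}. 1 / sqrt (real (Suc k)))"
proof -
  let ?K = "{k. k \<le> j \<and> j < 2 * k + 1}"
  have K: "?K = {(j + 1) div 2..j}" by auto
  have "real (Suc j) / 2 \<le> real (card ?K)" unfolding K by (simp add: field_simps)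
  then have "real (Suc j) / 2 * (1 / sqrt (real (Suc j))) \<le> real (card ?K) * (1 / sqrt (real (Suc j)))"
    by (rule mult_right_mono) simp
  also have "\<dots> = (\<Sum>k\<in>?K. 1 / sqrt (real (Suc j)))" by simp
  also have "\<dots> \<le> (\<Sum>k\<in>?K. 1 / sqrt (real (Suc k)))"
    by (rule sum_mono) (auto intro!: divide_left_mono mult_pos_pos)
  finally have "2 / sqrt (real (Suc j)) * (real (Suc j) / 2 * (1 / sqrt (real (Suc j))))
    \<le> 2 / sqrt (real (Suc j)) * (\<Sum>k\<in>?K. 1 / sqrt (real (Suc k)))"
    by (rule mult_left_mono) simp
  moreover have "2 / sqrt (real (Suc j)) * (real (Suc j) / 2 * (1 / sqrt (real (Suc j)))) = 1"
    by (simp add: real_div_sqrt field_simps)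
  ultimately show ?thesis by simp
qed

text \<open>Each \<open>c j\<close> is spread over the indices \<open>k\<close> with
  \<open>k <= j <= 2 * k\<close>. After exchanging the sums, Cauchy-Schwarz on the window of
  \<open>k + 1\<close> indices starting at \<open>k\<close> bounds the inner sum by
  \<open>T k\<close>, because the squared weights \<open>1 / (j + 1)\<close> add up to at most 1
  there.\<close>

lemma sum_le_tail_norms:
  fixes c T :: "nat \<Rightarrow> real"
  assumes c: "\<And>j. 0 \<le> c j" and T: "\<And>k. 0 \<le> T k" "\<And>k. k < J \<Longrightarrow> (\<Sum>j\<in>{k..<J}. (c j)\<^sup>2) \<le> (T k)\<^sup>2"
  shows "(\<Sum>j<J. c j) \<le> 2 * (\<Sum>k<J. T k / sqrt (real (Suc k)))"
proof -
  let ?w = "\<lambda>j k. if k \<le> j \<and> j < 2 * k + 1 then 2 / (sqrt (real (Suc j)) * sqrt (real (Suc k))) else 0"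
  have "(\<Sum>j<J. c j) \<le> (\<Sum>j<J. c j * (\<Sum>k<J. ?w j k))"
  proof (rule sum_mono)
    fix j assume "j \<in> {..<J}"
    then have "(\<Sum>k<J. ?w j k) = (\<Sum>k\<in>{k. k \<le> j \<and> j < 2 * k + 1}. 2 / (sqrt (real (Suc j)) * sqrt (real (Suc k))))"
      by (intro sum.mono_neutral_cong_right) auto
    then have "1 \<le> (\<Sum>k<J. ?w j k)"
      using inverse_sqrt_window[of j] by (simp add: sum_distrib_left)
    from mult_left_mono[OF this c[of j]] show "c j \<le> c j * (\<Sum>k<J. ?w j k)" by simp
  qed
  also have "\<dots> = (\<Sum>k<J. \<Sum>j<J. c j * ?w j k)"
    unfolding sum_distrib_left by (rule sum.swap)
  also have "\<dots> \<le> (\<Sum>k<J. 2 * (T k / sqrt (real (Suc k))))"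
  proof (rule sum_mono)
    fix k assume k: "k \<in> {..<J}"
    let ?I = "{k..<J} \<inter> {..<2 * k + 1}"
    have "(\<Sum>j<J. c j * ?w j k) = (\<Sum>j\<in>?I. c j * (2 / (sqrt (real (Suc j)) * sqrt (real (Suc k)))))"
      by (intro sum.mono_neutral_cong_right) auto
    also have "\<dots> = 2 / sqrt (real (Suc k)) * (\<Sum>j\<in>?I. c j * (1 / sqrt (real (Suc j))))"
      by (simp add: sum_distrib_left field_simps)
    also have "(\<Sum>j\<in>?I. c j * (1 / sqrt (real (Suc j)))) \<le> T k"
    proof (rule power2_le_imp_le)
      have "(\<Sum>j\<in>?I. c j * (1 / sqrt (real (Suc j))))\<^sup>2 \<le> (\<Sum>j\<in>?I. (c j)\<^sup>2) * (\<Sum>j\<in>?I. (1 / sqrt (real (Suc j)))\<^sup>2)"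
        by (rule Cauchy_Schwarz_ineq_sum)
      also have "\<dots> \<le> (T k)\<^sup>2 * 1"
      proof (rule mult_mono)
        have "(\<Sum>j\<in>?I. (c j)\<^sup>2) \<le> (\<Sum>j\<in>{k..<J}. (c j)\<^sup>2)" by (rule sum_mono2) auto
        then show "(\<Sum>j\<in>?I. (c j)\<^sup>2) \<le> (T k)\<^sup>2" using T(2)[of k] k by simp
        have "(\<Sum>j\<in>?I. (1 / sqrt (real (Suc j)))\<^sup>2) \<le> (\<Sum>j\<in>?I. 1 / real (Suc k))"
          by (rule sum_mono) (auto simp: power_divide intro!: divide_left_mono)
        also have "\<dots> \<le> (\<Sum>j\<in>{k..<2 * k + 1}. 1 / real (Suc k))" by (rule sum_mono2) auto
        also have "\<dots> = 1" by simp
        finally show "(\<Sum>j\<in>?I. (1 / sqrt (real (Suc j)))\<^sup>2) \<le> 1" .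
      qed (auto intro: sum_nonneg)
      finally show "(\<Sum>j\<in>?I. c j * (1 / sqrt (real (Suc j))))\<^sup>2 \<le> (T k)\<^sup>2" by simp
    qed (rule T)
    finally show "(\<Sum>j<J. c j * ?w j k) \<le> 2 * (T k / sqrt (real (Suc k)))"
      by (simp add: mult_left_mono divide_right_mono)
  qed
  also have "\<dots> = 2 * (\<Sum>k<J. T k / sqrt (real (Suc k)))" by (simp add: sum_distrib_left)
  finally show ?thesis .
qed

text \<open>The one-dimensional inequality is used once per index. \<open>A k j\<close> is the tail
  norm in the first index, and its own tail norms in the second index are bounded by
  \<open>E\<close>.\<close>

lemma double_sum_le_tail_norms:
  fixes c E :: "nat \<Rightarrow> nat \<Rightarrow> real"
  assumes c: "\<And>i j. 0 \<le> c i j" and E: "\<And>k l. 0 \<le> E k l"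
    and cE: "\<And>k l. k < J \<Longrightarrow> l < J \<Longrightarrow> (\<Sum>i\<in>{k..<J}. \<Sum>j\<in>{l..<J}. (c i j)\<^sup>2) \<le> (E k l)\<^sup>2"
  shows "(\<Sum>i<J. \<Sum>j<J. c i j) \<le> 4 * (\<Sum>k<J. \<Sum>l<J. E k l / (sqrt (real (Suc k)) * sqrt (real (Suc l))))"
proof -
  define A where "A k j = sqrt (\<Sum>i\<in>{k..<J}. (c i j)\<^sup>2)" for k j
  have A: "0 \<le> A k j" "(A k j)\<^sup>2 = (\<Sum>i\<in>{k..<J}. (c i j)\<^sup>2)" for k j
    by (auto simp: A_def sum_nonneg)
  have "(\<Sum>i<J. \<Sum>j<J. c i j) = (\<Sum>j<J. \<Sum>i<J. c i j)" by (rule sum.swap)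
  also have "\<dots> \<le> (\<Sum>j<J. 2 * (\<Sum>k<J. A k j / sqrt (real (Suc k))))"
    by (intro sum_mono sum_le_tail_norms) (use c A in auto)
  also have "\<dots> = 2 * (\<Sum>k<J. (\<Sum>j<J. A k j) / sqrt (real (Suc k)))"
    unfolding sum_distrib_left[symmetric] sum_divide_distrib by (subst sum.swap) simp
  also have "\<dots> \<le> 2 * (\<Sum>k<J. (2 * (\<Sum>l<J. E k l / sqrt (real (Suc l)))) / sqrt (real (Suc k)))"
  proof (intro mult_left_mono sum_mono divide_right_mono)
    fix k assume k: "k \<in> {..<J}"
    show "(\<Sum>j<J. A k j) \<le> 2 * (\<Sum>l<J. E k l / sqrt (real (Suc l)))"
    proof (rule sum_le_tail_norms[OF A(1) E])
      fix l assume l: "l < J"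
      have "(\<Sum>j\<in>{l..<J}. (A k j)\<^sup>2) = (\<Sum>i\<in>{k..<J}. \<Sum>j\<in>{l..<J}. (c i j)\<^sup>2)"
        unfolding A(2) by (rule sum.swap)
      then show "(\<Sum>j\<in>{l..<J}. (A k j)\<^sup>2) \<le> (E k l)\<^sup>2" using cE[of k l] k l by simp
    qed
  qed auto
  also have "\<dots> = 4 * (\<Sum>k<J. \<Sum>l<J. E k l / (sqrt (real (Suc k)) * sqrt (real (Suc l))))"
    by (simp add: sum_distrib_left sum_divide_distrib mult_ac)
  finally show ?thesis .
qed

context iid_field begin

text \<open>Projections at sites before \<open>(-k, -l)\<close> see \<open>f\<close> only through
  its conditional expectation there, so Bessel's inequality supplies the tail norms for
  \<open>double_sum_le_tail_norms\<close>. The edge norms decrease, and a decreasing sequence whose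
  sum with weights \<open>1 / sqrt (k + 1)\<close> is at most \<open>S\<close> is bounded by
  \<open>S / sqrt (J + 1)\<close>.\<close>

theorem projective_criterion:
  assumes f: "L2 \<Omega> f"
    and S: "\<And>J. (\<Sum>k<J. \<Sum>l<J. nrm \<Omega> (cexp (Gamma_set (- int k, - int l)) f) / (sqrt (real (Suc k)) * sqrt (real (Suc l)))) \<le> S"
  shows "(\<Sum>i<J. \<Sum>j<J. nrm \<Omega> (PP (- int i, - int j) f)) \<le> 4 * S"
    and "(\<lambda>J. nrm \<Omega> (cexp (Gamma_set (- int J, 0)) f)) \<longlonglongrightarrow> 0"
    and "(\<lambda>J. nrm \<Omega> (cexp (Gamma_set (0, - int J)) f)) \<longlonglongrightarrow> 0"
proof -
  define E where "E k l = nrm \<Omega> (cexp (Gamma_set (- int k, - int l)) f)" for k l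
  have "(\<Sum>i<J. \<Sum>j<J. nrm \<Omega> (PP (- int i, - int j) f)) \<le>
      4 * (\<Sum>k<J. \<Sum>l<J. E k l / (sqrt (real (Suc k)) * sqrt (real (Suc l))))"
  proof (rule double_sum_le_tail_norms)
    fix k l
    let ?g = "cexp (Gamma_set (- int k, - int l)) f"
    let ?I = "(\<lambda>x. (- int (fst x), - int (snd x))) ` ({k..<J} \<times> {l..<J})"
    have "(\<Sum>i\<in>{k..<J}. \<Sum>j\<in>{l..<J}. (nrm \<Omega> (PP (- int i, - int j) f))\<^sup>2) = (\<Sum>x\<in>?I. (nrm \<Omega> (PP x f))\<^sup>2)"
      by (subst sum.reindex) (auto simp: inj_on_def sum.cartesian_product case_prod_unfold)
    also have "\<dots> = (\<Sum>x\<in>?I. (nrm \<Omega> (PP x ?g))\<^sup>2)"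
    proof (rule sum.cong[OF refl])
      fix x assume "x \<in> ?I"
      then have "fst x \<le> fst (- int k, - int l)" "snd x \<le> snd (- int k, - int l)" by auto
      from PP_cexp[OF f this] show "(nrm \<Omega> (PP x f))\<^sup>2 = (nrm \<Omega> (PP x ?g))\<^sup>2"
        by (subst nrm_cong_AE[of "PP x f" \<Omega> "PP x ?g"]) (auto intro!: L2_meas[OF L2_PP] f elim: eventually_mono)
    qed
    also have "\<dots> \<le> (nrm \<Omega> ?g)\<^sup>2"
      by (rule PP_bessel[OF L2_cexp[OF f]]) simp
    finally show "(\<Sum>i\<in>{k..<J}. \<Sum>j\<in>{l..<J}. (nrm \<Omega> (PP (- int i, - int j) f))\<^sup>2) \<le> (E k l)\<^sup>2"
      by (simp add: E_def)
  qed (auto simp: E_def)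
  also have "\<dots> \<le> 4 * S" using S[of J] by (simp add: E_def)
  finally show "(\<Sum>i<J. \<Sum>j<J. nrm \<Omega> (PP (- int i, - int j) f)) \<le> 4 * S" .
  have E_nonneg: "0 \<le> E k l" for k l by (simp add: E_def)
  have E_mono: "E k' l' \<le> E k l" if "k \<le> k'" "l \<le> l'" for k k' l l'
  proof -
    have "AE \<omega> in \<Omega>. cexp (Gamma_set (- int k', - int l')) (cexp (Gamma_set (- int k, - int l)) f) \<omega>
        = cexp (Gamma_set (- int k', - int l')) f \<omega>"
      using cexp_cexp[OF f, of "Gamma_set (- int k', - int l')" "Gamma_set (- int k, - int l)"] that
      by (simp add: Gamma_set_Int min_def)
    then have "E k' l' = nrm \<Omega> (cexp (Gamma_set (- int k', - int l')) (cexp (Gamma_set (- int k, - int l)) f))"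
      unfolding E_def by (intro nrm_cong_AE L2_meas L2_cexp f) (auto elim: eventually_mono)
    also have "\<dots> \<le> E k l" unfolding E_def by (intro nrm_cexp_le L2_cexp f)
    finally show ?thesis .
  qed
  have S0: "(\<Sum>k<J. \<Sum>l<J. E k l / (sqrt (real (Suc k)) * sqrt (real (Suc l)))) \<le> S" for J
    using S by (simp add: E_def)
  have nn: "0 \<le> E k l / (sqrt (real (Suc k)) * sqrt (real (Suc l)))" for k l by (simp add: E_def)
  have lim: "(\<lambda>J. S / sqrt (real (Suc J))) \<longlonglongrightarrow> 0"
    by (intro real_tendsto_divide_at_top[OF tendsto_const] filterlim_compose[OF sqrt_at_top]
        filterlim_compose[OF filterlim_real_sequentially filterlim_Suc])
  have sq: "real (Suc J) / sqrt (real (Suc J)) \<le> (\<Sum>k<Suc J. 1 / sqrt (real (Suc k)))" for J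
  proof -
    have "(\<Sum>k<Suc J. 1 / sqrt (real (Suc J))) \<le> (\<Sum>k<Suc J. 1 / sqrt (real (Suc k)))"
      by (rule sum_mono) (auto intro!: divide_left_mono mult_pos_pos)
    then show ?thesis by simp
  qed
  have bound: "e J \<le> S / sqrt (real (Suc J))"
    if e: "\<And>k. k \<le> J \<Longrightarrow> e J \<le> e k" "\<And>k. 0 \<le> e k" "(\<Sum>k<Suc J. e k / sqrt (real (Suc k))) \<le> S" for e J
  proof -
    have "e J * (real (Suc J) / sqrt (real (Suc J))) \<le> e J * (\<Sum>k<Suc J. 1 / sqrt (real (Suc k)))"
      by (intro mult_left_mono sq e)
    also have "\<dots> = (\<Sum>k<Suc J. e J / sqrt (real (Suc k)))"
      by (simp add: sum_distrib_left del: sum.lessThan_Suc)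
    also have "\<dots> \<le> (\<Sum>k<Suc J. e k / sqrt (real (Suc k)))"
      by (intro sum_mono divide_right_mono e) auto
    finally have "e J * sqrt (real (Suc J)) \<le> S" using e(3) by (simp add: real_div_sqrt)
    then show ?thesis by (simp add: field_simps)
  qed
  have b1: "E J 0 \<le> S / sqrt (real (Suc J))" for J
  proof (rule bound)
    \<comment> \<open>Only the column \<open>l = 0\<close> is kept, where the second weight is
      1.\<close>
    have "(\<Sum>k<Suc J. E k 0 / sqrt (real (Suc k))) \<le> (\<Sum>k<Suc J. \<Sum>l<Suc J. E k l / (sqrt (real (Suc k)) * sqrt (real (Suc l))))"
    proof (rule sum_mono)
      fix k
      show "E k 0 / sqrt (real (Suc k)) \<le> (\<Sum>l<Suc J. E k l / (sqrt (real (Suc k)) * sqrt (real (Suc l))))"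
        using member_le_sum[of 0 "{..<Suc J}" "\<lambda>l. E k l / (sqrt (real (Suc k)) * sqrt (real (Suc l)))"] nn by auto
    qed
    then show "(\<Sum>k<Suc J. E k 0 / sqrt (real (Suc k))) \<le> S" using S0[of "Suc J"] by linarith
  qed (auto intro: E_mono E_nonneg)
  have b2: "E 0 J \<le> S / sqrt (real (Suc J))" for J
  proof (rule bound[of _ "\<lambda>J. E 0 J"])
    have "(\<Sum>l<Suc J. E 0 l / sqrt (real (Suc l))) \<le> (\<Sum>k<Suc J. \<Sum>l<Suc J. E k l / (sqrt (real (Suc k)) * sqrt (real (Suc l))))"
      using member_le_sum[of 0 "{..<Suc J}" "\<lambda>k. \<Sum>l<Suc J. E k l / (sqrt (real (Suc k)) * sqrt (real (Suc l)))"] nn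
      by (auto simp: sum_nonneg)
    then show "(\<Sum>l<Suc J. E 0 l / sqrt (real (Suc l))) \<le> S" using S0[of "Suc J"] by linarith
  qed (auto intro: E_mono E_nonneg)
  show "(\<lambda>J. nrm \<Omega> (cexp (Gamma_set (- int J, 0)) f)) \<longlonglongrightarrow> 0"
    by (rule tendsto_sandwich[OF always_eventually always_eventually tendsto_const lim]) (use b1 in \<open>auto simp: E_def\<close>)
  show "(\<lambda>J. nrm \<Omega> (cexp (Gamma_set (0, - int J)) f)) \<longlonglongrightarrow> 0"
    by (rule tendsto_sandwich[OF always_eventually always_eventually tendsto_const lim]) (use b2 in \<open>auto simp: E_def\<close>)
qed

section \<open>The linear field\<close>

lemma has_L2_sum_approx:
  assumes "has_L2_sum M X I Y" "0 < \<epsilon>"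
  obtains F0 where "finite F0" "F0 \<subseteq> I"
    "\<And>F. finite F \<Longrightarrow> F0 \<subseteq> F \<Longrightarrow> F \<subseteq> I \<Longrightarrow> (\<integral>\<^sup>+\<omega>. ennreal ((Y \<omega> - (\<Sum>i\<in>F. X i \<omega>))\<^sup>2) \<partial>M) < \<epsilon>"
proof -
  have "\<forall>\<^sub>F F in finite_subsets_at_top I. (\<integral>\<^sup>+\<omega>. ennreal ((Y \<omega> - (\<Sum>i\<in>F. X i \<omega>))\<^sup>2) \<partial>M) < \<epsilon>"
    using assms unfolding has_L2_sum_def by (intro order_tendstoD(2)) auto
  then obtain F0 where "finite F0" "F0 \<subseteq> I" and
      *: "\<forall>F. finite F \<and> F0 \<subseteq> F \<and> F \<subseteq> I \<longrightarrow> (\<integral>\<^sup>+\<omega>. ennreal ((Y \<omega> - (\<Sum>i\<in>F. X i \<omega>))\<^sup>2) \<partial>M) < \<epsilon>"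
    unfolding eventually_finite_subsets_at_top by auto
  from this(1,2) show thesis by (rule that) (use * in auto)
qed

text \<open>Stated in the extended reals, since \<open>has_L2_sum\<close> does not require the sum
  itself to be square integrable.\<close>

lemma nn_integral_power2_triangle:
  fixes u v w :: "'a \<Rightarrow> real"
  assumes [measurable]: "u \<in> borel_measurable M" "v \<in> borel_measurable M" "w \<in> borel_measurable M"
  shows "(\<integral>\<^sup>+x. ennreal ((u x - v x)\<^sup>2) \<partial>M) \<le>
    2 * (\<integral>\<^sup>+x. ennreal ((u x - w x)\<^sup>2) \<partial>M) + 2 * (\<integral>\<^sup>+x. ennreal ((v x - w x)\<^sup>2) \<partial>M)"
proof -
  have "(\<integral>\<^sup>+x. ennreal ((u x - v x)\<^sup>2) \<partial>M) \<le> (\<integral>\<^sup>+x. 2 * ennreal ((u x - w x)\<^sup>2) + 2 * ennreal ((v x - w x)\<^sup>2) \<partial>M)"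
  proof (rule nn_integral_mono)
    fix x
    have "0 \<le> (u x + v x - 2 * w x)\<^sup>2" by simp
    then have "(u x - v x)\<^sup>2 \<le> 2 * (u x - w x)\<^sup>2 + 2 * (v x - w x)\<^sup>2"
      by (simp add: power2_eq_square algebra_simps)
    then have "ennreal ((u x - v x)\<^sup>2) \<le> ennreal (2 * (u x - w x)\<^sup>2 + 2 * (v x - w x)\<^sup>2)"
      by (rule ennreal_leI)
    then show "ennreal ((u x - v x)\<^sup>2) \<le> 2 * ennreal ((u x - w x)\<^sup>2) + 2 * ennreal ((v x - w x)\<^sup>2)"
      by (simp add: ennreal_plus ennreal_mult')
  qed
  also have "\<dots> = 2 * (\<integral>\<^sup>+x. ennreal ((u x - w x)\<^sup>2) \<partial>M) + 2 * (\<integral>\<^sup>+x. ennreal ((v x - w x)\<^sup>2) \<partial>M)"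
    by (simp add: nn_integral_add nn_integral_cmult)
  finally show ?thesis .
qed

text \<open>Identities between versions of \<open>L2\<close> sums are proved this way: both sides
  are close to one and the same finite sum.\<close>

lemma AE_eqI_L2_approx:
  fixes u v :: "'a \<Rightarrow> real"
  assumes [measurable]: "u \<in> borel_measurable M" "v \<in> borel_measurable M"
    and *: "\<And>\<epsilon>::real. (0::real) < \<epsilon> \<Longrightarrow> \<exists>w\<in>borel_measurable M. (\<integral>\<^sup>+x. ennreal ((u x - w x)\<^sup>2) \<partial>M) \<le> \<epsilon> \<and> (\<integral>\<^sup>+x. ennreal ((v x - w x)\<^sup>2) \<partial>M) \<le> \<epsilon>"
  shows "AE x in M. u x = v x"
proof -
  have "(\<integral>\<^sup>+x. ennreal ((u x - v x)\<^sup>2) \<partial>M) \<le> 0"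
  proof (rule ennreal_le_epsilon)
    fix e :: real assume "0 < e"
    then obtain w where w: "w \<in> borel_measurable M" "(\<integral>\<^sup>+x. ennreal ((u x - w x)\<^sup>2) \<partial>M) \<le> ennreal (e / 4)"
      "(\<integral>\<^sup>+x. ennreal ((v x - w x)\<^sup>2) \<partial>M) \<le> ennreal (e / 4)"
      using *[of "e / 4"] by auto
    have "(\<integral>\<^sup>+x. ennreal ((u x - v x)\<^sup>2) \<partial>M) \<le>
        2 * (\<integral>\<^sup>+x. ennreal ((u x - w x)\<^sup>2) \<partial>M) + 2 * (\<integral>\<^sup>+x. ennreal ((v x - w x)\<^sup>2) \<partial>M)"
      by (rule nn_integral_power2_triangle) (use w in auto)
    also have "\<dots> \<le> 2 * ennreal (e / 4) + 2 * ennreal (e / 4)"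
      by (intro add_mono mult_left_mono w) auto
    also have "\<dots> = ennreal e"
      using \<open>0 < e\<close> by (simp add: ennreal_mult'[symmetric] ennreal_plus[symmetric] flip: ennreal_numeral)
    finally show "(\<integral>\<^sup>+x. ennreal ((u x - v x)\<^sup>2) \<partial>M) \<le> 0 + ennreal e" by simp
  qed
  then have "(\<integral>\<^sup>+x. ennreal ((u x - v x)\<^sup>2) \<partial>M) = 0" by simp
  then have "AE x in M. ennreal ((u x - v x)\<^sup>2) = 0"
    by (subst (asm) nn_integral_0_iff_AE) auto
  then show ?thesis by eventually_elim (simp add: ennreal_eq_0_iff)
qed

text \<open>A version \<open>Y\<close> of the sum need not satisfy \<open>dep A\<close> pointwise.
  What survives is that resampling patterns with the same trace on \<open>A\<close> give the same
  value almost surely, because they agree on the approximating finite sums.\<close>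

lemma has_L2_sum_merge:
  assumes sum: "has_L2_sum \<Omega> X I Y" and X: "\<And>i. i \<in> I \<Longrightarrow> dep A (X i)" and AB: "A \<inter> B = A \<inter> C"
  shows "AE x in \<Omega> \<Otimes>\<^sub>M \<Omega>. Y (merge B (fst x) (snd x)) = Y (merge C (fst x) (snd x))"
proof (rule AE_eqI_L2_approx)
  have [measurable]: "Y \<in> borel_measurable \<Omega>" using sum by (simp add: has_L2_sum_def)
  show "(\<lambda>x. Y (merge B (fst x) (snd x))) \<in> borel_measurable (\<Omega> \<Otimes>\<^sub>M \<Omega>)"
    "(\<lambda>x. Y (merge C (fst x) (snd x))) \<in> borel_measurable (\<Omega> \<Otimes>\<^sub>M \<Omega>)" by measurable
  fix \<epsilon> :: real assume "0 < \<epsilon>"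
  then have e: "0 < ennreal \<epsilon>" by simp
  obtain F where F: "finite F" "F \<subseteq> I" and F': "\<And>F'. finite F' \<Longrightarrow> F \<subseteq> F' \<Longrightarrow> F' \<subseteq> I \<Longrightarrow>
      (\<integral>\<^sup>+\<omega>. ennreal ((Y \<omega> - (\<Sum>i\<in>F'. X i \<omega>))\<^sup>2) \<partial>\<Omega>) < \<epsilon>"
    by (rule has_L2_sum_approx[OF sum e]) blast
  note F3 = F'[OF F(1) order_refl F(2)]
  define G where "G \<omega> = (\<Sum>i\<in>F. X i \<omega>)" for \<omega>
  have [measurable]: "G \<in> borel_measurable \<Omega>"
    unfolding G_def[abs_def] using sum F(2) by (intro borel_measurable_sum) (auto simp: has_L2_sum_def)
  have "dep A G" unfolding G_def[abs_def] using F(2) by (intro dep_sum X) auto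
  moreover have "i \<in> B \<longleftrightarrow> i \<in> C" if "i \<in> A" for i using AB that by blast
  ultimately have G: "G (merge B \<omega> \<omega>') = G (merge C \<omega> \<omega>')" for \<omega> \<omega>'
    by (intro depD[of A G]) (simp_all add: merge_def)
  have F4: "(\<integral>\<^sup>+\<omega>. ennreal ((Y \<omega> - G \<omega>)\<^sup>2) \<partial>\<Omega>) < \<epsilon>" using F3 by (simp add: G_def)
  have m: "(\<integral>\<^sup>+x. ennreal ((Y (merge D (fst x) (snd x)) - G (merge D (fst x) (snd x)))\<^sup>2) \<partial>(\<Omega> \<Otimes>\<^sub>M \<Omega>)) \<le> \<epsilon>" for D
    using nn_integral_merge[of "\<lambda>\<omega>. ennreal ((Y \<omega> - G \<omega>)\<^sup>2)" D] F4 by simp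
  show "\<exists>w\<in>borel_measurable (\<Omega> \<Otimes>\<^sub>M \<Omega>).
      (\<integral>\<^sup>+x. ennreal ((Y (merge B (fst x) (snd x)) - w x)\<^sup>2) \<partial>(\<Omega> \<Otimes>\<^sub>M \<Omega>)) \<le> \<epsilon> \<and>
      (\<integral>\<^sup>+x. ennreal ((Y (merge C (fst x) (snd x)) - w x)\<^sup>2) \<partial>(\<Omega> \<Otimes>\<^sub>M \<Omega>)) \<le> \<epsilon>"
    using m[of B] m[of C] by (intro bexI[of _ "\<lambda>x. G (merge B (fst x) (snd x))"]) (auto simp: G)
qed

end

lemma merge_UNIV [simp]: "merge UNIV \<omega> \<omega>' = \<omega>" and merge_empty [simp]: "merge {} \<omega> \<omega>' = \<omega>'"
  by (auto simp: merge_def)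

locale linear_fields = iid_field +
  fixes a :: "int \<times> int \<Rightarrow> real"
    and Z Zp Zm :: "int \<times> int \<Rightarrow> (int \<times> int \<Rightarrow> real) \<Rightarrow> real"
    and h :: nat
    and K :: "(nat \<Rightarrow> real) \<Rightarrow> real"
  assumes causal: "\<And>i j. \<not> (i \<ge> 0 \<and> j \<ge> 0) \<Longrightarrow> a (i, j) = 0"
    and Z: "linear_field P a Z"
    and Zp: "linear_field_plus P a Zp"
    and Zm: "linear_field_minus P a Zm"
    and h_pos: "h > 0"
    and K: "K \<in> borel_measurable (\<Pi>\<^sub>M m\<in>{..<h\<^sup>2}. borel)"
begin

abbreviation "X ij rs \<omega> \<equiv> a (ij - rs) * \<omega> rs"

lemma Z_sum: "has_L2_sum \<Omega> (\<lambda>rs \<omega>. a rs * \<omega> (ij - rs)) UNIV (Z ij)"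
  using Z by (cases ij) (auto simp: linear_field_def eps_def case_prod_unfold minus_prod_def)

lemma Zp_sum: "has_L2_sum \<Omega> (\<lambda>rs \<omega>. X ij rs \<omega>) (Gamma_set ij - Gamma_set (1, 1)) (Zp ij)"
  using Zp by (cases ij) (auto simp: linear_field_plus_def eps_def case_prod_unfold minus_prod_def)

lemma Zm_sum: "has_L2_sum \<Omega> (\<lambda>rs \<omega>. X ij rs \<omega>) (Gamma_set (1, 1)) (Zm ij)"
  using Zm by (cases ij) (auto simp: linear_field_minus_def eps_def case_prod_unfold minus_prod_def)

lemma Z_measurable [measurable]: "Z ij \<in> borel_measurable \<Omega>"
  and Zp_measurable [measurable]: "Zp ij \<in> borel_measurable \<Omega>"
  and Zm_measurable [measurable]: "Zm ij \<in> borel_measurable \<Omega>"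
  using Z_sum[of ij] Zp_sum[of ij] Zm_sum[of ij] by (auto simp: has_L2_sum_def)

lemma a_outside: "rs \<notin> Gamma_set ij \<Longrightarrow> a (ij - rs) = 0"
  by (cases ij; cases rs) (auto simp: Gamma_set_def intro!: causal)

text \<open>By causality the sites outside the quadrant of \<open>ij\<close> have coefficient 0, so
  a partial sum of \<open>Z\<close> is the sum of partial sums of the two parts.\<close>

lemma Z_decomp: "AE \<omega> in \<Omega>. Z ij \<omega> = Zp ij \<omega> + Zm ij \<omega>"
proof (rule AE_eqI_L2_approx)
  fix \<epsilon> :: real assume "0 < \<epsilon>"
  then have e: "0 < ennreal \<epsilon>" and e4: "0 < ennreal (\<epsilon> / 4)" by simp_all
  obtain F0 where F0: "finite F0" "F0 \<subseteq> UNIV" "\<And>F. finite F \<Longrightarrow> F0 \<subseteq> F \<Longrightarrow> F \<subseteq> UNIV \<Longrightarrow>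
      (\<integral>\<^sup>+\<omega>. ennreal ((Z ij \<omega> - (\<Sum>rs\<in>F. a rs * \<omega> (ij - rs)))\<^sup>2) \<partial>\<Omega>) < \<epsilon>"
    by (rule has_L2_sum_approx[OF Z_sum[of ij] e]) blast
  obtain F1 where F1: "finite F1" "F1 \<subseteq> Gamma_set ij - Gamma_set (1, 1)"
      "\<And>F. finite F \<Longrightarrow> F1 \<subseteq> F \<Longrightarrow> F \<subseteq> Gamma_set ij - Gamma_set (1, 1) \<Longrightarrow>
      (\<integral>\<^sup>+\<omega>. ennreal ((Zp ij \<omega> - (\<Sum>rs\<in>F. X ij rs \<omega>))\<^sup>2) \<partial>\<Omega>) < ennreal (\<epsilon> / 4)"
    by (rule has_L2_sum_approx[OF Zp_sum[of ij] e4]) blast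
  obtain F2 where F2: "finite F2" "F2 \<subseteq> Gamma_set (1, 1)"
      "\<And>F. finite F \<Longrightarrow> F2 \<subseteq> F \<Longrightarrow> F \<subseteq> Gamma_set (1, 1) \<Longrightarrow>
      (\<integral>\<^sup>+\<omega>. ennreal ((Zm ij \<omega> - (\<Sum>rs\<in>F. X ij rs \<omega>))\<^sup>2) \<partial>\<Omega>) < ennreal (\<epsilon> / 4)"
    by (rule has_L2_sum_approx[OF Zm_sum[of ij] e4]) blast
  \<comment> \<open>\<open>Z\<close> is indexed by lags and its two parts by sites; reflection at
    \<open>ij\<close> passes from one to the other. \<open>F\<close> is large enough for all three
    approximations at once.\<close>
  define F where "F = (\<lambda>rs. ij - rs) ` F0 \<union> F1 \<union> F2"
  define Fp where "Fp = F \<inter> (Gamma_set ij - Gamma_set (1, 1))"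
  define Fm where "Fm = F \<inter> Gamma_set (1, 1)"
  have fin: "finite F" "finite Fp" "finite Fm" by (auto simp: F_def Fp_def Fm_def F0 F1 F2)
  let ?G = "\<lambda>\<omega>. \<Sum>rs\<in>(\<lambda>rs. ij - rs) ` F. a rs * \<omega> (ij - rs)"
  let ?Gp = "\<lambda>\<omega>. \<Sum>rs\<in>Fp. X ij rs \<omega>" and ?Gm = "\<lambda>\<omega>. \<Sum>rs\<in>Fm. X ij rs \<omega>"
  have G: "?G \<omega> = ?Gp \<omega> + ?Gm \<omega>" for \<omega>
  proof -
    have "?G \<omega> = (\<Sum>rs\<in>F. X ij rs \<omega>)"
      by (subst sum.reindex) (auto simp: inj_on_def)
    also have "\<dots> = (\<Sum>rs\<in>Fp \<union> Fm. X ij rs \<omega>)"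
    proof (rule sum.mono_neutral_right)
      show "\<forall>rs\<in>F - (Fp \<union> Fm). X ij rs \<omega> = 0"
      proof
        fix rs assume "rs \<in> F - (Fp \<union> Fm)"
        then have "rs \<notin> Gamma_set ij" by (auto simp: Fp_def Fm_def)
        then show "X ij rs \<omega> = 0" by (simp add: a_outside)
      qed
    qed (auto simp: fin Fp_def Fm_def)
    also have "\<dots> = ?Gp \<omega> + ?Gm \<omega>"
      by (rule sum.union_disjoint) (use fin in \<open>auto simp: Fp_def Fm_def\<close>)
    finally show ?thesis .
  qed
  have e1: "(\<integral>\<^sup>+\<omega>. ennreal ((Z ij \<omega> - ?G \<omega>)\<^sup>2) \<partial>\<Omega>) < \<epsilon>"
  proof (rule F0(3))
    have "rs = ij - (ij - rs)" for rs by simp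
    then show "F0 \<subseteq> (\<lambda>rs. ij - rs) ` F" unfolding F_def by blast
  qed (simp_all add: fin)
  have ep: "(\<integral>\<^sup>+\<omega>. ennreal ((Zp ij \<omega> - ?Gp \<omega>)\<^sup>2) \<partial>\<Omega>) < ennreal (\<epsilon> / 4)"
    by (rule F1(3)) (use fin F1(2) in \<open>auto simp: Fp_def F_def\<close>)
  have em: "(\<integral>\<^sup>+\<omega>. ennreal ((Zm ij \<omega> - ?Gm \<omega>)\<^sup>2) \<partial>\<Omega>) < ennreal (\<epsilon> / 4)"
    by (rule F2(3)) (use fin F2(2) in \<open>auto simp: Fm_def F_def\<close>)
  have "(\<integral>\<^sup>+\<omega>. ennreal ((Zp ij \<omega> + Zm ij \<omega> - ?G \<omega>)\<^sup>2) \<partial>\<Omega>) =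
      (\<integral>\<^sup>+\<omega>. ennreal (((Zp ij \<omega> - ?Gp \<omega>) - (?Gm \<omega> - Zm ij \<omega>))\<^sup>2) \<partial>\<Omega>)"
    unfolding G by (simp add: algebra_simps)
  also have "\<dots> \<le> 2 * (\<integral>\<^sup>+\<omega>. ennreal (((Zp ij \<omega> - ?Gp \<omega>) - 0)\<^sup>2) \<partial>\<Omega>) + 2 * (\<integral>\<^sup>+\<omega>. ennreal (((?Gm \<omega> - Zm ij \<omega>) - 0)\<^sup>2) \<partial>\<Omega>)"
    by (rule nn_integral_power2_triangle) measurable
  also have "\<dots> \<le> 2 * ennreal (\<epsilon> / 4) + 2 * ennreal (\<epsilon> / 4)"
    using ep em by (intro add_mono mult_left_mono) (auto simp: power2_commute less_imp_le)
  also have "\<dots> = ennreal \<epsilon>"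
    using \<open>0 < \<epsilon>\<close> by (simp add: ennreal_mult'[symmetric] ennreal_plus[symmetric] flip: ennreal_numeral)
  finally show "\<exists>w\<in>borel_measurable \<Omega>. (\<integral>\<^sup>+\<omega>. ennreal ((Z ij \<omega> - w \<omega>)\<^sup>2) \<partial>\<Omega>) \<le> \<epsilon> \<and>
      (\<integral>\<^sup>+\<omega>. ennreal ((Zp ij \<omega> + Zm ij \<omega> - w \<omega>)\<^sup>2) \<partial>\<Omega>) \<le> \<epsilon>"
    using e1 by (intro bexI[of _ ?G]) (auto simp: less_imp_le)
qed measurable

text \<open>Exact for the partial sums; only almost sure in the limit, because the versions at
  different sites are chosen independently of each other.\<close>

lemma Z_shift: "AE \<omega> in \<Omega>. Z ij (shift kl \<omega>) = Z (ij + kl) \<omega>"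
proof (rule AE_eqI_L2_approx[where u="\<lambda>\<omega>. Z ij (shift kl \<omega>)" and v="Z (ij + kl)"])
  fix \<epsilon> :: real assume "0 < \<epsilon>"
  then have e: "0 < ennreal \<epsilon>" by simp
  obtain F0 where F0: "finite F0" "F0 \<subseteq> UNIV" "\<And>F. finite F \<Longrightarrow> F0 \<subseteq> F \<Longrightarrow> F \<subseteq> UNIV \<Longrightarrow>
      (\<integral>\<^sup>+\<omega>. ennreal ((Z ij \<omega> - (\<Sum>rs\<in>F. a rs * \<omega> (ij - rs)))\<^sup>2) \<partial>\<Omega>) < \<epsilon>"
    by (rule has_L2_sum_approx[OF Z_sum[of ij] e]) blast
  obtain F1 where F1: "finite F1" "F1 \<subseteq> UNIV" "\<And>F. finite F \<Longrightarrow> F1 \<subseteq> F \<Longrightarrow> F \<subseteq> UNIV \<Longrightarrow>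
      (\<integral>\<^sup>+\<omega>. ennreal ((Z (ij + kl) \<omega> - (\<Sum>rs\<in>F. a rs * \<omega> (ij + kl - rs)))\<^sup>2) \<partial>\<Omega>) < \<epsilon>"
    by (rule has_L2_sum_approx[OF Z_sum[of "ij + kl"] e]) blast
  let ?G = "\<lambda>\<omega>. \<Sum>rs\<in>F0 \<union> F1. a rs * \<omega> (ij - rs)" and ?G' = "\<lambda>\<omega>. \<Sum>rs\<in>F0 \<union> F1. a rs * \<omega> (ij + kl - rs)"
  have eq: "?G (shift kl \<omega>) = ?G' \<omega>" for \<omega>
    by (simp add: shift_apply algebra_simps)
  have "(\<integral>\<^sup>+\<omega>. ennreal ((Z ij \<omega> - ?G \<omega>)\<^sup>2) \<partial>\<Omega>) = (\<integral>\<^sup>+\<omega>. ennreal ((Z ij (shift kl \<omega>) - ?G' \<omega>)\<^sup>2) \<partial>\<Omega>)"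
    using nn_integral_distr[OF shift_measurable, of "\<lambda>\<omega>. ennreal ((Z ij \<omega> - ?G \<omega>)\<^sup>2)" kl]
    by (simp only: distr_shift eq) simp
  moreover have "(\<integral>\<^sup>+\<omega>. ennreal ((Z ij \<omega> - ?G \<omega>)\<^sup>2) \<partial>\<Omega>) < \<epsilon>"
    by (rule F0(3)) (use F0(1) F1(1) in auto)
  moreover have "(\<integral>\<^sup>+\<omega>. ennreal ((Z (ij + kl) \<omega> - ?G' \<omega>)\<^sup>2) \<partial>\<Omega>) < \<epsilon>"
    by (rule F1(3)) (use F0(1) F1(1) in auto)
  ultimately show "\<exists>w\<in>borel_measurable \<Omega>. (\<integral>\<^sup>+\<omega>. ennreal ((Z ij (shift kl \<omega>) - w \<omega>)\<^sup>2) \<partial>\<Omega>) \<le> \<epsilon> \<and>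
      (\<integral>\<^sup>+\<omega>. ennreal ((Z (ij + kl) \<omega> - w \<omega>)\<^sup>2) \<partial>\<Omega>) \<le> \<epsilon>"
    by (intro bexI[of _ ?G']) (auto simp: less_imp_le)
qed measurable

section \<open>Conditional expectations of the functional\<close>

lemma functional_measurable [measurable]: "functional h K Z \<in> borel_measurable \<Omega>"
proof -
  have "(\<lambda>\<omega>. window h (0, 0) (\<lambda>ij. Z ij \<omega>)) \<in> \<Omega> \<rightarrow>\<^sub>M (\<Pi>\<^sub>M m\<in>{..<h\<^sup>2}. borel)"
    unfolding window_def by (auto intro!: measurable_restrict)
  from measurable_compose[OF this K] show ?thesis by (simp add: functional_def[abs_def])
qed

lemma functional_shift:
  "AE \<omega> in \<Omega>. functional h K Z (shift kl \<omega>) =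
     K (\<lambda>m\<in>{..<h\<^sup>2}. window h kl (\<lambda>ij. Zp ij \<omega>) m + window h kl (\<lambda>ij. Zm ij \<omega>) m)"
proof -
  have "AE \<omega> in \<Omega>. \<forall>ij. Z ij (shift kl \<omega>) = Z (ij + kl) \<omega>"
    unfolding AE_all_countable using Z_shift by blast
  moreover have "AE \<omega> in \<Omega>. \<forall>ij. Z ij \<omega> = Zp ij \<omega> + Zm ij \<omega>"
    unfolding AE_all_countable using Z_decomp by blast
  ultimately show ?thesis
  proof eventually_elim
    case (elim \<omega>)
    then have "Z (i, j) (shift kl \<omega>) = Zp ((i, j) + kl) \<omega> + Zm ((i, j) + kl) \<omega>" for i j by simp
    then have "window h (0, 0) (\<lambda>ij. Z ij (shift kl \<omega>)) =
       (\<lambda>m\<in>{..<h\<^sup>2}. window h kl (\<lambda>ij. Zp ij \<omega>) m + window h kl (\<lambda>ij. Zm ij \<omega>) m)"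
      by (cases kl) (auto simp: window_def fun_eq_iff algebra_simps)
    then show ?case by (simp add: functional_def)
  qed
qed

text \<open>The plus part uses no coordinate of the quadrant of \<open>(1, 1)\<close> and the minus
  part uses no other. Integrating out the complement of this quadrant therefore reproduces the
  definition of \<open>K_kl\<close>, and the shift moves the quadrant by \<open>kl\<close>.\<close>

lemma K_kl_eq_cexp:
  "AE \<omega> in \<Omega>. K_kl P h K Zp kl (W_minus h Zm kl \<omega>)
     = cexp (Gamma_set ((1, 1) - kl)) (functional h K Z) (shift kl \<omega>)"
proof -
  let ?f = "functional h K Z"
  let ?R = "\<lambda>\<omega> \<omega>'. K (\<lambda>m\<in>{..<h\<^sup>2}. window h kl (\<lambda>ij. Zp ij \<omega>') m + window h kl (\<lambda>ij. Zm ij \<omega>) m)"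
  let ?G = "Gamma_set (1, 1)"
  have p: "AE x in \<Omega> \<Otimes>\<^sub>M \<Omega>. \<forall>ij. Zp ij (merge ?G (fst x) (snd x)) = Zp ij (snd x)"
    unfolding AE_all_countable
  proof
    fix ij
    have "dep (- ?G) (X ij rs)" if "rs \<in> Gamma_set ij - ?G" for rs
      using that by (auto simp: dep_def)
    from has_L2_sum_merge[OF Zp_sum this, of ?G "{}"]
    show "AE x in \<Omega> \<Otimes>\<^sub>M \<Omega>. Zp ij (merge ?G (fst x) (snd x)) = Zp ij (snd x)" by simp
  qed
  have m: "AE x in \<Omega> \<Otimes>\<^sub>M \<Omega>. \<forall>ij. Zm ij (merge ?G (fst x) (snd x)) = Zm ij (fst x)"
    unfolding AE_all_countable
  proof
    fix ij
    have "dep ?G (X ij rs)" if "rs \<in> ?G" for rs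
      using that by (auto simp: dep_def)
    from has_L2_sum_merge[OF Zm_sum this, of ?G UNIV]
    show "AE x in \<Omega> \<Otimes>\<^sub>M \<Omega>. Zm ij (merge ?G (fst x) (snd x)) = Zm ij (fst x)" by simp
  qed
  \<comment> \<open>The mixed point has law \<open>Omega P\<close>, so the almost sure identity
    \<open>functional_shift\<close> holds at it too.\<close>
  have f: "AE x in \<Omega> \<Otimes>\<^sub>M \<Omega>. ?f (shift kl (merge ?G (fst x) (snd x))) = ?R (merge ?G (fst x) (snd x)) (merge ?G (fst x) (snd x))"
    by (rule AE_distrD[OF merge_pair_measurable[of ?G]]) (use functional_shift in \<open>simp only: distr_merge\<close>)
  have "AE x in \<Omega> \<Otimes>\<^sub>M \<Omega>. ?f (shift kl (merge ?G (fst x) (snd x))) = ?R (fst x) (snd x)"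
    using f p m by eventually_elim (simp add: window_def case_prod_unfold del: split_paired_All)
  from Om2.AE_pair[OF this]
  have "AE \<omega> in \<Omega>. AE \<omega>' in \<Omega>. ?f (shift kl (merge ?G \<omega> \<omega>')) = ?R \<omega> \<omega>'" by simp
  then show ?thesis
  proof eventually_elim
    case (elim \<omega>)
    have mR: "?R \<omega> \<in> borel_measurable \<Omega>"
    proof -
      have "(\<lambda>\<omega>'. \<lambda>m\<in>{..<h\<^sup>2}. window h kl (\<lambda>ij. Zp ij \<omega>') m + window h kl (\<lambda>ij. Zm ij \<omega>) m) \<in> \<Omega> \<rightarrow>\<^sub>M (\<Pi>\<^sub>M m\<in>{..<h\<^sup>2}. borel)"
        by (rule measurable_restrict) (simp add: window_def case_prod_unfold)
      from measurable_compose[OF this K] show ?thesis .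
    qed
    have "cexp ?G (\<lambda>\<omega>. ?f (shift kl \<omega>)) \<omega> = (\<integral>\<omega>'. ?R \<omega> \<omega>' \<partial>\<Omega>)"
      unfolding cexp_def by (rule integral_cong_AE) (use mR elim in measurable)
    moreover have "cexp (Gamma_set ((1, 1) - kl)) ?f (shift kl \<omega>) = cexp ?G (\<lambda>\<omega>. ?f (shift kl \<omega>)) \<omega>"
      by (subst cexp_shift) (simp_all add: Gamma_set_shift)
    moreover have "(\<lambda>m\<in>{..<h\<^sup>2}. window h kl (\<lambda>ij. Zp ij \<omega>') m + W_minus h Zm kl \<omega> m) =
        (\<lambda>m\<in>{..<h\<^sup>2}. window h kl (\<lambda>ij. Zp ij \<omega>') m + window h kl (\<lambda>ij. Zm ij \<omega>) m)" for \<omega>'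
      by (simp add: W_minus_def)
    ultimately show ?case by (simp add: K_kl_def)
  qed
qed

text \<open>The window at the origin contains only sites with nonpositive coordinates, and by
  causality \<open>Z\<close> at such a site uses only the quadrant of the origin.\<close>

lemma functional_adapted: "AE \<omega> in \<Omega>. cexp (Gamma_set (0, 0)) (functional h K Z) \<omega> = functional h K Z \<omega>"
proof -
  let ?G = "Gamma_set (0, 0)"
  have "AE x in \<Omega> \<Otimes>\<^sub>M \<Omega>. \<forall>ij. ij \<in> ?G \<longrightarrow> Z ij (merge ?G (fst x) (snd x)) = Z ij (fst x)"
    unfolding AE_all_countable
  proof
    fix ij
    have "AE x in \<Omega> \<Otimes>\<^sub>M \<Omega>. Z ij (merge ?G (fst x) (snd x)) = Z ij (merge UNIV (fst x) (snd x))"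
      if ij: "ij \<in> ?G"
    proof (rule has_L2_sum_merge[OF Z_sum])
      show "dep ?G (\<lambda>\<omega>. a rs * \<omega> (ij - rs))" for rs
      proof (cases "a rs = 0")
        case False
        then have "fst rs \<ge> 0 \<and> snd rs \<ge> 0" using causal[of "fst rs" "snd rs"] by auto
        then have "ij - rs \<in> ?G" using ij by (cases ij; cases rs) (auto simp: Gamma_set_def)
        then show ?thesis by (auto simp: dep_def)
      qed simp
    qed simp
    then show "AE x in \<Omega> \<Otimes>\<^sub>M \<Omega>. ij \<in> ?G \<longrightarrow> Z ij (merge ?G (fst x) (snd x)) = Z ij (fst x)"
      by (cases "ij \<in> ?G") auto
  qed
  then have "AE x in \<Omega> \<Otimes>\<^sub>M \<Omega>. functional h K Z (merge ?G (fst x) (snd x)) = functional h K Z (fst x)"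
  proof eventually_elim
    case (elim x)
    have "window h (0, 0) (\<lambda>ij. Z ij (merge ?G (fst x) (snd x))) = window h (0, 0) (\<lambda>ij. Z ij (fst x))"
    proof -
      have "Z (0 - int h + 1 + int (m div h), 0 - int h + 1 + int (m mod h)) (merge ?G (fst x) (snd x))
          = Z (0 - int h + 1 + int (m div h), 0 - int h + 1 + int (m mod h)) (fst x)" if "m < h\<^sup>2" for m
      proof -
        have "m div h < h" using that by (simp add: less_mult_imp_div_less power2_eq_square)
        then have "int (m div h) < int h" by simp
        moreover have "int (m mod h) < int h" using mod_less_divisor[OF h_pos] of_nat_less_iff by blast
        ultimately have "(0 - int h + 1 + int (m div h), 0 - int h + 1 + int (m mod h)) \<in> ?G"
          by (simp only: Gamma_set_def case_prod_conv mem_Collect_eq) linarith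
        then show ?thesis using elim by blast
      qed
      then show ?thesis by (auto simp: window_def fun_eq_iff)
    qed
    then show ?case by (simp add: functional_def)
  qed
  from Om2.AE_pair[OF this]
  have "AE \<omega> in \<Omega>. AE \<omega>' in \<Omega>. functional h K Z (merge ?G \<omega> \<omega>') = functional h K Z \<omega>" by simp
  then show ?thesis
  proof eventually_elim
    case (elim \<omega>)
    have "cexp ?G (functional h K Z) \<omega> = (\<integral>\<omega>'. functional h K Z \<omega> \<partial>\<Omega>)"
      unfolding cexp_def by (rule integral_cong_AE) (use elim in measurable)
    then show ?case by simp
  qed
qed

text \<open>By stationarity the shift leaves the norm unchanged. The indices start at 0, so the
  quadrant of \<open>(1, 1)\<close> is moved back by \<open>(k + 1, l + 1)\<close> and ends at
  \<open>(-k, -l)\<close>.\<close>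

lemma star_term:
  "Lp_norm \<Omega> p (\<lambda>\<omega>. K_kl P h K Zp (int (Suc k), int (Suc l)) (W_minus h Zm (int (Suc k), int (Suc l)) \<omega>))
     = Lp_norm \<Omega> p (cexp (Gamma_set (- int k, - int l)) (functional h K Z))"
proof -
  let ?u = "cexp (Gamma_set (- int k, - int l)) (functional h K Z)"
  let ?kl = "(int (Suc k), int (Suc l))"
  have "(\<integral>\<^sup>+\<omega>. ennreal (\<bar>K_kl P h K Zp ?kl (W_minus h Zm ?kl \<omega>)\<bar> powr p) \<partial>\<Omega>)
      = (\<integral>\<^sup>+\<omega>. ennreal (\<bar>?u (shift ?kl \<omega>)\<bar> powr p) \<partial>\<Omega>)"
    by (rule nn_integral_cong_AE) (use K_kl_eq_cexp[of ?kl] in \<open>auto elim: eventually_mono\<close>)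
  also have "\<dots> = (\<integral>\<^sup>+\<omega>. ennreal (\<bar>?u \<omega>\<bar> powr p) \<partial>\<Omega>)"
    using nn_integral_distr[OF shift_measurable, of "\<lambda>\<omega>. ennreal (\<bar>?u \<omega>\<bar> powr p)" ?kl]
    by (simp add: distr_shift)
  finally show ?thesis unfolding Lp_norm_def by simp
qed

lemma Lp_norm_2:
  assumes "L2 \<Omega> u"
  shows "Lp_norm \<Omega> 2 u = ennreal (nrm \<Omega> u)"
proof -
  have "(\<integral>\<^sup>+\<omega>. ennreal (\<bar>u \<omega>\<bar> powr 2) \<partial>\<Omega>) = (\<integral>\<^sup>+\<omega>. ennreal ((u \<omega>)\<^sup>2) \<partial>\<Omega>)"
    by (simp add: powr_numeral)
  also have "\<dots> = ennreal (\<integral>\<omega>. (u \<omega>)\<^sup>2 \<partial>\<Omega>)"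
    by (rule nn_integral_eq_integral[OF L2_sq[OF assms]]) simp
  finally show ?thesis by (simp add: Lp_norm_def nrm_def powr_half_sqrt)
qed

text \<open>Young's inequality with exponents \<open>2 / p\<close> and \<open>1 - 2 / p\<close>,
  integrated after normalization by \<open>c\<close>, the norm of order \<open>p\<close>.\<close>

lemma Lp_norm_2_le:
  assumes "2 < p" "L2 \<Omega> u"
  shows "Lp_norm \<Omega> 2 u \<le> Lp_norm \<Omega> p u"
proof (cases "(\<integral>\<^sup>+\<omega>. ennreal (\<bar>u \<omega>\<bar> powr p) \<partial>\<Omega>) = \<infinity>")
  case False
  note [measurable] = L2_meas[OF assms(2)]
  have i: "integrable \<Omega> (\<lambda>\<omega>. \<bar>u \<omega>\<bar> powr p)"
    using False by (intro integrableI_bounded) (auto simp: top.not_eq_extremum)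
  define I where "I = (\<integral>\<omega>. \<bar>u \<omega>\<bar> powr p \<partial>\<Omega>)"
  have I: "(\<integral>\<^sup>+\<omega>. ennreal (\<bar>u \<omega>\<bar> powr p) \<partial>\<Omega>) = ennreal I"
    unfolding I_def by (rule nn_integral_eq_integral[OF i]) simp
  have I0: "0 \<le> I" unfolding I_def by simp
  have "nrm \<Omega> u \<le> I powr (1 / p)"
  proof (cases "I = 0")
    case True
    then have "AE \<omega> in \<Omega>. \<bar>u \<omega>\<bar> powr p = 0"
      using integral_nonneg_eq_0_iff_AE[OF i] by (simp add: I_def)
    then have "AE \<omega> in \<Omega>. u \<omega> = 0" by eventually_elim simp
    then have "nrm \<Omega> u = nrm \<Omega> (\<lambda>\<omega>. 0)" by (intro nrm_cong_AE) auto
    then show ?thesis using True by (simp add: nrm_def)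
  next
    case False
    then have Ipos: "0 < I" using I0 by simp
    define c where "c = I powr (1 / p)"
    have c: "0 < c" "c powr p = I" using Ipos assms(1) by (auto simp: c_def powr_powr)
    have young: "x\<^sup>2 \<le> c\<^sup>2 * (2 / p * (\<bar>x\<bar> powr p / I) + (1 - 2 / p))" for x
    proof (cases "x = 0")
      case True
      then show ?thesis using assms(1) Ipos by simp
    next
      case False
      have "(\<bar>x\<bar> powr p / I) powr (2 / p) * 1 powr (1 - 2 / p) \<le> 2 / p * (\<bar>x\<bar> powr p / I) + (1 - 2 / p) * 1"
        by (rule Youngs_inequality_0) (use assms(1) Ipos False in auto)
      moreover have "(\<bar>x\<bar> powr p / I) powr (2 / p) = x\<^sup>2 / c\<^sup>2"
        using Ipos False assms(1) c by (simp add: powr_divide powr_powr c_def powr_numeral flip: powr_numeral[of "I powr (1 / p)"])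
      ultimately have "x\<^sup>2 / c\<^sup>2 \<le> 2 / p * (\<bar>x\<bar> powr p / I) + (1 - 2 / p)" by simp
      then have "c\<^sup>2 * (x\<^sup>2 / c\<^sup>2) \<le> c\<^sup>2 * (2 / p * (\<bar>x\<bar> powr p / I) + (1 - 2 / p))"
        by (rule mult_left_mono) simp
      then show ?thesis using c(1) by simp
    qed
    have "(nrm \<Omega> u)\<^sup>2 \<le> (\<integral>\<omega>. c\<^sup>2 * (2 / p * (\<bar>u \<omega>\<bar> powr p / I) + (1 - 2 / p)) \<partial>\<Omega>)"
      unfolding nrm_sq by (rule integral_mono[OF L2_sq[OF assms(2)]]) (use i young in auto)
    also have "\<dots> = c\<^sup>2"
      using i Ipos by (simp add: I_def[symmetric])
    finally have "nrm \<Omega> u \<le> c" by (rule power2_le_imp_le) (use c in simp)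
    then show ?thesis by (simp add: c_def)
  qed
  then show ?thesis
    unfolding Lp_norm_2[OF assms(2)] unfolding Lp_norm_def Let_def I using I0 by (simp add: ennreal_leI)
qed (simp add: Lp_norm_def)

lemma star_condition_2:
  assumes "2 < p" "star_condition P h K Z Zp Zm p"
  shows "star_condition P h K Z Zp Zm 2"
proof -
  let ?f = "functional h K Z"
  have i: "integrable \<Omega> ?f" "(\<integral>\<omega>. ?f \<omega> \<partial>\<Omega>) = 0" "integrable \<Omega> (\<lambda>\<omega>. \<bar>?f \<omega>\<bar> powr p)"
    and fin: "(\<Sum>k. \<Sum>l. Lp_norm \<Omega> p (cexp (Gamma_set (- int k, - int l)) ?f)
              / ennreal (sqrt (real (Suc k)) * sqrt (real (Suc l)))) < \<infinity>"
    using assms(2) unfolding star_condition_def star_term by auto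
  have i2: "integrable \<Omega> (\<lambda>\<omega>. \<bar>?f \<omega>\<bar> powr 2)"
  proof (rule Bochner_Integration.integrable_bound)
    show "integrable \<Omega> (\<lambda>\<omega>. 1 + \<bar>?f \<omega>\<bar> powr p)" using i by simp
    have "\<bar>x\<bar> powr 2 \<le> 1 + \<bar>x\<bar> powr p" for x :: real
    proof (cases "\<bar>x\<bar> \<le> 1")
      case True
      then have "\<bar>x\<bar> powr 2 \<le> 1" by (simp add: powr_numeral abs_square_le_1)
      then show ?thesis using powr_ge_zero[of "\<bar>x\<bar>" p] by linarith
    next
      case False
      then have "\<bar>x\<bar> powr 2 \<le> \<bar>x\<bar> powr p" using assms(1) by (intro powr_mono) auto
      then show ?thesis by simp
    qed
    then show "AE \<omega> in \<Omega>. norm (\<bar>?f \<omega>\<bar> powr 2) \<le> norm (1 + \<bar>?f \<omega>\<bar> powr p)"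
      by (intro AE_I2) (simp add: abs_of_nonneg add_nonneg_nonneg)
  qed measurable
  then have "L2 \<Omega> ?f" by (simp add: L2_def powr_numeral)
  then have "(\<Sum>k. \<Sum>l. Lp_norm \<Omega> 2 (cexp (Gamma_set (- int k, - int l)) ?f)
              / ennreal (sqrt (real (Suc k)) * sqrt (real (Suc l))))
     \<le> (\<Sum>k. \<Sum>l. Lp_norm \<Omega> p (cexp (Gamma_set (- int k, - int l)) ?f)
              / ennreal (sqrt (real (Suc k)) * sqrt (real (Suc l))))"
    by (intro suminf_le summableI divide_right_mono_ennreal Lp_norm_2_le assms L2_cexp)
  also note fin
  finally show ?thesis
    unfolding star_condition_def star_term using i(1,2) i2 by simp
qed

text \<open>Passes from a finite extended real series to a uniform bound for real sums over squares
  of indices, the form that \<open>projective_criterion\<close> takes.\<close>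

lemma star_condition_projective:
  assumes "star_condition P h K Z Zp Zm 2"
  shows "L2 \<Omega> (functional h K Z)"
    and "\<exists>S. \<forall>J. (\<Sum>k<J. \<Sum>l<J. nrm \<Omega> (cexp (Gamma_set (- int k, - int l)) (functional h K Z))
      / (sqrt (real (Suc k)) * sqrt (real (Suc l)))) \<le> S"
proof -
  let ?f = "functional h K Z"
  have i: "integrable \<Omega> (\<lambda>\<omega>. \<bar>?f \<omega>\<bar> powr 2)"
    and fin: "(\<Sum>k. \<Sum>l. Lp_norm \<Omega> 2 (cexp (Gamma_set (- int k, - int l)) ?f)
              / ennreal (sqrt (real (Suc k)) * sqrt (real (Suc l)))) < \<infinity>"
    using assms unfolding star_condition_def star_term by auto
  show L2: "L2 \<Omega> ?f" using i by (simp add: L2_def powr_numeral)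
  let ?x = "\<lambda>k l. nrm \<Omega> (cexp (Gamma_set (- int k, - int l)) ?f) / (sqrt (real (Suc k)) * sqrt (real (Suc l)))"
  have "Lp_norm \<Omega> 2 (cexp (Gamma_set (- int k, - int l)) ?f) / ennreal (sqrt (real (Suc k)) * sqrt (real (Suc l)))
      = ennreal (?x k l)" for k l
    by (simp add: Lp_norm_2 L2_cexp L2 divide_ennreal)
  then have fin': "(\<Sum>k. \<Sum>l. ennreal (?x k l)) < \<infinity>" using fin by simp
  have "(\<Sum>k<J. \<Sum>l<J. ?x k l) \<le> enn2real (\<Sum>k. \<Sum>l. ennreal (?x k l))" for J
  proof -
    have "ennreal (\<Sum>k<J. \<Sum>l<J. ?x k l) = (\<Sum>k<J. \<Sum>l<J. ennreal (?x k l))"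
      by (simp add: sum_nonneg)
    also have "\<dots> \<le> (\<Sum>k<J. \<Sum>l. ennreal (?x k l))"
      by (intro sum_mono sum_le_suminf summableI) auto
    also have "\<dots> \<le> (\<Sum>k. \<Sum>l. ennreal (?x k l))"
      by (intro sum_le_suminf summableI) auto
    finally have "ennreal (\<Sum>k<J. \<Sum>l<J. ?x k l) \<le> (\<Sum>k. \<Sum>l. ennreal (?x k l))" .
    then have "enn2real (ennreal (\<Sum>k<J. \<Sum>l<J. ?x k l)) \<le> enn2real (\<Sum>k. \<Sum>l. ennreal (?x k l))"
      using fin' by (intro enn2real_mono) auto
    then show ?thesis by (simp add: sum_nonneg)
  qed
  then show "\<exists>S. \<forall>J. (\<Sum>k<J. \<Sum>l<J. ?x k l) \<le> S" by blast
qed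

end

section \<open>Normal laws\<close>

text \<open>The real part of the characteristic function after a rotation by
  \<open>\<alpha>\<close>.\<close>

lemma std_normal_cos:
  "(\<integral>x. cos (c * x + \<alpha>) \<partial>std_normal_distribution) = cos \<alpha> * exp (- c\<^sup>2 / 2)"
proof -
  interpret real_distribution std_normal_distribution by (rule real_dist_normal_dist)
  have i: "integrable std_normal_distribution (\<lambda>x. iexp (c * x))"
    by (rule integrable_iexp) auto
  have "(\<integral>x. cos (c * x + \<alpha>) \<partial>std_normal_distribution) = (\<integral>x. Re (iexp \<alpha> * iexp (c * x)) \<partial>std_normal_distribution)"
    by (rule Bochner_Integration.integral_cong) (auto simp: Re_exp Im_exp cos_add algebra_simps)
  also have "\<dots> = Re (iexp \<alpha> * char std_normal_distribution c)"
    using i unfolding char_def by (subst integral_Re) simp_all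
  also have "\<dots> = cos \<alpha> * exp (- c\<^sup>2 / 2)"
    unfolding char_std_normal_distribution by (simp add: Re_exp)
  finally show ?thesis .
qed

text \<open>An affine image of the standard normal law covers the degenerate and the proper case by
  one formula.\<close>

lemma normal_law_eq_distr:
  assumes "0 \<le> s"
  shows "normal_law m s = distr std_normal_distribution borel (\<lambda>x. m + s * x)"
proof (cases "s = 0")
  case True
  interpret prob_space std_normal_distribution by (rule prob_space_normal_density) simp
  show ?thesis using True distr_const[of m borel] by (simp add: normal_law_def)
next
  case False
  interpret prob_space std_normal_distribution by (rule prob_space_normal_density) simp
  have "distributed std_normal_distribution lborel (\<lambda>x. x) (normal_density 0 1)"
    by (simp add: distributed_def distr_id2)
  from normal_density_affine[OF this, of s m] False
  have "distributed std_normal_distribution lborel (\<lambda>x. m + s * x) (normal_density m s)"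
    using assms by simp
  then have "distr std_normal_distribution lborel (\<lambda>x. m + s * x) = density lborel (normal_density m s)"
    by (simp add: distributed_def)
  moreover have "distr std_normal_distribution lborel (\<lambda>x. m + s * x) = distr std_normal_distribution borel (\<lambda>x. m + s * x)"
    by (rule distr_cong) auto
  ultimately show ?thesis using False by (simp add: normal_law_def)
qed

lemma
  assumes "0 \<le> s"
  shows real_distribution_normal_law: "real_distribution (normal_law m s)"
    and normal_law_cos: "(\<integral>x. cos (c * x + \<alpha>) \<partial>normal_law m s) = cos (c * m + \<alpha>) * exp (- (c * s)\<^sup>2 / 2)"
    and normal_law_mean: "integrable (normal_law m s) (\<lambda>x. x)" "(\<integral>x. x \<partial>normal_law m s) = m"
    and normal_law_square: "integrable (normal_law m s) (\<lambda>x. x\<^sup>2)" "(\<integral>x. x\<^sup>2 \<partial>normal_law m s) = m\<^sup>2 + s\<^sup>2"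
proof -
  let ?N = "std_normal_distribution"
  note eq = normal_law_eq_distr[OF assms, of m]
  interpret real_distribution ?N by (rule real_dist_normal_dist)
  show "real_distribution (normal_law m s)"
    unfolding eq by (rule real_distribution_distr) simp
  have "(\<integral>x. cos (c * x + \<alpha>) \<partial>normal_law m s) = (\<integral>x. cos ((c * s) * x + (c * m + \<alpha>)) \<partial>?N)"
    unfolding eq by (subst integral_distr) (auto simp: algebra_simps)
  then show "(\<integral>x. cos (c * x + \<alpha>) \<partial>normal_law m s) = cos (c * m + \<alpha>) * exp (- (c * s)\<^sup>2 / 2)"
    by (simp only: std_normal_cos)
  have i1: "integrable ?N (\<lambda>x. x)" using integrable_std_normal_distribution_moment[of 1] by simp
  have i2: "integrable ?N (\<lambda>x. x\<^sup>2)" using integrable_std_normal_distribution_moment[of 2] by simp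
  have m1: "(\<integral>x. x \<partial>?N) = 0" using integral_std_normal_distribution_moment_odd[of 1] by simp
  have m2: "(\<integral>x. x\<^sup>2 \<partial>?N) = 1" using std_normal_distribution_even_moments(1)[of 1] by simp
  have sq: "(m + s * x)\<^sup>2 = m\<^sup>2 + 2 * m * s * x + s\<^sup>2 * x\<^sup>2" for x
    by (simp add: power2_eq_square algebra_simps)
  have mm: "(\<lambda>x. m + s * x) \<in> ?N \<rightarrow>\<^sub>M borel" by simp
  have ident: "(\<lambda>x::real. x) \<in> borel_measurable borel" by simp
  have j1: "integrable ?N (\<lambda>x. m + s * x)"
    by (intro Bochner_Integration.integrable_add integrable_const integrable_mult_right i1)
  have j2: "integrable ?N (\<lambda>x. (m + s * x)\<^sup>2)"
    unfolding sq by (intro Bochner_Integration.integrable_add integrable_const integrable_mult_right i1 i2)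
  have c: "(\<integral>x. a \<partial>?N) = a" for a :: real by (simp only: lebesgue_integral_const prob_space scaleR_one)
  show "integrable (normal_law m s) (\<lambda>x. x)"
    unfolding eq integrable_distr_eq[OF mm ident] by (rule j1)
  show "integrable (normal_law m s) (\<lambda>x. x\<^sup>2)"
    unfolding eq integrable_distr_eq[OF mm borel_measurable_power[OF ident]] by (rule j2)
  have "(\<integral>x. x \<partial>normal_law m s) = (\<integral>x. m + s * x \<partial>?N)"
    unfolding eq by (rule integral_distr[OF mm ident])
  also have "\<dots> = (\<integral>x. m \<partial>?N) + s * (\<integral>x. x \<partial>?N)"
    by (subst Bochner_Integration.integral_add) (intro integrable_const integrable_mult_right i1 | simp only: integral_mult_right_zero)+
  finally show "(\<integral>x. x \<partial>normal_law m s) = m" by (simp only: c m1 mult_zero_right add_0_right)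
  have "(\<integral>x. x\<^sup>2 \<partial>normal_law m s) = (\<integral>x. (m + s * x)\<^sup>2 \<partial>?N)"
    unfolding eq by (rule integral_distr[OF mm borel_measurable_power[OF ident]])
  also have "\<dots> = (\<integral>x. m\<^sup>2 + 2 * m * s * x \<partial>?N) + (\<integral>x. s\<^sup>2 * x\<^sup>2 \<partial>?N)"
    unfolding sq by (intro Bochner_Integration.integral_add Bochner_Integration.integrable_add integrable_const integrable_mult_right i1 i2)
  also have "(\<integral>x. m\<^sup>2 + 2 * m * s * x \<partial>?N) = (\<integral>x. m\<^sup>2 \<partial>?N) + (\<integral>x. 2 * m * s * x \<partial>?N)"
    by (intro Bochner_Integration.integral_add integrable_const integrable_mult_right i1)
  finally show "(\<integral>x. x\<^sup>2 \<partial>normal_law m s) = m\<^sup>2 + s\<^sup>2"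
    by (simp only: c m1 m2 integral_mult_right_zero mult_zero_right add_0_right mult_1_right)
qed

section \<open>The central limit theorem\<close>

lemma tendsto_by_approx:
  fixes x :: "nat \<Rightarrow> real"
  assumes "\<And>\<epsilon>. 0 < \<epsilon> \<Longrightarrow> \<exists>y l. y \<longlonglongrightarrow> l \<and> \<bar>l - L\<bar> \<le> \<epsilon> \<and> (\<forall>\<^sub>F n in sequentially. \<bar>x n - y n\<bar> \<le> \<epsilon>)"
  shows "x \<longlonglongrightarrow> L"
proof (rule tendstoI)
  fix e :: real assume e: "0 < e"
  then obtain y l where y: "y \<longlonglongrightarrow> l" "\<bar>l - L\<bar> \<le> e / 4" "\<forall>\<^sub>F n in sequentially. \<bar>x n - y n\<bar> \<le> e / 4"
    using assms[of "e / 4"] by auto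
  have "\<forall>\<^sub>F n in sequentially. dist (y n) l < e / 4"
    using y(1) e by (intro tendstoD) auto
  with y(3) show "\<forall>\<^sub>F n in sequentially. dist (x n) L < e"
  proof eventually_elim
    case (elim n)
    then show ?case using y(2) e unfolding dist_real_def by linarith
  qed
qed

lemma convergent_by_approx:
  fixes x :: "nat \<Rightarrow> real"
  assumes "\<And>\<epsilon>. 0 < \<epsilon> \<Longrightarrow> \<exists>y l. y \<longlonglongrightarrow> l \<and> (\<forall>\<^sub>F n in sequentially. \<bar>x n - y n\<bar> \<le> \<epsilon>)"
  shows "convergent x"
  unfolding Cauchy_convergent_iff[symmetric]
proof (rule metric_CauchyI)
  fix e :: real assume e: "0 < e"
  then obtain y l where y: "y \<longlonglongrightarrow> l" "\<forall>\<^sub>F n in sequentially. \<bar>x n - y n\<bar> \<le> e / 8"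
    using assms[of "e / 8"] by auto
  have "\<forall>\<^sub>F n in sequentially. dist (y n) l < e / 8"
    using y(1) e by (intro tendstoD) auto
  with y(2) have "\<forall>\<^sub>F n in sequentially. \<bar>x n - l\<bar> < e / 2"
  proof eventually_elim
    case (elim n)
    then show ?case using e unfolding dist_real_def by linarith
  qed
  then obtain N where N: "\<And>n. n \<ge> N \<Longrightarrow> \<bar>x n - l\<bar> < e / 2" by (auto simp: eventually_sequentially)
  have "dist (x m) (x n) < e" if "m \<ge> N" "n \<ge> N" for m n
    using N[OF that(1)] N[OF that(2)] unfolding dist_real_def by linarith
  then show "\<exists>N. \<forall>m\<ge>N. \<forall>n\<ge>N. dist (x m) (x n) < e" by blast
qed

text \<open>A quarter period turns cosine into sine, so mean cosines with a phase determine the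
  characteristic function.\<close>

lemma char_distr_cos:
  assumes "prob_space M" and [measurable]: "S \<in> borel_measurable M"
  shows "char (distr M borel S) t = Complex (\<integral>x. cos (t * S x) \<partial>M) (\<integral>x. cos (t * S x + (- pi / 2)) \<partial>M)"
proof -
  interpret prob_space M by fact
  have i: "integrable M (\<lambda>x. iexp (t * S x))" by (rule integrable_iexp) auto
  have "char (distr M borel S) t = (CLINT x|M. iexp (t * S x))"
    unfolding char_def by (subst integral_distr) auto
  moreover have "Re (CLINT x|M. iexp (t * S x)) = (\<integral>x. cos (t * S x) \<partial>M)"
    by (subst integral_Re[OF i, symmetric]) (simp add: Re_exp)
  moreover have "Im (CLINT x|M. iexp (t * S x)) = (\<integral>x. cos (t * S x + (- pi / 2)) \<partial>M)"
    by (subst integral_Im[OF i, symmetric]) (simp add: Im_exp cos_diff)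
  ultimately show ?thesis by (simp add: complex_eq_iff)
qed

context iid_field begin

text \<open>The conclusion of \<open>nice_clt\<close> as a predicate of \<open>\<sigma>\<close>, so
  that the central limit theorem and the functional one can refer to the same constant of an
  approximant.\<close>

definition clt_const :: "((int \<times> int \<Rightarrow> real) \<Rightarrow> real) \<Rightarrow> real \<Rightarrow> bool" where
  "clt_const g \<sigma> \<longleftrightarrow> 0 \<le> \<sigma> \<and>
    (\<forall>m1 m2 F c. filterlim m1 at_top sequentially \<longrightarrow> filterlim m2 at_top sequentially \<longrightarrow>
       finite F \<longrightarrow> F \<subseteq> unit_square \<longrightarrow>
       (\<lambda>n. \<integral>\<omega>. (lincomb g (m1 n) (m2 n) F c \<omega>)\<^sup>2 \<partial>\<Omega>) \<longlonglongrightarrow> \<sigma>\<^sup>2 * (\<Sum>s\<in>F. \<Sum>t\<in>F. c s * c t * sheet_cov s t)) \<and>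
    (\<forall>m1 m2 F c \<alpha>. filterlim m1 at_top sequentially \<longrightarrow> filterlim m2 at_top sequentially \<longrightarrow>
       finite F \<longrightarrow> F \<subseteq> unit_square \<longrightarrow>
       (\<lambda>n. \<integral>\<omega>. cos (lincomb g (m1 n) (m2 n) F c \<omega> + \<alpha>) \<partial>\<Omega>)
         \<longlonglongrightarrow> cos \<alpha> * exp (- (\<sigma>\<^sup>2 * (\<Sum>s\<in>F. \<Sum>t\<in>F. c s * c t * sheet_cov s t)) / 2))"

lemma
  assumes "clt_const g \<sigma>" "filterlim m1 at_top sequentially" "filterlim m2 at_top sequentially"
    "finite F" "F \<subseteq> unit_square"
  shows clt_const_var: "(\<lambda>n. \<integral>\<omega>. (lincomb g (m1 n) (m2 n) F c \<omega>)\<^sup>2 \<partial>\<Omega>)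
      \<longlonglongrightarrow> \<sigma>\<^sup>2 * (\<Sum>s\<in>F. \<Sum>t\<in>F. c s * c t * sheet_cov s t)"
    and clt_const_cos: "(\<lambda>n. \<integral>\<omega>. cos (lincomb g (m1 n) (m2 n) F c \<omega> + \<alpha>) \<partial>\<Omega>)
      \<longlonglongrightarrow> cos \<alpha> * exp (- (\<sigma>\<^sup>2 * (\<Sum>s\<in>F. \<Sum>t\<in>F. c s * c t * sheet_cov s t)) / 2)"
  using assms by (simp_all add: clt_const_def)

lemma nice_clt_const: "nice g \<Longrightarrow> \<exists>\<sigma>. clt_const g \<sigma>"
  by (erule nice_clt) (auto simp: clt_const_def)

lemma lincomb_single:
  "lincomb g n1 n2 {(1, 1)} (\<lambda>_. c) \<omega> = c * (S_rect g n1 n2 \<omega> / sqrt (real (n1 * n2)))"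
  by (simp add: lincomb_def Bsum_1)

lemma nice_L2: "nice g \<Longrightarrow> L2 \<Omega> g"
  by (erule nice_props) (rule Om.L2_bounded)

lemma abs_integral_cos_diff:
  assumes "L2 \<Omega> u" "L2 \<Omega> v"
  shows "\<bar>(\<integral>\<omega>. cos (u \<omega> + \<alpha>) \<partial>\<Omega>) - (\<integral>\<omega>. cos (v \<omega> + \<alpha>) \<partial>\<Omega>)\<bar> \<le> nrm \<Omega> (\<lambda>\<omega>. u \<omega> - v \<omega>)"
proof -
  note [measurable] = L2_meas[OF assms(1)] L2_meas[OF assms(2)]
  have d: "L2 \<Omega> (\<lambda>\<omega>. u \<omega> - v \<omega>)" by (intro L2_diff assms)
  have i: "integrable \<Omega> (\<lambda>\<omega>. cos (u \<omega> + \<alpha>))" "integrable \<Omega> (\<lambda>\<omega>. cos (v \<omega> + \<alpha>))"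
    by (rule Om.integrable_bounded[where b=1]; simp)+
  have "\<bar>(\<integral>\<omega>. cos (u \<omega> + \<alpha>) \<partial>\<Omega>) - (\<integral>\<omega>. cos (v \<omega> + \<alpha>) \<partial>\<Omega>)\<bar>
      = \<bar>\<integral>\<omega>. cos (u \<omega> + \<alpha>) - cos (v \<omega> + \<alpha>) \<partial>\<Omega>\<bar>" using i by simp
  also have "\<dots> \<le> (\<integral>\<omega>. \<bar>cos (u \<omega> + \<alpha>) - cos (v \<omega> + \<alpha>)\<bar> \<partial>\<Omega>)" by (rule integral_abs_bound)
  also have "\<dots> \<le> (\<integral>\<omega>. \<bar>u \<omega> - v \<omega>\<bar> \<partial>\<Omega>)"
  proof (rule integral_mono)
    fix \<omega>
    have "\<bar>cos x - cos y\<bar> \<le> \<bar>x - y\<bar>" for x y :: real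
    proof -
      have "\<bar>cos x - cos y\<bar> = 2 * \<bar>sin ((x + y) / 2)\<bar> * \<bar>sin ((y - x) / 2)\<bar>"
        by (simp add: cos_diff_cos abs_mult)
      also have "\<dots> \<le> 2 * 1 * \<bar>(y - x) / 2\<bar>"
        by (intro mult_mono abs_sin_x_le_abs_x) auto
      finally show ?thesis by (simp add: abs_minus_commute)
    qed
    from this[of "u \<omega> + \<alpha>" "v \<omega> + \<alpha>"] show "\<bar>cos (u \<omega> + \<alpha>) - cos (v \<omega> + \<alpha>)\<bar> \<le> \<bar>u \<omega> - v \<omega>\<bar>" by simp
  qed (use i Om.L2_integrable[OF d] in auto)
  also have "\<dots> \<le> nrm \<Omega> (\<lambda>\<omega>. u \<omega> - v \<omega>)" by (rule Om.expectation_abs_le_nrm[OF d])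
  finally show ?thesis .
qed

lemma nrm_S_rect_diff_le:
  assumes "L2 \<Omega> f" "L2 \<Omega> g" "nrm \<Omega> (Mx (\<lambda>\<omega>. f \<omega> - g \<omega>) n1 n2) \<le> \<epsilon> * sqrt (real (n1 * n2))" "0 \<le> \<epsilon>"
  shows "nrm \<Omega> (\<lambda>\<omega>. S_rect f n1 n2 \<omega> / sqrt (real (n1 * n2)) - S_rect g n1 n2 \<omega> / sqrt (real (n1 * n2))) \<le> \<epsilon>"
proof (cases "n1 * n2 = 0")
  case False
  let ?q = "sqrt (real (n1 * n2))"
  have q: "0 < ?q" using False by simp
  have "nrm \<Omega> (\<lambda>\<omega>. S_rect f n1 n2 \<omega> / ?q - S_rect g n1 n2 \<omega> / ?q) = nrm \<Omega> (\<lambda>\<omega>. (1 / ?q) * S_rect (\<lambda>\<omega>. f \<omega> - g \<omega>) n1 n2 \<omega>)"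
    by (simp add: S_rect_diff diff_divide_distrib)
  also have "\<dots> = nrm \<Omega> (S_rect (\<lambda>\<omega>. f \<omega> - g \<omega>) n1 n2) / ?q"
    unfolding nrm_cmult using q by simp
  also have "\<dots> \<le> nrm \<Omega> (Mx (\<lambda>\<omega>. f \<omega> - g \<omega>) n1 n2) / ?q"
    using q assms(1,2) Mx_ge[of n1 n1 n2 n2]
    by (intro divide_right_mono nrm_mono L2_Mx L2_diff L2_meas[OF L2_S_rect] AE_I2) auto
  also have "\<dots> \<le> \<epsilon>" using assms(3) q by (simp add: field_simps)
  finally show ?thesis .
\<comment> \<open>For an empty rectangle both quotients are 0, since division by 0 gives 0.\<close>
qed (use assms(4) in \<open>auto simp: nrm_def\<close>)

text \<open>\<open>\<sigma>\<close> is the limit of the normalized norms, which converge because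
  they are uniformly close to the convergent norms of the approximants. The last conclusion keeps
  approximants whose own constants are close to \<open>\<sigma>\<close>, for use in the functional
  theorem.\<close>

theorem clt_by_approx:
  assumes f: "L2 \<Omega> f"
    and approx: "\<And>\<epsilon>. 0 < \<epsilon> \<Longrightarrow> \<exists>g. nice g \<and> (\<forall>n1 n2. nrm \<Omega> (Mx (\<lambda>\<omega>. f \<omega> - g \<omega>) n1 n2) \<le> \<epsilon> * sqrt (real (n1 * n2)))"
    and m: "filterlim m1 at_top sequentially" "filterlim m2 at_top sequentially"
  obtains \<sigma> where "0 \<le> \<sigma>"
    "(\<lambda>n. (\<integral>\<omega>. (S_rect f (m1 n) (m2 n) \<omega>)\<^sup>2 \<partial>\<Omega>) / real (m1 n * m2 n)) \<longlonglongrightarrow> \<sigma>\<^sup>2"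
    "weak_conv_m (\<lambda>n. distr \<Omega> borel (\<lambda>\<omega>. S_rect f (m1 n) (m2 n) \<omega> / sqrt (real (m1 n * m2 n)))) (normal_law 0 \<sigma>)"
    "\<And>\<epsilon>. 0 < \<epsilon> \<Longrightarrow> \<exists>g \<sigma>'. nice g \<and> clt_const g \<sigma>' \<and> \<bar>\<sigma>' - \<sigma>\<bar> \<le> \<epsilon> \<and>
       (\<forall>n1 n2. nrm \<Omega> (Mx (\<lambda>\<omega>. f \<omega> - g \<omega>) n1 n2) \<le> \<epsilon> * sqrt (real (n1 * n2)))"
proof -
  define s where "s g n \<omega> = S_rect g (m1 n) (m2 n) \<omega> / sqrt (real (m1 n * m2 n))" for g n \<omega>
  have sL2: "L2 \<Omega> (s g n)" if "L2 \<Omega> g" for g n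
    using L2_cmult[OF L2_S_rect[OF that], of "1 / sqrt (real (m1 n * m2 n))" "m1 n" "m2 n"] by (simp add: s_def[abs_def])
  have diff: "nrm \<Omega> (\<lambda>\<omega>. s f n \<omega> - s g n \<omega>) \<le> \<epsilon>"
    if "nice g" "\<forall>n1 n2. nrm \<Omega> (Mx (\<lambda>\<omega>. f \<omega> - g \<omega>) n1 n2) \<le> \<epsilon> * sqrt (real (n1 * n2))" "0 < \<epsilon>" for g \<epsilon> n
    unfolding s_def using that by (intro nrm_S_rect_diff_le f nice_L2) auto
  have ndiff: "\<bar>nrm \<Omega> (s f n) - nrm \<Omega> (s g n)\<bar> \<le> \<epsilon>"
    if "nice g" "\<forall>n1 n2. nrm \<Omega> (Mx (\<lambda>\<omega>. f \<omega> - g \<omega>) n1 n2) \<le> \<epsilon> * sqrt (real (n1 * n2))" "0 < \<epsilon>" for g \<epsilon> n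
    using nrm_triangle_diff[OF sL2[OF f] sL2[OF nice_L2[OF that(1)]], of n n]
      nrm_triangle_diff[OF sL2[OF nice_L2[OF that(1)]] sL2[OF f], of n n]
      diff[OF that, of n] nrm_minus_commute[of \<Omega> "s f n" "s g n"] by linarith
  have glim: "(\<lambda>n. nrm \<Omega> (s g n)) \<longlonglongrightarrow> \<sigma>'" if "clt_const g \<sigma>'" for g \<sigma>'
  proof -
    have "(\<lambda>n. \<integral>\<omega>. (lincomb g (m1 n) (m2 n) {(1, 1)} (\<lambda>_. 1) \<omega>)\<^sup>2 \<partial>\<Omega>)
       \<longlonglongrightarrow> \<sigma>'\<^sup>2 * (\<Sum>s\<in>{(1, 1)}. \<Sum>t\<in>{(1, 1)}. 1 * 1 * sheet_cov s t)"
      by (rule clt_const_var[OF that m, where c="\<lambda>_. 1"]) (auto simp: unit_square_def)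
    then have "(\<lambda>n. (nrm \<Omega> (s g n))\<^sup>2) \<longlonglongrightarrow> \<sigma>'\<^sup>2"
      unfolding lincomb_single nrm_sq by (simp add: s_def sheet_cov_def)
    then have "(\<lambda>n. sqrt ((nrm \<Omega> (s g n))\<^sup>2)) \<longlonglongrightarrow> sqrt (\<sigma>'\<^sup>2)" by (rule tendsto_real_sqrt)
    then show ?thesis using that by (simp add: clt_const_def)
  qed
  have "convergent (\<lambda>n. nrm \<Omega> (s f n))"
  proof (rule convergent_by_approx)
    fix \<epsilon> :: real assume e: "0 < \<epsilon>"
    then obtain g where g: "nice g" "\<forall>n1 n2. nrm \<Omega> (Mx (\<lambda>\<omega>. f \<omega> - g \<omega>) n1 n2) \<le> \<epsilon> * sqrt (real (n1 * n2))"
      using approx by blast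
    obtain \<sigma>' where "clt_const g \<sigma>'" using nice_clt_const[OF g(1)] by blast
    from glim[OF this] show "\<exists>y l. y \<longlonglongrightarrow> l \<and> (\<forall>\<^sub>F n in sequentially. \<bar>nrm \<Omega> (s f n) - y n\<bar> \<le> \<epsilon>)"
      using ndiff[OF g e] by (intro exI[of _ "\<lambda>n. nrm \<Omega> (s g n)"] exI[of _ \<sigma>']) auto
  qed
  then obtain \<sigma> where \<sigma>: "(\<lambda>n. nrm \<Omega> (s f n)) \<longlonglongrightarrow> \<sigma>" by (auto simp: convergent_def)
  have \<sigma>0: "0 \<le> \<sigma>" by (rule LIMSEQ_le_const[OF \<sigma>]) auto
  have ap: "\<exists>g \<sigma>'. nice g \<and> clt_const g \<sigma>' \<and> \<bar>\<sigma>' - \<sigma>\<bar> \<le> \<epsilon> \<and>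
       (\<forall>n1 n2. nrm \<Omega> (Mx (\<lambda>\<omega>. f \<omega> - g \<omega>) n1 n2) \<le> \<epsilon> * sqrt (real (n1 * n2)))" if e: "0 < \<epsilon>" for \<epsilon>
  proof -
    obtain g where g: "nice g" "\<forall>n1 n2. nrm \<Omega> (Mx (\<lambda>\<omega>. f \<omega> - g \<omega>) n1 n2) \<le> \<epsilon> * sqrt (real (n1 * n2))"
      using approx[OF e] by blast
    obtain \<sigma>' where c: "clt_const g \<sigma>'" using nice_clt_const[OF g(1)] by blast
    have "(\<lambda>n. \<bar>nrm \<Omega> (s f n) - nrm \<Omega> (s g n)\<bar>) \<longlonglongrightarrow> \<bar>\<sigma> - \<sigma>'\<bar>"
      by (intro tendsto_intros \<sigma> glim[OF c])
    then have "\<bar>\<sigma> - \<sigma>'\<bar> \<le> \<epsilon>"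
      by (rule LIMSEQ_le_const2) (use ndiff[OF g e] in auto)
    then show ?thesis using g c by (auto simp: abs_minus_commute)
  qed
  have lim2: "(\<lambda>n. (\<integral>\<omega>. (S_rect f (m1 n) (m2 n) \<omega>)\<^sup>2 \<partial>\<Omega>) / real (m1 n * m2 n)) \<longlonglongrightarrow> \<sigma>\<^sup>2"
  proof -
    have "(\<lambda>n. (nrm \<Omega> (s f n))\<^sup>2) \<longlonglongrightarrow> \<sigma>\<^sup>2" by (intro tendsto_intros \<sigma>)
    then show ?thesis by (simp add: nrm_sq s_def power_divide)
  qed
  have lim_cos: "(\<lambda>n. \<integral>\<omega>. cos (t * s f n \<omega> + \<alpha>) \<partial>\<Omega>) \<longlonglongrightarrow> cos \<alpha> * exp (- (t * \<sigma>)\<^sup>2 / 2)" for t \<alpha>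
  proof (rule tendsto_by_approx)
    fix \<epsilon> :: real assume e: "0 < \<epsilon>"
    have "isCont (\<lambda>x. cos \<alpha> * exp (- (t * x)\<^sup>2 / 2)) \<sigma>" by (intro continuous_intros) simp
    then obtain d where d: "0 < d" "\<And>x. \<bar>x - \<sigma>\<bar> < d \<Longrightarrow>
        \<bar>cos \<alpha> * exp (- (t * x)\<^sup>2 / 2) - cos \<alpha> * exp (- (t * \<sigma>)\<^sup>2 / 2)\<bar> < \<epsilon>"
      using e unfolding continuous_at_eps_delta dist_real_def by blast
    \<comment> \<open>\<open>d / 2\<close> keeps \<open>\<sigma>'\<close> where the limit has
      changed by less than \<open>\<epsilon>\<close>; the other entry pays for the Lipschitz
      constant \<open>|t|\<close> of the cosine.\<close>
    define \<delta> where "\<delta> = min (d / 2) (\<epsilon> / (\<bar>t\<bar> + 1))"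
    have \<delta>: "0 < \<delta>" "\<delta> < d" using d(1) e by (auto simp: \<delta>_def)
    have "\<bar>t\<bar> * \<delta> \<le> \<bar>t\<bar> * (\<epsilon> / (\<bar>t\<bar> + 1))" by (rule mult_left_mono) (auto simp: \<delta>_def)
    also have "\<dots> \<le> \<epsilon>" using e by (simp add: field_simps)
    finally have t\<delta>: "\<bar>t\<bar> * \<delta> \<le> \<epsilon>" .
    obtain g \<sigma>' where g: "nice g" "clt_const g \<sigma>'" "\<bar>\<sigma>' - \<sigma>\<bar> \<le> \<delta>"
      "\<forall>n1 n2. nrm \<Omega> (Mx (\<lambda>\<omega>. f \<omega> - g \<omega>) n1 n2) \<le> \<delta> * sqrt (real (n1 * n2))"
      using ap[OF \<delta>(1)] by blast
    have "(\<lambda>n. \<integral>\<omega>. cos (lincomb g (m1 n) (m2 n) {(1, 1)} (\<lambda>_. t) \<omega> + \<alpha>) \<partial>\<Omega>)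
       \<longlonglongrightarrow> cos \<alpha> * exp (- (\<sigma>'\<^sup>2 * (\<Sum>s\<in>{(1, 1)}. \<Sum>u\<in>{(1, 1)}. t * t * sheet_cov s u)) / 2)"
      by (rule clt_const_cos[OF g(2) m, where c="\<lambda>_. t" and \<alpha>=\<alpha>]) (auto simp: unit_square_def)
    then have "(\<lambda>n. \<integral>\<omega>. cos (t * s g n \<omega> + \<alpha>) \<partial>\<Omega>) \<longlonglongrightarrow> cos \<alpha> * exp (- (t * \<sigma>')\<^sup>2 / 2)"
      unfolding lincomb_single by (simp add: s_def sheet_cov_def power2_eq_square mult_ac)
    moreover have "\<bar>cos \<alpha> * exp (- (t * \<sigma>')\<^sup>2 / 2) - cos \<alpha> * exp (- (t * \<sigma>)\<^sup>2 / 2)\<bar> \<le> \<epsilon>"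
      using d(2)[of \<sigma>'] g(3) \<delta> by auto
    moreover have "\<bar>(\<integral>\<omega>. cos (t * s f n \<omega> + \<alpha>) \<partial>\<Omega>) - (\<integral>\<omega>. cos (t * s g n \<omega> + \<alpha>) \<partial>\<Omega>)\<bar> \<le> \<epsilon>" for n
    proof -
      have "\<bar>(\<integral>\<omega>. cos (t * s f n \<omega> + \<alpha>) \<partial>\<Omega>) - (\<integral>\<omega>. cos (t * s g n \<omega> + \<alpha>) \<partial>\<Omega>)\<bar>
          \<le> nrm \<Omega> (\<lambda>\<omega>. t * s f n \<omega> - t * s g n \<omega>)"
        by (intro abs_integral_cos_diff L2_cmult sL2 f nice_L2 g)
      also have "\<dots> = nrm \<Omega> (\<lambda>\<omega>. t * (s f n \<omega> - s g n \<omega>))" by (simp add: algebra_simps)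
      also have "\<dots> \<le> \<bar>t\<bar> * \<delta>"
        unfolding nrm_cmult by (intro mult_left_mono diff g \<delta>) auto
      finally show ?thesis using t\<delta> by linarith
    qed
    ultimately show "\<exists>y l. y \<longlonglongrightarrow> l \<and> \<bar>l - cos \<alpha> * exp (- (t * \<sigma>)\<^sup>2 / 2)\<bar> \<le> \<epsilon> \<and>
      (\<forall>\<^sub>F n in sequentially. \<bar>(\<integral>\<omega>. cos (t * s f n \<omega> + \<alpha>) \<partial>\<Omega>) - y n\<bar> \<le> \<epsilon>)"
      by (intro exI[of _ "\<lambda>n. \<integral>\<omega>. cos (t * s g n \<omega> + \<alpha>) \<partial>\<Omega>"] exI[of _ "cos \<alpha> * exp (- (t * \<sigma>')\<^sup>2 / 2)"]) auto
  qed
  have weak: "weak_conv_m (\<lambda>n. distr \<Omega> borel (s f n)) (normal_law 0 \<sigma>)"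
  proof (rule levy_continuity)
    have [measurable]: "s f n \<in> borel_measurable \<Omega>" for n using L2_meas[OF sL2[OF f]] .
    show "real_distribution (distr \<Omega> borel (s f n))" for n by (rule Om.real_distribution_distr) simp
    show rd: "real_distribution (normal_law 0 \<sigma>)" by (rule real_distribution_normal_law[OF \<sigma>0])
    fix t
    interpret N: real_distribution "normal_law 0 \<sigma>" by (rule rd)
    have id: "distr (normal_law 0 \<sigma>) borel (\<lambda>x. x) = normal_law 0 \<sigma>"
      by (rule distr_id2) simp
    have "char (normal_law 0 \<sigma>) t = Complex (\<integral>x. cos (t * x + 0) \<partial>normal_law 0 \<sigma>) (\<integral>x. cos (t * x + (- pi / 2)) \<partial>normal_law 0 \<sigma>)"
      using char_distr_cos[OF N.prob_space_axioms, of "\<lambda>x. x" t] by (simp add: id)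
    also have "\<dots> = Complex (cos 0 * exp (- (t * \<sigma>)\<^sup>2 / 2)) (cos (- pi / 2) * exp (- (t * \<sigma>)\<^sup>2 / 2))"
      unfolding normal_law_cos[OF \<sigma>0] by simp
    finally have c: "char (normal_law 0 \<sigma>) t = \<dots>" .
    have l0: "(\<lambda>n. \<integral>\<omega>. cos (t * s f n \<omega>) \<partial>\<Omega>) \<longlonglongrightarrow> cos 0 * exp (- (t * \<sigma>)\<^sup>2 / 2)"
      using lim_cos[of t 0] by (simp only: add_0_right)
    show "(\<lambda>n. char (distr \<Omega> borel (s f n)) t) \<longlonglongrightarrow> char (normal_law 0 \<sigma>) t"
      unfolding c char_distr_cos[OF Om.prob_space_axioms L2_meas[OF sL2[OF f]]]
      by (intro tendsto_Complex lim_cos l0)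
  qed
  have s_eq: "s f n = (\<lambda>\<omega>. S_rect f (m1 n) (m2 n) \<omega> / sqrt (real (m1 n * m2 n)))" for n
    by (rule ext) (rule s_def)
  show thesis
    by (rule that[OF \<sigma>0 lim2 weak[unfolded s_eq] ap])
qed

end

section \<open>A Cramer-Wold device\<close>

text \<open>Trigonometric polynomials in the coordinates from \<open>F\<close>. They form an algebra
  by the product-to-sum formula, and their means are controlled by cosines of linear
  combinations.\<close>

inductive_set trigs :: "'i set \<Rightarrow> (('i \<Rightarrow> real) \<Rightarrow> real) set" for F where
  trigs_base: "(\<lambda>x. k * cos ((\<Sum>i\<in>F. c i * x i) + \<alpha>)) \<in> trigs F"
| trigs_add: "u \<in> trigs F \<Longrightarrow> v \<in> trigs F \<Longrightarrow> (\<lambda>x. u x + v x) \<in> trigs F"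

lemma trigs_const: "(\<lambda>_. k) \<in> trigs F"
  using trigs_base[of k "\<lambda>_. 0" F 0] by simp

lemma trigs_sin:
  assumes "finite F" "i \<in> F"
  shows "(\<lambda>x. sin (a * x i)) \<in> trigs F"
proof -
  have "(\<Sum>j\<in>F. (if j = i then a else 0) * x j) = a * x i" for x
    using assms by (simp add: if_distrib[of "\<lambda>y. y * _"] cong: if_cong)
  then show ?thesis
    using trigs_base[of 1 "\<lambda>j. if j = i then a else 0" F "- (pi / 2)"] by (simp add: cos_diff)
qed

lemma trigs_mult:
  assumes "u \<in> trigs F" "v \<in> trigs F"
  shows "(\<lambda>x. u x * v x) \<in> trigs F"
  using assms(1)
proof induction
  case (trigs_base k c \<alpha>)
  show ?case using assms(2)
  proof induction
    case (trigs_base k' c' \<alpha>')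
    have "k * cos ((\<Sum>i\<in>F. c i * x i) + \<alpha>) * (k' * cos ((\<Sum>i\<in>F. c' i * x i) + \<alpha>')) =
       (k * k' / 2) * cos ((\<Sum>i\<in>F. (c i - c' i) * x i) + (\<alpha> - \<alpha>'))
       + (k * k' / 2) * cos ((\<Sum>i\<in>F. (c i + c' i) * x i) + (\<alpha> + \<alpha>'))" for x
    proof -
      have "cos A * cos B = (cos (A - B) + cos (A + B)) / 2" for A B :: real
        by (simp add: cos_diff cos_add)
      moreover have "(\<Sum>i\<in>F. c i * x i) + \<alpha> - ((\<Sum>i\<in>F. c' i * x i) + \<alpha>') = (\<Sum>i\<in>F. (c i - c' i) * x i) + (\<alpha> - \<alpha>')"
        by (simp add: sum_subtractf left_diff_distrib)
      moreover have "(\<Sum>i\<in>F. c i * x i) + \<alpha> + ((\<Sum>i\<in>F. c' i * x i) + \<alpha>') = (\<Sum>i\<in>F. (c i + c' i) * x i) + (\<alpha> + \<alpha>')"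
        by (simp add: sum.distrib distrib_right)
      ultimately have "cos ((\<Sum>i\<in>F. c i * x i) + \<alpha>) * cos ((\<Sum>i\<in>F. c' i * x i) + \<alpha>') =
         (cos ((\<Sum>i\<in>F. (c i - c' i) * x i) + (\<alpha> - \<alpha>')) + cos ((\<Sum>i\<in>F. (c i + c' i) * x i) + (\<alpha> + \<alpha>'))) / 2"
        by metis
      then have "(k * k') * (cos ((\<Sum>i\<in>F. c i * x i) + \<alpha>) * cos ((\<Sum>i\<in>F. c' i * x i) + \<alpha>')) = (k * k') *
         ((cos ((\<Sum>i\<in>F. (c i - c' i) * x i) + (\<alpha> - \<alpha>')) + cos ((\<Sum>i\<in>F. (c i + c' i) * x i) + (\<alpha> + \<alpha>'))) / 2)"
        by (rule arg_cong)
      then show ?thesis by (simp add: field_simps)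
    qed
    then show ?case
      by (simp only:) (intro trigs.intros)
  next
    case (trigs_add u v)
    then show ?case by (simp only: distrib_left) (rule trigs.trigs_add)
  qed
next
  case (trigs_add u' v')
  then show ?case by (simp only: distrib_right) (rule trigs.trigs_add)
qed

lemma trigs_continuous: "u \<in> trigs F \<Longrightarrow> continuous_on UNIV u"
proof (induction rule: trigs.induct)
  case (trigs_base k c \<alpha>)
  have "continuous_on UNIV (\<lambda>x. c i * x i)" for i
    by (rule continuous_on_mult_left[OF continuous_on_product_coordinates])
  then have "continuous_on UNIV (\<lambda>x. (\<Sum>i\<in>F. c i * x i) + \<alpha>)"
    by (intro continuous_on_add continuous_on_sum continuous_on_const)
  moreover have "continuous_on UNIV (cos :: real \<Rightarrow> real)" by (intro continuous_intros)
  ultimately have "continuous_on UNIV (\<lambda>x. cos ((\<Sum>i\<in>F. c i * x i) + \<alpha>))"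
    using continuous_on_compose2 by blast
  then show ?case by (rule continuous_on_mult_left)
qed (intro continuous_intros)

lemma trigs_bounded: "u \<in> trigs F \<Longrightarrow> \<exists>b. \<forall>x. \<bar>u x\<bar> \<le> b"
proof (induction rule: trigs.induct)
  case (trigs_base k c \<alpha>)
  have "\<bar>k * cos y\<bar> \<le> \<bar>k\<bar>" for y
    using mult_left_mono[OF abs_cos_le_one[of y] abs_ge_zero[of k]] by (simp add: abs_mult)
  then show ?case by blast
next
  case (trigs_add u v)
  then obtain b b' where "\<And>x. \<bar>u x\<bar> \<le> b" "\<And>x. \<bar>v x\<bar> \<le> b'" by blast
  then have "\<bar>u x + v x\<bar> \<le> b + b'" for x by (meson abs_triangle_ineq add_mono order_trans)
  then show ?case by blast
qed

lemma trigs_integrable: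
  fixes X :: "'a \<Rightarrow> 'i::countable \<Rightarrow> real"
  assumes "u \<in> trigs F" "prob_space M" "\<And>i. (\<lambda>\<omega>. X \<omega> i) \<in> borel_measurable M"
  shows "integrable M (\<lambda>\<omega>. u (X \<omega>))"
proof -
  interpret prob_space M by fact
  obtain b where "\<And>x. \<bar>u x\<bar> \<le> b" using trigs_bounded[OF assms(1)] by blast
  moreover have "(\<lambda>\<omega>. u (X \<omega>)) \<in> borel_measurable M"
    by (rule measurable_compose[OF measurable_coordinatewise_then_product[OF assms(3)]
          borel_measurable_continuous_onI[OF trigs_continuous[OF assms(1)]]])
  ultimately show ?thesis by (intro integrable_const_bound[of _ b]) auto
qed

lemma trigs_expectation_tendsto:
  fixes X :: "nat \<Rightarrow> 'a \<Rightarrow> 'i::countable \<Rightarrow> real" and Y :: "'b \<Rightarrow> 'i \<Rightarrow> real"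
  assumes "u \<in> trigs F" "prob_space M" "prob_space N"
    and X: "\<And>n i. (\<lambda>\<omega>. X n \<omega> i) \<in> borel_measurable M" and Y: "\<And>i. (\<lambda>\<omega>. Y \<omega> i) \<in> borel_measurable N"
    and lim: "\<And>c \<alpha>. (\<lambda>n. \<integral>\<omega>. cos ((\<Sum>i\<in>F. c i * X n \<omega> i) + \<alpha>) \<partial>M) \<longlonglongrightarrow> (\<integral>\<omega>. cos ((\<Sum>i\<in>F. c i * Y \<omega> i) + \<alpha>) \<partial>N)"
  shows "(\<lambda>n. \<integral>\<omega>. u (X n \<omega>) \<partial>M) \<longlonglongrightarrow> (\<integral>\<omega>. u (Y \<omega>) \<partial>N)"
  using assms(1)
proof induction
  case (trigs_base k c \<alpha>)
  show ?case by (simp add: tendsto_mult_left lim)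
next
  case (trigs_add u v)
  then show ?case
    using trigs_integrable[where X="X _" and M=M, OF _ assms(2) X] trigs_integrable[where X=Y, OF _ assms(3) Y]
    by (simp add: tendsto_add)
qed

text \<open>The coordinates are compressed by \<open>x \<mapsto> sin (x / L)\<close>, so that \<open>G\<close> becomes a continuous function on a
  cube, which Stone-Weierstrass approximates by trigonometric polynomials. Where some coordinate
  exceeds \<open>L\<close> the second moments are used.\<close>

theorem cramer_wold:
  fixes X :: "nat \<Rightarrow> 'a \<Rightarrow> 'i::countable \<Rightarrow> real" and Y :: "'b \<Rightarrow> 'i \<Rightarrow> real"
    and G :: "('i \<Rightarrow> real) \<Rightarrow> real"
  assumes M: "prob_space M" and N: "prob_space N" and F: "finite F"
    and X: "\<And>n i. (\<lambda>\<omega>. X n \<omega> i) \<in> borel_measurable M" and Y: "\<And>i. (\<lambda>\<omega>. Y \<omega> i) \<in> borel_measurable N"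
    and X2: "\<And>n i. i \<in> F \<Longrightarrow> integrable M (\<lambda>\<omega>. (X n \<omega> i)\<^sup>2)" "\<And>n i. i \<in> F \<Longrightarrow> (\<integral>\<omega>. (X n \<omega> i)\<^sup>2 \<partial>M) \<le> C"
    and Y2: "\<And>i. i \<in> F \<Longrightarrow> integrable N (\<lambda>\<omega>. (Y \<omega> i)\<^sup>2)" "\<And>i. i \<in> F \<Longrightarrow> (\<integral>\<omega>. (Y \<omega> i)\<^sup>2 \<partial>N) \<le> C"
    and lim: "\<And>c \<alpha>. (\<lambda>n. \<integral>\<omega>. cos ((\<Sum>i\<in>F. c i * X n \<omega> i) + \<alpha>) \<partial>M) \<longlonglongrightarrow> (\<integral>\<omega>. cos ((\<Sum>i\<in>F. c i * Y \<omega> i) + \<alpha>) \<partial>N)"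
    and G: "continuous_on UNIV G" "\<And>x. \<bar>G x\<bar> \<le> b" "\<And>x y. (\<And>i. i \<in> F \<Longrightarrow> x i = y i) \<Longrightarrow> G x = G y"
  shows "(\<lambda>n. \<integral>\<omega>. G (X n \<omega>) \<partial>M) \<longlonglongrightarrow> (\<integral>\<omega>. G (Y \<omega>) \<partial>N)"
proof (rule LIMSEQ_I)
  fix e :: real assume e: "0 < e"
  have b0: "0 \<le> b" using G(2)[of undefined] by linarith
  \<comment> \<open>\<open>D / L^2\<close> bounds the mean error from points with a coordinate above
    \<open>L\<close>, by Chebyshev's inequality and the bound \<open>b\<close> for
    \<open>G\<close>.\<close>
  define D where "D = 2 * b * real (card F) * (\<bar>C\<bar> + 1)"
  have D0: "0 \<le> D" using b0 by (simp add: D_def)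
  obtain L where L: "0 < L" "D / L\<^sup>2 < e / 8"
  proof -
    define L where "L = sqrt (8 * D / e + 1)"
    have p: "0 < 8 * D / e + 1" using D0 e by (intro add_nonneg_pos divide_nonneg_pos) auto
    then have "0 < L" "L\<^sup>2 = 8 * D / e + 1" by (simp_all add: L_def)
    moreover have "D / (8 * D / e + 1) < e / 8"
      using p e D0 by (subst pos_divide_less_eq) (auto simp: field_simps)
    ultimately show thesis using that[of L] by simp
  qed
  define y where "y x i = (if i \<in> F then sin (x i / L) else 0)" for x i
  \<comment> \<open>Coordinates outside \<open>F\<close> are frozen at 0, so the set is compact and
    the coordinates in \<open>F\<close> separate its points.\<close>
  define S :: "('i \<Rightarrow> real) set" where "S = PiE UNIV (\<lambda>i. if i \<in> F then {-1..1} else {0})"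
  define R where "R = {q. continuous_on S q \<and> (\<lambda>x. q (y x)) \<in> trigs F}"
  define H where "H z = G (\<lambda>i. L * arcsin (z i))" for z
  have Smem: "z \<in> S \<longleftrightarrow> (\<forall>i. if i \<in> F then -1 \<le> z i \<and> z i \<le> 1 else z i = 0)" for z
    unfolding S_def by (auto simp: PiE_iff split: if_splits)
  have yS: "y x \<in> S" for x by (simp add: Smem y_def)
  have cS: "compact S"
  proof -
    have "compactin (product_topology (\<lambda>i. euclidean) UNIV) (PiE UNIV (\<lambda>i. if i \<in> F then {-1..1} else {0::real}))"
      unfolding compactin_PiE by (auto simp: compactin_euclidean_iff)
    then show ?thesis unfolding S_def by (simp add: euclidean_product_topology compactin_euclidean_iff)
  qed
  interpret R: function_ring_on R S
  proof
    show "compact S" by (rule cS)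
    show "continuous_on S f" if "f \<in> R" for f using that by (simp add: R_def)
    show "(\<lambda>x. f x + g x) \<in> R" if "f \<in> R" "g \<in> R" for f g
      using that by (auto simp: R_def intro: continuous_intros trigs_add)
    show "(\<lambda>x. f x * g x) \<in> R" if "f \<in> R" "g \<in> R" for f g
      using that by (auto simp: R_def intro: continuous_intros trigs_mult)
    show "(\<lambda>_. c) \<in> R" for c by (simp add: R_def trigs_const)
    show "\<exists>f\<in>R. f x \<noteq> f z" if xz: "x \<in> S" "z \<in> S" "x \<noteq> z" for x z
    proof -
      obtain i where i: "x i \<noteq> z i" using xz(3) by auto
      then have "i \<in> F" using xz(1,2) unfolding Smem by metis
      have "continuous_on S (\<lambda>x. x i)"
        by (rule continuous_on_subset[OF continuous_on_product_coordinates]) simp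
      moreover have "(\<lambda>x. y x i) \<in> trigs F"
        using trigs_sin[OF F \<open>i \<in> F\<close>, of "1 / L"] \<open>i \<in> F\<close> by (simp add: y_def)
      ultimately show ?thesis using i by (intro bexI[of _ "\<lambda>x. x i"]) (auto simp: R_def)
    qed
  qed
  have Hcont: "continuous_on S H"
  proof -
    have "continuous_on S (\<lambda>z. L * arcsin (z i))" for i
    proof -
      have "continuous_on S (\<lambda>z. z i)"
        by (rule continuous_on_subset[OF continuous_on_product_coordinates]) simp
      then show ?thesis
        by (intro continuous_intros) (auto simp: Smem split: if_splits, (metis (no_types) neg_le_0_iff_le zero_le_one)+)
    qed
    then have "continuous_on S (\<lambda>z i. L * arcsin (z i))"
      by (rule continuous_on_coordinatewise_then_product)
    from continuous_on_compose2[OF G(1) this] show ?thesis unfolding H_def by simp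
  qed
  obtain q where q: "q \<in> R" "\<And>z. z \<in> S \<Longrightarrow> \<bar>H z - q z\<bar> < e / 8"
    using R.Stone_Weierstrass_basic[OF Hcont, of "e / 8"] e by auto
  have qt: "(\<lambda>x. q (y x)) \<in> trigs F" using q(1) by (simp add: R_def)
  have Gq: "\<bar>G x - q (y x)\<bar> \<le> e / 8 + 2 * b * (\<Sum>i\<in>F. (x i)\<^sup>2 / L\<^sup>2)" for x
  proof (cases "\<forall>i\<in>F. \<bar>x i\<bar> \<le> L")
    case True
    have "H (y x) = G x"
      unfolding H_def
    proof (rule G(3))
      fix i assume i: "i \<in> F"
      \<comment> \<open>In \<open>[-1, 1]\<close> the function \<open>arcsin\<close> inverts the
        sine, so the compression is undone exactly.\<close>
      have "\<bar>x i / L\<bar> \<le> 1" using True i L by (simp add: abs_divide)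
      then have "- (pi / 2) \<le> x i / L" "x i / L \<le> pi / 2" using pi_ge_two by linarith+
      then show "L * arcsin (y x i) = x i" using i L by (simp add: y_def arcsin_sin)
    qed
    moreover have "0 \<le> 2 * b * (\<Sum>i\<in>F. (x i)\<^sup>2 / L\<^sup>2)" using b0 by (simp add: sum_nonneg)
    ultimately show ?thesis using q(2)[OF yS, of x] by simp
  next
    case False
    then obtain i where i: "i \<in> F" "L < \<bar>x i\<bar>" by auto
    then have "L\<^sup>2 \<le> (x i)\<^sup>2" using L by (simp add: abs_le_square_iff[symmetric])
    then have "1 \<le> (x i)\<^sup>2 / L\<^sup>2" using L by simp
    also have "\<dots> \<le> (\<Sum>i\<in>F. (x i)\<^sup>2 / L\<^sup>2)" by (rule member_le_sum) (use i F in auto)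
    finally have "2 * b * 1 \<le> 2 * b * (\<Sum>i\<in>F. (x i)\<^sup>2 / L\<^sup>2)" by (rule mult_left_mono) (use b0 in simp)
    moreover have "\<bar>H (y x)\<bar> \<le> b" unfolding H_def by (rule G(2))
    ultimately show ?thesis using q(2)[OF yS, of x] G(2)[of x] by linarith
  qed
  have bound: "\<bar>(\<integral>\<omega>. G (Z \<omega>) \<partial>K) - (\<integral>\<omega>. q (y (Z \<omega>)) \<partial>K)\<bar> \<le> e / 4"
    if K: "prob_space K" and Z: "\<And>i. (\<lambda>\<omega>. Z \<omega> i) \<in> borel_measurable K"
      and Z2: "\<And>i. i \<in> F \<Longrightarrow> integrable K (\<lambda>\<omega>. (Z \<omega> i)\<^sup>2)" "\<And>i. i \<in> F \<Longrightarrow> (\<integral>\<omega>. (Z \<omega> i)\<^sup>2 \<partial>K) \<le> C"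
    for K :: "'c measure" and Z :: "'c \<Rightarrow> 'i \<Rightarrow> real"
  proof -
    interpret K: prob_space K by fact
    have iG: "integrable K (\<lambda>\<omega>. G (Z \<omega>))"
      by (rule K.integrable_const_bound[of _ b])
        (use G(2) measurable_compose[OF measurable_coordinatewise_then_product[OF Z] borel_measurable_continuous_onI[OF G(1)]] in auto)
    have iq: "integrable K (\<lambda>\<omega>. q (y (Z \<omega>)))" by (rule trigs_integrable[OF qt K Z])
    have "\<bar>(\<integral>\<omega>. G (Z \<omega>) \<partial>K) - (\<integral>\<omega>. q (y (Z \<omega>)) \<partial>K)\<bar> = \<bar>\<integral>\<omega>. G (Z \<omega>) - q (y (Z \<omega>)) \<partial>K\<bar>"
      using iG iq by simp
    also have "\<dots> \<le> (\<integral>\<omega>. \<bar>G (Z \<omega>) - q (y (Z \<omega>))\<bar> \<partial>K)" by (rule integral_abs_bound)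
    also have "\<dots> \<le> (\<integral>\<omega>. e / 8 + 2 * b * (\<Sum>i\<in>F. (Z \<omega> i)\<^sup>2 / L\<^sup>2) \<partial>K)"
      by (rule integral_mono) (use iG iq Z2 Gq in auto)
    also have "\<dots> = e / 8 + 2 * b * (\<Sum>i\<in>F. (\<integral>\<omega>. (Z \<omega> i)\<^sup>2 \<partial>K) / L\<^sup>2)"
      using Z2 by (simp add: K.prob_space)
    also have "\<dots> \<le> e / 8 + 2 * b * (\<Sum>i\<in>F. (\<bar>C\<bar> + 1) / L\<^sup>2)"
    proof (intro add_left_mono mult_left_mono sum_mono divide_right_mono)
      fix i assume "i \<in> F"
      from Z2(2)[OF this] show "(\<integral>\<omega>. (Z \<omega> i)\<^sup>2 \<partial>K) \<le> \<bar>C\<bar> + 1" by linarith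
    qed (use b0 in auto)
    also have "\<dots> = e / 8 + D / L\<^sup>2" by (simp add: D_def)
    also have "\<dots> \<le> e / 4" using L(2) by linarith
    finally show ?thesis .
  qed
  have "(\<lambda>n. \<integral>\<omega>. q (y (X n \<omega>)) \<partial>M) \<longlonglongrightarrow> (\<integral>\<omega>. q (y (Y \<omega>)) \<partial>N)"
    by (rule trigs_expectation_tendsto[OF qt M N X Y lim])
  from LIMSEQ_D[OF this, of "e / 4"] e obtain n0 where n0:
    "\<And>n. n \<ge> n0 \<Longrightarrow> \<bar>(\<integral>\<omega>. q (y (X n \<omega>)) \<partial>M) - (\<integral>\<omega>. q (y (Y \<omega>)) \<partial>N)\<bar> < e / 4" by auto
  show "\<exists>n0. \<forall>n\<ge>n0. norm ((\<integral>\<omega>. G (X n \<omega>) \<partial>M) - (\<integral>\<omega>. G (Y \<omega>) \<partial>N)) < e"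
  proof (intro exI allI impI)
    fix n assume n: "n0 \<le> n"
    have "\<bar>(\<integral>\<omega>. G (X n \<omega>) \<partial>M) - (\<integral>\<omega>. q (y (X n \<omega>)) \<partial>M)\<bar> \<le> e / 4" by (rule bound[OF M X X2])
    moreover have "\<bar>(\<integral>\<omega>. G (Y \<omega>) \<partial>N) - (\<integral>\<omega>. q (y (Y \<omega>)) \<partial>N)\<bar> \<le> e / 4" by (rule bound[OF N Y Y2])
    ultimately show "norm ((\<integral>\<omega>. G (X n \<omega>) \<partial>M) - (\<integral>\<omega>. G (Y \<omega>) \<partial>N)) < e"
      using n0[OF n] e unfolding real_norm_def by linarith
  qed
qed

section \<open>Weak convergence in metric spaces\<close>

lemma space_borel_of [simp]: "space (borel_of T) = topspace T"
  by (simp add: borel_of_def space_measure_of_conv)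

lemma sets_borel_of: "sets (borel_of T) = sigma_sets (topspace T) {U. openin T U}"
  unfolding borel_of_def by (rule sets_measure_of) (auto dest: openin_subset)

lemma openin_sets_borel_of: "openin T U \<Longrightarrow> U \<in> sets (borel_of T)"
  unfolding sets_borel_of by auto

lemma measurable_borel_ofI:
  assumes "\<And>\<omega>. \<omega> \<in> space M \<Longrightarrow> f \<omega> \<in> topspace T"
    and "\<And>U. openin T U \<Longrightarrow> f -` U \<inter> space M \<in> sets M"
  shows "f \<in> M \<rightarrow>\<^sub>M borel_of T"
  by (rule measurable_sigma_sets[OF sets_borel_of]) (use assms in \<open>auto dest: openin_subset\<close>)

lemma continuous_map_borel_of:
  assumes "continuous_map T euclideanreal \<phi>"
  shows "\<phi> \<in> borel_measurable (borel_of T)"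
proof (rule borel_measurableI)
  fix U :: "real set" assume "open U"
  then have "openin T {x \<in> topspace T. \<phi> x \<in> U}"
    using assms by (auto simp: continuous_map_def)
  moreover have "\<phi> -` U \<inter> space (borel_of T) = {x \<in> topspace T. \<phi> x \<in> U}" by auto
  ultimately show "\<phi> -` U \<inter> space (borel_of T) \<in> sets (borel_of T)"
    by (simp add: openin_sets_borel_of)
qed

context Metric_space
begin

lemma lipschitz_continuous_map:
  assumes "\<And>x y. x \<in> M \<Longrightarrow> y \<in> M \<Longrightarrow> \<bar>\<phi> x - \<phi> y\<bar> \<le> L * d x y"
  shows "continuous_map mtopology euclideanreal \<phi>"
proof -
  have "\<exists>\<delta>>0. \<forall>y. y \<in> M \<and> d x y < \<delta> \<longrightarrow> \<bar>\<phi> x - \<phi> y\<bar> < e" if "x \<in> M" "0 < e" for x e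
  proof (intro exI conjI allI impI)
    show "0 < e / (\<bar>L\<bar> + 1)" using that by auto
    fix y assume y: "y \<in> M \<and> d x y < e / (\<bar>L\<bar> + 1)"
    have "\<bar>\<phi> x - \<phi> y\<bar> \<le> L * d x y" using assms that y by auto
    also have "\<dots> \<le> (\<bar>L\<bar> + 1) * d x y" by (intro mult_right_mono) auto
    also have "\<dots> < e" using y by (simp add: field_simps)
    finally show "\<bar>\<phi> x - \<phi> y\<bar> < e" .
  qed
  then show ?thesis
    using Metric_space.metric_continuous_map[OF Metric_space_axioms Met_TC.Metric_space_axioms, of \<phi>]
    by (simp add: mtopology_is_euclidean dist_real_def)
qed

text \<open>The infimal convolution of \<open>\<phi>\<close> with \<open>k\<close> times the
  distance. Points at distance at least \<open>\<delta>\<close> from \<open>x\<close> cannot compete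
  with \<open>x\<close> itself once \<open>k * \<delta>\<close> reaches
  \<open>2 * b\<close>.\<close>

lemma lipschitz_lower_approx:
  assumes cont: "continuous_map mtopology euclideanreal \<phi>" and bd: "\<And>x. x \<in> M \<Longrightarrow> \<bar>\<phi> x\<bar> \<le> b"
  obtains \<psi> :: "nat \<Rightarrow> 'a \<Rightarrow> real" where
    "\<And>k x y. x \<in> M \<Longrightarrow> y \<in> M \<Longrightarrow> \<bar>\<psi> k x - \<psi> k y\<bar> \<le> real k * d x y"
    "\<And>k x. x \<in> M \<Longrightarrow> \<psi> k x \<le> \<phi> x" "\<And>k x. x \<in> M \<Longrightarrow> - b \<le> \<psi> k x"
    "\<And>x. x \<in> M \<Longrightarrow> (\<lambda>k. \<psi> k x) \<longlonglongrightarrow> \<phi> x"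
proof -
  define \<psi> where "\<psi> k x = (INF y\<in>M. \<phi> y + real k * d x y)" for k :: nat and x
  have bdd: "bdd_below ((\<lambda>y. \<phi> y + real k * d x y) ` M)" for k x
  proof (rule bdd_belowI2)
    fix y assume "y \<in> M"
    then have "- b \<le> \<phi> y" using bd[of y] by linarith
    then show "- b \<le> \<phi> y + real k * d x y" using nonneg[of x y] by (simp add: add_increasing2)
  qed
  have low: "\<psi> k x \<le> \<phi> y + real k * d x y" if "y \<in> M" for k x y
    unfolding \<psi>_def by (rule cINF_lower[OF bdd that])
  have le: "\<psi> k x \<le> \<phi> x" if "x \<in> M" for k x
    using low[OF that, of k x] that by simp
  have ge: "- b \<le> \<psi> k x" if "x \<in> M" for k x
    unfolding \<psi>_def
  proof (rule cINF_greatest)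
    fix y assume "y \<in> M"
    then have "- b \<le> \<phi> y" using bd[of y] by linarith
    then show "- b \<le> \<phi> y + real k * d x y" using nonneg[of x y] by (simp add: add_increasing2)
  qed (use that in auto)
  have lip1: "\<psi> k x \<le> \<psi> k y + real k * d x y" if "x \<in> M" "y \<in> M" for k x y
  proof -
    have "\<psi> k x - real k * d x y \<le> \<psi> k y"
      unfolding \<psi>_def[of k y]
    proof (rule cINF_greatest)
      fix z assume z: "z \<in> M"
      have "real k * d x z \<le> real k * (d x y + d y z)"
        using triangle[OF that z] by (intro mult_left_mono) auto
      then show "\<psi> k x - real k * d x y \<le> \<phi> z + real k * d y z"
        using low[OF z, of k x] by (simp add: distrib_left)
    qed (use that in auto)
    then show ?thesis by simp
  qed
  have lip: "\<bar>\<psi> k x - \<psi> k y\<bar> \<le> real k * d x y" if "x \<in> M" "y \<in> M" for k x y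
    using lip1[OF that, of k] lip1[OF that(2,1), of k] commute[of x y] by (simp add: abs_le_iff)
  have lim: "(\<lambda>k. \<psi> k x) \<longlonglongrightarrow> \<phi> x" if x: "x \<in> M" for x
  proof (rule LIMSEQ_I)
    fix e :: real assume e: "0 < e"
    have "\<forall>a\<in>M. \<forall>\<epsilon>>0. \<exists>\<delta>>0. \<forall>y. y \<in> M \<and> d a y < \<delta> \<longrightarrow> \<bar>\<phi> a - \<phi> y\<bar> < \<epsilon>"
      using cont Metric_space.metric_continuous_map[OF Metric_space_axioms Met_TC.Metric_space_axioms, of \<phi>]
      by (simp add: mtopology_is_euclidean dist_real_def)
    from bspec[OF this x, rule_format, of "e / 2"] e
    obtain \<delta> where \<delta>: "0 < \<delta>" "\<And>y. y \<in> M \<Longrightarrow> d x y < \<delta> \<Longrightarrow> \<bar>\<phi> x - \<phi> y\<bar> < e / 2"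
      by auto
    obtain k0 :: nat where k0: "2 * b / \<delta> \<le> real k0" using real_arch_simple by blast
    have "\<phi> x - e / 2 \<le> \<psi> k x" if k: "k \<ge> k0" for k
      unfolding \<psi>_def
    proof (rule cINF_greatest)
      fix y assume y: "y \<in> M"
      show "\<phi> x - e / 2 \<le> \<phi> y + real k * d x y"
      proof (cases "d x y < \<delta>")
        case True
        then show ?thesis using \<delta>(2)[OF y True] nonneg[of x y] by (smt (verit) mult_nonneg_nonneg of_nat_0_le_iff)
      next
        case False
        have "2 * b \<le> real k0 * \<delta>" using k0 \<delta>(1) by (simp add: field_simps)
        also have "\<dots> \<le> real k * d x y" using False k \<delta>(1) by (intro mult_mono) auto
        finally show ?thesis using bd[OF x] bd[OF y] e by (simp add: abs_le_iff)
      qed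
    qed (use x in auto)
    then have "norm (\<psi> k x - \<phi> x) < e" if "k \<ge> k0" for k
      using le[OF x, of k] that e by (smt (verit) field_sum_of_halves real_norm_def)
    then show "\<exists>n0. \<forall>k\<ge>n0. norm (\<psi> k x - \<phi> x) < e" by blast
  qed
  from that[OF lip le ge lim] show thesis .
qed

text \<open>Lipschitz minorants bound the lower limit of the means from below; applied to
  \<open>\<phi>\<close> and to its negative, this gives convergence.\<close>

lemma expectation_tendsto_of_lipschitz:
  assumes P: "prob_space P" and Q: "prob_space Q"
    and X: "\<And>n. X n \<in> P \<rightarrow>\<^sub>M borel_of mtopology" and Y: "Y \<in> Q \<rightarrow>\<^sub>M borel_of mtopology"
    and lim: "\<And>\<phi> b L. (\<And>x. x \<in> M \<Longrightarrow> \<bar>\<phi> x\<bar> \<le> b) \<Longrightarrow> (\<And>x y. x \<in> M \<Longrightarrow> y \<in> M \<Longrightarrow> \<bar>\<phi> x - \<phi> y\<bar> \<le> L * d x y) \<Longrightarrow>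
      (\<lambda>n. \<integral>\<omega>. \<phi> (X n \<omega>) \<partial>P) \<longlonglongrightarrow> (\<integral>\<omega>. \<phi> (Y \<omega>) \<partial>Q)"
    and \<phi>: "continuous_map mtopology euclideanreal \<phi>" "\<And>x. x \<in> M \<Longrightarrow> \<bar>\<phi> x\<bar> \<le> b"
  shows "(\<lambda>n. \<integral>\<omega>. \<phi> (X n \<omega>) \<partial>P) \<longlonglongrightarrow> (\<integral>\<omega>. \<phi> (Y \<omega>) \<partial>Q)"
proof -
  interpret P: prob_space P by fact
  interpret Q: prob_space Q by fact
  have XM: "X n \<omega> \<in> M" if "\<omega> \<in> space P" for n \<omega>
    using measurable_space[OF X that] by simp
  have YM: "Y \<omega> \<in> M" if "\<omega> \<in> space Q" for \<omega>
    using measurable_space[OF Y that] by simp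
  have lower: "\<forall>\<^sub>F n in sequentially. (\<integral>\<omega>. \<phi> (Y \<omega>) \<partial>Q) - e < (\<integral>\<omega>. \<phi> (X n \<omega>) \<partial>P)"
    if \<phi>: "continuous_map mtopology euclideanreal \<phi>" "\<And>x. x \<in> M \<Longrightarrow> \<bar>\<phi> x\<bar> \<le> b" and e: "0 < e" for \<phi> e
  proof -
    obtain \<psi> where \<psi>: "\<And>k x y. x \<in> M \<Longrightarrow> y \<in> M \<Longrightarrow> \<bar>\<psi> k x - \<psi> k y\<bar> \<le> real k * d x y"
      "\<And>k x. x \<in> M \<Longrightarrow> \<psi> k x \<le> \<phi> x" "\<And>k x. x \<in> M \<Longrightarrow> - b \<le> \<psi> k x"
      "\<And>x. x \<in> M \<Longrightarrow> (\<lambda>k. \<psi> k x) \<longlonglongrightarrow> \<phi> x"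
      using lipschitz_lower_approx[OF \<phi>] by blast
    have \<psi>b: "\<bar>\<psi> k x\<bar> \<le> b" if "x \<in> M" for k x
      using \<psi>(2,3)[OF that, of k] \<phi>(2)[OF that] by linarith
    have \<psi>m: "\<psi> k \<in> borel_measurable (borel_of mtopology)" for k
      by (rule continuous_map_borel_of[OF lipschitz_continuous_map[OF \<psi>(1)]])
    have \<phi>m: "\<phi> \<in> borel_measurable (borel_of mtopology)" by (rule continuous_map_borel_of[OF \<phi>(1)])
    have "(\<lambda>k. \<integral>\<omega>. \<psi> k (Y \<omega>) \<partial>Q) \<longlonglongrightarrow> (\<integral>\<omega>. \<phi> (Y \<omega>) \<partial>Q)"
    proof (rule integral_dominated_convergence[where w="\<lambda>_. b"])
      show "AE \<omega> in Q. (\<lambda>k. \<psi> k (Y \<omega>)) \<longlonglongrightarrow> \<phi> (Y \<omega>)" by (rule AE_I2) (simp add: \<psi>(4) YM)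
      show "AE \<omega> in Q. norm (\<psi> k (Y \<omega>)) \<le> b" for k by (rule AE_I2) (simp add: \<psi>b YM)
    qed (use measurable_compose[OF Y] \<psi>m \<phi>m in auto)
    then have "\<forall>\<^sub>F k in sequentially. (\<integral>\<omega>. \<phi> (Y \<omega>) \<partial>Q) - e < (\<integral>\<omega>. \<psi> k (Y \<omega>) \<partial>Q)"
      using e by (intro order_tendstoD(1)) auto
    then obtain k where k: "(\<integral>\<omega>. \<phi> (Y \<omega>) \<partial>Q) - e < (\<integral>\<omega>. \<psi> k (Y \<omega>) \<partial>Q)"
      by (auto simp: eventually_sequentially)
    have "(\<lambda>n. \<integral>\<omega>. \<psi> k (X n \<omega>) \<partial>P) \<longlonglongrightarrow> (\<integral>\<omega>. \<psi> k (Y \<omega>) \<partial>Q)"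
      by (rule lim[OF \<psi>b \<psi>(1)])
    then have "\<forall>\<^sub>F n in sequentially. (\<integral>\<omega>. \<phi> (Y \<omega>) \<partial>Q) - e < (\<integral>\<omega>. \<psi> k (X n \<omega>) \<partial>P)"
      using k by (intro order_tendstoD(1)) auto
    then show ?thesis
    proof eventually_elim
      case (elim n)
      have "(\<integral>\<omega>. \<psi> k (X n \<omega>) \<partial>P) \<le> (\<integral>\<omega>. \<phi> (X n \<omega>) \<partial>P)"
      proof (rule integral_mono)
        show "integrable P (\<lambda>\<omega>. \<psi> k (X n \<omega>))"
          by (rule P.integrable_const_bound[of _ b]) (use \<psi>b XM measurable_compose[OF X \<psi>m] in auto)
        show "integrable P (\<lambda>\<omega>. \<phi> (X n \<omega>))"
          by (rule P.integrable_const_bound[of _ b]) (use \<phi>(2) XM measurable_compose[OF X \<phi>m] in auto)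
      qed (use \<psi>(2) XM in auto)
      then show ?case using elim by linarith
    qed
  qed
  show ?thesis
  proof (rule order_tendstoI)
    fix a assume "a < (\<integral>\<omega>. \<phi> (Y \<omega>) \<partial>Q)"
    then show "\<forall>\<^sub>F n in sequentially. a < (\<integral>\<omega>. \<phi> (X n \<omega>) \<partial>P)"
      using lower[OF \<phi>, of "(\<integral>\<omega>. \<phi> (Y \<omega>) \<partial>Q) - a"] by simp
  next
    fix a assume "(\<integral>\<omega>. \<phi> (Y \<omega>) \<partial>Q) < a"
    moreover have "continuous_map mtopology euclideanreal (\<lambda>x. - \<phi> x)" using \<phi>(1) by (intro continuous_intros)
    ultimately show "\<forall>\<^sub>F n in sequentially. (\<integral>\<omega>. \<phi> (X n \<omega>) \<partial>P) < a"
      using lower[of "\<lambda>x. - \<phi> x" "a - (\<integral>\<omega>. \<phi> (Y \<omega>) \<partial>Q)"] \<phi>(2) by simp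
  qed
qed

text \<open>\<open>W q\<close> is the closed set of points at distance at least
  \<open>1 / (q + 1)\<close> from every point outside \<open>U\<close>. The limit lies in
  \<open>U\<close> exactly if the sequence is eventually in some \<open>W q\<close>.\<close>

lemma measurable_borel_of_limit:
  assumes f: "\<And>n. f n \<in> N \<rightarrow>\<^sub>M borel_of mtopology" and g: "\<And>\<omega>. \<omega> \<in> space N \<Longrightarrow> g \<omega> \<in> M"
    and lim: "\<And>\<omega>. \<omega> \<in> space N \<Longrightarrow> (\<lambda>n. d (f n \<omega>) (g \<omega>)) \<longlonglongrightarrow> 0"
  shows "g \<in> N \<rightarrow>\<^sub>M borel_of mtopology"
proof (rule measurable_borel_ofI)
  show "g \<omega> \<in> topspace mtopology" if "\<omega> \<in> space N" for \<omega> using g[OF that] by simp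
  fix U assume U: "openin mtopology U"
  define W where "W q = M - (\<Union>z\<in>M - U. mball z (1 / real (Suc q)))" for q
  have fM: "f n \<omega> \<in> M" if "\<omega> \<in> space N" for n \<omega> using measurable_space[OF f that] by simp
  have W: "W q \<in> sets (borel_of mtopology)" for q
  proof -
    have "openin mtopology (\<Union>z\<in>M - U. mball z (1 / real (Suc q)))" by (intro openin_Union) auto
    then have "space (borel_of mtopology) - (\<Union>z\<in>M - U. mball z (1 / real (Suc q))) \<in> sets (borel_of mtopology)"
      by (intro sets.compl_sets openin_sets_borel_of)
    then show ?thesis by (simp add: W_def)
  qed
  have "g -` U \<inter> space N = (\<Union>q. \<Union>m. \<Inter>n\<in>{m..}. f n -` W q \<inter> space N)"
  proof (intro set_eqI iffI)
    fix \<omega> assume w: "\<omega> \<in> g -` U \<inter> space N"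
    then obtain r where r: "0 < r" "mball (g \<omega>) r \<subseteq> U"
      using U unfolding openin_mtopology by auto
    obtain q where q: "inverse (real (Suc q)) < r / 2" using reals_Archimedean[of "r / 2"] r by auto
    have "\<forall>\<^sub>F n in sequentially. d (f n \<omega>) (g \<omega>) < r / 2"
      using lim[of \<omega>] w r by (intro order_tendstoD(2)) auto
    then obtain m where m: "\<And>n. n \<ge> m \<Longrightarrow> d (f n \<omega>) (g \<omega>) < r / 2" by (auto simp: eventually_sequentially)
    have "f n \<omega> \<in> W q" if "n \<ge> m" for n
    proof (rule ccontr)
      assume "f n \<omega> \<notin> W q"
      then obtain z where z: "z \<in> M" "z \<notin> U" "d z (f n \<omega>) < 1 / real (Suc q)"
        using fM[of \<omega> n] w by (auto simp: W_def)
      have "d (g \<omega>) z \<le> d (g \<omega>) (f n \<omega>) + d (f n \<omega>) z"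
        using triangle[of "g \<omega>" "f n \<omega>" z] g[of \<omega>] fM[of \<omega> n] z w by auto
      also have "\<dots> < r"
        using m[OF that] z(3) q by (simp add: commute inverse_eq_divide)
      finally show False using r z g[of \<omega>] w by auto
    qed
    then show "\<omega> \<in> (\<Union>q. \<Union>m. \<Inter>n\<in>{m..}. f n -` W q \<inter> space N)" using w by blast
  next
    fix \<omega> assume "\<omega> \<in> (\<Union>q. \<Union>m. \<Inter>n\<in>{m..}. f n -` W q \<inter> space N)"
    then obtain q m where qm: "\<And>n. n \<ge> m \<Longrightarrow> f n \<omega> \<in> W q" "\<omega> \<in> space N" by auto
    have "g \<omega> \<in> U"
    proof (rule ccontr)
      assume "g \<omega> \<notin> U"
      have "\<forall>\<^sub>F n in sequentially. d (f n \<omega>) (g \<omega>) < 1 / real (Suc q)"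
        using lim[OF qm(2)] by (intro order_tendstoD(2)) auto
      then obtain m' where m': "\<And>n. n \<ge> m' \<Longrightarrow> d (f n \<omega>) (g \<omega>) < 1 / real (Suc q)" by (auto simp: eventually_sequentially)
      have "f (max m m') \<omega> \<in> mball (g \<omega>) (1 / real (Suc q))"
        using m'[of "max m m'"] fM[OF qm(2)] g[OF qm(2)] by (simp add: commute)
      then have "f (max m m') \<omega> \<notin> W q" using \<open>g \<omega> \<notin> U\<close> g[OF qm(2)] by (auto simp: W_def)
      then show False using qm(1)[of "max m m'"] by simp
    qed
    then show "\<omega> \<in> g -` U \<inter> space N" using qm by auto
  qed
  also have "\<dots> \<in> sets N"
    by (rule sets.countable_UN, rule image_subsetI, rule sets.countable_UN, rule image_subsetI,
        rule sets.countable_INT, rule image_subsetI)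
      (use measurable_sets[OF f W] in auto)
  finally show "g -` U \<inter> space N \<in> sets N" .
qed

end

section \<open>Bilinear interpolation\<close>

text \<open>Its integer translates form a partition of unity.\<close>

definition hat :: "real \<Rightarrow> real" where
  "hat z = max 0 (1 - \<bar>z\<bar>)"

lemma hat_nonneg [simp]: "0 \<le> hat z"
  by (simp add: hat_def)

lemma hat_eq_0: "1 \<le> \<bar>z\<bar> \<Longrightarrow> hat z = 0"
  by (simp add: hat_def)

lemma sum_hat_atMost: "0 \<le> z \<Longrightarrow> (\<Sum>p\<le>M. hat (z - real p)) = cl (real M + 1 - z)"
proof (induction M)
  case (Suc M)
  then have "(\<Sum>p\<le>Suc M. hat (z - real p)) = cl (real M + 1 - z) + hat (z - (real M + 1))" by (simp add: add.commute)
  also have "\<dots> = cl (real M + 1 + 1 - z)" unfolding cl_def hat_def by (simp add: max_def min_def abs_if)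
  finally show ?case by (simp add: add.commute)
qed (auto simp: cl_def hat_def)

lemma sum_hat_eq_1: "0 \<le> z \<Longrightarrow> z \<le> real n \<Longrightarrow> (\<Sum>p\<le>n. hat (z - real p)) = 1"
  by (simp add: sum_hat_atMost cl_def)

text \<open>The cell weights are tails of this partition of unity, which is what turns weighted sums
  into interpolated rectangle sums.\<close>

lemma sum_hat_tail:
  assumes z: "0 \<le> z" "z \<le> real n" and k: "1 \<le> k" "k \<le> int n"
  shows "(\<Sum>p\<le>n. hat (z - real p) * (if k \<le> int p then 1 else 0)) = cl (z - real_of_int k + 1)"
proof -
  have e: "{..n} = {..nat (k - 1)} \<union> {p. p \<le> n \<and> k \<le> int p}" "{..nat (k - 1)} \<inter> {p. p \<le> n \<and> k \<le> int p} = {}"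
    using k by auto
  have "(\<Sum>p\<le>n. hat (z - real p) * (if k \<le> int p then 1 else 0)) = (\<Sum>p\<in>{p. p \<le> n \<and> k \<le> int p}. hat (z - real p))"
    by (rule sum.mono_neutral_cong_right) auto
  also have "\<dots> = (\<Sum>p\<le>n. hat (z - real p)) - (\<Sum>p\<le>nat (k - 1). hat (z - real p))"
    using sum.union_disjoint[OF _ _ e(2), of "\<lambda>p. hat (z - real p)"] e(1) by simp
  also have "\<dots> = 1 - cl (real_of_int k - z)"
  proof -
    have "cl (real (nat (k - 1)) + 1 - z) = cl (real_of_int k - z)" using k by simp
    then show ?thesis by (simp only: sum_hat_eq_1[OF z] sum_hat_atMost[OF z(1), of "nat (k - 1)"])
  qed
  also have "\<dots> = cl (z - real_of_int k + 1)" by (simp add: cl_def max_def min_def)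
  finally show ?thesis .
qed

definition interp :: "nat \<Rightarrow> nat \<Rightarrow> (nat \<Rightarrow> nat \<Rightarrow> real) \<Rightarrow> real \<times> real \<Rightarrow> real" where
  "interp n1 n2 s t = (\<Sum>p\<le>n1. \<Sum>q\<le>n2. hat (real n1 * fst t - real p) * hat (real n2 * snd t - real q) * s p q)"

text \<open>The interpolation is a convex combination of the values at nodes less than 1 away in
  each direction.\<close>

lemma interp_near:
  assumes t: "t \<in> unit_square"
    and s: "\<And>p q. p \<le> n1 \<Longrightarrow> q \<le> n2 \<Longrightarrow> \<bar>real n1 * fst t - real p\<bar> < 1 \<Longrightarrow> \<bar>real n2 * snd t - real q\<bar> < 1 \<Longrightarrow> \<bar>s p q - c\<bar> \<le> B"
  shows "\<bar>interp n1 n2 s t - c\<bar> \<le> B"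
proof -
  let ?u = "\<lambda>p. hat (real n1 * fst t - real p)" and ?v = "\<lambda>q. hat (real n2 * snd t - real q)"
  have tt: "0 \<le> real n1 * fst t" "real n1 * fst t \<le> real n1" "0 \<le> real n2 * snd t" "real n2 * snd t \<le> real n2"
    using t by (auto simp: unit_square_def mem_Times_iff mult_left_le)
  have one: "(\<Sum>p\<le>n1. \<Sum>q\<le>n2. ?u p * ?v q * x) = x" for x
    using sum_product[of ?u "{..n1}" ?v "{..n2}"] sum_hat_eq_1[OF tt(1,2)] sum_hat_eq_1[OF tt(3,4)]
    by (simp flip: sum_distrib_right)
  have "\<bar>interp n1 n2 s t - c\<bar> = \<bar>\<Sum>p\<le>n1. \<Sum>q\<le>n2. ?u p * ?v q * (s p q - c)\<bar>"
    using one[of c] by (simp add: interp_def right_diff_distrib sum_subtractf)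
  also have "\<dots> \<le> (\<Sum>p\<le>n1. \<Sum>q\<le>n2. \<bar>?u p * ?v q * (s p q - c)\<bar>)"
    by (rule order_trans[OF sum_abs sum_mono]) (rule sum_abs)
  also have "\<dots> \<le> (\<Sum>p\<le>n1. \<Sum>q\<le>n2. ?u p * ?v q * B)"
  proof (intro sum_mono)
    fix p q assume pq: "p \<in> {..n1}" "q \<in> {..n2}"
    show "\<bar>?u p * ?v q * (s p q - c)\<bar> \<le> ?u p * ?v q * B"
    proof (cases "\<bar>real n1 * fst t - real p\<bar> < 1 \<and> \<bar>real n2 * snd t - real q\<bar> < 1")
      case True
      then show ?thesis using s[of p q] pq by (simp add: abs_mult mult_left_mono)
    next
      case False
      then have "?u p * ?v q = 0" using hat_eq_0[of "real n1 * fst t - real p"] hat_eq_0[of "real n2 * snd t - real q"] by auto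
      then show ?thesis by (simp only: mult_zero_left abs_zero order_refl)
    qed
  qed
  also have "\<dots> = B" by (rule one)
  finally show ?thesis .
qed

lemma interp_eq_sum: "interp n1 n2 s t =
   (\<Sum>i\<in>{..n1} \<times> {..n2}. s (fst i) (snd i) * (hat (real n1 * fst t - real (fst i)) * hat (real n2 * snd t - real (snd i))))"
  unfolding interp_def by (simp add: sum.cartesian_product case_prod_unfold mult_ac)

lemma continuous_hat: "continuous_on A (\<lambda>t. hat (c * fst t - d))" "continuous_on A (\<lambda>t. hat (c * snd t - d))"
  unfolding hat_def by (intro continuous_intros)+

section \<open>Smoothed sums as interpolated rectangle sums\<close>

context iid_field
begin

text \<open>Membership of \<open>k\<close> in the rectangle up to \<open>(p, q)\<close> is a product
  of two indicators. After exchanging sums, the sums over nodes factorize and are cell weights by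
  \<open>sum_hat_tail\<close>.\<close>

lemma Bsum_eq_interp:
  assumes t: "t \<in> unit_square"
  shows "Bsum g n1 n2 t \<omega> = interp n1 n2 (\<lambda>p q. S_rect g p q \<omega>) t"
proof -
  let ?u = "\<lambda>p. hat (real n1 * fst t - real p)" and ?v = "\<lambda>q. hat (real n2 * snd t - real q)"
  let ?V = "{1..int n1} \<times> {1..int n2}"
  have tt: "0 \<le> real n1 * fst t" "real n1 * fst t \<le> real n1" "0 \<le> real n2 * snd t" "real n2 * snd t \<le> real n2"
    using t by (auto simp: unit_square_def mem_Times_iff mult_left_le)
  let ?e = "\<lambda>k p. if k \<le> int p then 1 else (0::real)"
  have S: "S_rect g p q \<omega> = (\<Sum>k\<in>?V. ?e (fst k) p * ?e (snd k) q * g (shift k \<omega>))" if "p \<le> n1" "q \<le> n2" for p q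
    unfolding S_rect_def by (rule sum.mono_neutral_cong_left) (use that in auto)
  have "interp n1 n2 (\<lambda>p q. S_rect g p q \<omega>) t
      = (\<Sum>p\<le>n1. \<Sum>q\<le>n2. \<Sum>k\<in>?V. (?u p * ?e (fst k) p) * (?v q * ?e (snd k) q) * g (shift k \<omega>))"
    unfolding interp_def by (intro sum.cong refl) (auto simp: S sum_distrib_left mult_ac intro!: sum.cong)
  also have "\<dots> = (\<Sum>p\<le>n1. \<Sum>k\<in>?V. \<Sum>q\<le>n2. (?u p * ?e (fst k) p) * (?v q * ?e (snd k) q) * g (shift k \<omega>))"
    by (intro sum.cong refl) (rule sum.swap)
  also have "\<dots> = (\<Sum>k\<in>?V. \<Sum>p\<le>n1. \<Sum>q\<le>n2. (?u p * ?e (fst k) p) * (?v q * ?e (snd k) q) * g (shift k \<omega>))"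
    by (rule sum.swap)
  also have "\<dots> = (\<Sum>k\<in>?V. (\<Sum>p\<le>n1. ?u p * ?e (fst k) p) * (\<Sum>q\<le>n2. ?v q * ?e (snd k) q) * g (shift k \<omega>))"
    by (intro sum.cong refl) (subst sum_product, simp only: sum_distrib_right)
  also have "\<dots> = Bsum g n1 n2 t \<omega>"
    unfolding Bsum_def
  proof (rule sum.cong[OF refl])
    fix k assume k: "k \<in> ?V"
    then have k': "1 \<le> fst k" "fst k \<le> int n1" "1 \<le> snd k" "snd k \<le> int n2" by auto
    show "(\<Sum>p\<le>n1. ?u p * ?e (fst k) p) * (\<Sum>q\<le>n2. ?v q * ?e (snd k) q) * g (shift k \<omega>) =
        wt n1 (fst t) (fst k) * wt n2 (snd t) (snd k) * g (shift k \<omega>)"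
      unfolding sum_hat_tail[OF tt(1,2) k'(1,2)] sum_hat_tail[OF tt(3,4) k'(3,4)] by (simp add: wt_def k')
  qed
  finally show ?thesis ..
qed

lemma Bsum_diff: "Bsum (\<lambda>\<omega>. f \<omega> - g \<omega>) n1 n2 t \<omega> = Bsum f n1 n2 t \<omega> - Bsum g n1 n2 t \<omega>"
  by (simp add: Bsum_def right_diff_distrib sum_subtractf)

lemma abs_Bsum_le_Mx:
  assumes "t \<in> unit_square"
  shows "\<bar>Bsum g n1 n2 t \<omega>\<bar> \<le> Mx g n1 n2 \<omega>"
  using interp_near[OF assms, of n1 n2 "\<lambda>p q. S_rect g p q \<omega>" 0 "Mx g n1 n2 \<omega>"]
  by (simp add: Bsum_eq_interp[OF assms] Mx_ge)

text \<open>Every node that enters the interpolation is within 1 of its point; two points account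
  for the slack of 2.\<close>

lemma abs_Bsum_diff_le:
  assumes t: "t \<in> unit_square" and t': "t' \<in> unit_square"
    and s: "\<And>p q p' q'. p \<le> n1 \<Longrightarrow> q \<le> n2 \<Longrightarrow> p' \<le> n1 \<Longrightarrow> q' \<le> n2 \<Longrightarrow>
       \<bar>real p - real p'\<bar> \<le> real n1 * \<bar>fst t - fst t'\<bar> + 2 \<Longrightarrow> \<bar>real q - real q'\<bar> \<le> real n2 * \<bar>snd t - snd t'\<bar> + 2 \<Longrightarrow>
       \<bar>S_rect g p q \<omega> - S_rect g p' q' \<omega>\<bar> \<le> B"
  shows "\<bar>Bsum g n1 n2 t \<omega> - Bsum g n1 n2 t' \<omega>\<bar> \<le> B"
proof -
  have close: "\<bar>real p - real p'\<bar> \<le> real n * \<bar>x - x'\<bar> + 2" if "\<bar>real n * x - real p\<bar> < 1" "\<bar>real n * x' - real p'\<bar> < 1" for n p p' x x'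
  proof -
    have "real n * \<bar>x - x'\<bar> = \<bar>real n * x - real n * x'\<bar>" by (simp add: abs_mult flip: right_diff_distrib)
    then show ?thesis using that by linarith
  qed
  show ?thesis
    unfolding Bsum_eq_interp[OF t]
  proof (rule interp_near[OF t])
    fix p q assume p: "p \<le> n1" "q \<le> n2" "\<bar>real n1 * fst t - real p\<bar> < 1" "\<bar>real n2 * snd t - real q\<bar> < 1"
    have "\<bar>Bsum g n1 n2 t' \<omega> - S_rect g p q \<omega>\<bar> \<le> B"
      unfolding Bsum_eq_interp[OF t']
    proof (rule interp_near[OF t'])
      fix p' q' assume p': "p' \<le> n1" "q' \<le> n2" "\<bar>real n1 * fst t' - real p'\<bar> < 1" "\<bar>real n2 * snd t' - real q'\<bar> < 1"
      show "\<bar>S_rect g p' q' \<omega> - S_rect g p q \<omega>\<bar> \<le> B"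
        using s[OF p(1,2) p'(1,2) close[OF p(3) p'(3)] close[OF p(4) p'(4)]] by (simp add: abs_minus_commute)
    qed
    then show "\<bar>S_rect g p q \<omega> - Bsum g n1 n2 t' \<omega>\<bar> \<le> B" by (simp add: abs_minus_commute)
  qed
qed

lemma S_rect_strip1: "S_rect g (a + i) j \<omega> = S_rect g a j \<omega> + S_rect g i j (shift (int a, 0) \<omega>)"
proof (induction i)
  case (Suc i)
  have "shift (1 + int (a + i), l) \<omega> = shift (1 + int i, l) (shift (int a, 0) \<omega>)" for l
    by (simp add: shift_def fun_eq_iff add_ac)
  then show ?case using Suc by (simp add: S_rect_Suc1)
qed simp

lemma S_rect_strip2: "S_rect g i (a + j) \<omega> = S_rect g i a \<omega> + S_rect g i j (shift (0, int a) \<omega>)"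
proof (induction j)
  case (Suc j)
  have "shift (l, 1 + int (a + j)) \<omega> = shift (l, 1 + int j) (shift (0, int a) \<omega>)" for l
    by (simp add: shift_def fun_eq_iff add_ac)
  then show ?case using Suc by (simp add: S_rect_Suc2)
qed simp

text \<open>Since \<open>t\<close> lies in the unit square, cells beyond \<open>(n1, n2)\<close> do
  not meet \<open>V_rect\<close>, and the infinite sum becomes finite.\<close>

lemma B_rect_eq_Bsum:
  assumes t: "t \<in> unit_square"
  shows "B_rect f n1 n2 t \<omega> = Bsum f n1 n2 t \<omega>"
proof -
  have cell: "{0..x} \<inter> {real_of_int k - 1<..real_of_int k} = {real_of_int k - 1<..min x (real_of_int k)}" if "1 \<le> k" for x k
    using that by auto
  have len: "emeasure lborel {real_of_int k - 1<..min x (real_of_int k)} = ennreal (cl (x - real_of_int k + 1))" for x k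
    by (cases "real_of_int k \<le> x"; cases "real_of_int k - 1 \<le> x") (simp_all add: cl_def)
  have meas: "measure lborel (V_rect n1 n2 t \<inter> R_cell k) =
      cl (real n1 * fst t - real_of_int (fst k) + 1) * cl (real n2 * snd t - real_of_int (snd k) + 1)"
    if k: "1 \<le> fst k" "1 \<le> snd k" for k
  proof -
    have "V_rect n1 n2 t \<inter> R_cell k = {real_of_int (fst k) - 1<..min (real n1 * fst t) (real_of_int (fst k))} \<times>
        {real_of_int (snd k) - 1<..min (real n2 * snd t) (real_of_int (snd k))}"
      unfolding V_rect_def R_cell_def Times_Int_Times cell[OF k(1)] cell[OF k(2)] ..
    then have "emeasure (lborel :: (real \<times> real) measure) (V_rect n1 n2 t \<inter> R_cell k) =
        ennreal (cl (real n1 * fst t - real_of_int (fst k) + 1)) * ennreal (cl (real n2 * snd t - real_of_int (snd k) + 1))"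
      by (simp only: lborel_prod[symmetric]) (simp add: lborel.emeasure_pair_measure_Times len)
    moreover have "0 \<le> cl x" for x by (simp add: cl_def)
    ultimately show ?thesis by (simp add: measure_def enn2real_mult)
  qed
  have zero: "cl (real n * x - real_of_int k + 1) = 0" if "x \<le> 1" "int n < k" for n x k
  proof -
    have "real n * x \<le> real n * 1" by (rule mult_left_mono) (use that in auto)
    moreover have "real n + 1 \<le> real_of_int k" using that by linarith
    ultimately show ?thesis by (simp add: cl_def)
  qed
  have "B_rect f n1 n2 t \<omega> = infsum (\<lambda>k. wt n1 (fst t) (fst k) * wt n2 (snd t) (snd k) * f (shift k \<omega>)) ({1..int n1} \<times> {1..int n2})"
    unfolding B_rect_def
  proof (rule infsum_cong_neutral)
    fix k assume k: "k \<in> {1..} \<times> {1..} - {1..int n1} \<times> {1..int n2}"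
    then have "int n1 < fst k \<or> int n2 < snd k" "1 \<le> fst k" "1 \<le> snd k" by auto
    then show "measure lborel (V_rect n1 n2 t \<inter> R_cell k) * f (shift k \<omega>) = 0"
      using zero[of "fst t" n1 "fst k"] zero[of "snd t" n2 "snd k"] t
      by (auto simp: meas unit_square_def mem_Times_iff)
  next
    fix k assume "k \<in> {1..} \<times> {1..} \<inter> {1..int n1} \<times> {1..int n2}"
    then show "measure lborel (V_rect n1 n2 t \<inter> R_cell k) * f (shift k \<omega>) =
        wt n1 (fst t) (fst k) * wt n2 (snd t) (snd k) * f (shift k \<omega>)"
      by (auto simp: meas wt_def)
  qed auto
  then show ?thesis by (simp add: Bsum_def)
qed

end

section \<open>The space of continuous functions on the square\<close>

definition Cm :: "(real \<times> real \<Rightarrow> real) metric" where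
  "Cm = cfunspace (top_of_set unit_square) euclidean_metric"

interpretation C: Metric_space "mspace Cm" "mdist Cm"
  by (rule Metric_space_mspace_mdist)

lemma C_square_eq: "C_square = C.mtopology"
  by (simp add: C_square_def Cm_def mtopology_of_def)

lemma compact_unit_square: "compact unit_square"
  unfolding unit_square_def by (intro compact_Times compact_Icc)

lemma mspace_Cm: "f \<in> mspace Cm \<longleftrightarrow> f \<in> extensional unit_square \<and> continuous_on unit_square f"
proof -
  have "bounded (f ` unit_square)" if "continuous_on unit_square f"
    by (rule compact_imp_bounded[OF compact_continuous_image[OF that compact_unit_square]])
  then show ?thesis unfolding Cm_def by (auto simp: Met_TC.mbounded_def)
qed

lemma restrict_mspace_Cm: "(\<lambda>t\<in>unit_square. f t) \<in> mspace Cm \<longleftrightarrow> continuous_on unit_square f"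
  unfolding mspace_Cm by (simp cong: continuous_on_cong)

lemma mdist_Cm_le:
  assumes "\<And>t. t \<in> unit_square \<Longrightarrow> \<bar>f t - g t\<bar> \<le> a"
  shows "mdist Cm f g \<le> a"
proof -
  have "0 \<le> a" using assms[of "(0, 0)"] by (auto simp: unit_square_def)
  then show ?thesis unfolding Cm_def by (rule mdist_cfunspace_le) (use assms in \<open>simp add: dist_real_def\<close>)
qed

text \<open>Random combinations of fixed continuous functions become random elements of the path
  space this way, and test functions pull back to continuous functions of the coefficients.\<close>

lemma continuous_map_finite_sum_Cm:
  fixes F :: "'i set"
  assumes F: "finite F" and e: "\<And>i. i \<in> F \<Longrightarrow> continuous_on unit_square (e i)"
  shows "continuous_map euclidean C.mtopology (\<lambda>x :: 'i \<Rightarrow> real. \<lambda>t\<in>unit_square. \<Sum>i\<in>F. x i * e i t)"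
    (is "continuous_map _ _ ?Phi")
proof -
  have "\<exists>b. \<forall>t\<in>unit_square. \<bar>e i t\<bar> \<le> b" if "i \<in> F" for i
    using compact_imp_bounded[OF compact_continuous_image[OF e[OF that] compact_unit_square]]
    by (auto simp: bounded_iff)
  then obtain b where b: "\<And>i t. i \<in> F \<Longrightarrow> t \<in> unit_square \<Longrightarrow> \<bar>e i t\<bar> \<le> b i" by metis
  have mem: "?Phi x \<in> mspace Cm" for x
    unfolding restrict_mspace_Cm using e by (intro continuous_intros)
  have dist: "mdist Cm (?Phi x) (?Phi y) \<le> (\<Sum>i\<in>F. \<bar>x i - y i\<bar> * b i)" for x y
  proof (rule mdist_Cm_le)
    fix t assume t: "t \<in> unit_square"
    have "\<bar>?Phi x t - ?Phi y t\<bar> = \<bar>\<Sum>i\<in>F. (x i - y i) * e i t\<bar>"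
      using t by (simp add: sum_subtractf left_diff_distrib)
    also have "\<dots> \<le> (\<Sum>i\<in>F. \<bar>(x i - y i) * e i t\<bar>)" by (rule sum_abs)
    also have "\<dots> \<le> (\<Sum>i\<in>F. \<bar>x i - y i\<bar> * b i)"
      by (rule sum_mono) (use b[OF _ t] in \<open>simp add: abs_mult mult_left_mono\<close>)
    finally show "\<bar>?Phi x t - ?Phi y t\<bar> \<le> (\<Sum>i\<in>F. \<bar>x i - y i\<bar> * b i)" .
  qed
  show ?thesis
    unfolding continuous_map_def
  proof (intro conjI allI impI)
    show "?Phi \<in> topspace euclidean \<rightarrow> topspace C.mtopology" using mem by simp
    fix U assume U: "openin C.mtopology U"
    have "\<exists>T. open T \<and> x \<in> T \<and> T \<subseteq> {x. ?Phi x \<in> U}" if x: "?Phi x \<in> U" for x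
    proof -
      obtain r where r: "0 < r" "C.mball (?Phi x) r \<subseteq> U" using U x unfolding C.openin_mtopology by blast
      have "continuous_on UNIV (\<lambda>y. y i)" for i :: 'i
        by (rule continuous_on_product_coordinates)
      then have "continuous_on UNIV (\<lambda>y. \<Sum>i\<in>F. \<bar>x i - y i\<bar> * b i)"
        by (intro continuous_on_sum continuous_on_mult_right continuous_on_rabs continuous_on_diff continuous_on_const)
      then have "open ((\<lambda>y. \<Sum>i\<in>F. \<bar>x i - y i\<bar> * b i) -` {..<r})"
        by (rule continuous_imp_open_vimage) auto
      moreover have "?Phi y \<in> U" if "(\<Sum>i\<in>F. \<bar>x i - y i\<bar> * b i) < r" for y
        using r(2) dist[of x y] that mem by auto
      ultimately show ?thesis
        using r(1) by (intro exI[of _ "(\<lambda>y. \<Sum>i\<in>F. \<bar>x i - y i\<bar> * b i) -` {..<r}"]) auto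
    qed
    then have "open {x. ?Phi x \<in> U}" by (subst open_subopen) blast
    then show "openin euclidean {x \<in> topspace euclidean. ?Phi x \<in> U}" by simp
  qed
qed

text \<open>The path is a continuous image of its coefficient vector; with a countable index type
  such a vector is Borel measurable as soon as its coordinates are.\<close>

lemma measurable_finite_sum_Cm:
  fixes F :: "'i::countable set"
  assumes F: "finite F" and e: "\<And>i. i \<in> F \<Longrightarrow> continuous_on unit_square (e i)"
    and \<xi>: "\<And>i. i \<in> F \<Longrightarrow> \<xi> i \<in> borel_measurable M"
  shows "(\<lambda>\<omega>. \<lambda>t\<in>unit_square. \<Sum>i\<in>F. \<xi> i \<omega> * e i t) \<in> M \<rightarrow>\<^sub>M borel_of C.mtopology"
proof -
  let ?Phi = "\<lambda>x :: 'i \<Rightarrow> real. \<lambda>t\<in>unit_square. \<Sum>i\<in>F. x i * e i t"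
  let ?\<xi> = "\<lambda>\<omega> i. if i \<in> F then \<xi> i \<omega> else 0"
  have c: "continuous_map euclidean C.mtopology ?Phi"
    by (rule continuous_map_finite_sum_Cm[OF F]) (rule e)
  have "?Phi \<in> borel \<rightarrow>\<^sub>M borel_of C.mtopology"
  proof (rule measurable_borel_ofI)
    show "?Phi x \<in> topspace C.mtopology" for x
      unfolding C.topspace_mtopology restrict_mspace_Cm using e by (intro continuous_intros)
    fix U assume "openin C.mtopology U"
    then have "openin euclidean {x \<in> topspace euclidean. ?Phi x \<in> U}" using c unfolding continuous_map_def by blast
    then have "open (?Phi -` U)" by (simp add: vimage_def)
    then show "?Phi -` U \<inter> space borel \<in> sets borel" by simp
  qed
  moreover have "?\<xi> \<in> borel_measurable M"
  proof (rule measurable_coordinatewise_then_product)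
    show "(\<lambda>\<omega>. if i \<in> F then \<xi> i \<omega> else 0) \<in> borel_measurable M" for i
      by (cases "i \<in> F") (use \<xi> in simp_all)
  qed
  ultimately have "(\<lambda>\<omega>. ?Phi (?\<xi> \<omega>)) \<in> M \<rightarrow>\<^sub>M borel_of C.mtopology"
    by (rule measurable_compose[rotated])
  moreover have "?Phi (?\<xi> \<omega>) = (\<lambda>t\<in>unit_square. \<Sum>i\<in>F. \<xi> i \<omega> * e i t)" for \<omega>
    by (intro restrict_ext sum.cong) auto
  ultimately show ?thesis by simp
qed

lemma expectation_lipschitz_diff:
  assumes M: "prob_space M" and X: "X \<in> M \<rightarrow>\<^sub>M borel_of C.mtopology" and Y: "Y \<in> M \<rightarrow>\<^sub>M borel_of C.mtopology"
    and \<phi>: "\<And>x. x \<in> mspace Cm \<Longrightarrow> \<bar>\<phi> x\<bar> \<le> b" "\<And>x y. x \<in> mspace Cm \<Longrightarrow> y \<in> mspace Cm \<Longrightarrow> \<bar>\<phi> x - \<phi> y\<bar> \<le> L * mdist Cm x y"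
    and L: "0 \<le> L" and Q: "integrable M Q" "\<And>\<omega>. \<omega> \<in> space M \<Longrightarrow> mdist Cm (X \<omega>) (Y \<omega>) \<le> Q \<omega>"
  shows "\<bar>(\<integral>\<omega>. \<phi> (X \<omega>) \<partial>M) - (\<integral>\<omega>. \<phi> (Y \<omega>) \<partial>M)\<bar> \<le> L * (\<integral>\<omega>. Q \<omega> \<partial>M)"
proof -
  interpret prob_space M by fact
  have \<phi>m: "\<phi> \<in> borel_measurable (borel_of C.mtopology)"
    by (rule continuous_map_borel_of[OF C.lipschitz_continuous_map[OF \<phi>(2)]])
  have XM: "X \<omega> \<in> mspace Cm" "Y \<omega> \<in> mspace Cm" if "\<omega> \<in> space M" for \<omega>
    using measurable_space[OF X that] measurable_space[OF Y that] by simp_all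
  have i: "integrable M (\<lambda>\<omega>. \<phi> (X \<omega>))" "integrable M (\<lambda>\<omega>. \<phi> (Y \<omega>))"
    using measurable_compose[OF X \<phi>m] measurable_compose[OF Y \<phi>m] XM \<phi>(1)
    by (auto intro!: integrable_const_bound[of _ b])
  have "\<bar>(\<integral>\<omega>. \<phi> (X \<omega>) \<partial>M) - (\<integral>\<omega>. \<phi> (Y \<omega>) \<partial>M)\<bar> = \<bar>\<integral>\<omega>. \<phi> (X \<omega>) - \<phi> (Y \<omega>) \<partial>M\<bar>" using i by simp
  also have "\<dots> \<le> (\<integral>\<omega>. \<bar>\<phi> (X \<omega>) - \<phi> (Y \<omega>)\<bar> \<partial>M)" by (rule integral_abs_bound)
  also have "\<dots> \<le> (\<integral>\<omega>. L * Q \<omega> \<partial>M)"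
  proof (rule integral_mono)
    fix \<omega> assume w: "\<omega> \<in> space M"
    show "\<bar>\<phi> (X \<omega>) - \<phi> (Y \<omega>)\<bar> \<le> L * Q \<omega>"
      using \<phi>(2)[OF XM[OF w]] mult_left_mono[OF Q(2)[OF w] L] by linarith
  qed (use i Q(1) in auto)
  finally show ?thesis by simp
qed

section \<open>Restriction to a grid\<close>

definition grid :: "nat \<Rightarrow> nat \<times> nat \<Rightarrow> real \<times> real" where
  "grid M i = (real (fst i) / real M, real (snd i) / real M)"

definition bil :: "nat \<Rightarrow> nat \<times> nat \<Rightarrow> real \<times> real \<Rightarrow> real" where
  "bil M i t = hat (real M * fst t - real (fst i)) * hat (real M * snd t - real (snd i))"

text \<open>Bilinear interpolation of the values at \<open>(M + 1)^2\<close> nodes; it reduces weak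
  convergence of paths to that of finitely many coordinates.\<close>

definition gridded :: "nat \<Rightarrow> (real \<times> real \<Rightarrow> real) \<Rightarrow> real \<times> real \<Rightarrow> real" where
  "gridded M x = (\<lambda>t\<in>unit_square. \<Sum>i\<in>{..M} \<times> {..M}. x (grid M i) * bil M i t)"

lemma continuous_bil: "continuous_on A (bil M i)"
  unfolding bil_def by (intro continuous_on_mult continuous_hat)

lemma gridded_mspace: "gridded M x \<in> mspace Cm"
  unfolding gridded_def restrict_mspace_Cm
  by (intro continuous_on_sum continuous_on_mult continuous_on_const continuous_bil)

lemma grid_unit_square: "0 < M \<Longrightarrow> i \<in> {..M} \<times> {..M} \<Longrightarrow> grid M i \<in> unit_square"
  by (auto simp: grid_def unit_square_def field_simps)

lemma inj_grid: "0 < M \<Longrightarrow> inj_on (grid M) A"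
  by (auto simp: inj_on_def grid_def)

lemma mdist_gridded_le:
  assumes M: "0 < M" and x: "\<And>t t'. t \<in> unit_square \<Longrightarrow> t' \<in> unit_square \<Longrightarrow> \<bar>fst t - fst t'\<bar> \<le> 1 / real M \<Longrightarrow>
     \<bar>snd t - snd t'\<bar> \<le> 1 / real M \<Longrightarrow> \<bar>x t' - x t\<bar> \<le> B"
  shows "mdist Cm (gridded M x) (restrict x unit_square) \<le> B"
proof (rule mdist_Cm_le)
  fix t assume t: "t \<in> unit_square"
  have "gridded M x t = interp M M (\<lambda>p q. x (grid M (p, q))) t"
    using t by (simp add: gridded_def interp_eq_sum bil_def)
  moreover have "\<bar>interp M M (\<lambda>p q. x (grid M (p, q))) t - x t\<bar> \<le> B"
  proof (rule interp_near[OF t])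
    fix p q assume pq: "p \<le> M" "q \<le> M" "\<bar>real M * fst t - real p\<bar> < 1" "\<bar>real M * snd t - real q\<bar> < 1"
    have near: "\<bar>u - real p / real M\<bar> \<le> 1 / real M" if "\<bar>real M * u - real p\<bar> < 1" for u p
    proof -
      have "u - real p / real M = (real M * u - real p) / real M" using M by (simp add: field_simps)
      then show ?thesis using that M by (simp add: abs_divide divide_right_mono)
    qed
    show "\<bar>x (grid M (p, q)) - x t\<bar> \<le> B"
      by (rule x[OF t grid_unit_square[OF M]]) (use pq near[OF pq(3)] near[OF pq(4)] in \<open>auto simp: grid_def\<close>)
  qed
  ultimately show "\<bar>gridded M x t - restrict x unit_square t\<bar> \<le> B" using t by simp
qed

lemma gridded_tendsto:
  assumes "continuous_on unit_square x"
  shows "(\<lambda>M. mdist Cm (gridded M x) (restrict x unit_square)) \<longlonglongrightarrow> 0"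
proof (rule LIMSEQ_I)
  fix e :: real assume e: "0 < e"
  have "uniformly_continuous_on unit_square x"
    by (rule compact_uniformly_continuous[OF assms compact_unit_square])
  then obtain d where d: "0 < d" "\<And>t t'. t \<in> unit_square \<Longrightarrow> t' \<in> unit_square \<Longrightarrow> dist t' t < d \<Longrightarrow> \<bar>x t' - x t\<bar> < e / 2"
    using half_gt_zero[OF e] unfolding uniformly_continuous_on_def dist_real_def by metis
  obtain n0 where n0: "inverse (real (Suc n0)) < d / 2" using reals_Archimedean[of "d / 2"] d by auto
  have "norm (mdist Cm (gridded M x) (restrict x unit_square) - 0) < e" if M: "M \<ge> Suc n0" for M
  proof -
    have "1 / real M < d / 2" 
    proof -
      have "1 / real M \<le> 1 / real (Suc n0)" by (rule divide_left_mono) (use M in auto)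
      then show ?thesis using n0 by (simp add: inverse_eq_divide)
    qed
    have "mdist Cm (gridded M x) (restrict x unit_square) \<le> e / 2"
    proof (rule mdist_gridded_le)
      fix t t' assume t: "t \<in> unit_square" "t' \<in> unit_square" "\<bar>fst t - fst t'\<bar> \<le> 1 / real M" "\<bar>snd t - snd t'\<bar> \<le> 1 / real M"
      have "dist t' t \<le> dist (fst t') (fst t) + dist (snd t') (snd t)"
        unfolding dist_prod_def by (rule sqrt_sum_squares_le_sum) auto
      also have "\<dots> < d" using t(3,4) \<open>1 / real M < d / 2\<close> by (simp add: dist_real_def abs_minus_commute)
      finally show "\<bar>x t' - x t\<bar> \<le> e / 2" using d(2)[OF t(1,2)] by simp
    qed (use M in auto)
    then show ?thesis using e C.nonneg[of "gridded M x" "restrict x unit_square"] by simp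
  qed
  then show "\<exists>n0. \<forall>M\<ge>n0. norm (mdist Cm (gridded M x) (restrict x unit_square) - 0) < e" by blast
qed

lemma gridded_cong: "0 < M \<Longrightarrow> (\<And>t. t \<in> unit_square \<Longrightarrow> x t = y t) \<Longrightarrow> gridded M x = gridded M y"
  unfolding gridded_def by (intro restrict_ext sum.cong refl) (simp add: grid_unit_square)

lemma gridded_measurable:
  assumes "\<And>t. t \<in> unit_square \<Longrightarrow> (\<lambda>\<omega>. x \<omega> t) \<in> borel_measurable N" "0 < M"
  shows "(\<lambda>\<omega>. gridded M (x \<omega>)) \<in> N \<rightarrow>\<^sub>M borel_of C.mtopology"
  unfolding gridded_def
  by (rule measurable_finite_sum_Cm[where F="{..M} \<times> {..M}" and e="bil M" and \<xi>="\<lambda>i \<omega>. x \<omega> (grid M i)"])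
    (intro finite_SigmaI finite_atMost continuous_bil assms(1)[OF grid_unit_square[OF assms(2)]] | assumption)+

section \<open>The Brownian sheet\<close>

context
  fixes N :: "'b measure" and BB
  assumes sheet: "standard_brownian_sheet N BB"
begin

lemma sheet_prob: "prob_space N"
  and sheet_meas: "t \<in> unit_square \<Longrightarrow> BB t \<in> borel_measurable N"
  and sheet_continuous: "\<omega> \<in> space N \<Longrightarrow> continuous_on unit_square (\<lambda>t. BB t \<omega>)"
  and sheet_gaussian: "finite F \<Longrightarrow> F \<subseteq> unit_square \<Longrightarrow>
    \<exists>m s. s \<ge> 0 \<and> distr N borel (\<lambda>\<omega>. \<Sum>t\<in>F. c t * BB t \<omega>) = normal_law m s"
  and sheet_mean: "t \<in> unit_square \<Longrightarrow> (\<integral>\<omega>. BB t \<omega> \<partial>N) = 0"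
  and sheet_covariance: "s \<in> unit_square \<Longrightarrow> t \<in> unit_square \<Longrightarrow> (\<integral>\<omega>. BB s \<omega> * BB t \<omega> \<partial>N) = sheet_cov s t"
  using sheet unfolding standard_brownian_sheet_def sheet_cov_def by blast+

lemma sheet_L2:
  assumes t: "t \<in> unit_square"
  shows "L2 N (BB t)"
proof -
  note [measurable] = sheet_meas[OF t]
  have "\<exists>m s. s \<ge> 0 \<and> distr N borel (\<lambda>\<omega>. \<Sum>t\<in>{t}. 1 * BB t \<omega>) = normal_law m s"
    by (rule sheet_gaussian) (use t in auto)
  then obtain m s where ms: "s \<ge> 0" "distr N borel (BB t) = normal_law m s" by auto
  have "integrable (distr N borel (BB t)) (\<lambda>x. x\<^sup>2)" unfolding ms(2) by (rule normal_law_square(1)[OF ms(1)])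
  then show ?thesis by (simp add: L2_def integrable_distr_eq)
qed

text \<open>The linear combination is normal with unspecified parameters; its first two moments
  identify them.\<close>

lemma sheet_cos:
  assumes F: "finite F" "F \<subseteq> unit_square"
  shows "(\<integral>\<omega>. cos ((\<Sum>t\<in>F. c t * BB t \<omega>) + \<alpha>) \<partial>N) = cos \<alpha> * exp (- (\<Sum>s\<in>F. \<Sum>t\<in>F. c s * c t * sheet_cov s t) / 2)"
proof -
  interpret prob_space N by (rule sheet_prob)
  let ?Y = "\<lambda>\<omega>. \<Sum>t\<in>F. c t * BB t \<omega>"
  have l2: "L2 N (BB t)" if "t \<in> F" for t by (rule sheet_L2[OF subsetD[OF F(2) that]])
  have Ym: "?Y \<in> borel_measurable N" 
    by (rule borel_measurable_sum, rule borel_measurable_times[OF borel_measurable_const L2_meas[OF l2]])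
  obtain m s where ms: "s \<ge> 0" "distr N borel ?Y = normal_law m s"
    using sheet_gaussian[OF F, of c] by blast
  have "m = (\<integral>x. x \<partial>normal_law m s)" using normal_law_mean(2)[OF ms(1)] by simp
  also have "\<dots> = (\<integral>\<omega>. ?Y \<omega> \<partial>N)" unfolding ms(2)[symmetric] by (rule integral_distr[OF Ym]) simp
  also have "\<dots> = (\<Sum>t\<in>F. c t * (\<integral>\<omega>. BB t \<omega> \<partial>N))"
    using L2_integrable[OF l2] by simp
  also have "\<dots> = 0" by (intro sum.neutral ballI) (simp add: sheet_mean[OF subsetD[OF F(2)]])
  finally have m: "m = 0" .
  have sq: "(?Y \<omega>)\<^sup>2 = (\<Sum>s\<in>F. \<Sum>t\<in>F. c s * c t * (BB s \<omega> * BB t \<omega>))" for \<omega>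
    unfolding power2_eq_square sum_product by (intro sum.cong refl) (simp add: mult_ac)
  have "s\<^sup>2 = (\<integral>x. x\<^sup>2 \<partial>normal_law m s)" using normal_law_square(2)[OF ms(1), of m] by (simp add: m)
  also have "\<dots> = (\<integral>\<omega>. (?Y \<omega>)\<^sup>2 \<partial>N)" unfolding ms(2)[symmetric] by (rule integral_distr[OF Ym]) simp
  also have "\<dots> = (\<Sum>s\<in>F. \<Sum>t\<in>F. c s * c t * (\<integral>\<omega>. BB s \<omega> * BB t \<omega> \<partial>N))"
    unfolding sq using L2_mult_integrable[OF l2 l2] by simp
  also have "\<dots> = (\<Sum>s\<in>F. \<Sum>t\<in>F. c s * c t * sheet_cov s t)"
    by (intro sum.cong refl) (simp add: sheet_covariance[OF subsetD[OF F(2)] subsetD[OF F(2)]])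
  finally have s: "s\<^sup>2 = (\<Sum>s\<in>F. \<Sum>t\<in>F. c s * c t * sheet_cov s t)" .
  have "(\<integral>\<omega>. cos (?Y \<omega> + \<alpha>) \<partial>N) = (\<integral>x. cos (1 * x + \<alpha>) \<partial>normal_law m s)"
    unfolding ms(2)[symmetric] by (subst integral_distr[OF Ym]) auto
  also have "\<dots> = cos (1 * m + \<alpha>) * exp (- (1 * s)\<^sup>2 / 2)" by (rule normal_law_cos[OF ms(1)])
  finally show ?thesis by (simp add: m s)
qed

definition "sheet_path \<sigma> \<omega> = (\<lambda>t\<in>unit_square. \<sigma> * BB t \<omega>)"

lemma sheet_path_mspace: "\<omega> \<in> space N \<Longrightarrow> sheet_path \<sigma> \<omega> \<in> mspace Cm"
  unfolding sheet_path_def restrict_mspace_Cm by (intro continuous_on_mult_left sheet_continuous)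

lemma gridded_sheet_path_tendsto:
  assumes "\<omega> \<in> space N"
  shows "(\<lambda>M. mdist Cm (gridded (Suc M) (sheet_path \<sigma> \<omega>)) (sheet_path \<sigma> \<omega>)) \<longlonglongrightarrow> 0"
proof -
  have "continuous_on unit_square (\<lambda>t. \<sigma> * BB t \<omega>)" by (intro continuous_on_mult_left sheet_continuous assms)
  from LIMSEQ_Suc[OF gridded_tendsto[OF this]] gridded_cong[of "Suc _" "sheet_path \<sigma> \<omega>" "\<lambda>t. \<sigma> * BB t \<omega>"]
  show ?thesis by (simp add: sheet_path_def)
qed

lemma gridded_sheet_path_measurable: "0 < M \<Longrightarrow> (\<lambda>\<omega>. gridded M (sheet_path \<sigma> \<omega>)) \<in> N \<rightarrow>\<^sub>M borel_of C.mtopology"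
proof (rule gridded_measurable)
  fix t assume t: "t \<in> unit_square"
  have "(\<lambda>\<omega>. \<sigma> * BB t \<omega>) \<in> borel_measurable N"
    by (rule borel_measurable_times[OF borel_measurable_const sheet_meas[OF t]])
  with t show "(\<lambda>\<omega>. sheet_path \<sigma> \<omega> t) \<in> borel_measurable N" by (simp add: sheet_path_def)
qed

text \<open>The path is a pointwise limit of its measurable grid interpolations.
  \<open>Suc M\<close> excludes the degenerate grid.\<close>

lemma sheet_path_measurable: "sheet_path \<sigma> \<in> N \<rightarrow>\<^sub>M borel_of C.mtopology"
proof (rule C.measurable_borel_of_limit)
  show "(\<lambda>\<omega>. gridded (Suc M) (sheet_path \<sigma> \<omega>)) \<in> N \<rightarrow>\<^sub>M borel_of C.mtopology" for M
    by (rule gridded_sheet_path_measurable) simp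
qed (rule sheet_path_mspace gridded_sheet_path_tendsto; assumption)+

end

section \<open>The functional central limit theorem\<close>

text \<open>Prepares the replacement of a maximum over strips by a sum: the cutoff
  \<open>\<delta>\<close> is paid once for the strip that occurs, and only the small fourth powers
  are summed over all strips.\<close>

lemma le_add_power4:
  fixes x \<delta> :: real
  assumes "0 < \<delta>" "0 \<le> x"
  shows "x \<le> \<delta> + x^4 / \<delta>^3"
proof (cases "x \<le> \<delta>")
  case False
  then have "\<delta>^3 * x \<le> x^3 * x" using assms by (intro mult_right_mono power_mono) auto
  then have "x \<le> x^4 / \<delta>^3" using assms by (simp add: field_simps power4_eq_xxxx power3_eq_cube)
  then show ?thesis using assms by linarith
qed (use assms in \<open>simp add: add_increasing2\<close>)

text \<open>Two close indices need not lie in one strip of width \<open>w\<close>, but both are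
  within \<open>2 * w\<close> of the start of the strip that contains the smaller one. In
  \<open>w\<close>, 1 makes up for the rounding in \<open>n div M\<close> and 2 for the slack of the
  interpolation.\<close>

lemma strip_index:
  assumes M: "0 < M" and p: "p \<le> n" "p' \<le> n" "\<bar>real p - real p'\<bar> \<le> real n / real M + 2"
  defines "w \<equiv> n div M + 3"
  obtains i where "i \<le> M" "i * w \<le> p" "i * w \<le> p'" "p - i * w \<le> 2 * w" "p' - i * w \<le> 2 * w"
proof
  define m where "m = min p p'"
  let ?i = "m div w"
  have w: "0 < w" by (simp add: w_def)
  have nd: "n < Suc (n div M) * M" using div_less_iff_less_mult[of M n "Suc (n div M)"] M by simp
  also have "\<dots> \<le> w * M" by (rule mult_le_mono1) (simp add: w_def)
  finally have "n \<le> M * w" by (simp add: mult.commute)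
  then have "n div w \<le> M * w div w" by (rule div_le_mono)
  then have "n div w \<le> M" using w by simp
  moreover have "m div w \<le> n div w" by (rule div_le_mono) (use p in \<open>simp add: m_def\<close>)
  ultimately show "?i \<le> M" by (rule order_trans[rotated])
  have "?i * w \<le> m" by (rule div_times_less_eq_dividend)
  then show "?i * w \<le> p" "?i * w \<le> p'" by (auto simp: m_def)
  have "real n < real (Suc (n div M)) * real M" using nd by (metis of_nat_less_iff of_nat_mult)
  then have "real n / real M < real (n div M) + 1" using M by (simp add: divide_less_eq add.commute)
  then have "\<bar>real p - real p'\<bar> \<le> real w" using p(3) by (simp add: w_def)
  then have "p \<le> m + w" "p' \<le> m + w" by (auto simp: m_def abs_le_iff)
  moreover have "m = ?i * w + m mod w" "m mod w < w" using w by simp_all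
  ultimately show "p - ?i * w \<le> 2 * w" "p' - ?i * w \<le> 2 * w" by linarith+
qed

lemma continuous_wt: "continuous_on A (\<lambda>t. wt n (fst t) k)" "continuous_on A (\<lambda>t. wt n (snd t) k)"
  by (cases "1 \<le> k \<and> k \<le> int n"; auto simp: wt_def cl_def intro!: continuous_intros)+

context iid_field
begin

definition sum_path :: "((int \<times> int \<Rightarrow> real) \<Rightarrow> real) \<Rightarrow> nat \<Rightarrow> nat \<Rightarrow> (int \<times> int \<Rightarrow> real) \<Rightarrow> real \<times> real \<Rightarrow> real" where
  "sum_path f n1 n2 \<omega> = (\<lambda>t\<in>unit_square. Bsum f n1 n2 t \<omega> / sqrt (real (n1 * n2)))"

lemma sum_path_measurable:
  assumes f: "f \<in> borel_measurable \<Omega>"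
  shows "sum_path f n1 n2 \<in> \<Omega> \<rightarrow>\<^sub>M borel_of C.mtopology"
proof -
  have "(\<lambda>\<omega>. \<lambda>t\<in>unit_square. \<Sum>k\<in>{1..int n1} \<times> {1..int n2}. (f (shift k \<omega>) / sqrt (real (n1 * n2))) * (wt n1 (fst t) (fst k) * wt n2 (snd t) (snd k)))
      \<in> \<Omega> \<rightarrow>\<^sub>M borel_of C.mtopology"
    using f by (intro measurable_finite_sum_Cm continuous_on_mult continuous_wt borel_measurable_divide measurable_compose[OF shift_measurable f]) auto
  moreover have "sum_path f n1 n2 = (\<lambda>\<omega>. \<lambda>t\<in>unit_square. \<Sum>k\<in>{1..int n1} \<times> {1..int n2}. (f (shift k \<omega>) / sqrt (real (n1 * n2))) * (wt n1 (fst t) (fst k) * wt n2 (snd t) (snd k)))"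
    unfolding sum_path_def Bsum_def
    by (intro ext restrict_ext) (simp add: sum_divide_distrib mult_ac)
  ultimately show ?thesis by simp
qed

lemma mdist_sum_path_le:
  "mdist Cm (sum_path f n1 n2 \<omega>) (sum_path g n1 n2 \<omega>) \<le> Mx (\<lambda>\<omega>. f \<omega> - g \<omega>) n1 n2 \<omega> / sqrt (real (n1 * n2))"
proof (rule mdist_Cm_le)
  fix t assume t: "t \<in> unit_square"
  have "\<bar>sum_path f n1 n2 \<omega> t - sum_path g n1 n2 \<omega> t\<bar> = \<bar>Bsum (\<lambda>\<omega>. f \<omega> - g \<omega>) n1 n2 t \<omega>\<bar> / sqrt (real (n1 * n2))"
    using t by (simp add: sum_path_def Bsum_diff diff_divide_distrib[symmetric] abs_divide)
  also have "\<dots> \<le> Mx (\<lambda>\<omega>. f \<omega> - g \<omega>) n1 n2 \<omega> / sqrt (real (n1 * n2))"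
    by (intro divide_right_mono abs_Bsum_le_Mx[OF t]) simp
  finally show "\<bar>sum_path f n1 n2 \<omega> t - sum_path g n1 n2 \<omega> t\<bar> \<le> Mx (\<lambda>\<omega>. f \<omega> - g \<omega>) n1 n2 \<omega> / sqrt (real (n1 * n2))" .
qed

text \<open>The two rectangles share the part before the start of the strip, which cancels; two
  partial sums over a translated strip are left.\<close>

lemma S_rect_strip1_le:
  assumes M: "0 < M" and p: "p \<le> n1" "p' \<le> n1" "\<bar>real p - real p'\<bar> \<le> real n1 / real M + 2" and q: "q \<le> n2"
  obtains i where "i \<le> M" "\<bar>S_rect g p q \<omega> - S_rect g p' q \<omega>\<bar> \<le> 2 * Mx g (2 * (n1 div M + 3)) n2 (shift (int (i * (n1 div M + 3)), 0) \<omega>)"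
proof -
  define w where "w = n1 div M + 3"
  obtain i where i: "i \<le> M" "i * w \<le> p" "i * w \<le> p'" "p - i * w \<le> 2 * w" "p' - i * w \<le> 2 * w"
    using strip_index[OF M p] unfolding w_def by blast
  have "S_rect g p q \<omega> = S_rect g (i * w) q \<omega> + S_rect g (p - i * w) q (shift (int (i * w), 0) \<omega>)"
    "S_rect g p' q \<omega> = S_rect g (i * w) q \<omega> + S_rect g (p' - i * w) q (shift (int (i * w), 0) \<omega>)"
    using S_rect_strip1[of g "i * w" "p - i * w" q \<omega>] S_rect_strip1[of g "i * w" "p' - i * w" q \<omega>] i(2,3) by simp_all
  then have "\<bar>S_rect g p q \<omega> - S_rect g p' q \<omega>\<bar> \<le> 2 * Mx g (2 * w) n2 (shift (int (i * w), 0) \<omega>)"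
    using Mx_ge[OF i(4) q, of g "shift (int (i * w), 0) \<omega>"] Mx_ge[OF i(5) q, of g "shift (int (i * w), 0) \<omega>"] by linarith
  with i(1) show thesis using that unfolding w_def by blast
qed

lemma S_rect_strip2_le:
  assumes M: "0 < M" and q: "q \<le> n2" "q' \<le> n2" "\<bar>real q - real q'\<bar> \<le> real n2 / real M + 2" and p: "p \<le> n1"
  obtains j where "j \<le> M" "\<bar>S_rect g p q \<omega> - S_rect g p q' \<omega>\<bar> \<le> 2 * Mx g n1 (2 * (n2 div M + 3)) (shift (0, int (j * (n2 div M + 3))) \<omega>)"
proof -
  define w where "w = n2 div M + 3"
  obtain i where i: "i \<le> M" "i * w \<le> q" "i * w \<le> q'" "q - i * w \<le> 2 * w" "q' - i * w \<le> 2 * w"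
    using strip_index[OF M q] unfolding w_def by blast
  have "S_rect g p q \<omega> = S_rect g p (i * w) \<omega> + S_rect g p (q - i * w) (shift (0, int (i * w)) \<omega>)"
    "S_rect g p q' \<omega> = S_rect g p (i * w) \<omega> + S_rect g p (q' - i * w) (shift (0, int (i * w)) \<omega>)"
    using S_rect_strip2[of g p "i * w" "q - i * w" \<omega>] S_rect_strip2[of g p "i * w" "q' - i * w" \<omega>] i(2,3) by simp_all
  then have "\<bar>S_rect g p q \<omega> - S_rect g p q' \<omega>\<bar> \<le> 2 * Mx g n1 (2 * w) (shift (0, int (i * w)) \<omega>)"
    using Mx_ge[OF p i(4), of g "shift (0, int (i * w)) \<omega>"] Mx_ge[OF p i(5), of g "shift (0, int (i * w)) \<omega>"] by linarith
  with i(1) show thesis using that unfolding w_def by blast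
qed

lemma strip_width: "0 < M \<Longrightarrow> M \<le> n \<Longrightarrow> real (2 * (n div M + 3)) \<le> 8 * real n / real M"
proof -
  assume M: "0 < M" "M \<le> n"
  have "real (n div M) * real M \<le> real n" by (metis div_times_less_eq_dividend of_nat_le_iff of_nat_mult)
  then have "real (2 * (n div M + 3)) * real M \<le> 8 * real n" using M by (simp add: algebra_simps)
  then show ?thesis using M by (simp add: le_divide_eq)
qed

text \<open>The modulus of continuity is controlled by the maximal partial sums over \<open>M + 1\<close> strips in each
  direction, each of which has a fourth moment of order \<open>M\<^sup>-\<^sup>2\<close> after normalization.\<close>

lemma nice_modulus:
  assumes g: "nice g"
  obtains C where "0 \<le> C"
    "\<And>M \<delta> n1 n2. 0 < M \<Longrightarrow> 0 < \<delta> \<Longrightarrow> M \<le> n1 \<Longrightarrow> M \<le> n2 \<Longrightarrow>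
      \<exists>Q. integrable \<Omega> Q \<and> (\<forall>\<omega>. mdist Cm (gridded M (sum_path g n1 n2 \<omega>)) (sum_path g n1 n2 \<omega>) \<le> Q \<omega>) \<and>
        (\<integral>\<omega>. Q \<omega> \<partial>\<Omega>) \<le> 4 * \<delta> + C / (real M * \<delta>^3)"
proof -
  obtain C where C: "0 \<le> C" "\<And>n1 n2. integrable \<Omega> (\<lambda>\<omega>. (Mx g n1 n2 \<omega>)^4)"
    "\<And>n1 n2. (\<integral>\<omega>. (Mx g n1 n2 \<omega>)^4 \<partial>\<Omega>) \<le> C * (real (n1 * n2))\<^sup>2"
    using nice_Mx_power4[OF g] by blast
  note [measurable] = L2_meas[OF nice_L2[OF g]]
  have Mxm: "(\<lambda>\<omega>. (Mx g a b \<omega>)^4) \<in> borel_measurable \<Omega>" for a b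
    by (rule borel_measurable_integrable[OF C(2)])
  show thesis
  proof (rule that[of "512 * C"])
    fix M n1 n2 :: nat and \<delta> :: real
    assume M: "0 < M" and \<delta>: "0 < \<delta>" and n: "M \<le> n1" "M \<le> n2"
    define w1 where "w1 = n1 div M + 3"
    define w2 where "w2 = n2 div M + 3"
    define q where "q = sqrt (real (n1 * n2))"
    have q: "0 < q" using n M by (simp add: q_def)
    have q4: "q^4 = (real n1 * real n2)\<^sup>2"
    proof -
      have "q^4 = (q\<^sup>2)\<^sup>2" by simp
      then show ?thesis by (simp add: q_def)
    qed
    define y where "y i \<omega> = Mx g (2 * w1) n2 (shift (int (i * w1), 0) \<omega>) / q" for i \<omega>
    define z where "z j \<omega> = Mx g n1 (2 * w2) (shift (0, int (j * w2)) \<omega>) / q" for j \<omega>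
    have yz0: "0 \<le> y i \<omega>" "0 \<le> z i \<omega>" for i \<omega> using q by (simp_all add: y_def z_def)
    have wid: "real (2 * w1) \<le> 8 * real n1 / real M" "real (2 * w2) \<le> 8 * real n2 / real M"
      unfolding w1_def w2_def by (rule strip_width; use M n in simp)+
    have int: "integrable \<Omega> (\<lambda>\<omega>. (y i \<omega>)^4)" "integrable \<Omega> (\<lambda>\<omega>. (z i \<omega>)^4)" for i
      unfolding y_def z_def power_divide by (intro integrable_divide integrable_shift C(2))+
    \<comment> \<open>The strip has relative width at most \<open>8 / M\<close>, so the normalized
      fourth moment is at most \<open>C * (8 / M)^2\<close>.\<close>
    have ey: "(\<integral>\<omega>. (y i \<omega>)^4 \<partial>\<Omega>) \<le> 64 * C / (real M)\<^sup>2" for i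
    proof -
      have "(\<integral>\<omega>. (y i \<omega>)^4 \<partial>\<Omega>) = (\<integral>\<omega>. (Mx g (2 * w1) n2 \<omega>)^4 \<partial>\<Omega>) / q^4"
        using integral_shift[OF Mxm, of "2 * w1" n2 "(int (i * w1), 0)"] by (simp add: y_def power_divide)
      also have "\<dots> \<le> C * (real (2 * w1 * n2))\<^sup>2 / q^4" by (intro divide_right_mono C(3)) simp
      also have "\<dots> \<le> C * (8 * real n1 / real M * real n2)\<^sup>2 / q^4"
        unfolding of_nat_mult[of "2 * w1"] by (intro divide_right_mono mult_left_mono power_mono mult_right_mono wid C(1)) auto
      also have "\<dots> = 64 * C / (real M)\<^sup>2" using n M unfolding q4 by (simp add: field_simps power2_eq_square)
      finally show ?thesis .
    qed
    have ez: "(\<integral>\<omega>. (z i \<omega>)^4 \<partial>\<Omega>) \<le> 64 * C / (real M)\<^sup>2" for i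
    proof -
      have "(\<integral>\<omega>. (z i \<omega>)^4 \<partial>\<Omega>) = (\<integral>\<omega>. (Mx g n1 (2 * w2) \<omega>)^4 \<partial>\<Omega>) / q^4"
        using integral_shift[OF Mxm, of n1 "2 * w2" "(0, int (i * w2))"] by (simp add: z_def power_divide)
      also have "\<dots> \<le> C * (real (n1 * (2 * w2)))\<^sup>2 / q^4" by (intro divide_right_mono C(3)) simp
      also have "\<dots> \<le> C * (real n1 * (8 * real n2 / real M))\<^sup>2 / q^4"
        unfolding of_nat_mult[of n1] by (intro divide_right_mono mult_left_mono power_mono wid C(1)) auto
      also have "\<dots> = 64 * C / (real M)\<^sup>2" using n M unfolding q4 by (simp add: field_simps power2_eq_square)
      finally show ?thesis .
    qed
    \<comment> \<open>An increment is at most \<open>2 * q * (y i + z j)\<close>, and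
      \<open>le_add_power4\<close> for \<open>y i\<close> and \<open>z j\<close> gives this form
      once the strips that occur are dominated by all of them. In the mean,
      \<open>M + 1 <= 2 * M\<close> turns 256 into 512.\<close>
    define Q where "Q \<omega> = 4 * \<delta> + 2 / \<delta>^3 * (\<Sum>i\<le>M. (y i \<omega>)^4 + (z i \<omega>)^4)" for \<omega>
    have Qi: "integrable \<Omega> Q"
      unfolding Q_def by (intro Bochner_Integration.integrable_add integrable_mult_right Bochner_Integration.integrable_sum int) simp
    have "(\<integral>\<omega>. Q \<omega> \<partial>\<Omega>) = 4 * \<delta> + 2 / \<delta>^3 * (\<Sum>i\<le>M. (\<integral>\<omega>. (y i \<omega>)^4 \<partial>\<Omega>) + (\<integral>\<omega>. (z i \<omega>)^4 \<partial>\<Omega>))"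
      unfolding Q_def using int by (simp add: Om.prob_space)
    also have "\<dots> \<le> 4 * \<delta> + 2 / \<delta>^3 * (\<Sum>i\<le>M. 128 * C / (real M)\<^sup>2)"
    proof (intro add_left_mono mult_left_mono sum_mono)
      show "(\<integral>\<omega>. (y i \<omega>)^4 \<partial>\<Omega>) + (\<integral>\<omega>. (z i \<omega>)^4 \<partial>\<Omega>) \<le> 128 * C / (real M)\<^sup>2" for i
        using ey[of i] ez[of i] by simp
    qed (use \<delta> in simp)
    also have "\<dots> = 4 * \<delta> + 256 * C * (real M + 1) / ((real M)\<^sup>2 * \<delta>^3)" by (simp add: field_simps)
    also have "\<dots> \<le> 4 * \<delta> + 256 * C * (2 * real M) / ((real M)\<^sup>2 * \<delta>^3)"
      using C(1) \<delta> M by (intro add_left_mono divide_right_mono mult_left_mono) auto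
    also have "\<dots> = 4 * \<delta> + 512 * C / (real M * \<delta>^3)" using M \<delta> by (simp add: field_simps power2_eq_square)
    finally have EQ: "(\<integral>\<omega>. Q \<omega> \<partial>\<Omega>) \<le> 4 * \<delta> + 512 * C / (real M * \<delta>^3)" .
    have ext: "restrict (sum_path g n1 n2 \<omega>) unit_square = sum_path g n1 n2 \<omega>" for \<omega> by (simp add: sum_path_def)
    have "mdist Cm (gridded M (sum_path g n1 n2 \<omega>)) (restrict (sum_path g n1 n2 \<omega>) unit_square) \<le> Q \<omega>" for \<omega>
    proof (rule mdist_gridded_le[OF M])
      fix t t' assume t: "t \<in> unit_square" "t' \<in> unit_square" "\<bar>fst t - fst t'\<bar> \<le> 1 / real M" "\<bar>snd t - snd t'\<bar> \<le> 1 / real M"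
      have nb: "real n1 * \<bar>fst t' - fst t\<bar> \<le> real n1 / real M" "real n2 * \<bar>snd t' - snd t\<bar> \<le> real n2 / real M"
        using mult_left_mono[OF t(3), of "real n1"] mult_left_mono[OF t(4), of "real n2"] by (simp_all add: abs_minus_commute)
      have "\<bar>Bsum g n1 n2 t' \<omega> - Bsum g n1 n2 t \<omega>\<bar> \<le> q * Q \<omega>"
      proof (rule abs_Bsum_diff_le[OF t(2,1)])
        fix a b a' b' assume ab: "a \<le> n1" "b \<le> n2" "a' \<le> n1" "b' \<le> n2"
          "\<bar>real a - real a'\<bar> \<le> real n1 * \<bar>fst t' - fst t\<bar> + 2" "\<bar>real b - real b'\<bar> \<le> real n2 * \<bar>snd t' - snd t\<bar> + 2"
        obtain i where i: "i \<le> M" "\<bar>S_rect g a b \<omega> - S_rect g a' b \<omega>\<bar> \<le> 2 * Mx g (2 * w1) n2 (shift (int (i * w1), 0) \<omega>)"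
          unfolding w1_def by (rule S_rect_strip1_le[OF M ab(1,3) _ ab(2)]) (use ab(5) nb(1) in linarith)
        obtain j where j: "j \<le> M" "\<bar>S_rect g a' b \<omega> - S_rect g a' b' \<omega>\<bar> \<le> 2 * Mx g n1 (2 * w2) (shift (0, int (j * w2)) \<omega>)"
          unfolding w2_def by (rule S_rect_strip2_le[OF M ab(2,4) _ ab(3)]) (use ab(6) nb(2) in linarith)
        have s: "(y i \<omega>)^4 + (z j \<omega>)^4 \<le> (\<Sum>i\<le>M. (y i \<omega>)^4 + (z i \<omega>)^4)"
          unfolding sum.distrib using i(1) j(1) by (intro add_mono member_le_sum) auto
        have "y i \<omega> + z j \<omega> \<le> 2 * \<delta> + ((y i \<omega>)^4 + (z j \<omega>)^4) / \<delta>^3"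
          using le_add_power4[OF \<delta> yz0(1)[of i \<omega>]] le_add_power4[OF \<delta> yz0(2)[of j \<omega>]] by (simp add: add_divide_distrib)
        also have "\<dots> \<le> 2 * \<delta> + (\<Sum>i\<le>M. (y i \<omega>)^4 + (z i \<omega>)^4) / \<delta>^3"
          using \<delta> by (intro add_left_mono divide_right_mono s) simp
        finally have yz: "y i \<omega> + z j \<omega> \<le> Q \<omega> / 2" by (simp add: Q_def)
        have "\<bar>S_rect g a b \<omega> - S_rect g a' b' \<omega>\<bar> \<le> 2 * (q * y i \<omega>) + 2 * (q * z j \<omega>)"
          using i(2) j(2) q by (simp add: y_def z_def)
        also have "\<dots> = q * (2 * (y i \<omega> + z j \<omega>))" by (simp add: algebra_simps)
        also have "\<dots> \<le> q * Q \<omega>" using yz q by (intro mult_left_mono) auto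
        finally show "\<bar>S_rect g a b \<omega> - S_rect g a' b' \<omega>\<bar> \<le> q * Q \<omega>" .
      qed
      moreover have "sum_path g n1 n2 \<omega> u = Bsum g n1 n2 u \<omega> / q" if "u \<in> unit_square" for u
        using that by (simp add: sum_path_def q_def)
      ultimately show "\<bar>sum_path g n1 n2 \<omega> t' - sum_path g n1 n2 \<omega> t\<bar> \<le> Q \<omega>"
        using t q by (simp add: diff_divide_distrib[symmetric] abs_divide pos_divide_le_eq mult.commute)
    qed
    then have "mdist Cm (gridded M (sum_path g n1 n2 \<omega>)) (sum_path g n1 n2 \<omega>) \<le> Q \<omega>" for \<omega>
      unfolding ext .
    then show "\<exists>Q. integrable \<Omega> Q \<and> (\<forall>\<omega>. mdist Cm (gridded M (sum_path g n1 n2 \<omega>)) (sum_path g n1 n2 \<omega>) \<le> Q \<omega>) \<and>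
        (\<integral>\<omega>. Q \<omega> \<partial>\<Omega>) \<le> 4 * \<delta> + 512 * C / (real M * \<delta>^3)"
      using Qi EQ by blast
  qed (use C(1) in simp)
qed

end

lemma tendsto_0_by_bound:
  fixes x y :: "nat \<Rightarrow> real"
  assumes "y \<longlonglongrightarrow> c * 0" "\<And>k. \<bar>x k\<bar> \<le> y k"
  shows "x \<longlonglongrightarrow> 0"
  by (rule Lim_null_comparison[of _ y]) (use assms in auto)

context iid_field
begin

text \<open>The uniform bound that \<open>cramer_wold\<close> asks for, taken from the fourth moment
  of the maximum by \<open>x <= 1 + x^2\<close>.\<close>

lemma sum_path_second_moment:
  assumes g: "nice g"
  obtains C where "\<And>n1 n2 t. t \<in> unit_square \<Longrightarrow> integrable \<Omega> (\<lambda>\<omega>. (sum_path g n1 n2 \<omega> t)\<^sup>2)"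
    "\<And>n1 n2 t. t \<in> unit_square \<Longrightarrow> (\<integral>\<omega>. (sum_path g n1 n2 \<omega> t)\<^sup>2 \<partial>\<Omega>) \<le> C"
proof -
  obtain C where C: "0 \<le> C" "\<And>n1 n2. integrable \<Omega> (\<lambda>\<omega>. (Mx g n1 n2 \<omega>)^4)"
    "\<And>n1 n2. (\<integral>\<omega>. (Mx g n1 n2 \<omega>)^4 \<partial>\<Omega>) \<le> C * (real (n1 * n2))\<^sup>2"
    using nice_Mx_power4[OF g] by blast
  note [measurable] = L2_meas[OF nice_L2[OF g]]
  show thesis
  proof (rule that[of "1 + C"])
    fix n1 n2 t assume t: "t \<in> unit_square"
    define q where "q = real (n1 * n2)"
    have q: "0 \<le> q" by (simp add: q_def)
    have eq: "sum_path g n1 n2 \<omega> t = Bsum g n1 n2 t \<omega> / sqrt q" for \<omega> using t by (simp add: sum_path_def q_def)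
    have le: "(sum_path g n1 n2 \<omega> t)\<^sup>2 \<le> 1 + (Mx g n1 n2 \<omega>)^4 / q\<^sup>2" for \<omega>
    proof -
      have "(sum_path g n1 n2 \<omega> t)\<^sup>2 = (Bsum g n1 n2 t \<omega>)\<^sup>2 / q" using q by (simp add: eq power_divide)
      also have "\<dots> \<le> (Mx g n1 n2 \<omega>)\<^sup>2 / q"
        using abs_Bsum_le_Mx[OF t, of g n1 n2 \<omega>] q by (intro divide_right_mono) (auto simp: abs_le_square_iff[symmetric])
      also have "\<dots> \<le> 1 + ((Mx g n1 n2 \<omega>)\<^sup>2 / q)\<^sup>2"
      proof -
        have "x \<le> 1 + x\<^sup>2" if "0 \<le> x" for x :: real
          using sum_squares_bound[of 1 x] that by simp
        then show ?thesis using q by simp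
      qed
      finally show ?thesis by (simp add: power_divide)
    qed
    have Qi: "integrable \<Omega> (\<lambda>\<omega>. 1 + (Mx g n1 n2 \<omega>)^4 / q\<^sup>2)"
      by (intro Bochner_Integration.integrable_add integrable_divide C(2)) simp
    show i: "integrable \<Omega> (\<lambda>\<omega>. (sum_path g n1 n2 \<omega> t)\<^sup>2)"
    proof (rule Bochner_Integration.integrable_bound[OF Qi])
      show "(\<lambda>\<omega>. (sum_path g n1 n2 \<omega> t)\<^sup>2) \<in> borel_measurable \<Omega>" unfolding eq by measurable
      show "AE \<omega> in \<Omega>. norm ((sum_path g n1 n2 \<omega> t)\<^sup>2) \<le> norm (1 + (Mx g n1 n2 \<omega>)^4 / q\<^sup>2)"
        using le by (intro AE_I2) (smt (verit) real_norm_def zero_le_power2)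
    qed
    have "(\<integral>\<omega>. (sum_path g n1 n2 \<omega> t)\<^sup>2 \<partial>\<Omega>) \<le> (\<integral>\<omega>. 1 + (Mx g n1 n2 \<omega>)^4 / q\<^sup>2 \<partial>\<Omega>)"
      by (rule integral_mono[OF i Qi le])
    also have "\<dots> = 1 + (\<integral>\<omega>. (Mx g n1 n2 \<omega>)^4 \<partial>\<Omega>) / q\<^sup>2" using C(2) by (simp add: Om.prob_space)
    also have "\<dots> \<le> 1 + C * q\<^sup>2 / q\<^sup>2" unfolding q_def by (intro add_left_mono divide_right_mono C(3)) simp
    also have "\<dots> \<le> 1 + C" using C(1) by simp
    finally show "(\<integral>\<omega>. (sum_path g n1 n2 \<omega> t)\<^sup>2 \<partial>\<Omega>) \<le> 1 + C" .
  qed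
qed

text \<open>A test function of the interpolated path is a continuous function of the node values, so
  \<open>cramer_wold\<close> applies. Its vectors are indexed by pairs of naturals, a countable
  type, and \<open>?inv\<close> translates to the points of the square used by
  \<open>lincomb\<close> and \<open>sheet_cos\<close>.\<close>

lemma gridded_sum_path_tendsto:
  assumes g: "nice g" and \<sigma>: "clt_const g \<sigma>" and m: "filterlim m1 at_top sequentially" "filterlim m2 at_top sequentially"
    and sheet: "standard_brownian_sheet N BB" and M: "0 < M"
    and \<phi>: "\<And>x. x \<in> mspace Cm \<Longrightarrow> \<bar>\<phi> x\<bar> \<le> b" "continuous_map C.mtopology euclideanreal \<phi>"
  shows "(\<lambda>n. \<integral>\<omega>. \<phi> (gridded M (sum_path g (m1 n) (m2 n) \<omega>)) \<partial>\<Omega>)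
     \<longlonglongrightarrow> (\<integral>\<omega>. \<phi> (gridded M (sheet_path BB \<sigma> \<omega>)) \<partial>N)"
proof -
  define F where "F = {..M} \<times> {..M}"
  have F: "finite F" by (simp add: F_def)
  have sq: "grid M i \<in> unit_square" if "i \<in> F" for i using grid_unit_square[OF M] that by (simp add: F_def)
  define X where "X n \<omega> i = (if i \<in> F then sum_path g (m1 n) (m2 n) \<omega> (grid M i) else 0)" for n \<omega> i
  define Y where "Y \<omega> i = (if i \<in> F then sheet_path BB \<sigma> \<omega> (grid M i) else 0)" for \<omega> i
  define G where "G x = \<phi> (\<lambda>t\<in>unit_square. \<Sum>i\<in>F. x i * bil M i t)" for x
  note [measurable] = L2_meas[OF nice_L2[OF g]]
  have Xeq: "X n \<omega> i = Bsum g (m1 n) (m2 n) (grid M i) \<omega> / sqrt (real (m1 n * m2 n))" if "i \<in> F" for n \<omega> i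
    using that sq[OF that] by (simp add: X_def sum_path_def)
  have Yeq: "Y \<omega> i = \<sigma> * BB (grid M i) \<omega>" if "i \<in> F" for \<omega> i
    using that sq[OF that] by (simp add: Y_def sheet_path_def[OF sheet])
  obtain C1 where C1: "\<And>n1 n2 t. t \<in> unit_square \<Longrightarrow> integrable \<Omega> (\<lambda>\<omega>. (sum_path g n1 n2 \<omega> t)\<^sup>2)"
    "\<And>n1 n2 t. t \<in> unit_square \<Longrightarrow> (\<integral>\<omega>. (sum_path g n1 n2 \<omega> t)\<^sup>2 \<partial>\<Omega>) \<le> C1"
    using sum_path_second_moment[OF g] by blast
  define C where "C = \<bar>C1\<bar> + (\<Sum>i\<in>F. (\<integral>\<omega>. (Y \<omega> i)\<^sup>2 \<partial>N))"
  have Ci: "(\<integral>\<omega>. (Y \<omega> i)\<^sup>2 \<partial>N) \<le> C" if "i \<in> F" for i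
    using member_le_sum[OF that _ F, of "\<lambda>i. \<integral>\<omega>. (Y \<omega> i)\<^sup>2 \<partial>N"] by (simp add: C_def)
  have C1C: "C1 \<le> C" unfolding C_def using sum_nonneg[of F "\<lambda>i. \<integral>\<omega>. (Y \<omega> i)\<^sup>2 \<partial>N"] by simp
  let ?G = "grid M ` F" and ?inv = "the_inv_into F (grid M)"
  have inj: "inj_on (grid M) F" by (rule inj_grid[OF M])
  have Gs: "finite ?G" "?G \<subseteq> unit_square" using F sq by auto
  have re: "(\<Sum>t\<in>?G. u (?inv t) t) = (\<Sum>i\<in>F. u i (grid M i))" for u :: "_ \<Rightarrow> _ \<Rightarrow> real"
    by (subst sum.reindex[OF inj]) (simp add: the_inv_into_f_f[OF inj])
  have cos_lim: "(\<lambda>n. \<integral>\<omega>. cos ((\<Sum>i\<in>F. c i * X n \<omega> i) + \<alpha>) \<partial>\<Omega>) \<longlonglongrightarrow> (\<integral>\<omega>. cos ((\<Sum>i\<in>F. c i * Y \<omega> i) + \<alpha>) \<partial>N)" for c \<alpha>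
  proof -
    have "lincomb g (m1 n) (m2 n) ?G (\<lambda>t. c (?inv t)) \<omega> = (\<Sum>i\<in>F. c i * X n \<omega> i)" for n \<omega>
      unfolding lincomb_def re[of "\<lambda>i t. c i * Bsum g (m1 n) (m2 n) t \<omega>"]
      by (simp add: Xeq sum_divide_distrib)
    with clt_const_cos[OF \<sigma> m Gs, of "\<lambda>t. c (?inv t)" \<alpha>]
    have "(\<lambda>n. \<integral>\<omega>. cos ((\<Sum>i\<in>F. c i * X n \<omega> i) + \<alpha>) \<partial>\<Omega>)
       \<longlonglongrightarrow> cos \<alpha> * exp (- (\<sigma>\<^sup>2 * (\<Sum>s\<in>?G. \<Sum>t\<in>?G. c (?inv s) * c (?inv t) * sheet_cov s t)) / 2)" by simp
    also have "\<sigma>\<^sup>2 * (\<Sum>s\<in>?G. \<Sum>t\<in>?G. c (?inv s) * c (?inv t) * sheet_cov s t) =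
        (\<Sum>s\<in>?G. \<Sum>t\<in>?G. (c (?inv s) * \<sigma>) * (c (?inv t) * \<sigma>) * sheet_cov s t)"
      unfolding sum_distrib_left by (intro sum.cong refl) (simp add: power2_eq_square mult_ac)
    also have "cos \<alpha> * exp (- (\<Sum>s\<in>?G. \<Sum>t\<in>?G. (c (?inv s) * \<sigma>) * (c (?inv t) * \<sigma>) * sheet_cov s t) / 2)
        = (\<integral>\<omega>. cos ((\<Sum>t\<in>?G. (c (?inv t) * \<sigma>) * BB t \<omega>) + \<alpha>) \<partial>N)"
      by (rule sheet_cos[OF sheet Gs, symmetric])
    also have "\<dots> = (\<integral>\<omega>. cos ((\<Sum>i\<in>F. c i * Y \<omega> i) + \<alpha>) \<partial>N)"
      unfolding re[of "\<lambda>i t. c i * \<sigma> * BB t _"] by (simp add: Yeq mult.assoc)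
    finally show ?thesis .
  qed
  have "(\<lambda>n. \<integral>\<omega>. G (X n \<omega>) \<partial>\<Omega>) \<longlonglongrightarrow> (\<integral>\<omega>. G (Y \<omega>) \<partial>N)"
  proof (rule cramer_wold[where X=X and Y=Y and G=G and F=F and C=C and b=b and M=\<Omega> and N=N, OF _ sheet_prob[OF sheet] F])
    show "prob_space \<Omega>" by (rule Om.prob_space_axioms)
    show "(\<lambda>\<omega>. X n \<omega> i) \<in> borel_measurable \<Omega>" for n i
    proof (cases "i \<in> F")
      case True
      then show ?thesis by (simp only: Xeq) measurable
    qed (simp add: X_def)
    have YL2: "L2 N (\<lambda>\<omega>. Y \<omega> i)" for i
    proof (cases "i \<in> F")
      case True
      show ?thesis unfolding Yeq[OF True] by (rule L2_cmult[OF sheet_L2[OF sheet sq[OF True]]])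
    qed (simp add: Y_def)
    show "(\<lambda>\<omega>. Y \<omega> i) \<in> borel_measurable N" for i by (rule L2_meas[OF YL2])
    show "integrable \<Omega> (\<lambda>\<omega>. (X n \<omega> i)\<^sup>2)" if "i \<in> F" for n i using C1(1)[OF sq[OF that]] that by (simp add: X_def)
    show "(\<integral>\<omega>. (X n \<omega> i)\<^sup>2 \<partial>\<Omega>) \<le> C" if "i \<in> F" for n i
      using order_trans[OF C1(2)[OF sq[OF that]] C1C] that by (simp add: X_def)
    show "integrable N (\<lambda>\<omega>. (Y \<omega> i)\<^sup>2)" for i by (rule L2_sq[OF YL2])
    show "(\<integral>\<omega>. (Y \<omega> i)\<^sup>2 \<partial>N) \<le> C" if "i \<in> F" for i by (rule Ci[OF that])
    show "(\<lambda>n. \<integral>\<omega>. cos ((\<Sum>i\<in>F. c i * X n \<omega> i) + \<alpha>) \<partial>\<Omega>) \<longlonglongrightarrow> (\<integral>\<omega>. cos ((\<Sum>i\<in>F. c i * Y \<omega> i) + \<alpha>) \<partial>N)" for c \<alpha>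
      by (rule cos_lim)
    have "continuous_map euclidean C.mtopology (\<lambda>x. \<lambda>t\<in>unit_square. \<Sum>i\<in>F. x i * bil M i t)"
      by (rule continuous_map_finite_sum_Cm[OF F continuous_bil])
    from continuous_map_compose[OF this \<phi>(2)]
    show "continuous_on UNIV G" by (simp add: G_def[abs_def] o_def)
    show "\<bar>G x\<bar> \<le> b" for x
      unfolding G_def by (rule \<phi>(1)) (unfold restrict_mspace_Cm, intro continuous_on_sum continuous_on_mult continuous_on_const continuous_bil)
    show "G x = G y" if "\<And>i. i \<in> F \<Longrightarrow> x i = y i" for x y
      unfolding G_def using that by (simp cong: sum.cong)
  qed
  moreover have "G (X n \<omega>) = \<phi> (gridded M (sum_path g (m1 n) (m2 n) \<omega>))" for n \<omega>
    unfolding G_def gridded_def F_def[symmetric] by (simp add: X_def cong: sum.cong)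
  moreover have "G (Y \<omega>) = \<phi> (gridded M (sheet_path BB \<sigma> \<omega>))" for \<omega>
    unfolding G_def gridded_def F_def[symmetric] by (simp add: Y_def cong: sum.cong)
  ultimately show ?thesis by simp
qed

text \<open>Sums and sheet are compared with their interpolations on one common grid: the sheet by
  dominated convergence along finer grids, the sums by \<open>nice_modulus\<close> for all large
  \<open>n\<close>.\<close>

lemma nice_functional_clt:
  assumes g: "nice g" and \<sigma>: "clt_const g \<sigma>" and m: "filterlim m1 at_top sequentially" "filterlim m2 at_top sequentially"
    and sheet: "standard_brownian_sheet N BB"
    and \<phi>: "\<And>x. x \<in> mspace Cm \<Longrightarrow> \<bar>\<phi> x\<bar> \<le> b" "\<And>x y. x \<in> mspace Cm \<Longrightarrow> y \<in> mspace Cm \<Longrightarrow> \<bar>\<phi> x - \<phi> y\<bar> \<le> L * mdist Cm x y"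
    and L: "0 \<le> L"
  shows "(\<lambda>n. \<integral>\<omega>. \<phi> (sum_path g (m1 n) (m2 n) \<omega>) \<partial>\<Omega>) \<longlonglongrightarrow> (\<integral>\<omega>. \<phi> (sheet_path BB \<sigma> \<omega>) \<partial>N)"
proof (rule tendsto_by_approx)
  fix \<epsilon> :: real assume \<epsilon>: "0 < \<epsilon>"
  interpret N: prob_space N by (rule sheet_prob[OF sheet])
  note gm = L2_meas[OF nice_L2[OF g]]
  have cont: "continuous_map C.mtopology euclideanreal \<phi>" by (rule C.lipschitz_continuous_map[OF \<phi>(2)])
  have \<phi>m: "\<phi> \<in> borel_measurable (borel_of C.mtopology)" by (rule continuous_map_borel_of[OF cont])
  obtain C where C: "0 \<le> C"
    "\<And>M \<delta> n1 n2. 0 < M \<Longrightarrow> 0 < \<delta> \<Longrightarrow> M \<le> n1 \<Longrightarrow> M \<le> n2 \<Longrightarrow>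
      \<exists>Q. integrable \<Omega> Q \<and> (\<forall>\<omega>. mdist Cm (gridded M (sum_path g n1 n2 \<omega>)) (sum_path g n1 n2 \<omega>) \<le> Q \<omega>) \<and>
        (\<integral>\<omega>. Q \<omega> \<partial>\<Omega>) \<le> 4 * \<delta> + C / (real M * \<delta>^3)"
    using nice_modulus[OF g] by blast
  \<comment> \<open>Once \<open>C / (M * \<delta>^3)\<close> is below \<open>4 * \<delta>\<close>,
    the mean distance is at most \<open>8 * \<delta>\<close>, and
    \<open>(L + 1) * (8 * \<delta>)\<close> is \<open>\<epsilon>\<close>.\<close>
  define \<delta> where "\<delta> = \<epsilon> / (L + 1) / 8"
  have \<delta>: "0 < \<delta>" using \<epsilon> L by (simp add: \<delta>_def)
  have "(\<lambda>k. \<integral>\<omega>. \<phi> (gridded (Suc k) (sheet_path BB \<sigma> \<omega>)) \<partial>N) \<longlonglongrightarrow> (\<integral>\<omega>. \<phi> (sheet_path BB \<sigma> \<omega>) \<partial>N)"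
  proof (rule integral_dominated_convergence[where w="\<lambda>_. b"])
    show "(\<lambda>\<omega>. \<phi> (sheet_path BB \<sigma> \<omega>)) \<in> borel_measurable N"
      by (rule measurable_compose[OF sheet_path_measurable[OF sheet] \<phi>m])
    show "(\<lambda>\<omega>. \<phi> (gridded (Suc k) (sheet_path BB \<sigma> \<omega>))) \<in> borel_measurable N" for k
      by (rule measurable_compose[OF gridded_sheet_path_measurable[OF sheet] \<phi>m]) simp
    show "AE \<omega> in N. (\<lambda>k. \<phi> (gridded (Suc k) (sheet_path BB \<sigma> \<omega>))) \<longlonglongrightarrow> \<phi> (sheet_path BB \<sigma> \<omega>)"
    proof (rule AE_I2)
      fix \<omega> assume w: "\<omega> \<in> space N"
      have "(\<lambda>k. L * mdist Cm (gridded (Suc k) (sheet_path BB \<sigma> \<omega>)) (sheet_path BB \<sigma> \<omega>)) \<longlonglongrightarrow> L * 0"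
        by (intro tendsto_mult_left gridded_sheet_path_tendsto[OF sheet w])
      moreover have "\<bar>\<phi> (gridded (Suc k) (sheet_path BB \<sigma> \<omega>)) - \<phi> (sheet_path BB \<sigma> \<omega>)\<bar>
          \<le> L * mdist Cm (gridded (Suc k) (sheet_path BB \<sigma> \<omega>)) (sheet_path BB \<sigma> \<omega>)" for k
        by (rule \<phi>(2)[OF gridded_mspace sheet_path_mspace[OF sheet w]])
      ultimately have "(\<lambda>k. \<phi> (gridded (Suc k) (sheet_path BB \<sigma> \<omega>)) - \<phi> (sheet_path BB \<sigma> \<omega>)) \<longlonglongrightarrow> 0"
        by (rule tendsto_0_by_bound)
      then show "(\<lambda>k. \<phi> (gridded (Suc k) (sheet_path BB \<sigma> \<omega>))) \<longlonglongrightarrow> \<phi> (sheet_path BB \<sigma> \<omega>)"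
        by (simp add: LIM_zero_iff)
    qed
    show "AE \<omega> in N. norm (\<phi> (gridded (Suc k) (sheet_path BB \<sigma> \<omega>))) \<le> b" for k
      by (rule AE_I2) (simp add: \<phi>(1)[OF gridded_mspace])
  qed simp
  then have ev1: "\<forall>\<^sub>F k in sequentially. \<bar>(\<integral>\<omega>. \<phi> (gridded (Suc k) (sheet_path BB \<sigma> \<omega>)) \<partial>N) - (\<integral>\<omega>. \<phi> (sheet_path BB \<sigma> \<omega>) \<partial>N)\<bar> < \<epsilon>"
    using \<epsilon> by (auto dest!: tendstoD[of _ _ _ \<epsilon>] simp: dist_real_def)
  have "(\<lambda>k. C / \<delta>^3 * (1 / real (Suc k))) \<longlonglongrightarrow> C / \<delta>^3 * 0"
    by (intro tendsto_mult_left LIMSEQ_Suc[OF lim_1_over_n])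
  then have ev2: "\<forall>\<^sub>F k in sequentially. C / \<delta>^3 * (1 / real (Suc k)) < 4 * \<delta>"
    using \<delta> by (intro order_tendstoD(2)) auto
  obtain k where k: "\<bar>(\<integral>\<omega>. \<phi> (gridded (Suc k) (sheet_path BB \<sigma> \<omega>)) \<partial>N) - (\<integral>\<omega>. \<phi> (sheet_path BB \<sigma> \<omega>) \<partial>N)\<bar> < \<epsilon>"
    "C / \<delta>^3 * (1 / real (Suc k)) < 4 * \<delta>"
    using eventually_happens'[OF sequentially_bot eventually_conj[OF ev1 ev2]] by blast
  define M where "M = Suc k"
  have M: "0 < M" by (simp add: M_def)
  have "\<forall>\<^sub>F n in sequentially. M \<le> m1 n" "\<forall>\<^sub>F n in sequentially. M \<le> m2 n"
    using m unfolding filterlim_at_top by blast+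
  then have "\<forall>\<^sub>F n in sequentially. \<bar>(\<integral>\<omega>. \<phi> (sum_path g (m1 n) (m2 n) \<omega>) \<partial>\<Omega>) - (\<integral>\<omega>. \<phi> (gridded M (sum_path g (m1 n) (m2 n) \<omega>)) \<partial>\<Omega>)\<bar> \<le> \<epsilon>"
  proof eventually_elim
    case (elim n)
    obtain Q where Q: "integrable \<Omega> Q" "\<And>\<omega>. mdist Cm (gridded M (sum_path g (m1 n) (m2 n) \<omega>)) (sum_path g (m1 n) (m2 n) \<omega>) \<le> Q \<omega>"
      "(\<integral>\<omega>. Q \<omega> \<partial>\<Omega>) \<le> 4 * \<delta> + C / (real M * \<delta>^3)"
      using C(2)[OF M \<delta> elim] by blast
    have spm: "(\<lambda>\<omega>. gridded M (sum_path g (m1 n) (m2 n) \<omega>)) \<in> \<Omega> \<rightarrow>\<^sub>M borel_of C.mtopology"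
    proof (rule gridded_measurable[OF _ M])
      fix t assume t: "t \<in> unit_square"
      note [measurable] = gm
      show "(\<lambda>\<omega>. sum_path g (m1 n) (m2 n) \<omega> t) \<in> borel_measurable \<Omega>"
        using t by (simp add: sum_path_def) measurable
    qed
    have "\<bar>(\<integral>\<omega>. \<phi> (sum_path g (m1 n) (m2 n) \<omega>) \<partial>\<Omega>) - (\<integral>\<omega>. \<phi> (gridded M (sum_path g (m1 n) (m2 n) \<omega>)) \<partial>\<Omega>)\<bar> \<le> L * (\<integral>\<omega>. Q \<omega> \<partial>\<Omega>)"
      by (rule expectation_lipschitz_diff[OF Om.prob_space_axioms sum_path_measurable[OF gm] spm \<phi> L Q(1)])
        (use Q(2) in \<open>simp_all add: C.commute\<close>)
    also have "\<dots> \<le> L * (4 * \<delta> + C / (real M * \<delta>^3))" by (rule mult_left_mono[OF Q(3) L])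
    also have "\<dots> \<le> L * (8 * \<delta>)" using k(2) by (intro mult_left_mono L) (simp add: M_def mult.commute)
    also have "\<dots> \<le> (L + 1) * (8 * \<delta>)" using \<delta> by (intro mult_right_mono) auto
    also have "\<dots> = \<epsilon>"
    proof -
      have "s * (8 * (\<epsilon> / s / 8)) = \<epsilon>" if "s \<noteq> 0" for s using that by simp
      from this[of "L + 1"] show ?thesis using L unfolding \<delta>_def by simp
    qed
    finally show ?case .
  qed
  then show "\<exists>y l. y \<longlonglongrightarrow> l \<and> \<bar>l - (\<integral>\<omega>. \<phi> (sheet_path BB \<sigma> \<omega>) \<partial>N)\<bar> \<le> \<epsilon> \<and>
      (\<forall>\<^sub>F n in sequentially. \<bar>(\<integral>\<omega>. \<phi> (sum_path g (m1 n) (m2 n) \<omega>) \<partial>\<Omega>) - y n\<bar> \<le> \<epsilon>)"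
    by (intro exI[of _ "\<lambda>n. \<integral>\<omega>. \<phi> (gridded M (sum_path g (m1 n) (m2 n) \<omega>)) \<partial>\<Omega>"]
        exI[of _ "\<integral>\<omega>. \<phi> (gridded M (sheet_path BB \<sigma> \<omega>)) \<partial>N"] conjI)
      (rule gridded_sum_path_tendsto[OF g \<sigma> m sheet M \<phi>(1) cont] less_imp_le[OF k(1)[folded M_def]] | assumption)+
qed

text \<open>Each approximant converges to the sheet scaled by its own constant. The paths of the
  sheet are bounded, so the scaled sheets converge uniformly as the constants tend to
  \<open>\<sigma>\<close>; replacing \<open>f\<close> by an approximant costs at most
  \<open>L * \<delta> k\<close> in the mean, for every rectangle.\<close>

theorem functional_clt:
  assumes f: "L2 \<Omega> f"
    and approx: "\<And>\<epsilon>. 0 < \<epsilon> \<Longrightarrow> \<exists>g \<sigma>'. nice g \<and> clt_const g \<sigma>' \<and> \<bar>\<sigma>' - \<sigma>\<bar> \<le> \<epsilon> \<and>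
       (\<forall>n1 n2. nrm \<Omega> (Mx (\<lambda>\<omega>. f \<omega> - g \<omega>) n1 n2) \<le> \<epsilon> * sqrt (real (n1 * n2)))"
    and m: "filterlim m1 at_top sequentially" "filterlim m2 at_top sequentially"
    and sheet: "standard_brownian_sheet N BB"
  shows "converges_in_distribution C_square \<Omega> (\<lambda>n. sum_path f (m1 n) (m2 n)) N (sheet_path BB \<sigma>)"
proof -
  interpret N: prob_space N by (rule sheet_prob[OF sheet])
  have Xm: "sum_path f (m1 n) (m2 n) \<in> \<Omega> \<rightarrow>\<^sub>M borel_of C.mtopology" for n
    by (rule sum_path_measurable[OF L2_meas[OF f]])
  note Ym = sheet_path_measurable[OF sheet]
  have lip: "(\<lambda>n. \<integral>\<omega>. \<phi> (sum_path f (m1 n) (m2 n) \<omega>) \<partial>\<Omega>) \<longlonglongrightarrow> (\<integral>\<omega>. \<phi> (sheet_path BB \<sigma> \<omega>) \<partial>N)"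
    if \<phi>: "\<And>x. x \<in> mspace Cm \<Longrightarrow> \<bar>\<phi> x\<bar> \<le> b" "\<And>x y. x \<in> mspace Cm \<Longrightarrow> y \<in> mspace Cm \<Longrightarrow> \<bar>\<phi> x - \<phi> y\<bar> \<le> L0 * mdist Cm x y" for \<phi> b L0
  proof (rule tendsto_by_approx)
    fix \<epsilon> :: real assume \<epsilon>: "0 < \<epsilon>"
    define L where "L = \<bar>L0\<bar>"
    have L: "0 \<le> L" by (simp add: L_def)
    have \<phi>2: "\<bar>\<phi> x - \<phi> y\<bar> \<le> L * mdist Cm x y" if "x \<in> mspace Cm" "y \<in> mspace Cm" for x y
      using \<phi>(2)[OF that] mult_right_mono[OF abs_ge_self[of L0] C.nonneg[of x y]] by (simp add: L_def)
    have \<phi>m: "\<phi> \<in> borel_measurable (borel_of C.mtopology)"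
      by (rule continuous_map_borel_of[OF C.lipschitz_continuous_map[OF \<phi>(2)]])
    \<comment> \<open>The first entry bounds the cost of replacing \<open>f\<close> by
      \<open>g k\<close>; the second forces \<open>\<sigma>' k\<close> to converge to
      \<open>\<sigma>\<close>.\<close>
    define \<delta> where "\<delta> k = min (\<epsilon> / (L + 1)) (1 / real (Suc k))" for k
    have \<delta>: "0 < \<delta> k" for k using \<epsilon> L by (simp add: \<delta>_def)
    have "\<forall>k. \<exists>g \<sigma>'. nice g \<and> clt_const g \<sigma>' \<and> \<bar>\<sigma>' - \<sigma>\<bar> \<le> \<delta> k \<and>
       (\<forall>n1 n2. nrm \<Omega> (Mx (\<lambda>\<omega>. f \<omega> - g \<omega>) n1 n2) \<le> \<delta> k * sqrt (real (n1 * n2)))"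
      using approx[OF \<delta>] by blast
    then obtain g \<sigma>' where g: "\<And>k. nice (g k)" "\<And>k. clt_const (g k) (\<sigma>' k)" "\<And>k. \<bar>\<sigma>' k - \<sigma>\<bar> \<le> \<delta> k"
      "\<And>k n1 n2. nrm \<Omega> (Mx (\<lambda>\<omega>. f \<omega> - g k \<omega>) n1 n2) \<le> \<delta> k * sqrt (real (n1 * n2))" by metis
    have "(\<lambda>k. \<sigma>' k - \<sigma>) \<longlonglongrightarrow> 0"
    proof (rule Lim_null_comparison)
      show "\<forall>\<^sub>F k in sequentially. norm (\<sigma>' k - \<sigma>) \<le> 1 / real (Suc k)"
        using g(3) by (intro always_eventually allI) (simp add: \<delta>_def)
      show "(\<lambda>k. 1 / real (Suc k)) \<longlonglongrightarrow> 0" by (rule LIMSEQ_Suc[OF lim_1_over_n])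
    qed
    then have absl: "(\<lambda>k. \<bar>\<sigma>' k - \<sigma>\<bar>) \<longlonglongrightarrow> 0" by (rule tendsto_rabs_zero)
    have "(\<lambda>k. \<integral>\<omega>. \<phi> (sheet_path BB (\<sigma>' k) \<omega>) \<partial>N) \<longlonglongrightarrow> (\<integral>\<omega>. \<phi> (sheet_path BB \<sigma> \<omega>) \<partial>N)"
    proof (rule integral_dominated_convergence[where w="\<lambda>_. b"])
      show "(\<lambda>\<omega>. \<phi> (sheet_path BB \<sigma> \<omega>)) \<in> borel_measurable N"
        by (rule measurable_compose[OF sheet_path_measurable[OF sheet] \<phi>m])
      show "(\<lambda>\<omega>. \<phi> (sheet_path BB (\<sigma>' k) \<omega>)) \<in> borel_measurable N" for k
        by (rule measurable_compose[OF sheet_path_measurable[OF sheet] \<phi>m])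
      show "AE \<omega> in N. (\<lambda>k. \<phi> (sheet_path BB (\<sigma>' k) \<omega>)) \<longlonglongrightarrow> \<phi> (sheet_path BB \<sigma> \<omega>)"
      proof (rule AE_I2)
        fix \<omega> assume w: "\<omega> \<in> space N"
        obtain B where B: "\<And>t. t \<in> unit_square \<Longrightarrow> \<bar>BB t \<omega>\<bar> \<le> B"
          using compact_imp_bounded[OF compact_continuous_image[OF sheet_continuous[OF sheet w] compact_unit_square]]
          by (auto simp: bounded_iff)
        have "mdist Cm (sheet_path BB (\<sigma>' k) \<omega>) (sheet_path BB \<sigma> \<omega>) \<le> \<bar>\<sigma>' k - \<sigma>\<bar> * B" for k
        proof (rule mdist_Cm_le)
          fix t assume t: "t \<in> unit_square"
          have "\<bar>sheet_path BB (\<sigma>' k) \<omega> t - sheet_path BB \<sigma> \<omega> t\<bar> = \<bar>\<sigma>' k - \<sigma>\<bar> * \<bar>BB t \<omega>\<bar>"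
            using t by (simp add: sheet_path_def[OF sheet] abs_mult flip: left_diff_distrib)
          then show "\<bar>sheet_path BB (\<sigma>' k) \<omega> t - sheet_path BB \<sigma> \<omega> t\<bar> \<le> \<bar>\<sigma>' k - \<sigma>\<bar> * B"
            using B[OF t] by (simp add: mult_left_mono)
        qed
        then have "\<bar>\<phi> (sheet_path BB (\<sigma>' k) \<omega>) - \<phi> (sheet_path BB \<sigma> \<omega>)\<bar> \<le> L * (\<bar>\<sigma>' k - \<sigma>\<bar> * B)" for k
          using \<phi>2[OF sheet_path_mspace[OF sheet w] sheet_path_mspace[OF sheet w]] mult_left_mono[OF _ L] order_trans by meson
        moreover have "(\<lambda>k. L * (\<bar>\<sigma>' k - \<sigma>\<bar> * B)) \<longlonglongrightarrow> L * 0"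
          using tendsto_mult_left[OF tendsto_mult_left_zero[OF absl, of B], of L] .
        ultimately have "(\<lambda>k. \<phi> (sheet_path BB (\<sigma>' k) \<omega>) - \<phi> (sheet_path BB \<sigma> \<omega>)) \<longlonglongrightarrow> 0"
          by (rule tendsto_0_by_bound[rotated]) 
        then show "(\<lambda>k. \<phi> (sheet_path BB (\<sigma>' k) \<omega>)) \<longlonglongrightarrow> \<phi> (sheet_path BB \<sigma> \<omega>)"
          by (simp add: LIM_zero_iff)
      qed
      show "AE \<omega> in N. norm (\<phi> (sheet_path BB (\<sigma>' k) \<omega>)) \<le> b" for k
        by (rule AE_I2) (simp add: \<phi>(1)[OF sheet_path_mspace[OF sheet]])
    qed simp
    then have "\<forall>\<^sub>F k in sequentially. \<bar>(\<integral>\<omega>. \<phi> (sheet_path BB (\<sigma>' k) \<omega>) \<partial>N) - (\<integral>\<omega>. \<phi> (sheet_path BB \<sigma> \<omega>) \<partial>N)\<bar> < \<epsilon>"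
      using \<epsilon> by (auto dest!: tendstoD[of _ _ _ \<epsilon>] simp: dist_real_def)
    then obtain k where k: "\<bar>(\<integral>\<omega>. \<phi> (sheet_path BB (\<sigma>' k) \<omega>) \<partial>N) - (\<integral>\<omega>. \<phi> (sheet_path BB \<sigma> \<omega>) \<partial>N)\<bar> < \<epsilon>"
      by (auto simp: eventually_sequentially)
    have d: "L2 \<Omega> (\<lambda>\<omega>. f \<omega> - g k \<omega>)" by (intro L2_diff f nice_L2 g(1))
    have close: "\<bar>(\<integral>\<omega>. \<phi> (sum_path f n1 n2 \<omega>) \<partial>\<Omega>) - (\<integral>\<omega>. \<phi> (sum_path (g k) n1 n2 \<omega>) \<partial>\<Omega>)\<bar> \<le> \<epsilon>" for n1 n2
    proof -
      let ?q = "sqrt (real (n1 * n2))"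
      note Mi = Om.L2_integrable[OF L2_Mx[OF d, of n1 n2]]
      have "\<bar>(\<integral>\<omega>. \<phi> (sum_path f n1 n2 \<omega>) \<partial>\<Omega>) - (\<integral>\<omega>. \<phi> (sum_path (g k) n1 n2 \<omega>) \<partial>\<Omega>)\<bar>
          \<le> L * (\<integral>\<omega>. Mx (\<lambda>\<omega>. f \<omega> - g k \<omega>) n1 n2 \<omega> / ?q \<partial>\<Omega>)"
        by (rule expectation_lipschitz_diff[OF Om.prob_space_axioms sum_path_measurable[OF L2_meas[OF f]]
              sum_path_measurable[OF L2_meas[OF nice_L2[OF g(1)]]] \<phi>(1) \<phi>2 L])
          (use Mi mdist_sum_path_le in auto)
      also have "\<dots> \<le> L * \<delta> k"
      proof (rule mult_left_mono[OF _ L])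
        have "(\<integral>\<omega>. Mx (\<lambda>\<omega>. f \<omega> - g k \<omega>) n1 n2 \<omega> \<partial>\<Omega>) \<le> \<delta> k * ?q"
          using Om.expectation_abs_le_nrm[OF L2_Mx[OF d, of n1 n2]] g(4)[of k n1 n2] by simp
        then have "(\<integral>\<omega>. Mx (\<lambda>\<omega>. f \<omega> - g k \<omega>) n1 n2 \<omega> \<partial>\<Omega>) / ?q \<le> \<delta> k * ?q / ?q" by (rule divide_right_mono) simp
        also have "\<dots> \<le> \<delta> k" using \<delta>[of k] by simp
        finally show "(\<integral>\<omega>. Mx (\<lambda>\<omega>. f \<omega> - g k \<omega>) n1 n2 \<omega> / ?q \<partial>\<Omega>) \<le> \<delta> k" by simp
      qed
      also have "\<dots> \<le> L * (\<epsilon> / (L + 1))" by (intro mult_left_mono L) (simp add: \<delta>_def)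
      also have "\<dots> \<le> \<epsilon>" using L \<epsilon> by (simp add: field_simps)
      finally show ?thesis .
    qed
    show "\<exists>y l. y \<longlonglongrightarrow> l \<and> \<bar>l - (\<integral>\<omega>. \<phi> (sheet_path BB \<sigma> \<omega>) \<partial>N)\<bar> \<le> \<epsilon> \<and>
        (\<forall>\<^sub>F n in sequentially. \<bar>(\<integral>\<omega>. \<phi> (sum_path f (m1 n) (m2 n) \<omega>) \<partial>\<Omega>) - y n\<bar> \<le> \<epsilon>)"
    proof (intro exI conjI)
      show "(\<lambda>n. \<integral>\<omega>. \<phi> (sum_path (g k) (m1 n) (m2 n) \<omega>) \<partial>\<Omega>) \<longlonglongrightarrow> (\<integral>\<omega>. \<phi> (sheet_path BB (\<sigma>' k) \<omega>) \<partial>N)"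
        by (rule nice_functional_clt[OF g(1) g(2) m sheet \<phi>(1) \<phi>2 L])
    qed (use k close in \<open>simp_all add: less_imp_le\<close>)
  qed
  show ?thesis
    unfolding converges_in_distribution_def C_square_eq
  proof (intro conjI allI impI)
    fix \<phi> assume a: "continuous_map C.mtopology euclideanreal \<phi> \<and> bounded (\<phi> ` topspace C.mtopology)"
    then obtain b where b: "\<And>x. x \<in> mspace Cm \<Longrightarrow> \<bar>\<phi> x\<bar> \<le> b" by (auto simp: bounded_iff)
    have \<phi>m: "\<phi> \<in> borel_measurable (borel_of C.mtopology)" by (rule continuous_map_borel_of) (use a in blast)
    have "(\<lambda>n. \<integral>\<omega>. \<phi> (sum_path f (m1 n) (m2 n) \<omega>) \<partial>\<Omega>) \<longlonglongrightarrow> (\<integral>\<omega>. \<phi> (sheet_path BB \<sigma> \<omega>) \<partial>N)"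
      by (rule C.expectation_tendsto_of_lipschitz[OF Om.prob_space_axioms N.prob_space_axioms Xm Ym lip conjunct1[OF a] b])
    then show "(\<lambda>n. \<integral>x. \<phi> x \<partial>distr \<Omega> (borel_of C.mtopology) (sum_path f (m1 n) (m2 n)))
        \<longlonglongrightarrow> (\<integral>x. \<phi> x \<partial>distr N (borel_of C.mtopology) (sheet_path BB \<sigma>))"
      by (simp only: integral_distr[OF Xm \<phi>m] integral_distr[OF Ym \<phi>m])
  qed (use Xm Ym in auto)
qed

end

text \<open>The same \<open>\<sigma>\<close> serves the variance, the normal limit and the
  invariance principle, and it is obtained before any sheet is fixed.\<close>

lemma (in linear_fields) star_condition_clt:
  assumes star: "star_condition P h K Z Zp Zm 2"
    and m: "filterlim m1 at_top sequentially" "filterlim m2 at_top sequentially"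
  obtains \<sigma> where "0 \<le> \<sigma>"
    "(\<lambda>n. (\<integral>\<omega>. (S_rect (functional h K Z) (m1 n) (m2 n) \<omega>)\<^sup>2 \<partial>\<Omega>) / real (m1 n * m2 n)) \<longlonglongrightarrow> \<sigma>\<^sup>2"
    "weak_conv_m (\<lambda>n. distr \<Omega> borel (\<lambda>\<omega>. S_rect (functional h K Z) (m1 n) (m2 n) \<omega> / sqrt (real (m1 n * m2 n)))) (normal_law 0 \<sigma>)"
    "\<And>(N :: 'b measure) BB. standard_brownian_sheet N BB \<Longrightarrow>
      converges_in_distribution C_square \<Omega> (\<lambda>n. sum_path (functional h K Z) (m1 n) (m2 n)) N (sheet_path BB \<sigma>)"
proof -
  note L2 = star_condition_projective(1)[OF star]
  obtain S where S: "\<And>J. (\<Sum>k<J. \<Sum>l<J. nrm \<Omega> (cexp (Gamma_set (- int k, - int l)) (functional h K Z))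
      / (sqrt (real (Suc k)) * sqrt (real (Suc l)))) \<le> S"
    using star_condition_projective(2)[OF star] by blast
  have approx: "\<exists>g. nice g \<and> (\<forall>n1 n2. nrm \<Omega> (Mx (\<lambda>\<omega>. functional h K Z \<omega> - g \<omega>) n1 n2) \<le> \<epsilon> * sqrt (real (n1 * n2)))"
    if \<epsilon>: "0 < \<epsilon>" for \<epsilon>
  proof (rule hannan_approximation[OF L2 functional_adapted projective_criterion[OF L2 S] \<epsilon>])
    fix g assume "nice g" "\<And>n1 n2. nrm \<Omega> (Mx (\<lambda>\<omega>. functional h K Z \<omega> - g \<omega>) n1 n2) \<le> \<epsilon> * sqrt (real (n1 * n2))"
    then show ?thesis by (intro exI conjI allI)
  qed
  show thesis
  proof (rule clt_by_approx[OF L2 approx m])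
    fix \<sigma> assume \<sigma>: "0 \<le> \<sigma>"
      "(\<lambda>n. (\<integral>\<omega>. (S_rect (functional h K Z) (m1 n) (m2 n) \<omega>)\<^sup>2 \<partial>\<Omega>) / real (m1 n * m2 n)) \<longlonglongrightarrow> \<sigma>\<^sup>2"
      "weak_conv_m (\<lambda>n. distr \<Omega> borel (\<lambda>\<omega>. S_rect (functional h K Z) (m1 n) (m2 n) \<omega> / sqrt (real (m1 n * m2 n)))) (normal_law 0 \<sigma>)"
      and approx: "\<And>\<epsilon>. 0 < \<epsilon> \<Longrightarrow> \<exists>g \<sigma>'. nice g \<and> clt_const g \<sigma>' \<and> \<bar>\<sigma>' - \<sigma>\<bar> \<le> \<epsilon> \<and>
         (\<forall>n1 n2. nrm \<Omega> (Mx (\<lambda>\<omega>. functional h K Z \<omega> - g \<omega>) n1 n2) \<le> \<epsilon> * sqrt (real (n1 * n2)))"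
    show thesis
      by (rule that[OF \<sigma>]) (rule functional_clt[OF L2 approx m])
  qed
qed

theorem theorem6p1:
  fixes P :: "real measure"
    and a :: "int \<times> int \<Rightarrow> real"
    and Z Zp Zm :: "int \<times> int \<Rightarrow> (int \<times> int \<Rightarrow> real) \<Rightarrow> real"
    and h :: nat
    and K :: "(nat \<Rightarrow> real) \<Rightarrow> real"
    and f :: "(int \<times> int \<Rightarrow> real) \<Rightarrow> real"
    and m1 m2 :: "nat \<Rightarrow> nat"
  assumes "prob_space P" and "sets P = sets borel"
    and eps_variance: "\<And>i j. integrable (Omega P) (\<lambda>\<omega>. (eps (i, j) \<omega>)\<^sup>2)"
    and eps_mean: "\<And>i j. (\<integral>\<omega>. eps (i, j) \<omega> \<partial>Omega P) = 0"
    and a_square_summable: "(\<lambda>ij. (a ij)\<^sup>2) summable_on UNIV"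
    and a_causal: "\<And>i j. \<not> (i \<ge> 0 \<and> j \<ge> 0) \<Longrightarrow> a (i, j) = 0"
    and Z: "linear_field P a Z"
    and Zp: "linear_field_plus P a Zp"
    and Zm: "linear_field_minus P a Zm"
    and "h > 0"
    and K: "K \<in> borel_measurable (\<Pi>\<^sub>M m\<in>{..<h\<^sup>2}. borel)"
    and f: "f = functional h K Z"
    and m1: "mono m1" "filterlim m1 at_top sequentially"
    and m2: "mono m2" "filterlim m2 at_top sequentially"
  shows
    "(star_condition P h K Z Zp Zm 2 \<longrightarrow>
       (\<exists>\<sigma>\<ge>0.
          (\<lambda>n. (\<integral>\<omega>. (S_rect f (m1 n) (m2 n) \<omega>)\<^sup>2 \<partial>Omega P) / real (m1 n * m2 n)) \<longlonglongrightarrow> \<sigma>\<^sup>2 \<and>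
          weak_conv_m
            (\<lambda>n. distr (Omega P) borel
                   (\<lambda>\<omega>. S_rect f (m1 n) (m2 n) \<omega> / sqrt (real (m1 n * m2 n))))
            (normal_law 0 \<sigma>)))
     \<and>
     (\<forall>p>2. star_condition P h K Z Zp Zm p \<longrightarrow>
       (\<exists>\<sigma>\<ge>0.
          (\<lambda>n. (\<integral>\<omega>. (S_rect f (m1 n) (m2 n) \<omega>)\<^sup>2 \<partial>Omega P) / real (m1 n * m2 n)) \<longlonglongrightarrow> \<sigma>\<^sup>2 \<and>
          (\<forall>(N :: 'b measure) BB. standard_brownian_sheet N BB \<longrightarrow>
             converges_in_distribution C_square
               (Omega P)
               (\<lambda>n \<omega>. \<lambda>t\<in>unit_square. B_rect f (m1 n) (m2 n) t \<omega> / sqrt (real (m1 n * m2 n)))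
               N
               (\<lambda>\<omega>. \<lambda>t\<in>unit_square. \<sigma> * BB t \<omega>))))"
proof -
  interpret linear_fields P a Z Zp Zm h K
    by (intro linear_fields.intro iid_field.intro linear_fields_axioms.intro) (fact assms)+
  \<comment> \<open>Outside the square both sides are \<open>undefined\<close>, so
    \<open>B_rect_eq_Bsum\<close> is applied only to points of the square.\<close>
  have path: "(\<lambda>n \<omega>. \<lambda>t\<in>unit_square. B_rect f (m1 n) (m2 n) t \<omega> / sqrt (real (m1 n * m2 n)))
      = (\<lambda>n. sum_path f (m1 n) (m2 n))"
    unfolding sum_path_def by (intro ext restrict_ext) (simp add: B_rect_eq_Bsum)
  have clt: "\<exists>\<sigma>\<ge>0.
      (\<lambda>n. (\<integral>\<omega>. (S_rect f (m1 n) (m2 n) \<omega>)\<^sup>2 \<partial>\<Omega>) / real (m1 n * m2 n)) \<longlonglongrightarrow> \<sigma>\<^sup>2 \<and>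
      weak_conv_m (\<lambda>n. distr \<Omega> borel (\<lambda>\<omega>. S_rect f (m1 n) (m2 n) \<omega> / sqrt (real (m1 n * m2 n)))) (normal_law 0 \<sigma>) \<and>
      (\<forall>(N :: 'b measure) BB. standard_brownian_sheet N BB \<longrightarrow>
        converges_in_distribution C_square \<Omega> (\<lambda>n. sum_path f (m1 n) (m2 n)) N (\<lambda>\<omega>. \<lambda>t\<in>unit_square. \<sigma> * BB t \<omega>))"
    if "star_condition P h K Z Zp Zm 2"
    unfolding f
  proof (rule star_condition_clt[OF that m1(2) m2(2)])
    fix \<sigma> assume "0 \<le> \<sigma>"
      "(\<lambda>n. (\<integral>\<omega>. (S_rect (functional h K Z) (m1 n) (m2 n) \<omega>)\<^sup>2 \<partial>\<Omega>) / real (m1 n * m2 n)) \<longlonglongrightarrow> \<sigma>\<^sup>2"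
      "weak_conv_m (\<lambda>n. distr \<Omega> borel (\<lambda>\<omega>. S_rect (functional h K Z) (m1 n) (m2 n) \<omega> / sqrt (real (m1 n * m2 n)))) (normal_law 0 \<sigma>)"
      and sheet: "\<And>(N :: 'b measure) BB. standard_brownian_sheet N BB \<Longrightarrow>
        converges_in_distribution C_square \<Omega> (\<lambda>n. sum_path (functional h K Z) (m1 n) (m2 n)) N (sheet_path BB \<sigma>)"
    then show "\<exists>\<sigma>\<ge>0.
      (\<lambda>n. (\<integral>\<omega>. (S_rect (functional h K Z) (m1 n) (m2 n) \<omega>)\<^sup>2 \<partial>\<Omega>) / real (m1 n * m2 n)) \<longlonglongrightarrow> \<sigma>\<^sup>2 \<and>
      weak_conv_m (\<lambda>n. distr \<Omega> borel (\<lambda>\<omega>. S_rect (functional h K Z) (m1 n) (m2 n) \<omega> / sqrt (real (m1 n * m2 n)))) (normal_law 0 \<sigma>) \<and>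
      (\<forall>(N :: 'b measure) BB. standard_brownian_sheet N BB \<longrightarrow>
        converges_in_distribution C_square \<Omega> (\<lambda>n. sum_path (functional h K Z) (m1 n) (m2 n)) N (\<lambda>\<omega>. \<lambda>t\<in>unit_square. \<sigma> * BB t \<omega>))"
    proof (intro exI[of _ \<sigma>] conjI allI impI)
      fix N :: "'b measure" and BB assume N: "standard_brownian_sheet N BB"
      show "converges_in_distribution C_square \<Omega> (\<lambda>n. sum_path (functional h K Z) (m1 n) (m2 n)) N (\<lambda>\<omega>. \<lambda>t\<in>unit_square. \<sigma> * BB t \<omega>)"
        using sheet[OF N] unfolding sheet_path_def[OF N, abs_def] .
    qed
  qed
  show ?thesis
    unfolding path
  proof (intro conjI allI impI)
    assume "star_condition P h K Z Zp Zm 2"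
    then show "\<exists>\<sigma>\<ge>0.
        (\<lambda>n. (\<integral>\<omega>. (S_rect f (m1 n) (m2 n) \<omega>)\<^sup>2 \<partial>\<Omega>) / real (m1 n * m2 n)) \<longlonglongrightarrow> \<sigma>\<^sup>2 \<and>
        weak_conv_m (\<lambda>n. distr \<Omega> borel (\<lambda>\<omega>. S_rect f (m1 n) (m2 n) \<omega> / sqrt (real (m1 n * m2 n)))) (normal_law 0 \<sigma>)"
      using clt by blast
  next
    fix p :: real assume "2 < p" "star_condition P h K Z Zp Zm p"
    from clt[OF star_condition_2[OF this]]
    show "\<exists>\<sigma>\<ge>0.
        (\<lambda>n. (\<integral>\<omega>. (S_rect f (m1 n) (m2 n) \<omega>)\<^sup>2 \<partial>\<Omega>) / real (m1 n * m2 n)) \<longlonglongrightarrow> \<sigma>\<^sup>2 \<and>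
        (\<forall>(N :: 'b measure) BB. standard_brownian_sheet N BB \<longrightarrow>
           converges_in_distribution C_square \<Omega> (\<lambda>n. sum_path f (m1 n) (m2 n))
             N (\<lambda>\<omega>. \<lambda>t\<in>unit_square. \<sigma> * BB t \<omega>))"
      by (elim exE conjE) (intro exI conjI)
  qed
qed

end
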